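(* Let $(\xi_i)_{i\in\mathbb{Z}}$ be i.i.d. centered random variables with $0<\mathbb{E}\xi_0^2<\infty$ and $\mathbb{E}|\xi_0|^p<\infty$ for a certain $p>2$. Let $1/2<r<1$, let $l$ be a positive slowly varying function, and let $a_i=l(i+1)(1+i)^{-r}$ for $i\ge0$ (with $a_0=1$), $a_i=0$ for $i<0$. Let $X_k=\sum_{j=-\infty}^ka_{k-j}\xi_j$, $S_n=\sum_{i=1}^nX_i$ and $\sigma_n^2=\mathrm{var}(S_n)$. Let $K:\mathbb{R}\to\mathbb{R}$ be measurable with $\mathbb{E}K(X_0)=0$, and let $H_n=\sum_{i=1}^nK(X_i)$. Let $K_\infty(w)=\mathbb{E}[K(w+X_n)]$ (independent of $n$) and assume $\kappa:=K_\infty'(0)\neq0$. Let $\omega(r)$ and $\rho(r)$ be as defined in the context, and assume that Condition B of the context holds with this $p$ and with $q=p\,\omega(r)$. Let $c$ be such that $0<c\le p-2$ and $c<2p\rho(r)$. Then if $x=x_n$ satisfies $x^2\le c\ln n$, we have $$\mathbb{P}(H_n\ge|\kappa|\sigma_nx)=(1-\Phi(x))(1+o(1))\quad\text{as }n\to\infty.$$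
   Context: $\Phi$ is the standard normal distribution function; $\|Y\|_q=(\mathbb{E}|Y|^q)^{1/q}$. A (measurable) function $l$ is slowly varying if $\lim_{x\to\infty}l(\lambda x)/l(x)=1$ for all $\lambda>0$. $o(1)$ denotes a sequence (possibly depending on $(x_n)$) converging to $0$. For $1/2<r<1$ and $1/2\le v<1$ define $$\chi(v,r)=v\max(r-r/v,\;1/2-r,\;r-1),\qquad \omega(r)=\mathrm{argmin}_{1/2\le v<1}\chi(v,r),\qquad \rho(r)=-\chi(\omega(r),r).$$ Let $\mathcal{F}_n$ be the sigma-field generated by $(\ldots,\xi_{n-1},\xi_n)$, $X_{n,k}=\mathbb{E}(X_n|\mathcal{F}_k)$, and $K_n(w)=\mathbb{E}[K(w+X_n-X_{n,0})]$. For a function $g$ and $\lambda>0$ let $g(w;\lambda)=\sup_{|y|\le\lambda}|g(w+y)|$; $g^{(i)}$ is the $i$-th derivative, and $K_{n-1}^{(i)}(w;\lambda)=\sup_{|y|\le\lambda}|K_{n-1}^{(i)}(w+y)|$. Condition B (for given $p,q$): $2\le q<p\le2q$ and $\|\xi_0\|_p<\infty$; $K_n\in C^2(\mathbb{R})$ for all large $n$; and for some $\lambda>0$, $$\sum_{i=0}^2\|K_{n-1}^{(i)}(X_{n,0};\lambda)\|_q+\big\||\xi_1|^{p/q}K_{n-1}(X_{n,1})\big\|_q+\|\xi_1K_{n-1}'(X_{n,1})\|_q=O(1)\quad\text{as }n\to\infty.$$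
   Formalization: The formal theorem additionally assumes that ‖K(X_0)‖_q is finite with q = pω(r); Condition B restricts K_n only for large n, and without this the claim fails, e.g. for Gaussian ξ with K having a singularity |x|^{-0.9} at 0. *)

theory Defs
  imports "HOL-Probability.Probability"
begin

definition chi :: "real \<Rightarrow> real \<Rightarrow> real" where
  "chi v r = v * max (r - r / v) (max (1/2 - r) (r - 1))"

text \<open>\<open>arg_min_on\<close> is a choice operator; \<open>omega_well_defined\<close> below shows that for
  \<open>1/2 < r < 1\<close> there is exactly one minimiser to choose.\<close>

definition omega :: "real \<Rightarrow> real" where
  "omega r = arg_min_on (\<lambda>v. chi v r) {1/2..<1}"

definition rho :: "real \<Rightarrow> real" where
  "rho r = - chi (omega r) r"

lemma omega_well_defined:
  fixes r :: real
  assumes "1/2 < r" "r < 1"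
  shows "\<exists>!v. is_arg_min (\<lambda>v. chi v r) (\<lambda>v. v \<in> {1/2..<1}) v"
proof -
  define m where "m = max (1/2 - r) (r - 1)"
  define u where "u = r / (r - m)"
  have m: "m < 0" "- m \<le> r"
    using assms by (auto simp: m_def max_def)
  have chi: "chi v r = max (r * v - r) (m * v)" if "v > 0" for v
  proof -
    have "chi v r = v * max (r - r / v) m" by (simp only: chi_def m_def)
    also have "\<dots> = max (v * (r - r / v)) (v * m)"
      using that by (simp add: max_mult_distrib_left)
    also have "v * (r - r / v) = r * v - r" using that by (simp add: field_simps)
    finally show ?thesis by (simp add: mult.commute)
  qed
  have rm: "r - m > 0" using m assms by simp
  have u1: "u < 1" using m assms rm by (simp add: u_def field_simps)
  have u2: "1/2 \<le> u" using m assms rm by (simp add: u_def field_simps)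
  have eq: "r * u - r = m * u" using rm by (simp add: u_def field_simps)
  have lt: "chi u r < chi v r" if v: "v \<in> {1/2..<1}" "v \<noteq> u" for v
  proof (cases "v < u")
    case True
    hence "m * u < m * v" using m by simp
    thus ?thesis using v u2 eq by (simp add: chi)
  next
    case False
    hence "r * u < r * v" using v assms by simp
    thus ?thesis using v u2 eq by (simp add: chi)
  qed
  show ?thesis
  proof (rule ex1I[of _ u])
    show "is_arg_min (\<lambda>v. chi v r) (\<lambda>v. v \<in> {1/2..<1}) u"
      using lt u1 u2 unfolding is_arg_min_def by (metis atLeastLessThan_iff order_less_asym less_irrefl)
    show "\<And>v. is_arg_min (\<lambda>v. chi v r) (\<lambda>v. v \<in> {1/2..<1}) v \<Longrightarrow> v = u"
      using lt u1 u2 unfolding is_arg_min_def by (metis atLeastLessThan_iff)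
  qed
qed

text \<open>Only the values on the positive half-line matter.\<close>

definition slowly_varying :: "(real \<Rightarrow> real) \<Rightarrow> bool" where
  "slowly_varying l \<longleftrightarrow>
     set_borel_measurable borel {0<..} l \<and>
     (\<forall>t>0. ((\<lambda>x. l (t * x) / l x) \<longlongrightarrow> 1) at_top)"

text \<open>The coefficients are indexed by \<open>nat\<close>, so the convention that they vanish at negative
  indices is built in. The series \<open>\<Sum>j\<le>k. a (k - j) * \<xi> j\<close> is reindexed by \<open>i = k - j\<close>. It
  converges almost surely but in general not absolutely (hence \<open>suminf\<close>, not \<open>infsum\<close>).\<close>

definition lin_proc :: "(nat \<Rightarrow> real) \<Rightarrow> (int \<Rightarrow> 'a \<Rightarrow> real) \<Rightarrow> int \<Rightarrow> 'a \<Rightarrow> real" where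
  "lin_proc a \<xi> k \<omega> = (\<Sum>i. a i * \<xi> (k - int i) \<omega>)"

definition past_field :: "'a measure \<Rightarrow> (int \<Rightarrow> 'a \<Rightarrow> real) \<Rightarrow> int \<Rightarrow> 'a measure" where
  "past_field M \<xi> n = sigma (space M) {\<xi> j -` A \<inter> space M | j A. j \<le> n \<and> A \<in> sets borel}"

text \<open>\<open>lin_pred M a \<xi> n k\<close> is \<open>X_{n,k} = E(X_n | F_k)\<close>.\<close>

definition lin_pred ::
  "'a measure \<Rightarrow> (nat \<Rightarrow> real) \<Rightarrow> (int \<Rightarrow> 'a \<Rightarrow> real) \<Rightarrow> int \<Rightarrow> int \<Rightarrow> 'a \<Rightarrow> real" where
  "lin_pred M a \<xi> n k = real_cond_exp M (past_field M \<xi> k) (lin_proc a \<xi> n)"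

definition K_fin ::
  "'a measure \<Rightarrow> (nat \<Rightarrow> real) \<Rightarrow> (int \<Rightarrow> 'a \<Rightarrow> real) \<Rightarrow> (real \<Rightarrow> real) \<Rightarrow> nat \<Rightarrow> real \<Rightarrow> real" where
  "K_fin M a \<xi> K n w =
     (\<integral>\<omega>. K (w + lin_proc a \<xi> (int n) \<omega> - lin_pred M a \<xi> (int n) 0 \<omega>) \<partial>M)"

text \<open>By stationarity \<open>X_0\<close> may stand for any \<open>X_n\<close>.\<close>

definition K_inf ::
  "'a measure \<Rightarrow> (nat \<Rightarrow> real) \<Rightarrow> (int \<Rightarrow> 'a \<Rightarrow> real) \<Rightarrow> (real \<Rightarrow> real) \<Rightarrow> real \<Rightarrow> real" where
  "K_inf M a \<xi> K w = (\<integral>\<omega>. K (w + lin_proc a \<xi> 0 \<omega>) \<partial>M)"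

definition S_sum :: "(nat \<Rightarrow> real) \<Rightarrow> (int \<Rightarrow> 'a \<Rightarrow> real) \<Rightarrow> nat \<Rightarrow> 'a \<Rightarrow> real" where
  "S_sum a \<xi> n \<omega> = (\<Sum>i=1..n. lin_proc a \<xi> (int i) \<omega>)"

definition H_sum ::
  "(nat \<Rightarrow> real) \<Rightarrow> (int \<Rightarrow> 'a \<Rightarrow> real) \<Rightarrow> (real \<Rightarrow> real) \<Rightarrow> nat \<Rightarrow> 'a \<Rightarrow> real" where
  "H_sum a \<xi> K n \<omega> = (\<Sum>i=1..n. K (lin_proc a \<xi> (int i) \<omega>))"

definition sigma_S :: "'a measure \<Rightarrow> (nat \<Rightarrow> real) \<Rightarrow> (int \<Rightarrow> 'a \<Rightarrow> real) \<Rightarrow> nat \<Rightarrow> real" where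
  "sigma_S M a \<xi> n = sqrt (prob_space.variance M (S_sum a \<xi> n))"

text \<open>A Bochner integral is \<open>0\<close> for a non-integrable function, so \<open>Lnorm\<close> is the \<open>q\<close>-norm only
  together with \<open>in_Lq\<close>, which expresses its finiteness.\<close>

definition in_Lq :: "'a measure \<Rightarrow> real \<Rightarrow> ('a \<Rightarrow> real) \<Rightarrow> bool" where
  "in_Lq M q Y \<longleftrightarrow> Y \<in> borel_measurable M \<and> integrable M (\<lambda>\<omega>. \<bar>Y \<omega>\<bar> powr q)"

definition Lnorm :: "'a measure \<Rightarrow> real \<Rightarrow> ('a \<Rightarrow> real) \<Rightarrow> real" where
  "Lnorm M q Y = (\<integral>\<omega>. \<bar>Y \<omega>\<bar> powr q \<partial>M) powr (1 / q)"

text \<open>The supremum is used only for continuous \<open>g\<close>, where it is taken over a bounded set.\<close>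

definition local_sup :: "(real \<Rightarrow> real) \<Rightarrow> real \<Rightarrow> real \<Rightarrow> real" where
  "local_sup g \<delta> w = (SUP y\<in>{-\<delta>..\<delta>}. \<bar>g (w + y)\<bar>)"

definition C2 :: "(real \<Rightarrow> real) \<Rightarrow> bool" where
  "C2 f \<longleftrightarrow> (\<forall>i<2. (deriv ^^ i) f differentiable_on UNIV) \<and> continuous_on UNIV ((deriv ^^ 2) f)"

text \<open>The integrability clause says that the expectation defining \<open>K_n\<close> exists. The three
  \<open>in_Lq\<close> clauses say that the norms in the \<open>O(1)\<close> condition are eventually finite.\<close>

definition condition_B ::
  "'a measure \<Rightarrow> (nat \<Rightarrow> real) \<Rightarrow> (int \<Rightarrow> 'a \<Rightarrow> real) \<Rightarrow> (real \<Rightarrow> real) \<Rightarrow> real \<Rightarrow> real \<Rightarrow> bool" where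
  "condition_B M a \<xi> K p q \<longleftrightarrow>
     2 \<le> q \<and> q < p \<and> p \<le> 2 * q \<and> in_Lq M p (\<xi> 0) \<and>
     (\<forall>\<^sub>F n in sequentially.
        (\<forall>w. integrable M
           (\<lambda>\<omega>. K (w + lin_proc a \<xi> (int n) \<omega> - lin_pred M a \<xi> (int n) 0 \<omega>))) \<and>
        C2 (K_fin M a \<xi> K n)) \<and>
     (\<exists>\<delta>>0.
        let A = (\<lambda>i n \<omega>. local_sup ((deriv ^^ i) (K_fin M a \<xi> K (n - 1))) \<delta>
                           (lin_pred M a \<xi> (int n) 0 \<omega>));
            B = (\<lambda>n \<omega>. \<bar>\<xi> 1 \<omega>\<bar> powr (p / q) * K_fin M a \<xi> K (n - 1) (lin_pred M a \<xi> (int n) 1 \<omega>));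
            C = (\<lambda>n \<omega>. \<xi> 1 \<omega> * deriv (K_fin M a \<xi> K (n - 1)) (lin_pred M a \<xi> (int n) 1 \<omega>))
        in (\<forall>\<^sub>F n in sequentially.
              (\<forall>i\<le>2. in_Lq M q (A i n)) \<and> in_Lq M q (B n) \<and> in_Lq M q (C n)) \<and>
           (\<lambda>n. (\<Sum>i\<le>2. Lnorm M q (A i n)) + Lnorm M q (B n) + Lnorm M q (C n)) \<in> O(\<lambda>_. 1))"

end

theory Submission imports Defs "HOL-Real_Asymp.Real_Asymp" begin

text \<open>
  Let \<open>L(x) = K(x) - \<kappa>x\<close>. The sum of the \<open>L(X_i)\<close> is split along the filtration into martingale
  differences. Their \<open>q\<close>-norms are estimated by expanding \<open>K_m\<close> to second order (Condition B controls
  the remainder) and by viewing \<open>K_m'(X_{n,k})\<close> as a reverse martingale with limit \<open>\<kappa>\<close>; it is a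
  martingale because \<open>X_0\<close> has a density, which follows from the decay of its characteristic function.
  A moment inequality for martingales gives a bound of order \<open>n^{3/2 - \<beta>}\<close> for
  \<open>\<parallel>H_n - \<kappa>S_n\<parallel>_q\<close> with \<open>\<beta>\<close> close to \<open>min (r/v) (2r - 1/2) 1\<close>, \<open>v = \<omega>(r)\<close>. As \<open>\<sigma>_n\<close> is of order
  \<open>n^{3/2 - r}\<close> up to slowly varying factors, Markov's inequality makes \<open>H_n - \<kappa>S_n\<close> negligible exactly when
  \<open>c < 2p\<rho>(r)\<close>. It remains to treat \<open>S_n\<close>, a weighted sum of the \<open>\<xi>_j\<close> with uniformly small weights,
  for which truncation, an exponential change of measure and a Lindeberg replacement give the
  moderate deviation estimate for \<open>x^2 \<le> (p - 2) ln n\<close>.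
\<close>

section \<open>Slowly varying coefficients\<close>

text \<open>Two obstacles shape the proof. Condition B controls K_m and its derivatives only in L^q
  along the process, so the identity K_{m+1}(w) = E K_m(w + a_m \<xi>) cannot be differentiated at a
  given w. It is differentiated for almost every w, by comparing integrals over intervals, and this
  says something about the process because the predictors have densities. For the same reason the
  limit \<kappa> is reached indirectly: L^q bounds at a predictor that tends to 0 become
  deterministic bounds near 0, and these give K_m'(0) -> \<kappa>. The second obstacle is that the
  normal approximation must be relative to a tail as small as n^{-c/2}. The change of measure is
  never made explicit; the derivatives of the smoothed normal distribution function carry a factor
  exp(lam*z + lam^2*s/2), whose mean is a moment generating function. At the end point c = p - 2 the
  probability of truncation has the same power of n as the tail, and a truncation level of order
  sqrt(ln n) is what makes it smaller. A loss of n^\<eta> in Potter bounds is harmless where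
  exponents leave room; the weights of S_n need the exact order.\<close>

text \<open>For \<open>h u = ln (l (exp u))\<close> this is the uniform convergence theorem, by a
  covering argument of Steinhaus type: pointwise convergence makes the bad sets small in measure,
  and two small sets cannot cover an interval of length 1.\<close>

lemma slowly_varying_uniform:
 fixes l :: "real => real"
 assumes pos: "!!t. 0 < t ==> 0 < l t" and sv: "slowly_varying l" and eta: "0 < \<eta>"
 shows "\<exists>x0\<ge>1. \<forall>x\<ge>x0. \<forall>t\<in>{1..2}. \<bar>ln (l (t*x)) - ln (l x)\<bar> <= \<eta>"
proof -
 define h where "h u = ln (l (exp u))" for u
 have "(%x. indicator {0<..} x *\<^sub>R l x) \<in> borel_measurable borel"
  using sv unfolding slowly_varying_def set_borel_measurable_def by auto
 then have "(%u. ln (indicator {0<..} (exp u) *\<^sub>R l (exp u))) \<in> borel_measurable borel"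
  by measurable
 also have "(%u. ln (indicator {0<..} (exp u) *\<^sub>R l (exp u))) = h"
  by (auto simp: h_def)
 finally have hm[measurable]: "h \<in> borel_measurable borel" .
 have hlim: "((%x. h (x + u) - h x) \<longlongrightarrow> 0) at_top" for u
 proof -
  have "((%x. l (exp u*x)/l x) \<longlongrightarrow> 1) at_top"
   using sv unfolding slowly_varying_def by auto
  then have "((%x. l (exp u*exp x)/l (exp x)) \<longlongrightarrow> 1) at_top"
   by (rule filterlim_compose[OF _ exp_at_top])
  then have "((%x. ln (l (exp u*exp x)/l (exp x))) \<longlongrightarrow> ln 1) at_top"
   by (intro tendsto_ln) auto
  moreover have "ln (l (exp u*exp x)/l (exp x)) = h (x + u) - h x" for x
   by (simp add: h_def exp_add ln_div pos mult.commute less_imp_neq[OF pos, symmetric])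
  ultimately show ?thesis by simp
 qed
 \<comment> \<open>Increments up to 2 are collected so that, for \<open>u\<close> in [0,1] and
   \<open>v\<close> in [1,2], both \<open>v\<close> and \<open>v - u\<close> are admissible. The
   tolerance is halved because two of these sets are combined.\<close>
 define B where "B x = {u\<in>{0..2::real}. \<bar>h (x + u) - h x\<bar> > \<eta>/2}" for x
 have Bm[measurable]: "B x \<in> sets borel" for x unfolding B_def by measurable
 have "((%x. \<integral>u. (indicator (B x) u :: real) \<partial>lborel) \<longlongrightarrow> (\<integral>u. 0 \<partial>(lborel::real measure))) at_top"
 proof (rule integral_dominated_convergence_at_top[where f="%_. 0" and s="%x. indicator (B x)" and w="indicator {0..2::real}" and M=lborel])
  show "integrable lborel (indicator {0..2::real} :: real => real)" by simp
  show "AE u in lborel. ((%x. indicator (B x) u :: real) \<longlongrightarrow> 0) at_top"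
  proof (rule AE_I2)
   fix u :: real
   have "eventually (%x. \<bar>h (x + u) - h x\<bar> < \<eta>/2) at_top"
    using tendstoD[OF hlim[of u], of "\<eta>/2"] eta by (simp add: dist_real_def)
   then have "eventually (%x. indicator (B x) u = (0::real)) at_top"
    by eventually_elim (auto simp: B_def indicator_def)
   then show "((%x. indicator (B x) u :: real) \<longlongrightarrow> 0) at_top"
    by (rule tendsto_eventually)
  qed
  show "\<forall>\<^sub>F x in at_top. AE u in lborel. norm (indicator (B x) u :: real) <= indicator {0..2} u"
   by (auto simp: B_def indicator_def)
 qed auto
 then have "eventually (%x. measure lborel (B x) < 1/2) at_top"
  by (auto dest: order_tendstoD(2)[where a="1/2"])
 then obtain X where X: "!!x. x >= X ==> measure lborel (B x) < 1/2"
  by (auto simp: eventually_at_top_linorder)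
 have main: "\<bar>h (x + u) - h x\<bar> <= \<eta>" if "x >= X" "u \<in> {0..1}" for x u
 proof (rule ccontr)
  assume neg: "\<not> ?thesis"
  let ?B' = "(%v. (-u) + v) -` B (x + u)"
  have fin: "emeasure lborel (B y) < \<infinity>" for y
  proof -
   have "emeasure lborel (B y) <= emeasure lborel {0..2::real}"
    by (rule emeasure_mono) (auto simp: B_def)
   then show ?thesis by (simp add: order.strict_trans1)
  qed
  have eqB: "emeasure lborel (B y) = ennreal (measure lborel (B y))" for y
   using fin[of y] by (simp add: emeasure_eq_ennreal_measure less_top[symmetric])
  have tr: "emeasure lborel ?B' = emeasure lborel (B (x + u))"
  proof -
   have "emeasure lborel (B (x + u)) = emeasure (distr lborel borel ((+) (-u))) (B (x + u))"
    by (simp add: lborel_distr_plus)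
   also have "... = emeasure lborel ?B'"
    by (subst emeasure_distr) auto
   finally show ?thesis ..
  qed
  have vB[measurable]: "?B' \<in> sets borel" by (rule measurable_sets_borel[OF _ Bm]) measurable
  \<comment> \<open>If the increment \<open>u\<close> were bad by more than \<eta>, every
    \<open>v\<close> would be bad seen from \<open>x\<close> or, after the shift by
    \<open>u\<close>, seen from \<open>x + u\<close>.\<close>
  have sub: "{1..2} \<subseteq> B x \<union> ?B'"
  proof
   fix v :: real assume v: "v \<in> {1..2}"
   show "v \<in> B x \<union> ?B'"
   proof (rule ccontr)
    assume "v \<notin> B x \<union> ?B'"
    then have "\<bar>h (x + v) - h x\<bar> <= \<eta>/2" "\<bar>h (x + v) - h (x + u)\<bar> <= \<eta>/2"
     using v that by (auto simp: B_def)
    then show False using neg by linarith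
   qed
  qed
  have "1 = emeasure lborel {1..2::real}" by simp
  also have "... <= emeasure lborel (B x \<union> ?B')"
   using sub vB by (intro emeasure_mono) auto
  also have "... <= emeasure lborel (B x) + emeasure lborel ?B'"
   using vB by (intro emeasure_subadditive) auto
  also have "... = ennreal (measure lborel (B x) + measure lborel (B (x + u)))"
   unfolding tr eqB by simp
  finally have "ennreal 1 <= ennreal (measure lborel (B x) + measure lborel (B (x + u)))" by (simp only: ennreal_1)
  then have "1 <= measure lborel (B x) + measure lborel (B (x + u))"
   by (subst (asm) ennreal_le_iff) (auto intro: add_nonneg_nonneg)
  moreover have "measure lborel (B x) < 1/2" "measure lborel (B (x+u)) < 1/2"
   using X that by auto
  ultimately show False by simp
 qed
 show ?thesis
 proof (intro exI[of _ "max 1 (exp X)"] conjI allI impI ballI)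
  fix x t :: real assume x: "max 1 (exp X) <= x" and t: "t \<in> {1..2}"
  have lnt: "ln t \<in> {0..1}" using t ln_le_minus_one[of t] by auto
  have "ln x >= X" using x by (metis exp_gt_zero ln_exp ln_le_cancel_iff max.bounded_iff order_less_le_trans)
  from main[OF this lnt] show "\<bar>ln (l (t*x)) - ln (l x)\<bar> <= \<eta>"
   using x t by (simp add: h_def exp_add mult.commute)
 qed auto
qed

text \<open>Each doubling of the argument costs at most \<eta> ln 2 in ln l, which the term \<eta>
  ln(y/x) pays for; one spare \<eta> ln 2 covers the last, incomplete doubling. The integers below
  the threshold are finitely many and go into the constant.\<close>

lemma potter_bound:
 fixes l :: "real => real"
 assumes pos: "!!t. 0 < t ==> 0 < l t" and sv: "slowly_varying l" and eta: "0 < \<eta>"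
 shows "\<exists>C\<ge>1. \<forall>m n::nat. 1 <= m \<longrightarrow> m <= n \<longrightarrow>
  l (real n) <= C*(real n/real m) powr \<eta>*l (real m) &
  l (real m) <= C*(real n/real m) powr \<eta>*l (real n)"
proof -
 obtain x0 where x0: "x0 >= 1" "!!x t. x >= x0 ==> t \<in> {1..2} ==> \<bar>ln (l (t*x)) - ln (l x)\<bar> <= \<eta>*ln 2"
  using slowly_varying_uniform[OF pos sv, of "\<eta>*ln 2"] eta by auto
 have step: "x >= x0 ==> x <= y ==> y <= 2 ^ k*x ==> \<bar>ln (l y) - ln (l x)\<bar> <= \<eta>*ln (y/x) + \<eta>*ln 2"
  for x y :: real and k :: nat
 proof (induction k arbitrary: y)
  case 0
  then have "y = x" by simp
  then show ?case using eta 0 x0(1) by simp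
 next
  case (Suc k)
  show ?case
  proof (cases "y <= 2*x")
   case True
   have "\<bar>ln (l (y/x*x)) - ln (l x)\<bar> <= \<eta>*ln 2"
    using Suc.prems True x0(1) by (intro x0(2)) (auto simp: field_simps)
   moreover have "\<eta>*ln (y/x) >= 0"
    using Suc.prems x0(1) eta by (intro mult_nonneg_nonneg) (auto simp: ln_ge_zero_iff)
   ultimately show ?thesis using Suc.prems x0(1) by simp
  next
   case False
   have "\<bar>ln (l (y/2)) - ln (l x)\<bar> <= \<eta>*ln (y/2/x) + \<eta>*ln 2"
    using Suc.prems False by (intro Suc.IH) auto
   moreover have "\<bar>ln (l (2*(y/2))) - ln (l (y/2))\<bar> <= \<eta>*ln 2"
    using Suc.prems False x0 by (intro x0(2)) auto
   moreover have "ln (y/x) = ln (y/2/x) + ln 2"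
    using Suc.prems False x0 by (simp add: ln_div ln_mult)
   ultimately show ?thesis by (simp add: algebra_simps)
  qed
 qed
 have big: "\<bar>ln (l y) - ln (l x)\<bar> <= \<eta>*ln (y/x) + \<eta>*ln 2" if "x >= x0" "x <= y" for x y
 proof -
  obtain k :: nat where "y/x < 2 ^ k" using real_arch_pow[of 2 "y/x"] by auto
  then show ?thesis using that x0 by (intro step[of x y k]) (auto simp: field_simps)
 qed
 define N where "N = nat \<lceil>x0\<rceil>"
 have N: "real N >= x0" "N >= 1" using x0(1) by (auto simp: N_def) linarith
 \<comment> \<open>\<open>D\<close> bounds |ln l| at all integers up to the threshold; the constant
   contains it twice, once for each of the two arguments compared.\<close>
 define D where "D = (\<Sum>m\<in>{1..N}. \<bar>ln (l (real m))\<bar>)"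
 have D: "\<bar>ln (l (real m))\<bar> <= D" if "1 <= m" "m <= N" for m
  unfolding D_def using that by (intro member_le_sum) auto
 have D0: "D >= 0" unfolding D_def by (intro sum_nonneg) auto
 have all: "\<bar>ln (l (real n)) - ln (l (real m))\<bar> <= \<eta>*ln (real n/real m) + (\<eta>*ln 2 + 2*D)"
  if mn: "1 <= m" "m <= n" for m n :: nat
 proof -
  have nn: "\<eta>*ln (real n/real m) >= 0" "\<eta>*ln 2 >= 0"
   using mn eta by (auto intro!: mult_nonneg_nonneg simp: ln_ge_zero_iff)
  consider "m >= N" | "n <= N" | "m < N" "N < n" by linarith
  then show ?thesis
  proof cases
   case 1
   then have "\<bar>ln (l (real n)) - ln (l (real m))\<bar> <= \<eta>*ln (real n/real m) + \<eta>*ln 2"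
    using mn N by (intro big) auto
   then show ?thesis using D0 by simp
  next
   case 2
   then show ?thesis using D[of m] D[of n] mn nn by auto
  next
   case 3
   have "\<bar>ln (l (real n)) - ln (l (real N))\<bar> <= \<eta>*ln (real n/real N) + \<eta>*ln 2"
    using 3 N by (intro big) auto
   moreover have "\<eta>*ln (real n/real N) <= \<eta>*ln (real n/real m)"
    using 3 N mn eta by (intro mult_left_mono) (auto simp: frac_le)
   ultimately show ?thesis using D[of m] D[of N] mn 3 N by (simp add: abs_le_iff)
  qed
 qed
 define C where "C = exp (\<eta>*ln 2 + 2*D)"
 have C1: "C >= 1" using D0 eta by (simp add: C_def)
 show ?thesis
 proof (intro exI[of _ C] conjI allI impI C1)
  fix m n :: nat assume mn: "1 <= m" "m <= n"
  have p: "l (real n) > 0" "l (real m) > 0" using pos mn by auto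
  have eq: "C*(real n/real m) powr \<eta> = exp (\<eta>*ln (real n/real m) + (\<eta>*ln 2 + 2*D))"
   using mn by (simp add: C_def powr_def exp_add)
  have "l (real n) = exp (ln (l (real n)) - ln (l (real m)))*l (real m)"
   using p by (simp add: exp_diff)
  also have "... <= C*(real n/real m) powr \<eta>*l (real m)"
   unfolding eq using all[OF mn] p by (intro mult_right_mono) auto
  finally show "l (real n) <= C*(real n/real m) powr \<eta>*l (real m)" .
  have "l (real m) = exp (ln (l (real m)) - ln (l (real n)))*l (real n)"
   using p by (simp add: exp_diff)
  also have "... <= C*(real n/real m) powr \<eta>*l (real n)"
   unfolding eq using all[OF mn] p by (intro mult_right_mono) auto
  finally show "l (real m) <= C*(real n/real m) powr \<eta>*l (real n)" .
 qed
qed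

section \<open>Power sums and the growth of the coefficients\<close>

lemma powr_diff_bounds:
 fixes x t :: real
 assumes "x > 0"
 shows "\<exists>z>x. z < x + 1 & (x + 1) powr t - x powr t = t*z powr (t - 1)"
proof -
 have "\<exists>z>x. z < x + 1 & (x + 1) powr t - x powr t = (x + 1 - x)*(t*z powr (t - 1))"
  using assms by (intro MVT2) (auto intro!: derivative_eq_intros simp: powr_diff field_simps)
 then show ?thesis by simp
qed

lemma sum_powr_le:
 fixes s :: real
 assumes "0 <= s" "s < 1"
 shows "(\<Sum>i<n. (real i + 1) powr (- s)) <= real n powr (1 - s)/(1 - s)"
proof (induction n)
 case (Suc n)
 have "(1 - s)*(real n + 1) powr (- s) <= (real n + 1) powr (1 - s) - real n powr (1 - s)"
 proof (cases "n = 0")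
  case False
  then obtain z where z: "z > real n" "z < real n + 1"
   "(real n + 1) powr (1 - s) - real n powr (1 - s) = (1 - s)*z powr (1 - s - 1)"
   using powr_diff_bounds[of "real n" "1 - s"] by auto
  have "(real n + 1) powr (- s) <= z powr (- s)"
   using z assms False by (intro powr_mono2') auto
  then show ?thesis using z assms by (auto intro!: mult_left_mono)
 qed (use assms in auto)
 then have "(real n + 1) powr (- s) <= ((real n + 1) powr (1 - s) - real n powr (1 - s))/(1 - s)"
  using assms by (simp add: field_simps)
 then show ?case using Suc assms by (simp add: diff_divide_distrib add.commute)
qed (use assms in auto)

text \<open>The factor s/(s-1) is 1 + 1/(s-1): the first term is bounded by
  \<open>m powr (1 - s)\<close> on its own, the others telescope by the mean value theorem.\<close>

lemma sum_powr_tail_le: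
 fixes s :: real
 assumes "s > 1" "m >= 1"
 shows "(\<Sum>i<n. (real (m + i)) powr (- s)) <= s/(s - 1)*real m powr (1 - s)"
proof -
 have *: "(\<Sum>i<n. (real (m + i + 1)) powr (- s)) <= (real m powr (1 - s) - real (m + n) powr (1 - s))/(s - 1)"
 proof (induction n)
  case (Suc n)
  obtain z where z: "z > real (m + n)" "z < real (m + n) + 1"
   "(real (m + n) + 1) powr (1 - s) - real (m + n) powr (1 - s) = (1 - s)*z powr (1 - s - 1)"
   using powr_diff_bounds[of "real (m+n)" "1 - s"] assms by auto
  have "(real (m + n) + 1) powr (- s) <= z powr (- s)"
   using z assms by (intro powr_mono2') auto
  then have "(s - 1)*(real (m + n) + 1) powr (- s) <= (s - 1)*z powr (- s)"
   using assms by (intro mult_left_mono) auto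
  also have "... = real (m + n) powr (1 - s) - (real (m + n) + 1) powr (1 - s)"
   using z(3) by (simp add: algebra_simps)
  finally have "(real (m + n) + 1) powr (- s) <= (real (m + n) powr (1 - s) - (real (m + n) + 1) powr (1 - s))/(s - 1)"
   using assms by (simp add: field_simps)
  then show ?case using Suc assms by (simp add: diff_divide_distrib add_ac)
 qed (use assms in auto)
 have sm: "(\<Sum>i<n. (real (m + i)) powr (- s)) <= real m powr (- s) + (\<Sum>i<n. (real (m + i + 1)) powr (- s))"
 proof (cases n)
  case (Suc k)
  have "(\<Sum>i<n. (real (m + i)) powr (- s)) = real m powr (- s) + (\<Sum>i<k. (real (m + i + 1)) powr (- s))"
   unfolding Suc by (subst sum.lessThan_Suc_shift) simp
  also have "(\<Sum>i<k. (real (m + i + 1)) powr (- s)) <= (\<Sum>i<n. (real (m + i + 1)) powr (- s))"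
   using Suc by (intro sum_mono2) auto
  finally show ?thesis by simp
 qed simp
 have "real m powr (- s) <= real m powr (1 - s)" using assms by (intro powr_mono) auto
 then have "(\<Sum>i<n. (real (m + i)) powr (- s)) <= real m powr (1 - s) + real m powr (1 - s)/(s - 1)"
  using sm * assms by (smt (verit) divide_right_mono powr_ge_zero)
 also have "... = s/(s - 1)*real m powr (1 - s)"
  using assms by (simp add: field_simps)
 finally show ?thesis .
qed

text \<open>Potter's bound is taken against the argument 1, where \<open>l 1 = 1\<close> because
  \<open>a 0 = 1\<close>.\<close>

lemma regularly_varying_coeffs:
 fixes l :: "real => real" and a :: "nat => real"
 assumes pos: "!!t. 0 < t ==> 0 < l t" and sv: "slowly_varying l"
  and a: "!!i. a i = l (real i + 1)*(1 + real i) powr (- r)" "a 0 = 1"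
  and r: "1/2 < r" "r < 1" and eta: "0 < \<eta>"
 shows "\<exists>C\<ge>1. \<forall>i. a i <= C*(1 + real i) powr (\<eta> - r) & (1 + real i) powr (- r - \<eta>) <= C * a i"
proof -
 obtain C where C: "C >= 1" "!!m n::nat. 1 <= m ==> m <= n ==>
  l (real n) <= C*(real n/real m) powr \<eta>*l (real m) &
  l (real m) <= C*(real n/real m) powr \<eta>*l (real n)"
  using potter_bound[OF pos sv eta] by auto
 have l1: "l 1 = 1" using a(1)[of 0] a(2) by simp
 show ?thesis
 proof (intro exI[of _ C] conjI allI C(1))
  fix i
  have 1: "l (real i + 1) <= C*(1 + real i) powr \<eta>" "1 <= C*(1 + real i) powr \<eta>*l (real i + 1)"
   using C(2)[of 1 "Suc i"] l1 by (auto simp: add.commute)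
  have "a i <= C*(1 + real i) powr \<eta>*(1 + real i) powr (- r)"
   unfolding a(1) using 1(1) by (intro mult_right_mono) auto
  then show "a i <= C*(1 + real i) powr (\<eta> - r)" by (simp add: powr_diff powr_minus field_simps)
  have "(1 + real i) powr (- r - \<eta>)*1 <= (1 + real i) powr (- r - \<eta>)*(C*(1 + real i) powr \<eta>*l (real i + 1))"
   using 1(2) by (intro mult_left_mono) auto
  also have "... = C * a i" unfolding a(1) by (simp add: powr_diff field_simps)
  finally show "(1 + real i) powr (- r - \<eta>) <= C * a i" by simp
 qed
qed

text \<open>A Karamata estimate of the exact order n^{1-r} l(n), so that later the ratio of a weight
  to the standard deviation is of order n^{-1/2} without loss. A window is split at the index n:
  below it the sum is compared with a power sum of exponent r + \<eta> < 1, above it each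
  coefficient is at most a constant times n^{-r} l(n).\<close>

lemma regularly_varying_sums:
 fixes l :: "real => real" and a :: "nat => real"
 assumes pos: "!!t. 0 < t ==> 0 < l t" and sv: "slowly_varying l"
  and a: "!!i. a i = l (real i + 1)*(1 + real i) powr (- r)"
  and r: "1/2 < r" "r < 1"
 shows "\<exists>C\<ge>1. \<forall>n\<ge>1. (\<forall>J. (\<Sum>i\<in>{J..<J + n}. a i) <= C*(real n powr (1 - r)*l (real n))) &
  (\<forall>k. n <= 2 * k \<longrightarrow> k <= n \<longrightarrow> real n powr (1 - r)*l (real n) <= C*(\<Sum>i<k. a i))"
proof -
 \<comment> \<open>Small enough for r + \<eta> < 1 in the power sum and for \<eta> < r, which makes
   the power \<eta> - r decreasing.\<close>
 define \<eta> where "\<eta> = (1 - r)/2"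
 have eta: "0 < \<eta>" "\<eta> < r" "r + \<eta> < 1" using r by (auto simp: \<eta>_def field_simps)
 obtain C where C: "C >= 1" "!!m n::nat. 1 <= m ==> m <= n ==>
  l (real n) <= C*(real n/real m) powr \<eta>*l (real m) &
  l (real m) <= C*(real n/real m) powr \<eta>*l (real n)"
  using potter_bound[OF pos sv eta(1)] by auto
 have apos: "a i > 0" for i unfolding a using pos[of "real i + 1"] by simp
 define R where "R n = real n powr (1 - r)*l (real n)" for n :: nat
 have up1: "(\<Sum>i<n. a i) <= C/(1 - r - \<eta>) * R n" if n: "n >= 1" for n
 proof -
  have "(\<Sum>i<n. a i) <= (\<Sum>i<n. C*real n powr \<eta>*l (real n)*(real i + 1) powr (- (r + \<eta>)))"
  proof (intro sum_mono)
   fix i assume "i \<in> {..<n}"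
   then have "l (real (Suc i)) <= C*(real n/real (Suc i)) powr \<eta>*l (real n)"
    using C(2)[of "Suc i" n] by auto
   then have "a i <= C*(real n/real (Suc i)) powr \<eta>*l (real n)*(1 + real i) powr (- r)"
    unfolding a by (intro mult_right_mono) (auto simp: add.commute)
   also have "... = C*real n powr \<eta>*l (real n)*(real i + 1) powr (- (r + \<eta>))"
    by (simp add: powr_divide powr_diff powr_minus powr_add field_simps)
   finally show "a i <= C*real n powr \<eta>*l (real n)*(real i + 1) powr (- (r + \<eta>))" .
  qed
  also have "... = C*real n powr \<eta>*l (real n)*(\<Sum>i<n. (real i + 1) powr (- (r + \<eta>)))"
   by (simp add: sum_distrib_left)
  also have "... <= C*real n powr \<eta>*l (real n)*(real n powr (1 - (r + \<eta>))/(1 - (r + \<eta>)))"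
   using C(1) pos[of "real n"] n eta r by (intro mult_left_mono sum_powr_le) auto
  also have "... = C/(1 - r - \<eta>)*(l (real n)*(real n powr \<eta>*real n powr (1 - (r + \<eta>))))"
   by (simp add: diff_diff_eq)
  also have "real n powr \<eta>*real n powr (1 - (r + \<eta>)) = real n powr (1 - r)"
   unfolding powr_add[symmetric] by (simp add: algebra_simps)
  finally show ?thesis by (simp add: R_def mult_ac)
 qed
 have up2: "a i <= C*(R n/real n)" if n: "n >= 1" "n <= i" for n i
 proof -
  have "l (real (Suc i)) <= C*(real (Suc i)/real n) powr \<eta>*l (real n)"
   using C(2)[of n "Suc i"] n by auto
  then have "a i <= C*(real (Suc i)/real n) powr \<eta>*l (real n)*(1 + real i) powr (- r)"
   unfolding a by (intro mult_right_mono) (auto simp: add.commute)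
  also have "... = C*l (real n)*real n powr (- r)*(real (Suc i)/real n) powr (\<eta> - r)"
   using n by (simp add: powr_divide powr_diff powr_minus field_simps)
  also have "... <= C*l (real n)*real n powr (- r)*1"
  proof -
   have "(real (Suc i)/real n) powr (\<eta> - r) <= 1 powr (\<eta> - r)"
    using n eta by (intro powr_mono2') (auto simp: field_simps)
   then show ?thesis using C(1) pos[of "real n"] n by (intro mult_left_mono) auto
  qed
  also have "... = C*(R n/real n)" using n by (simp add: R_def powr_diff powr_minus field_simps)
  finally show ?thesis .
 qed
 have low: "R n/real n <= C * a i" if n: "i < n" for n i
 proof -
  have "l (real n) <= C*(real n/real (Suc i)) powr \<eta>*l (real (Suc i))"
   using C(2)[of "Suc i" n] n by auto
  then have "real n powr (-r)*l (real n) <= real n powr (-r)*(C*(real n/real (Suc i)) powr \<eta>*l (real (Suc i)))"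
   by (intro mult_left_mono) auto
  also have "... = C * a i*(real n/real (Suc i)) powr (\<eta> - r)"
   unfolding a using n by (simp add: powr_divide powr_diff powr_minus field_simps)
  also have "... <= C * a i*1"
  proof -
   have "(real n/real (Suc i)) powr (\<eta> - r) <= 1 powr (\<eta> - r)"
    using n eta by (intro powr_mono2') (auto simp: field_simps)
   then show ?thesis using C(1) apos[of i] by (intro mult_left_mono) auto
  qed
  finally show ?thesis using n by (simp add: R_def powr_diff powr_minus field_simps)
 qed
 define D where "D = C/(1 - r - \<eta>) + 2*C"
 have Cr: "C/(1 - r - \<eta>) >= 0" using C eta r by (intro divide_nonneg_nonneg) auto
 then have D: "D >= 1" "2*C <= D" using C by (auto simp: D_def)
 have Rp: "R n > 0" if "n >= 1" for n unfolding R_def using pos[of "real n"] that by simp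
 show ?thesis unfolding R_def[symmetric]
 proof (intro exI[of _ D] conjI allI impI D(1))
  fix n J :: nat assume n: "1 <= n"
  have "(\<Sum>i\<in>{J..<J + n}. a i) <= (\<Sum>i\<in>{..<n} \<union> ({J..<J+n} \<inter> {n..}). a i)"
   using apos by (intro sum_mono2) (auto simp: less_imp_le)
  also have "... <= (\<Sum>i<n. a i) + (\<Sum>i\<in>{J..<J+n} \<inter> {n..}. a i)"
   by (subst sum.union_disjoint) auto
  also have "(\<Sum>i\<in>{J..<J+n} \<inter> {n..}. a i) <= of_nat (card ({J..<J+n} \<inter> {n..}))*(C*(R n/real n))"
   using n up2[OF n] by (intro sum_bounded_above) auto
  also have "... <= real n*(C*(R n/real n))"
  proof -
   have "card ({J..<J+n} \<inter> {n..}) <= card {J..<J+n}" by (intro card_mono) auto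
   then show ?thesis using C Rp[OF n] by (intro mult_right_mono) auto
  qed
  also have "... = C * R n" using n by simp
  finally have "(\<Sum>i\<in>{J..<J + n}. a i) <= C/(1 - r - \<eta>) * R n + C * R n"
   using up1[OF n] by simp
  also have "... <= D * R n" unfolding D_def using Rp[OF n] C by (simp add: algebra_simps)
  finally show "(\<Sum>i\<in>{J..<J + n}. a i) <= D * R n" .
 next
  fix n k :: nat assume n: "1 <= n" "n <= 2 * k" "k <= n"
  have "R n = 2*(real n/2*(R n/real n))" using n by simp
  also have "real n/2*(R n/real n) <= real k*(R n/real n)"
   using n Rp[of n] by (intro mult_right_mono) auto
  also have "real k*(R n/real n) = (\<Sum>i<k. R n/real n)" by simp
  also have "... <= (\<Sum>i<k. C * a i)" using n by (intro sum_mono low) auto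
  finally have "R n <= 2*C*(\<Sum>i<k. a i)" by (simp add: sum_distrib_left mult.assoc)
  also have "... <= D*(\<Sum>i<k. a i)"
   using D(2) apos by (intro mult_right_mono sum_nonneg) (auto simp: less_imp_le)
  finally show "R n <= D*(\<Sum>i<k. a i)" .
 qed
qed

section \<open>Moments and martingale differences\<close>

lemma powr_convex_combination:
 fixes u v t q :: real
 assumes "u >= 0" "v >= 0" "0 <= t" "t <= 1" "q >= 1"
 shows "(t*u + (1 - t) * v) powr q <= t*u powr q + (1 - t) * v powr q"
proof -
 have le: "s powr q <= s" if "0 <= s" "s <= 1" for s :: real
 proof (cases "s = 0")
  case False
  then have "s powr q <= s powr 1" using that assms by (intro powr_mono') auto
  then show ?thesis using that False by simp
 qed simp
 consider "u = 0" | "v = 0" | "u > 0" "v > 0" using assms by linarith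
 then show ?thesis
 proof cases
  case 1
  then show ?thesis using le[of "1 - t"] assms by (simp add: powr_mult mult_right_mono)
 next
  case 2
  then show ?thesis using le[of t] assms by (simp add: powr_mult mult_right_mono)
 next
  case 3
  have "(t*u + (1 - t) * v) powr q <= t*u powr q + (1 - t) * v powr q"
   using convex_onD[OF powr_convex[OF assms(5)], of "1 - t" u v] 3 assms by simp
  then show ?thesis .
 qed
qed

text \<open>Where |d| >= |x|/2, every term is dominated by |d|^q. Otherwise x and x + d have the
  same sign, and two applications of the mean value theorem leave an intermediate point of size at
  most 3|x|/2. The constant is the sum of what the two cases require.\<close>

lemma powr_add_expansion:
 fixes q :: real
 assumes q: "q >= 2"
 shows "\<exists>C\<ge>0. \<forall>x d. \<bar>x + d\<bar> powr q <= (abs x) powr q + q*(sgn x*(abs x) powr (q - 1))*d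
      + C*((abs x) powr (q - 2)*d^2 + (abs d) powr q)"
proof -
 have mvt: "\<exists>z. \<bar>z - x\<bar> <= \<bar>y - x\<bar> & min x y <= z & z <= max x y & y powr s - x powr s = s*z powr (s - 1)*(y - x)"
  if "x > 0" "y > 0" for x y s :: real
 proof -
  consider "x < y" | "x = y" | "y < x" by linarith
  then show ?thesis
  proof cases
   case 1
   have "\<exists>z>x. z < y & y powr s - x powr s = (y - x)*(s*z powr (s - 1))"
    using 1 that by (intro MVT2) (auto intro!: derivative_eq_intros simp: powr_diff field_simps)
   then obtain z where "z > x" "z < y" "y powr s - x powr s = (y - x)*(s*z powr (s - 1))" by auto
   then show ?thesis using 1 by (intro exI[of _ z]) (auto simp: algebra_simps)
  next
   case 3
   have "\<exists>z>y. z < x & x powr s - y powr s = (x - y)*(s*z powr (s - 1))"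
    using 3 that by (intro MVT2) (auto intro!: derivative_eq_intros simp: powr_diff field_simps)
   then obtain z where "z > y" "z < x" "x powr s - y powr s = (x - y)*(s*z powr (s - 1))" by auto
   then show ?thesis using 3 by (intro exI[of _ z]) (auto simp: algebra_simps)
  qed auto
 qed
 define C where "C = 3 powr q + q*2 powr (q - 1) + q*(q - 1)*(3/2) powr (q - 2)"
 have C0: "3 powr q + q*2 powr (q - 1) <= C" "q*(q - 1)*(3/2) powr (q - 2) <= C" "0 <= C" "1 <= C"
  using q ge_one_powr_ge_zero[of 3 q] by (auto simp: C_def intro!: add_nonneg_nonneg add_increasing2)
 have pos: "\<bar>x + d\<bar> powr q <= (abs x) powr q + q*(sgn x*(abs x) powr (q - 1))*d
      + C*((abs x) powr (q - 2)*d^2 + (abs d) powr q)" if x: "x > 0" for x d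
 proof (cases "(abs d) >= x/2")
  case True
  have "\<bar>x + d\<bar> powr q <= (3*(abs d)) powr q" using True x q by (intro powr_mono2) auto
  then have 1: "\<bar>x + d\<bar> powr q <= 3 powr q*(abs d) powr q" by (simp add: powr_mult)
  have "x powr (q - 1)*(abs d) <= (2*(abs d)) powr (q - 1)*(abs d)"
   using True x q by (intro mult_right_mono powr_mono2) auto
  also have "... = 2 powr (q - 1)*(abs d) powr q"
   using True x by (simp add: powr_mult powr_diff)
  finally have 2: "q*(x powr (q - 1)*(abs d)) <= q*(2 powr (q - 1)*(abs d) powr q)"
   using q by (intro mult_left_mono) auto
  have "- (q*(x powr (q - 1)*d)) <= q*(x powr (q - 1)*(abs d))"
   using q x abs_ge_minus_self[of "q*(x powr (q - 1)*d)"] by (simp add: abs_mult)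
  moreover have "(3 powr q + q*2 powr (q - 1))*(abs d) powr q <= C*(abs d) powr q"
   using C0 by (intro mult_right_mono) auto
  moreover have "0 <= C*((abs x) powr (q - 2)*d^2)" using C0 by simp
  ultimately show ?thesis using 1 2 x by (simp add: algebra_simps) (smt (verit) powr_ge_zero)
 next
  case False
  then have y: "x + d > 0" by (auto simp: abs_if split: if_splits)
  obtain z where z: "\<bar>z - x\<bar> <= (abs d)" "min x (x+d) <= z" "z <= max x (x+d)" "(x+d) powr q - x powr q = q*z powr (q - 1)*d"
   using mvt[OF x y, of q] by auto
  have z0: "z > 0" using z(2) x y by (auto simp: min_def split: if_splits)
  obtain w where w: "min x z <= w" "w <= max x z" "z powr (q-1) - x powr (q-1) = (q - 1)*w powr (q - 1 - 1)*(z - x)"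
   using mvt[OF x z0, of "q - 1"] by auto
  have w0: "w > 0" "w <= 3/2*x" using w(1,2) x z0 z False by (auto simp: min_def max_def split: if_splits)
  have "(x+d) powr q - x powr q - q*x powr (q - 1)*d = q*(z powr (q-1) - x powr (q-1))*d"
   unfolding z(4) by (simp add: algebra_simps)
  also have "... = q*(q - 1)*w powr (q - 2)*((z - x)*d)" unfolding w(3) by (simp add: algebra_simps)
  also have "... <= q*(q - 1)*((3/2) powr (q - 2)*x powr (q - 2))*((abs d)*(abs d))"
  proof (rule mult_mono)
   have "w powr (q - 2) <= (3/2*x) powr (q - 2)" using w0 q by (intro powr_mono2) auto
   then have "w powr (q - 2) <= (3/2) powr (q - 2)*x powr (q - 2)" using x by (subst (asm) powr_mult) auto
   then show "q*(q - 1)*w powr (q - 2) <= q*(q - 1)*((3/2) powr (q - 2)*x powr (q - 2))"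
    using q by (intro mult_left_mono) auto
   have "(z - x)*d <= \<bar>z - x\<bar>*(abs d)" by (metis abs_ge_self abs_mult)
   also have "... <= (abs d)*(abs d)" using z(1) by (intro mult_right_mono) auto
   finally show "(z - x)*d <= (abs d)*(abs d)" .
   show "0 <= (z - x)*d"
   proof (cases "d >= 0")
    case True then show ?thesis using z(2) by auto
   next
    case False then show ?thesis using z(3) by (intro mult_nonpos_nonpos) auto
   qed
  qed (use q in auto)
  also have "... = q*(q - 1)*(3/2) powr (q - 2)*(x powr (q - 2)*d^2)"
   by (simp add: power2_eq_square algebra_simps)
  also have "... <= C*(x powr (q - 2)*d^2)" using C0 by (intro mult_right_mono) auto
  finally have "(x+d) powr q - x powr q - q*x powr (q - 1)*d <= C*(x powr (q - 2)*d^2)" .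
  moreover have "0 <= C*(abs d) powr q" using C0 by simp
  ultimately have "(x+d) powr q <= x powr q + q*x powr (q - 1)*d + C*(x powr (q - 2)*d^2) + C*(abs d) powr q" by linarith
  then show ?thesis using x y by (simp add: distrib_left)
 qed
 show ?thesis
 proof (intro exI[of _ C] conjI allI C0(3))
  fix x d :: real
  consider "x > 0" | "x = 0" | "x < 0" by linarith
  then show "\<bar>x + d\<bar> powr q <= (abs x) powr q + q*(sgn x*(abs x) powr (q - 1))*d
      + C*((abs x) powr (q - 2)*d^2 + (abs d) powr q)"
  proof cases
   case 1 then show ?thesis by (rule pos)
  next
   case 2 then show ?thesis using C0(4) mult_right_mono[of 1 C "(abs d) powr q"] by simp
  next
   case 3
   then show ?thesis using pos[of "-x" "-d"] by (simp add: abs_minus_commute add.commute)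
  qed
 qed
qed

text \<open>Closes the induction for martingale differences: \<open>u\<close> is the sum of the
  squared bounds so far, \<open>v\<close> the next square, \<open>h\<close> is q/2. Superadditivity
  of the h-th power leaves room for half of the mixed term and half of v^h, and
  \<open>K >= 4*C\<close> makes these halves large enough.\<close>

lemma powr_sum_step:
 fixes u v h C K :: real
 assumes "u > 0" "v > 0" "h >= 1" "C >= 0" "K >= 1" "K >= 4*C"
 shows "(K*u) powr h + C*(2*((K*u) powr (h - 1) * v) + v powr h) <= (K*(u + v)) powr h"
proof -
 have split: "x powr h = x powr (h - 1)*x" if "x > 0" for x using that by (simp add: powr_diff)
 have "(u + v) powr (h - 1) >= u powr (h - 1)" "(u + v) powr (h - 1) >= v powr (h - 1)"
  using assms by (auto intro!: powr_mono2)
 then have "u powr (h-1)*u + u powr (h-1) * v <= (u+v) powr (h-1)*u + (u+v) powr (h-1) * v"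
  "u powr (h-1)*u + v powr (h-1) * v <= (u+v) powr (h-1)*u + (u+v) powr (h-1) * v"
  using assms by (auto intro!: add_mono mult_right_mono)
 then have 1: "u powr h + u powr (h-1) * v <= (u + v) powr h" "u powr h + v powr h <= (u + v) powr h"
  using assms split[of u] split[of v] split[of "u+v"] by (auto simp: distrib_left)
 then have 2: "u powr h + u powr (h-1) * v/2 + v powr h/2 <= (u + v) powr h" by linarith
 have "K powr h*(u powr h + u powr (h-1) * v/2 + v powr h/2) <= K powr h*(u + v) powr h"
  using 2 by (intro mult_left_mono) auto
 moreover have "2*C*(K powr (h - 1)) <= K powr h/2"
 proof -
  have "K powr (h - 1)*(4*C) <= K powr (h - 1)*K" using assms by (intro mult_left_mono) auto
  then show ?thesis using split[of K] assms by simp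
 qed
 then have "2*C*(K powr (h - 1))*(u powr (h-1) * v) <= K powr h/2*(u powr (h-1) * v)"
  using assms by (intro mult_right_mono) auto
 moreover have "C <= K powr h/2"
 proof -
  have "K powr 1 <= K powr h" using assms by (intro powr_mono) auto
  then show ?thesis using assms by simp
 qed
 then have "C * v powr h <= K powr h/2 * v powr h" by (intro mult_right_mono) auto
 ultimately have "K powr h*u powr h + 2*C*(K powr (h - 1))*(u powr (h-1) * v) + C * v powr h <= K powr h*(u + v) powr h"
  by (simp add: algebra_simps)
 moreover have "(K*(u + v)) powr h = K powr h*(u + v) powr h" "(K*u) powr h = K powr h*u powr h"
  "(K*u) powr (h - 1) = K powr (h - 1)*u powr (h - 1)"
  using assms by (auto simp: powr_mult)
 ultimately show ?thesis by (simp only: mult_ac distrib_left add_ac)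
qed

section \<open>Bounds on the L^q norm\<close>

text \<open>Membership in L^q is part of the predicate, so that no bound rests on the value 0 which
  the Bochner integral gives to a non-integrable function. Bounds are carried instead of norms
  because they add, scale and survive conditioning without case distinctions.\<close>

definition nrm_le :: "'a measure => real => ('a => real) => real => bool" where
 "nrm_le M q X b \<longleftrightarrow> 0 <= b & X \<in> borel_measurable M & integrable M (%om. (abs (X om)) powr q) &
   (LINT om|M. (abs (X om)) powr q) <= b powr q"

lemma nrm_le_meas: "nrm_le M q X b ==> X \<in> borel_measurable M"
 by (simp add: nrm_le_def)

lemma nrm_le_nonneg: "nrm_le M q X b ==> 0 <= b"
 by (simp add: nrm_le_def)

lemma nrm_le_mono:
 assumes "nrm_le M q X b" "b <= c" "q >= 0"
 shows "nrm_le M q X c"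
 using assms powr_mono2[of q b c] unfolding nrm_le_def by auto

lemma nrm_le_dominated:
 assumes "nrm_le M q Y b" "X \<in> borel_measurable M" "AE om in M. (abs (X om)) <= (abs (Y om))" "q >= 0"
 shows "nrm_le M q X b"
proof -
 have Y: "integrable M (%om. (abs (Y om)) powr q)" using assms by (simp add: nrm_le_def)
 have ae: "AE om in M. (abs (X om)) powr q <= (abs (Y om)) powr q"
  using assms(3) by eventually_elim (use assms in \<open>auto intro!: powr_mono2\<close>)
 have X: "integrable M (%om. (abs (X om)) powr q)"
  by (rule Bochner_Integration.integrable_bound[OF Y]) (use ae assms in auto)
 have "(LINT om|M. (abs (X om)) powr q) <= (LINT om|M. (abs (Y om)) powr q)"
  using X Y ae by (rule integral_mono_AE)
 then show ?thesis using assms X unfolding nrm_le_def by auto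
qed

lemma nrm_le_cong_AE:
 assumes "nrm_le M q Y b" "X \<in> borel_measurable M" "AE om in M. X om = Y om" "q >= 0"
 shows "nrm_le M q X b"
 using assms by (intro nrm_le_dominated[OF assms(1,2)]) auto

lemma nrm_le_scale:
 assumes "nrm_le M q X b" "q >= 0"
 shows "nrm_le M q (%om. c*X om) ((abs c)*b)"
proof -
 have "(%om. \<bar>c*X om\<bar> powr q) = (%om. (abs c) powr q*(abs (X om)) powr q)"
  by (auto simp: abs_mult powr_mult)
 then show ?thesis using assms unfolding nrm_le_def
  by (auto simp: powr_mult intro!: mult_left_mono)
qed

lemma nrm_le_limit_const:
 assumes "!!e. e > 0 ==> nrm_le M q X (b + e)" "b >= 0" "q > 0"
 shows "nrm_le M q X b"
proof -
 have "(%n. (b + inverse (real (Suc n))) powr q) \<longlonglongrightarrow> (b + 0) powr q"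
  using assms by (intro tendsto_powr' tendsto_add tendsto_const LIMSEQ_inverse_real_of_nat) auto
 then have "(LINT om|M. (abs (X om)) powr q) <= (b + 0) powr q"
  by (rule LIMSEQ_le_const) (use assms(1) in \<open>auto simp: nrm_le_def\<close>)
 then show ?thesis using assms(1)[of 1] assms(2) by (auto simp: nrm_le_def)
qed

text \<open>Minkowski's inequality from convexity: X + Y is (b + c) times the convex combination of
  X/b and Y/c with weights b/(b+c) and c/(b+c). A vanishing bound cannot be divided by, hence the
  passage through b + e/2 and c + e/2.\<close>

lemma nrm_le_add:
 assumes X: "nrm_le M q X b" and Y: "nrm_le M q Y c" and q: "q >= 1"
 shows "nrm_le M q (%om. X om + Y om) (b + c)"
proof -
 have pos: "nrm_le M q (%om. X om + Y om) (b + c)"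
  if X: "nrm_le M q X b" and Y: "nrm_le M q Y c" and bc: "b > 0" "c > 0" for b c
 proof -
  define t where "t = b/(b + c)"
  have t: "0 <= t" "t <= 1" "1 - t = c/(b + c)" using bc by (auto simp: t_def field_simps)
  let ?Z = "%om. (b + c) powr q*(t*((abs (X om)) powr q/b powr q) + (1 - t)*((abs (Y om)) powr q/c powr q))"
  have pt: "\<bar>X om + Y om\<bar> powr q <= ?Z om" for om
  proof -
   have "\<bar>X om + Y om\<bar> powr q <= ((abs (X om)) + (abs (Y om))) powr q" using q by (intro powr_mono2) auto
   also have "(abs (X om)) + (abs (Y om)) = (b + c)*(t*((abs (X om))/b) + (1 - t)*((abs (Y om))/c))"
    unfolding t(3) using bc by (simp add: t_def distrib_left)
   also have "... powr q = (b + c) powr q*(t*((abs (X om))/b) + (1 - t)*((abs (Y om))/c)) powr q"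
    by (rule powr_mult)
   also have "... <= (b + c) powr q*(t*((abs (X om))/b) powr q + (1 - t)*((abs (Y om))/c) powr q)"
    using bc t q by (intro mult_left_mono powr_convex_combination) auto
   also have "... = ?Z om" using bc by (simp add: powr_divide)
   finally show ?thesis .
  qed
  have iX: "integrable M (%om. (abs (X om)) powr q)" "(LINT om|M. (abs (X om)) powr q) <= b powr q" "X \<in> borel_measurable M"
   and iY: "integrable M (%om. (abs (Y om)) powr q)" "(LINT om|M. (abs (Y om)) powr q) <= c powr q" "Y \<in> borel_measurable M"
   using X Y by (auto simp: nrm_le_def)
  have iZ: "integrable M ?Z" using iX iY by auto
  have i: "integrable M (%om. \<bar>X om + Y om\<bar> powr q)"
   by (rule Bochner_Integration.integrable_bound[OF iZ]) (use iX iY pt in \<open>auto intro!: order_trans[OF pt] abs_ge_self\<close>)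
  have "(LINT om|M. \<bar>X om + Y om\<bar> powr q) <= (LINT om|M. ?Z om)"
   using i iZ pt by (intro integral_mono) auto
  also have "... = (b + c) powr q*(t*((LINT om|M. (abs (X om)) powr q)/b powr q) + (1 - t)*((LINT om|M. (abs (Y om)) powr q)/c powr q))"
   using iX iY by simp
  also have "... <= (b + c) powr q*(t*1 + (1 - t)*1)"
   using bc t iX iY by (intro mult_left_mono add_mono) auto
  finally show ?thesis using i iX iY bc unfolding nrm_le_def by auto
 qed
 have bc: "b >= 0" "c >= 0" using X Y by (auto simp: nrm_le_def)
 show ?thesis
 proof (rule nrm_le_limit_const)
  fix e :: real assume e: "e > 0"
  have "nrm_le M q (%om. X om + Y om) ((b + e/2) + (c + e/2))"
   by (rule pos) (use X Y bc e q in \<open>auto intro: nrm_le_mono\<close>)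
  then show "nrm_le M q (%om. X om + Y om) (b + c + e)" by (simp add: add_ac)
 qed (use bc q in auto)
qed

lemma nrm_le_diff:
 assumes "nrm_le M q X b" "nrm_le M q Y c" "q >= 1"
 shows "nrm_le M q (%om. X om - Y om) (b + c)"
 using nrm_le_add[OF assms(1) nrm_le_scale[OF assms(2), of "-1"] assms(3)] assms(3) by simp

lemma nrm_le_0: "nrm_le M q (%om. 0) 0"
 by (simp add: nrm_le_def)

lemma nrm_le_sum:
 assumes "!!i. i \<in> I ==> nrm_le M q (X i) (b i)" "q >= 1"
 shows "nrm_le M q (%om. \<Sum>i\<in>I. X i om) (\<Sum>i\<in>I. b i)"
 using assms(1)
proof (induction I rule: infinite_finite_induct)
 case (insert i I)
 then show ?case using nrm_le_add[of M q "X i" "b i" "%om. \<Sum>i\<in>I. X i om" "\<Sum>i\<in>I. b i"] assms(2) by simp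
qed (auto simp: nrm_le_0)

context prob_space
begin

lemma nrm_le_const: "nrm_le M q (%om. c) (abs c)"
 by (simp add: nrm_le_def prob_space)

lemma nrm_le_integrable:
 assumes "nrm_le M q X b" "q >= 1"
 shows "integrable M X"
proof (rule Bochner_Integration.integrable_bound)
 show "integrable M (%om. 1 + (abs (X om)) powr q)" using assms by (auto simp: nrm_le_def)
 show "AE x in M. norm (X x) <= norm (1 + (abs (X x)) powr q)"
 proof (rule AE_I2)
  fix x
  show "norm (X x) <= norm (1 + (abs (X x)) powr q)"
  proof (cases "(abs (X x)) <= 1")
   case False
   then have "(abs (X x)) powr 1 <= (abs (X x)) powr q" using assms by (intro powr_mono) auto
   then show ?thesis using False by simp
  qed (auto intro: order_trans)
 qed
qed (use assms in \<open>auto simp: nrm_le_def\<close>)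

lemma nrm_le_Markov:
 assumes "nrm_le M q X b" "q > 0" "t > 0"
 shows "prob {om\<in>space M. (abs (X om)) >= t} <= (b/t) powr q"
proof -
 have X: "integrable M (%om. (abs (X om)) powr q)" "(LINT om|M. (abs (X om)) powr q) <= b powr q" "b >= 0"
  using assms by (auto simp: nrm_le_def)
 have [measurable]: "X \<in> borel_measurable M" using assms by (auto simp: nrm_le_def)
 have "prob {om\<in>space M. (abs (X om)) >= t} <= prob {om\<in>space M. (abs (X om)) powr q >= t powr q}"
  using assms by (intro finite_measure_mono) (auto intro!: powr_mono2)
 also have "... <= (LINT om|M. (abs (X om)) powr q)/t powr q"
  using X assms by (intro integral_Markov_inequality_measure[where A="space M"]) auto
 also have "... <= b powr q/t powr q" using X assms by (intro divide_right_mono) auto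
 also have "... = (b/t) powr q" using X assms by (simp add: powr_divide)
 finally show ?thesis .
qed

text \<open>A uniform L^q bound survives when B_N is replaced by its constant limit in probability.
  It serves both to send a reverse martingale to its limit and to discard the remote past.\<close>

lemma nrm_le_limit_in_prob:
 assumes A: "A \<in> borel_measurable M" and B: "!!N. B N \<in> borel_measurable M"
  and D: "!!N. nrm_le M q (%om. A om - B N om) c"
  and lim: "!!e. e > 0 ==> (%N. prob {om\<in>space M. \<bar>B N om - \<beta>\<bar> > e}) \<longlonglongrightarrow> 0"
  and q: "q >= 1"
 shows "nrm_le M q (%om. A om - \<beta>) c"
proof -
 note [measurable] = A B
 have c: "c >= 0" using D[of 0] by (simp add: nrm_le_def)
 \<comment> \<open>Truncation at K makes the event where B_N is far from its limit cost at most K^q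
   times its probability, which vanishes as N grows with K fixed; K is then removed by monotone
   convergence.\<close>
 have tr: "(LINT om|M. (min \<bar>A om - \<beta>\<bar> K) powr q) <= (c + e) powr q" if "e > 0" "K > 0" for e K :: real
 proof -
  have n: "nrm_le M q (%om. \<bar>A om - B N om\<bar> + e) (c + e)" for N
  proof -
   have "nrm_le M q (%om. \<bar>A om - B N om\<bar>) c" using D[of N] by (auto simp: nrm_le_def)
   from nrm_le_add[OF this nrm_le_const[of q e] q] show ?thesis using that by simp
  qed
  then have I: "integrable M (%om. (\<bar>A om - B N om\<bar> + e) powr q)" "(LINT om|M. (\<bar>A om - B N om\<bar> + e) powr q) <= (c + e) powr q" for N
   using that by (auto simp: nrm_le_def)
  let ?S = "%N. {om\<in>space M. \<bar>B N om - \<beta>\<bar> > e}"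
  have iK: "integrable M (%om. (min \<bar>A om - \<beta>\<bar> K) powr q)"
   using that q by (intro integrable_const_bound[where B="K powr q"]) (auto intro!: AE_I2 powr_mono2)
  have le: "(LINT om|M. (min \<bar>A om - \<beta>\<bar> K) powr q) <= (c + e) powr q + K powr q*prob (?S N)" for N
  proof -
   have "(LINT om|M. (min \<bar>A om - \<beta>\<bar> K) powr q) <= (LINT om|M. (\<bar>A om - B N om\<bar> + e) powr q + K powr q*indicator (?S N) om)"
   proof (intro integral_mono iK)
    show "integrable M (%om. (\<bar>A om - B N om\<bar> + e) powr q + K powr q*indicator (?S N) om)"
     using I by (intro Bochner_Integration.integrable_add integrable_mult_right) (auto simp: less_top[symmetric])
    fix om assume om: "om \<in> space M"
    show "(min \<bar>A om - \<beta>\<bar> K) powr q <= (\<bar>A om - B N om\<bar> + e) powr q + K powr q*indicator (?S N) om"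
    proof (cases "om \<in> ?S N")
     case True
     have "(min \<bar>A om - \<beta>\<bar> K) powr q <= K powr q" using that q by (intro powr_mono2) auto
     then show ?thesis using True by (simp add: add_increasing)
    next
     case False
     then have "\<bar>A om - \<beta>\<bar> <= \<bar>A om - B N om\<bar> + e" using om by auto
     then have "(min \<bar>A om - \<beta>\<bar> K) powr q <= (\<bar>A om - B N om\<bar> + e) powr q" using that q by (intro powr_mono2) auto
     then show ?thesis using False by simp
    qed
   qed
   also have "... = (LINT om|M. (\<bar>A om - B N om\<bar> + e) powr q) + K powr q*prob (?S N)"
    using I by (subst Bochner_Integration.integral_add) (auto simp: less_top[symmetric])
   finally show ?thesis using I(2)[of N] by linarith
  qed
  have "(%N. (c + e) powr q + K powr q*prob (?S N)) \<longlonglongrightarrow> (c + e) powr q + K powr q*0"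
   using lim[OF that(1)] by (intro tendsto_intros)
  then show ?thesis using le LIMSEQ_le_const by fastforce
 qed
 have "nrm_le M q (%om. A om - \<beta>) (c + e)" if e: "e > 0" for e
 proof -
  let ?f = "%n om. (min \<bar>A om - \<beta>\<bar> (real (Suc n))) powr q"
  have i: "integrable M (?f n)" for n
   using that q by (intro integrable_const_bound[where B="real (Suc n) powr q"]) (auto intro!: AE_I2 powr_mono2)
  have "mono (%n. ?f n om)" for om using q by (intro monoI powr_mono2) auto
  have pt: "(%n. ?f n om) \<longlonglongrightarrow> \<bar>A om - \<beta>\<bar> powr q" for om
  proof (rule tendsto_eventually)
   obtain N where N: "\<bar>A om - \<beta>\<bar> <= real N" using real_arch_simple by auto
   show "\<forall>\<^sub>F n in sequentially. ?f n om = \<bar>A om - \<beta>\<bar> powr q"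
    using eventually_ge_at_top[of N] by eventually_elim (use N in \<open>auto simp: min_def\<close>)
  qed
  have inc: "incseq (%n. integral\<^sup>L M (?f n))"
   using q by (intro incseq_SucI integral_mono i powr_mono2) auto
  have bd: "integral\<^sup>L M (?f n) <= (c + e) powr q" for n using tr[OF e, of "real (Suc n)"] by simp
  obtain L where L: "(%n. integral\<^sup>L M (?f n)) \<longlonglongrightarrow> L" "L <= (c+e) powr q"
   using incseq_convergent[OF inc, of "(c+e) powr q"] bd LIMSEQ_le_const2 by metis
  have I: "integrable M (%om. \<bar>A om - \<beta>\<bar> powr q)"
   by (rule integrable_monotone_convergence[where f="?f", OF i _ _ L(1)]) (use \<open>!!om. mono (%n. ?f n om)\<close> pt in auto)
  have "(LINT om|M. \<bar>A om - \<beta>\<bar> powr q) = L"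
   by (rule integral_monotone_convergence[where f="?f", OF i _ _ L(1)]) (use \<open>!!om. mono (%n. ?f n om)\<close> pt in auto)
  then show ?thesis using I L c e unfolding nrm_le_def by auto
 qed
 then show ?thesis by (rule nrm_le_limit_const) (use c q in auto)
qed

section \<open>Martingale differences in L^q\<close>

text \<open>The term linear in \<open>D\<close> has mean 0, since its other factor is measurable
  with respect to \<open>F\<close>. The mixed term is estimated after dividing \<open>S\<close> by
  \<open>A\<close> and \<open>D\<close> by \<open>B\<close>; Young's inequality then bounds it by
  two normalised moments, whence the factor 2.\<close>

lemma nrm_le_mds_step:
 assumes q: "q >= 2" and C: "C >= 0"
  "!!x d. \<bar>x + d\<bar> powr q <= (abs x) powr q + q*(sgn x*(abs x) powr (q - 1))*d + C*((abs x) powr (q - 2)*d^2 + (abs d) powr q)"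
  and S: "nrm_le M q S A" "A > 0" and D: "nrm_le M q D B" "B > 0"
  and F: "subalgebra M F" "S \<in> borel_measurable F" "AE om in M. real_cond_exp M F D om = 0"
 shows "integrable M (%om. \<bar>S om + D om\<bar> powr q)"
  "(LINT om|M. \<bar>S om + D om\<bar> powr q) <= A powr q + C*(2*(A powr (q - 2)*B^2) + B powr q)"
proof -
 interpret F: sigma_finite_subalgebra M F
  using F(1) finite_measure_axioms by (intro finite_measure_subalgebra_is_sigma_finite finite_measure_subalgebra.intro) (auto simp: finite_measure_subalgebra_axioms_def)
 note [measurable] = nrm_le_meas[OF S(1)] nrm_le_meas[OF D(1)] F(2)
 have iS: "integrable M (%om. (abs (S om)) powr q)" "(LINT om|M. (abs (S om)) powr q) <= A powr q"
  and iD: "integrable M (%om. (abs (D om)) powr q)" "(LINT om|M. (abs (D om)) powr q) <= B powr q"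
  using S D by (auto simp: nrm_le_def)
 let ?g = "%om. sgn (S om)*(abs (S om)) powr (q - 1)"
 have gF: "?g \<in> borel_measurable F" by measurable
 have young: "u powr (q - 1) * v <= u powr q + v powr q" "u powr (q - 2) * v^2 <= u powr q + v powr q" if "u >= 0" "v >= 0" for u v :: real
 proof -
  have "u powr (q-1) * v <= max u v powr (q-1) * max u v" "u powr (q-2) * v^2 <= max u v powr (q-2)*(max u v)^2"
   using that q by (auto intro!: mult_mono powr_mono2 power_mono)
  moreover have "max u v powr (q-1) * max u v = max u v powr q" "max u v powr (q-2)*(max u v)^2 = max u v powr q"
   using that by (auto simp: powr_diff max_def powr_numeral split: if_splits)
  moreover have "max u v powr q <= u powr q + v powr q" by (auto simp: max_def)
  ultimately show "u powr (q - 1) * v <= u powr q + v powr q" "u powr (q - 2) * v^2 <= u powr q + v powr q" by linarith+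
 qed
 have igD: "integrable M (%om. ?g om*D om)"
  by (rule Bochner_Integration.integrable_bound[of M "%om. (abs (S om)) powr q + (abs (D om)) powr q"])
    (use iS iD young in \<open>auto simp: abs_mult sgn_if\<close>)
 have z: "(LINT om|M. ?g om*D om) = 0"
 proof -
  have "(LINT om|M. ?g om*D om) = (LINT om|M. ?g om*real_cond_exp M F D om)"
   by (rule F.real_cond_exp_intg(2)[symmetric]) (use igD gF in auto)
  also have "... = (LINT om|M. 0)" using F(3) by (intro integral_cong_AE) auto
  finally show ?thesis by simp
 qed
 let ?h = "%om. (abs (S om)) powr (q - 2)*(D om)^2"
 have pt: "?h om <= A powr (q - 2)*B^2*((abs (S om)) powr q/A powr q + (abs (D om)) powr q/B powr q)" for om
 proof -
  have "?h om = A powr (q - 2)*B^2*(((abs (S om))/A) powr (q - 2)*((abs (D om))/B)^2)"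
   using S(2) D(2) by (simp add: powr_divide power_divide)
  also have "... <= A powr (q - 2)*B^2*(((abs (S om))/A) powr q + ((abs (D om))/B) powr q)"
   using S(2) D(2) by (intro mult_left_mono young) auto
  finally show ?thesis using S(2) D(2) by (simp add: powr_divide)
 qed
 have ih: "integrable M ?h"
 proof (rule Bochner_Integration.integrable_bound)
  show "integrable M (%om. A powr (q - 2)*B^2*((abs (S om)) powr q/A powr q + (abs (D om)) powr q/B powr q))" using iS iD by auto
  show "AE x in M. norm ((abs (S x)) powr (q - 2)*(D x)^2) <= norm (A powr (q - 2)*B^2*((abs (S x)) powr q/A powr q + (abs (D x)) powr q/B powr q))"
   using pt by (intro AE_I2) (auto intro: order_trans[OF _ abs_ge_self])
 qed auto
 have h: "(LINT om|M. ?h om) <= 2*(A powr (q - 2)*B^2)"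
 proof -
  have "(LINT om|M. ?h om) <= (LINT om|M. A powr (q - 2)*B^2*((abs (S om)) powr q/A powr q + (abs (D om)) powr q/B powr q))"
   using iS iD pt ih by (intro integral_mono) auto
  also have "... = A powr (q - 2)*B^2*((LINT om|M. (abs (S om)) powr q)/A powr q + (LINT om|M. (abs (D om)) powr q)/B powr q)"
   using iS iD by simp
  also have "... <= A powr (q - 2)*B^2*(1 + 1)"
   using iS iD S(2) D(2) by (intro mult_left_mono add_mono) auto
  finally show ?thesis by simp
 qed
 let ?R = "%om. (abs (S om)) powr q + q*(?g om*D om) + C*(?h om + (abs (D om)) powr q)"
 have iR: "integrable M ?R" using iS iD igD ih by auto
 have le: "\<bar>S om + D om\<bar> powr q <= ?R om" for om using C(2)[of "S om" "D om"] by (simp add: mult_ac)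
 show i: "integrable M (%om. \<bar>S om + D om\<bar> powr q)"
  by (rule Bochner_Integration.integrable_bound[OF iR]) (use le in \<open>auto intro!: order_trans[OF le abs_ge_self]\<close>)
 have "(LINT om|M. \<bar>S om + D om\<bar> powr q) <= (LINT om|M. ?R om)" using i iR le by (intro integral_mono) auto
 also have "... = (LINT om|M. (abs (S om)) powr q) + q*(LINT om|M. ?g om*D om) + C*((LINT om|M. ?h om) + (LINT om|M. (abs (D om)) powr q))"
  using iS iD igD ih by simp
 also have "... <= A powr q + q*0 + C*(2*(A powr (q - 2)*B^2) + B powr q)"
  unfolding z using h iS iD C q by (intro add_mono mult_left_mono) auto
 finally show "(LINT om|M. \<bar>S om + D om\<bar> powr q) <= A powr q + C*(2*(A powr (q - 2)*B^2) + B powr q)" by simp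
qed

text \<open>Only the norms of the differences enter, not a square function. One constant serves all
  fields, differences and lengths, so it may be used uniformly in n and N. The bounds are strictly
  positive because each step divides by them.\<close>

lemma martingale_difference_moment:
 assumes q: "q >= 2"
 shows "\<exists>K>0. \<forall>(F :: nat => 'a measure) D b N.
  (\<forall>k<N. subalgebra M (F k) & (\<forall>j<k. D j \<in> borel_measurable (F k)) &
    (AE om in M. real_cond_exp M (F k) (D k) om = 0) & nrm_le M q (D k) (b k) & b k > 0) \<longrightarrow>
  nrm_le M q (%om. \<Sum>k<N. D k om) (K * sqrt (\<Sum>k<N. (b k)^2))"
proof -
 obtain C where C: "C >= 0"
  "!!x d. \<bar>x + d\<bar> powr q <= (abs x) powr q + q*(sgn x*(abs x) powr (q - 1))*d + C*((abs x) powr (q - 2)*d^2 + (abs d) powr q)"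
  using powr_add_expansion[OF q] by auto
 define L where "L = max 1 (4*C)"
 have L: "L >= 1" "L >= 4*C" by (auto simp: L_def)
 have main: "nrm_le M q (%om. \<Sum>k<N. D k om) (sqrt (L*(\<Sum>k<N. (b k)^2)))"
  if "\<forall>k<N. subalgebra M (F k) & (\<forall>j<k. D j \<in> borel_measurable (F k)) &
    (AE om in M. real_cond_exp M (F k) (D k) om = 0) & nrm_le M q (D k) (b k) & b k > 0"
  for F :: "nat => 'a measure" and D b N
  using that
 proof (induction N)
  case 0
  then show ?case by (simp add: nrm_le_0)
 next
  case (Suc N)
  then have IH: "nrm_le M q (%om. \<Sum>k<N. D k om) (sqrt (L*(\<Sum>k<N. (b k)^2)))" by auto
  have N: "subalgebra M (F N)" "!!j. j<N ==> D j \<in> borel_measurable (F N)"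
    "AE om in M. real_cond_exp M (F N) (D N) om = 0" "nrm_le M q (D N) (b N)" "b N > 0"
   using Suc.prems by auto
  show ?case
  \<comment> \<open>The first difference is treated alone: the bound for the empty sum is 0 and
    cannot be normalised.\<close>
  proof (cases "N = 0")
   case True
   have "b 0*1 <= b 0 * sqrt L" using N(5) L True by (intro mult_left_mono) auto
   then show ?thesis using N(4,5) True L q by (auto simp: real_sqrt_mult mult_ac intro: nrm_le_mono)
  next
   case False
   define u where "u = (\<Sum>k<N. (b k)^2)"
   have u: "u > 0" unfolding u_def using False Suc.prems by (intro sum_pos) (auto simp: less_Suc_eq intro!: zero_less_power)
   have A: "sqrt (L*u) > 0" using L u by simp
   note st = nrm_le_mds_step[OF q C IH[folded u_def] A N(4,5,1) _ N(3)]
   have m: "(%om. \<Sum>k<N. D k om) \<in> borel_measurable (F N)" using N(2) by (intro borel_measurable_sum) auto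
   have p: "sqrt (L*u) powr q = (L*u) powr (q/2)" "sqrt (L*u) powr (q-2) = (L*u) powr (q/2-1)" "b N powr q = (b N)\<^sup>2 powr (q/2)"
    "sqrt (L*(u + (b N)^2)) powr q = (L*(u + (b N)^2)) powr (q/2)"
    using u L N(5) by (auto simp: powr_half_sqrt[symmetric] powr_powr powr_numeral[symmetric] diff_divide_distrib simp del: powr_numeral)
   have "(LINT om|M. \<bar>(\<Sum>k<N. D k om) + D N om\<bar> powr q) <= (L*u) powr (q/2) + C*(2*((L*u) powr (q/2-1)*(b N)^2) + (b N)\<^sup>2 powr (q/2))"
    using st(2)[OF m] unfolding p .
   also have "... <= (L*(u + (b N)^2)) powr (q/2)"
    using u N(5) q C L by (intro powr_sum_step) auto
   finally show ?thesis using st(1)[OF m] p(4) u L N(4) nrm_le_meas[OF IH] nrm_le_meas[OF N(4)] unfolding nrm_le_def by (auto simp: u_def)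
  qed
 qed
 show ?thesis
  by (intro exI[of _ "sqrt L"] conjI allI impI) (use L main in \<open>auto simp: real_sqrt_mult\<close>)
qed

lemma nrm_le_cond_exp:
 assumes "nrm_le M q X b" "q > 1" and F: "subalgebra M F"
 shows "nrm_le M q (real_cond_exp M F X) b"
proof -
 interpret F: sigma_finite_subalgebra M F
  using F(1) finite_measure_axioms by (intro finite_measure_subalgebra_is_sigma_finite finite_measure_subalgebra.intro) (auto simp: finite_measure_subalgebra_axioms_def)
 have iX: "integrable M X" using assms by (intro nrm_le_integrable) auto
 have iq: "integrable M (%om. (abs (X om)) powr q)" using assms by (auto simp: nrm_le_def)
 have cv: "convex_on UNIV (%x::real. (abs x) powr q)"
 proof (rule convex_onI)
  fix t x y :: real assume t: "0 < t" "t < 1"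
  have "\<bar>(1 - t)*x + t*y\<bar> powr q <= ((1 - t)*(abs x) + t*(abs y)) powr q"
   using t assms by (intro powr_mono2) (auto intro!: order_trans[OF abs_triangle_ineq] simp: abs_mult)
  also have "... <= (1 - t)*(abs x) powr q + t*(abs y) powr q"
   using powr_convex_combination[of "(abs x)" "(abs y)" "1 - t" q] t assms by simp
  finally show "\<bar>(1 - t) *\<^sub>R x + t *\<^sub>R y\<bar> powr q <= (1 - t)*(abs x) powr q + t*(abs y) powr q" by simp
 qed simp
 have J: "AE om in M. (abs (real_cond_exp M F X om)) powr q <= real_cond_exp M F (%om. (abs (X om)) powr q) om"
  by (rule F.real_cond_exp_jensens_inequality(2)[where I=UNIV and X=X]) (use iX iq cv in auto)
 have ic: "integrable M (real_cond_exp M F (%om. (abs (X om)) powr q))" using iq by (rule F.real_cond_exp_int)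
 have i: "integrable M (%om. (abs (real_cond_exp M F X om)) powr q)"
  by (rule Bochner_Integration.integrable_bound[OF ic]) (use J in auto)
 have "(LINT om|M. (abs (real_cond_exp M F X om)) powr q) <= (LINT om|M. real_cond_exp M F (%om. (abs (X om)) powr q) om)"
  using i ic J by (rule integral_mono_AE)
 also have "... = (LINT om|M. (abs (X om)) powr q)" using iq by (rule F.real_cond_exp_int)
 finally show ?thesis using assms i unfolding nrm_le_def by auto
qed

end

section \<open>Independent sequences\<close>

lemma (in prob_space) indep_sets_reindex:
 assumes ind: "indep_sets E (f ` I)" and inj: "inj_on f I"
 shows "indep_sets (%i. E (f i)) I"
proof (rule indep_setsI)
 show "E (f i) \<subseteq> events" if "i \<in> I" for i using ind that by (auto simp: indep_sets_def)
next
 fix A J assume J: "J \<noteq> {}" "J \<subseteq> I" "finite J" "\<forall>j\<in>J. A j \<in> E (f j)"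
 have injJ: "inj_on f J" using inj J inj_on_subset by blast
 let ?B = "%k. A (the_inv_into J f k)"
 have "prob (\<Inter>k\<in>f ` J. ?B k) = (\<Prod>k\<in>f ` J. prob (?B k))"
  using J injJ by (intro indep_setsD[OF ind]) (auto simp: the_inv_into_f_f)
 also have "(\<Inter>k\<in>f ` J. ?B k) = (\<Inter>j\<in>J. A j)" using injJ by (auto simp: the_inv_into_f_f)
 also have "(\<Prod>k\<in>f ` J. prob (?B k)) = (\<Prod>j\<in>J. prob (A j))"
  using injJ by (subst prod.reindex) (auto simp: the_inv_into_f_f)
 finally show "prob (\<Inter>j\<in>J. A j) = (\<Prod>j\<in>J. prob (A j))" .
qed

lemma (in prob_space) finite_measure_sub:
 assumes "subalgebra M F" shows "sigma_finite_subalgebra M F"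
 using assms finite_measure_axioms by (intro finite_measure_subalgebra_is_sigma_finite finite_measure_subalgebra.intro) (auto simp: finite_measure_subalgebra_axioms_def)

text \<open>Independence of \<open>U\<close> from the field \<open>F\<close> is expressed as the
  product form of the joint law of \<open>U\<close> and of the identity map into \<open>F\<close>.
  With that, freezing the \<open>F\<close>-measurable argument is Fubini's theorem.\<close>

lemma (in prob_space) cond_exp_freeze:
 fixes h :: "'a \<times> 'b => real" and N :: "'b measure" and U :: "'a => 'b"
 assumes sub: "subalgebra M F" and U[measurable]: "U \<in> measurable M N"
  and eq: "distr M F (%om. om) \<Otimes>\<^sub>M distr M N U = distr M (F \<Otimes>\<^sub>M N) (%om. (om, U om))"
  and h: "h \<in> borel_measurable (F \<Otimes>\<^sub>M N)" and int: "integrable M (%om. h (om, U om))"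
 shows "AE om in M. real_cond_exp M F (%om. h (om, U om)) om = (\<integral>u. h (om, u) \<partial>distr M N U)"
proof -
 interpret F: sigma_finite_subalgebra M F using sub by (rule finite_measure_sub)
 have idm[measurable]: "(%om. om) \<in> measurable M F"
  using measurable_from_subalg[OF sub measurable_ident] by (simp add: id_def)
 let ?P = "distr M F (%om. om)" and ?Q = "distr M N U"
 interpret P: prob_space ?P by (rule prob_space_distr) measurable
 interpret Q: prob_space ?Q by (rule prob_space_distr) measurable
 interpret PQ: pair_sigma_finite ?P ?Q by unfold_locales
 note hm[measurable] = h
 have pm: "(%om. (om, U om)) \<in> measurable M (F \<Otimes>\<^sub>M N)" by measurable
 have ih: "integrable (?P \<Otimes>\<^sub>M ?Q) h" unfolding eq using int by (subst integrable_distr_eq[OF pm]) auto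
 have gm: "(%om. \<integral>u. h (om, u) \<partial>?Q) \<in> borel_measurable F" by measurable
 have ig: "integrable ?P (%om. \<integral>u. h (om, u) \<partial>?Q)" using PQ.integrable_fst'[OF ih] by simp
 show ?thesis
 proof (rule F.real_cond_exp_charact)
  show "integrable M (%om. \<integral>u. h (om, u) \<partial>?Q)" using ig gm by (subst (asm) integrable_distr_eq) auto
  fix A assume A[measurable]: "A \<in> sets F"
  have "A \<in> sets M" using A sub by (auto simp: subalgebra_def)
  have i2: "integrable (?P \<Otimes>\<^sub>M ?Q) (%x. indicator A (fst x)*h x)"
  proof -
   have "integrable (?P \<Otimes>\<^sub>M ?Q) (%x. indicator (A \<times> space N) x *\<^sub>R h x)"
    by (rule integrable_mult_indicator[OF _ ih]) (auto intro!: pair_measureI)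
   also have "?this \<longleftrightarrow> integrable (?P \<Otimes>\<^sub>M ?Q) (%x. indicator A (fst x)*h x)"
    by (intro Bochner_Integration.integrable_cong) (auto simp: space_pair_measure indicator_def)
   finally show ?thesis .
  qed
  have "(\<integral>om\<in>A. h (om, U om) \<partial>M) = (\<integral>x. indicator A (fst x)*h x \<partial>(?P \<Otimes>\<^sub>M ?Q))"
   unfolding eq set_lebesgue_integral_def by (subst integral_distr[OF pm]) auto
  also have "... = (\<integral>om. (\<integral>u. indicator A om*h (om, u) \<partial>?Q) \<partial>?P)"
   using PQ.integral_fst'[OF i2] by simp
  also have "... = (\<integral>om. indicator A om*(\<integral>u. h (om, u) \<partial>?Q) \<partial>?P)" by simp
  also have "... = (\<integral>om\<in>A. (\<integral>u. h (om, u) \<partial>?Q) \<partial>M)"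
   unfolding set_lebesgue_integral_def using gm by (subst integral_distr) auto
  finally show "(\<integral>om\<in>A. h (om, U om) \<partial>M) = (\<integral>om\<in>A. (\<integral>u. h (om, u) \<partial>?Q) \<partial>M)" .
 qed (use int gm in auto)
qed

section \<open>The innovations: fields, independence and shifts\<close>

locale iid_sequence = prob_space M for M :: "'a measure" +
 fixes \<xi> :: "int => 'a => real"
 assumes indep: "indep_vars (%_. borel) \<xi> UNIV"
  and ident: "!!i. distr M borel (\<xi> i) = distr M borel (\<xi> 0)"
  and centered: "integrable M (\<xi> 0)" "(LINT om|M. \<xi> 0 om) = 0"
  and second_moment: "integrable M (%om. (\<xi> 0 om)^2)" "0 < (LINT om|M. (\<xi> 0 om)^2)"
begin

definition s2 :: real where "s2 = (LINT om|M. (\<xi> 0 om)^2)"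
definition \<nu> :: "real measure" where "\<nu> = distr M borel (\<xi> 0)"
text \<open>Fields for arbitrary index sets, so that the past, finite blocks and single innovations
  are instances of one notion and disjoint index sets mean independence.\<close>

definition field_of :: "int set => 'a measure" where
 "field_of I = sigma (space M) {\<xi> j -` A \<inter> space M | j A. j \<in> I & A \<in> sets borel}"

lemma s2_pos: "s2 > 0" using second_moment by (simp add: s2_def)

lemma xi_measurable[measurable]: "\<xi> i \<in> borel_measurable M"
 using indep by (auto simp: indep_vars_def)

lemma prob_space_nu: "prob_space \<nu>" unfolding \<nu>_def by (rule prob_space_distr) simp

lemma sets_nu[simp, measurable_cong]: "sets \<nu> = sets borel" by (simp add: \<nu>_def)
lemma space_nu[simp]: "space \<nu> = UNIV" by (simp add: \<nu>_def)

lemma distr_xi: "distr M borel (\<xi> i) = \<nu>" using ident[of i] by (simp add: \<nu>_def)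

lemma integrable_xi_iff:
 fixes f :: "real => real"
 assumes "f \<in> borel_measurable borel"
 shows "integrable M (%om. f (\<xi> i om)) \<longleftrightarrow> integrable \<nu> f"
  "(LINT om|M. f (\<xi> i om)) = (LINT y|\<nu>. f y)"
proof -
 show "integrable M (%om. f (\<xi> i om)) \<longleftrightarrow> integrable \<nu> f"
  unfolding distr_xi[of i, symmetric] using assms by (simp add: integrable_distr_eq)
 show "(LINT om|M. f (\<xi> i om)) = (LINT y|\<nu>. f y)"
  unfolding distr_xi[of i, symmetric] using assms by (simp add: integral_distr)
qed

lemma nu_moments: "integrable \<nu> (%y. y)" "(LINT y|\<nu>. y) = 0" "integrable \<nu> (%y. y^2)" "(LINT y|\<nu>. y^2) = s2"
proof -
 show "integrable \<nu> (%y. y)" by (rule integrable_xi_iff(1)[THEN iffD1, of _ 0]) (use centered in auto)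
 show "(LINT y|\<nu>. y) = 0" by (subst integrable_xi_iff(2)[symmetric, of _ 0]) (use centered in auto)
 show "integrable \<nu> (%y. y^2)" by (rule integrable_xi_iff(1)[THEN iffD1, of _ 0]) (use second_moment in auto)
 show "(LINT y|\<nu>. y^2) = s2" unfolding s2_def by (subst integrable_xi_iff(2)[symmetric, of _ 0]) auto
qed

lemma xi_moments: "integrable M (\<xi> i)" "(LINT om|M. \<xi> i om) = 0" "integrable M (%om. (\<xi> i om)^2)" "(LINT om|M. (\<xi> i om)^2) = s2"
proof -
 have m: "(%y::real. y) \<in> borel_measurable borel" "(%y::real. y^2) \<in> borel_measurable borel" by measurable
 show "integrable M (\<xi> i)" by (rule integrable_xi_iff(1)[OF m(1), THEN iffD2, OF nu_moments(1)])
 show "(LINT om|M. \<xi> i om) = 0" by (rule trans[OF integrable_xi_iff(2)[OF m(1)] nu_moments(2)])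
 show "integrable M (%om. (\<xi> i om)^2)" by (rule integrable_xi_iff(1)[OF m(2), THEN iffD2, OF nu_moments(3)])
 show "(LINT om|M. (\<xi> i om)^2) = s2" by (rule trans[OF integrable_xi_iff(2)[OF m(2)] nu_moments(4)])
qed

lemma sets_field_of: "sets (field_of I) = sigma_sets (space M) (\<Union>i\<in>I. {\<xi> i -` A \<inter> space M | A. A \<in> sets borel})"
proof -
 have "{\<xi> j -` A \<inter> space M | j A. j \<in> I & A \<in> sets borel} = (\<Union>i\<in>I. {\<xi> i -` A \<inter> space M | A. A \<in> sets borel})" by auto
 then show ?thesis unfolding field_of_def by (simp add: sets_measure_of_conv) auto
qed

lemma space_field_of[simp]: "space (field_of I) = space M" by (simp add: field_of_def space_measure_of_conv)

lemma subalgebra_field_of: "subalgebra M (field_of I)"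
 unfolding subalgebra_def sets_field_of by (auto intro!: sets.sigma_sets_subset measurable_sets[OF xi_measurable])

lemma field_of_mono: "I \<subseteq> J ==> sets (field_of I) \<subseteq> sets (field_of J)"
 unfolding sets_field_of by (intro sigma_sets_mono') auto

lemma subalgebra_field_of_mono: "I \<subseteq> J ==> subalgebra (field_of J) (field_of I)"
 using field_of_mono by (auto simp: subalgebra_def)

lemma xi_field_of: "j \<in> I ==> \<xi> j \<in> borel_measurable (field_of I)"
 by (rule measurableI) (auto simp: sets_field_of intro!: sigma_sets.Basic)

lemma field_of_measurable_mono: "f \<in> measurable (field_of I) N ==> I \<subseteq> J ==> f \<in> measurable (field_of J) N"
 using field_of_mono[of I J] by (auto simp: measurable_def)

lemma field_of_measurable: "f \<in> measurable (field_of I) N ==> f \<in> measurable M N"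
 using measurable_from_subalg[OF subalgebra_field_of] by blast

lemma id_field_of: "(%om. om) \<in> measurable M (field_of I)"
 using measurable_from_subalg[OF subalgebra_field_of measurable_ident] by (simp add: id_def)

lemma past_field_eq: "past_field M \<xi> n = field_of {..n}"
 by (auto simp: past_field_def field_of_def)

text \<open>Stated for the identity maps into the two fields, so that independence of all measurable
  functions and the product form of joint laws follow by composition.\<close>

lemma indep_field_of:
 assumes "I \<inter> J = {}"
 shows "indep_var (field_of I) (%om. om) (field_of J) (%om. om)"
proof -
 let ?E = "%i. {\<xi> i -` A \<inter> space M | A. A \<in> sets borel}"
 have ind: "indep_sets ?E UNIV" using indep by (auto simp: indep_vars_def2)
 have "indep_sets (%b. sigma_sets (space M) (\<Union>i\<in>case_bool I J b. ?E i)) UNIV"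
 proof (rule indep_sets_collect_sigma)
  show "indep_sets ?E (\<Union>j\<in>UNIV. case j of True => I | False => J)" using ind by (rule indep_sets_mono_index[rotated]) simp
  show "Int_stable (?E i)" for i
  proof (rule Int_stableI)
   fix a b assume "a \<in> ?E i" "b \<in> ?E i"
   then obtain A B where A: "a = \<xi> i -` A \<inter> space M" "A \<in> sets borel" and B: "b = \<xi> i -` B \<inter> space M" "B \<in> sets borel" by blast
   have "a \<inter> b = \<xi> i -` (A \<inter> B) \<inter> space M" unfolding A B by blast
   moreover have "A \<inter> B \<in> sets borel" using A B by (rule_tac sets.Int)
   ultimately show "a \<inter> b \<in> ?E i" by blast
  qed
  show "disjoint_family_on (case_bool I J) UNIV" using assms by (auto simp: disjoint_family_on_def split: bool.split)
 qed
 moreover have "(%b. sigma_sets (space M) (\<Union>i\<in>case_bool I J b. ?E i)) = case_bool (sets (field_of I)) (sets (field_of J))"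
  by (auto simp: sets_field_of fun_eq_iff split: bool.split)
 ultimately have s: "indep_set (sets (field_of I)) (sets (field_of J))" unfolding indep_set_def by (simp only:)
 have e: "{(%om. om) -` A \<inter> space M | A. A \<in> sets (field_of K)} = sets (field_of K)" for K
 proof -
  have "(%om. om) -` A \<inter> space M = A" if "A \<in> sets (field_of K)" for A
   using sets.sets_into_space[OF that] by auto
  then show ?thesis by (auto intro!: exI)
 qed
 have sg: "sigma_sets (space M) (sets (field_of K)) = sets (field_of K)" for K
  using sets.sigma_sets_eq[of "field_of K"] by simp
 show ?thesis unfolding indep_var_eq e sg using s id_field_of by auto
qed

lemma distr_field_of_pair:
 assumes IJ: "I \<inter> J = {}" and V: "V \<in> measurable (field_of I) N'" and U: "U \<in> measurable (field_of J) N"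
 shows "distr M N' V \<Otimes>\<^sub>M distr M N U = distr M (N' \<Otimes>\<^sub>M N) (%om. (V om, U om))"
proof -
 note [measurable] = id_field_of V U
 have eq: "distr M (field_of I) (%om. om) \<Otimes>\<^sub>M distr M (field_of J) (%om. om) = distr M (field_of I \<Otimes>\<^sub>M field_of J) (%om. (om, om))"
  using indep_field_of[OF IJ] by (auto simp: indep_var_distribution_eq)
 have d: "distr M N' V = distr (distr M (field_of I) (%om. om)) N' V" "distr M N U = distr (distr M (field_of J) (%om. om)) N U"
  by (subst distr_distr; simp add: comp_def)+
 have "prob_space (distr M N U)" using field_of_measurable[OF U] by (rule prob_space_distr)
 then have sf: "sigma_finite_measure (distr (distr M (field_of J) (%om. om)) N U)"
  unfolding d(2)[symmetric] by (simp add: prob_space_imp_sigma_finite)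
 show ?thesis unfolding d
  by (subst pair_measure_distr[OF _ _ sf]) (auto simp: eq distr_distr comp_def split_beta')
qed

lemma indep_field_of'':
 fixes V U :: "'a => real"
 assumes "I \<inter> J = {}" "V \<in> measurable (field_of I) N'" "U \<in> measurable (field_of J) N"
 shows "indep_var N' V N U"
 using indep_var_compose[OF indep_field_of[OF assms(1)] assms(2) assms(3)] by (simp add: comp_def id_def)

lemma expectation_mult_xi:
 assumes "j \<notin> I" "f \<in> borel_measurable (field_of I)" "integrable M f"
 shows "integrable M (%om. f om*\<xi> j om)" "(LINT om|M. f om*\<xi> j om) = 0"
proof -
 have "indep_var borel f borel (\<xi> j)" using assms by (intro indep_field_of''[of I "{j}"] xi_field_of) auto
 then show "integrable M (%om. f om*\<xi> j om)" "(LINT om|M. f om*\<xi> j om) = 0"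
  using indep_var_integrable[of f "\<xi> j"] indep_var_lebesgue_integral[of f "\<xi> j"] assms(3) xi_moments[of j] by auto
qed

lemma sum_xi_second_moment:
 assumes "finite J"
 shows "integrable M (%om. (\<Sum>j\<in>J. w j*\<xi> j om)^2)" "(LINT om|M. (\<Sum>j\<in>J. w j*\<xi> j om)^2) = s2*(\<Sum>j\<in>J. (w j)^2)"
proof -
 have "integrable M (%om. (\<Sum>j\<in>J. w j*\<xi> j om)^2) & (LINT om|M. (\<Sum>j\<in>J. w j*\<xi> j om)^2) = s2*(\<Sum>j\<in>J. (w j)^2)"
  using assms
 proof (induction J rule: finite_induct)
  case (insert j J)
  let ?S = "%om. \<Sum>j\<in>J. w j*\<xi> j om"
  have m: "?S \<in> borel_measurable (field_of J)" by (intro borel_measurable_sum borel_measurable_times xi_field_of) auto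
  have i: "integrable M ?S" by (intro Bochner_Integration.integrable_sum integrable_mult_right xi_moments)
  note c = expectation_mult_xi[OF insert(2) m i]
  have e: "(%om. (\<Sum>j\<in>insert j J. w j*\<xi> j om)^2) = (%om. (w j)^2*(\<xi> j om)^2 + 2*w j*(?S om*\<xi> j om) + (?S om)^2)"
   using insert by (auto simp: power2_eq_square algebra_simps)
  show ?case unfolding e using c insert xi_moments[of j] by (auto simp: algebra_simps)
 qed simp
 then show "integrable M (%om. (\<Sum>j\<in>J. w j*\<xi> j om)^2)" "(LINT om|M. (\<Sum>j\<in>J. w j*\<xi> j om)^2) = s2*(\<Sum>j\<in>J. (w j)^2)" by auto
qed

text \<open>Read backwards from any time, the innovations have the same infinite product law, so a
  measurable functional of them has a law independent of the starting time. All uses of stationarity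
  go back to this.\<close>

lemma distr_shift:
 fixes g :: "(nat => real) => real"
 assumes g[measurable]: "g \<in> borel_measurable (PiM UNIV (%_. borel))"
 shows "distr M borel (%om. g (%k. \<xi> (s - int k) om)) = distr M borel (%om. g (%k. \<xi> (t - int k) om))"
proof -
 have "distr M (PiM UNIV (%_. borel)) (%om. \<lambda>k\<in>UNIV. \<xi> (s - int k) om) = PiM UNIV (%_::nat. \<nu>)" for s
 proof -
  have "indep_vars (%_. borel) (%k. \<xi> (s - int k)) UNIV"
  proof -
   have "indep_sets (%i. {\<xi> i -` A \<inter> space M | A. A \<in> sets borel}) UNIV" using indep by (auto simp: indep_vars_def2)
   then have "indep_sets (%i. {\<xi> i -` A \<inter> space M | A. A \<in> sets borel}) ((%k. s - int k) ` UNIV)"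
    by (rule indep_sets_mono_index[rotated]) simp
   from indep_sets_reindex[OF this] show ?thesis by (auto simp: indep_vars_def2 inj_on_def)
  qed
  then show ?thesis by (subst (asm) indep_vars_iff_distr_eq_PiM) (auto simp: distr_xi)
 qed
 then have eq: "distr M (PiM UNIV (%_. borel)) (%om k. \<xi> (s - int k) om) = distr M (PiM UNIV (%_. borel)) (%om k. \<xi> (t - int k) om)"
  by (auto simp: restrict_def)
 have m: "(%om k. \<xi> (s - int k) om) \<in> measurable M (PiM UNIV (%_. borel))" for s
  by (rule measurable_PiM_single') auto
 have "distr M borel (%om. g (%k. \<xi> (s - int k) om)) = distr (distr M (PiM UNIV (%_. borel)) (%om k. \<xi> (s - int k) om)) borel g" for s
  using m by (subst distr_distr) (auto simp: comp_def)
 then show ?thesis using eq by simp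
qed

section \<open>Almost sure convergence of the innovation series\<close>

text \<open>Kolmogorov's inequality through the stopped sum: once a partial sum exceeds \<epsilon>,
  the stopped sum keeps that value, so Chebyshev's inequality at the final time covers all earlier
  exceedances.\<close>

lemma maximal_inequality:
 fixes w :: "nat => real" and h :: "nat => int"
 assumes e: "\<epsilon> > 0" and w: "inj h"
 shows "prob {om\<in>space M. \<exists>j\<le>n. \<bar>\<Sum>k<j. w k*\<xi> (h k) om\<bar> > \<epsilon>} <= s2*(\<Sum>k\<le>n. (w k)^2)/\<epsilon>\<^sup>2"
proof -
 define R where "R j om = (\<Sum>k<j. w k*\<xi> (h k) om)" for j om
 define I where "I k om = (if \<forall>j\<le>k. (abs (R j om)) <= \<epsilon> then 1 else 0::real)" for k om
 \<comment> \<open>\<open>T\<close> is the stopped sum. Its switch \<open>I k\<close> depends only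
   on the terms before index \<open>k\<close>, hence is independent of the innovation it multiplies,
   and the increments stay orthogonal.\<close>
 define T where "T = rec_nat (%om. 0) (%k t om. t om + I k om*(w k*\<xi> (h k) om))"
 have T0: "T 0 = (%om. 0)" and TS: "T (Suc k) = (%om. T k om + I k om*(w k*\<xi> (h k) om))" for k
  by (auto simp: T_def)
 have Rm: "R j \<in> borel_measurable (field_of (h ` {..<k}))" if "j <= k" for j k
  unfolding R_def[abs_def] using that by (intro borel_measurable_sum borel_measurable_times xi_field_of) auto
 have Im: "I k \<in> borel_measurable (field_of (h ` {..<k}))" for k
 proof -
  have eq: "I k = (%om. if \<forall>j\<in>{..k}. (abs (R j om)) <= \<epsilon> then 1 else 0)" by (auto simp: I_def fun_eq_iff)
  show ?thesis unfolding eq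
   apply (rule measurable_If; (simp; fail)?)
   apply (rule predE, rule pred_intros_countable_bounded(3))
   using Rm by auto
 qed
 have Tm: "T k \<in> borel_measurable (field_of (h ` {..<k}))" for k
 proof (induction k)
  case (Suc k)
  have sub: "h ` {..<k} \<subseteq> h ` {..<Suc k}" by auto
  show ?case unfolding TS
   by (intro borel_measurable_add borel_measurable_times field_of_measurable_mono[OF Suc.IH sub]
     field_of_measurable_mono[OF Im sub] xi_field_of) auto
 qed (simp add: T0)
 have T2: "integrable M (%om. (T k om)^2) & (LINT om|M. (T k om)^2) <= s2*(\<Sum>k<k. (w k)^2)" for k
 proof (induction k)
  case (Suc k)
  have Tm': "T k \<in> borel_measurable M" "I k \<in> borel_measurable M" by (rule field_of_measurable[OF Tm] field_of_measurable[OF Im])+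
  have I01: "0 <= I k om" "I k om <= 1" "I k om*I k om = I k om" for om by (simp_all add: I_def)
  have iT: "integrable M (T k)" using Suc Tm' square_integrable_imp_integrable by blast
  have iIT: "integrable M (%om. T k om*I k om)"
   using Tm' I01 by (intro Bochner_Integration.integrable_bound[OF iT] AE_I2 borel_measurable_times) (auto simp: abs_mult intro!: mult_right_le_one_le)
  have nin: "h k \<notin> h ` {..<k}" using w by (auto simp: inj_def)
  note c = expectation_mult_xi[OF nin borel_measurable_times[OF Tm Im] iIT]
  have iX: "integrable M (%om. I k om*(\<xi> (h k) om)^2)"
   using Tm' I01 by (intro Bochner_Integration.integrable_bound[OF xi_moments(3)[of "h k"]] AE_I2 borel_measurable_times borel_measurable_power xi_measurable) (auto simp: abs_mult intro!: mult_left_le_one_le)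
  have X: "(LINT om|M. I k om*(\<xi> (h k) om)^2) <= s2"
   unfolding xi_moments(4)[of "h k", symmetric] using I01 by (intro integral_mono iX xi_moments(3)) (auto intro!: mult_left_le_one_le)
  have "(T k om + I k om*(w k*\<xi> (h k) om))^2 =
    (T k om)^2 + 2*w k*(T k om*I k om*\<xi> (h k) om) + (w k)^2*(I k om*(\<xi> (h k) om)^2)" for om
  proof -
   have "(T k om + I k om*(w k*\<xi> (h k) om))^2 =
    (T k om)^2 + 2*w k*(T k om*I k om*\<xi> (h k) om) + (w k)^2*((I k om*I k om)*(\<xi> (h k) om)^2)"
    by (simp only: power2_eq_square algebra_simps)
   then show ?thesis unfolding I01(3) .
  qed
  then have e: "(%om. (T (Suc k) om)^2) =
    (%om. (T k om)^2 + 2*w k*(T k om*I k om*\<xi> (h k) om) + (w k)^2*(I k om*(\<xi> (h k) om)^2))"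
   unfolding TS by auto
  have "(LINT om|M. (T (Suc k) om)^2) = (LINT om|M. (T k om)^2) + 2*w k*0 + (w k)^2*(LINT om|M. I k om*(\<xi> (h k) om)^2)"
   unfolding e using Suc c iX by simp
  also have "... <= s2*(\<Sum>k<k. (w k)^2) + 2*w k*0 + (w k)^2 * s2"
   using Suc mult_left_mono[OF X, of "(w k)^2"] by simp
  finally have le: "(LINT om|M. (T (Suc k) om)^2) <= s2*(\<Sum>k<Suc k. (w k)^2)" by (simp add: algebra_simps)
  have "integrable M (%om. (T (Suc k) om)^2)"
   unfolding e using Suc c(1) iX by (intro Bochner_Integration.integrable_add integrable_mult_right) blast+
  with le show ?case by blast
 qed (simp add: T0)
 have stop: "if \<forall>j<k. (abs (R j om)) <= \<epsilon> then T k om = R k om else (abs (T k om)) > \<epsilon>" for k om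
 proof (induction k)
  case 0 then show ?case by (simp add: T0 R_def)
 next
  case (Suc k)
  consider "\<forall>j\<le>k. (abs (R j om)) <= \<epsilon>" | "\<forall>j<k. (abs (R j om)) <= \<epsilon>" "(abs (R k om)) > \<epsilon>" | "\<exists>j<k. (abs (R j om)) > \<epsilon>"
   by (metis le_neq_implies_less not_le)
  then show ?case
  proof cases
   case 1
   then have "T k om = R k om" using Suc by auto
   then show ?thesis using 1 by (auto simp: TS I_def R_def)
  next
   case 2
   then have "T k om = R k om" using Suc by auto
   moreover have "I k om = 0" using 2 by (auto simp: I_def not_le)
   ultimately show ?thesis using 2 by (auto simp: TS not_le less_Suc_eq)
  next
   case 3
   then have "(abs (T k om)) > \<epsilon>" using Suc by (auto simp: not_le)
   moreover have "I k om = 0" using 3 by (auto simp: I_def not_le intro: less_imp_le)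
   ultimately show ?thesis using 3 by (auto simp: TS not_le less_Suc_eq)
  qed
 qed
 have Tm': "T (Suc n) \<in> borel_measurable M" by (rule field_of_measurable[OF Tm])
 have "prob {om\<in>space M. \<exists>j\<le>n. (abs (R j om)) > \<epsilon>} <= prob {om\<in>space M. (T (Suc n) om)^2 >= \<epsilon>\<^sup>2}"
 proof (intro finite_measure_mono subsetI)
  fix om assume "om \<in> {om\<in>space M. \<exists>j\<le>n. (abs (R j om)) > \<epsilon>}"
  then have "\<bar>T (Suc n) om\<bar> > \<epsilon>" using stop[of "Suc n" om] by (auto simp: not_le less_Suc_eq_le split: if_splits)
  then show "om \<in> {om\<in>space M. (T (Suc n) om)^2 >= \<epsilon>\<^sup>2}"
   using e \<open>om \<in> _\<close> by (auto simp: abs_le_square_iff[symmetric])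
 qed (use Tm' in auto)
 also have "... <= (LINT om|M. (T (Suc n) om)^2)/\<epsilon>\<^sup>2"
  using T2[of "Suc n"] e by (intro integral_Markov_inequality_measure[where A="space M"]) auto
 also have "... <= s2*(\<Sum>k<Suc n. (w k)^2)/\<epsilon>\<^sup>2"
  using T2[of "Suc n"] by (intro divide_right_mono) auto
 finally show ?thesis by (simp add: R_def lessThan_Suc_atMost)
qed

text \<open>The maximal inequality for tails makes the oscillation after N small in probability;
  intersecting over N and over a null sequence of \<epsilon> gives the Cauchy property off a null
  set. Square summable weights do not yield absolute convergence.\<close>

lemma AE_summable_xi:
 fixes w :: "nat => real" and h :: "nat => int"
 assumes sm: "summable (%k. (w k)^2)" and h: "inj h"
 shows "AE om in M. summable (%k. w k*\<xi> (h k) om)"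
proof -
 define S where "S n om = (\<Sum>k<n. w k*\<xi> (h k) om)" for n om
 have [measurable]: "S n \<in> borel_measurable M" for n unfolding S_def[abs_def] by measurable
 define B where "B \<epsilon> N = {om\<in>space M. \<exists>j. \<bar>S (N + j) om - S N om\<bar> > \<epsilon>}" for \<epsilon> N
 have Bm[measurable]: "B \<epsilon> N \<in> sets M" for \<epsilon> N unfolding B_def by measurable
 have dif: "S (N + j) om - S N om = (\<Sum>k<j. w (N + k)*\<xi> (h (N + k)) om)" for N j om
  unfolding S_def by (induction j) auto
 have bnd: "prob (B \<epsilon> N) <= s2*(\<Sum>k. (w (k + N))^2)/\<epsilon>\<^sup>2" if e: "\<epsilon> > 0" for \<epsilon> N
 proof -
  let ?A = "%n. {om\<in>space M. \<exists>j\<le>n. \<bar>S (N + j) om - S N om\<bar> > \<epsilon>}"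
  have l: "(%n. prob (?A n)) \<longlonglongrightarrow> prob (\<Union>n. ?A n)"
   by (rule finite_Lim_measure_incseq) (auto simp: incseq_def intro: order_trans)
  have eq: "(\<Union>n. ?A n) = B \<epsilon> N" by (auto simp: B_def)
  have le: "prob (?A n) <= s2*(\<Sum>k. (w (k + N))^2)/\<epsilon>\<^sup>2" for n
  proof -
   have "prob (?A n) <= s2*(\<Sum>k\<le>n. (w (N + k))^2)/\<epsilon>\<^sup>2"
    unfolding dif using e h by (intro maximal_inequality[where h="%k. h (N+k)" and w="%k. w (N + k)"]) (auto intro!: injI dest!: injD)
   also have "(\<Sum>k\<le>n. (w (N + k))^2) <= (\<Sum>k. (w (k + N))^2)"
    using sm by (subst add.commute, intro sum_le_suminf) (auto intro: summable_ignore_initial_segment)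
   finally show ?thesis using s2_pos by (simp add: divide_right_mono mult_left_mono)
  qed
  show ?thesis using LIMSEQ_le_const2[OF l] le unfolding eq by blast
 qed
 have null: "prob (\<Inter>N. B \<epsilon> N) = 0" if e: "\<epsilon> > 0" for \<epsilon>
 proof -
  have "(%N. \<Sum>k. (w (k + N))^2) \<longlonglongrightarrow> 0" by (rule suminf_exist_split2[OF sm])
  then have l: "(%N. s2*(\<Sum>k. (w (k + N))^2)/\<epsilon>\<^sup>2) \<longlonglongrightarrow> s2*0/\<epsilon>\<^sup>2"
   using e by (intro tendsto_intros) auto
  have le: "prob (\<Inter>N. B \<epsilon> N) <= s2*(\<Sum>k. (w (k + N))^2)/\<epsilon>\<^sup>2" for N
   by (rule order_trans[OF finite_measure_mono bnd[OF e]]) (rule INF_lower, rule UNIV_I, rule Bm)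
  have "prob (\<Inter>N. B \<epsilon> N) <= s2*0/\<epsilon>\<^sup>2" using LIMSEQ_le_const[OF l] le by blast
  then show ?thesis by (simp add: measure_le_0_iff)
 qed
 have "AE om in M. \<forall>m. om \<notin> (\<Inter>N. B (inverse (real (Suc m))) N)"
  unfolding AE_all_countable
 proof
  fix m
  have "(\<Inter>N. B (inverse (real (Suc m))) N) \<in> null_sets M"
   using null[of "inverse (real (Suc m))"] by (auto simp: null_sets_def emeasure_eq_measure)
  then show "AE om in M. om \<notin> (\<Inter>N. B (inverse (real (Suc m))) N)" by (rule AE_not_in)
 qed
 moreover have "AE om in M. om \<in> space M" by simp
 ultimately show ?thesis
 proof eventually_elim
  case (elim om)
  have "Cauchy (%n. S n om)"
  proof (rule metric_CauchyI)
   fix e :: real assume "e > 0"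
   then obtain m where m: "inverse (real (Suc m)) < e/2" using reals_Archimedean[of "e/2"] by auto
   obtain N where "om \<notin> B (inverse (real (Suc m))) N" using elim by auto
   then have *: "\<bar>S (N + j) om - S N om\<bar> <= inverse (real (Suc m))" for j using elim by (auto simp: B_def not_less)
   show "\<exists>K. \<forall>i\<ge>K. \<forall>n\<ge>K. dist (S i om) (S n om) < e"
   proof (intro exI[of _ N] allI impI)
    fix i n assume "N <= i" "N <= n"
    then show "dist (S i om) (S n om) < e"
     using *[of "i - N"] *[of "n - N"] m by (auto simp: dist_real_def)
   qed
  qed
  then have "convergent (%n. S n om)" by (simp add: Cauchy_convergent_iff)
  then show ?case by (simp add: summable_iff_convergent S_def)
 qed
qed

end

section \<open>Linear processes\<close>

locale linear_process = iid_sequence M \<xi> for M :: "'a measure" and \<xi> :: "int => 'a => real" +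
 fixes a :: "nat => real"
 assumes a_sq: "summable (%k. (a k)^2)"
begin

text \<open>The predictor of X_{s+m} from time s, that is X_{n,k} with n = s + m and k = s. Indexing
  by lag and time makes stationarity visible: the law depends on the lag \<open>m\<close>
  alone.\<close>

definition V :: "nat => int => 'a => real" where
 "V m s om = (\<Sum>k. a (m + k)*\<xi> (s - int k) om)"

definition U :: "nat => nat => int => 'a => real" where
 "U m n s om = (\<Sum>k<n. a (m + k)*\<xi> (s - int k) om)"

definition A2 :: "nat => real" where "A2 m = (\<Sum>k. (a (m + k))^2)"

definition \<mu> :: "nat => real measure" where "\<mu> m = distr M borel (V m 0)"

text \<open>The law of X_m - X_{m,0}, the part not predicted from time 0; K_m(w) is the integral of
  K(w + u) against it.\<close>

definition \<tau> :: "nat => real measure" where "\<tau> m = distr M borel (U 0 m 0)"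

lemma a_sq_shift: "summable (%k. (a (m + k))^2)"
 using summable_ignore_initial_segment[OF a_sq, of m] by (simp add: add.commute)

lemma A2_nonneg: "A2 m >= 0" unfolding A2_def by (intro suminf_nonneg a_sq_shift) auto

lemma A2_lim: "A2 \<longlonglongrightarrow> 0"
 using suminf_exist_split2[OF a_sq] by (simp add: A2_def[abs_def] add.commute)

lemma V_field: "V m s \<in> borel_measurable (field_of {..s})"
 unfolding V_def[abs_def]
 by (intro borel_measurable_suminf borel_measurable_times borel_measurable_const xi_field_of) simp

lemma V_past: "V m s \<in> borel_measurable (past_field M \<xi> s)"
 using V_field by (simp add: past_field_eq)

lemma V_measurable[measurable]: "V m s \<in> borel_measurable M"
 by (rule field_of_measurable[OF V_field])

lemma U_field: "U m n s \<in> borel_measurable (field_of {s - int n<..s})"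
 unfolding U_def[abs_def]
 by (intro borel_measurable_sum borel_measurable_times borel_measurable_const xi_field_of) auto

lemma U_measurable[measurable]: "U m n s \<in> borel_measurable M"
 by (rule field_of_measurable[OF U_field])

lemma AE_summable: "AE om in M. \<forall>m s. summable (%k. a (m + k)*\<xi> (s - int k) om)"
 unfolding AE_all_countable
 by (intro allI AE_summable_xi a_sq_shift) (simp add: inj_def)

lemma lin_proc_eq: "lin_proc a \<xi> i = V 0 i"
 by (simp add: lin_proc_def V_def fun_eq_iff)

text \<open>One null set serves all lags, times and block lengths, these being countable. Reindexing
  the tail of a series is legitimate only where the series converges, which is why the identity is
  almost sure.\<close>

lemma AE_V_split: "AE om in M. \<forall>m s n. V m s om = U m n s om + V (m + n) (s - int n) om"
 using AE_summable
proof eventually_elim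
 case (elim om)
 show ?case
 proof (intro allI)
  fix m s n
  have "V m s om = (\<Sum>k. a (m + (k + n))*\<xi> (s - int (k + n)) om) + (\<Sum>k<n. a (m + k)*\<xi> (s - int k) om)"
   unfolding V_def by (rule suminf_split_initial_segment) (use elim in blast)
  also have "(\<Sum>k. a (m + (k + n))*\<xi> (s - int (k + n)) om) = V (m + n) (s - int n) om"
   unfolding V_def by (simp add: algebra_simps)
  finally show "V m s om = U m n s om + V (m + n) (s - int n) om" by (simp add: U_def)
 qed
qed

lemma AE_V_step: "AE om in M. \<forall>m s. V m s om = a m*\<xi> s om + V (Suc m) (s - 1) om"
 using AE_V_split
proof eventually_elim
 case (elim om)
 show ?case
 proof (intro allI)
  fix m s
  have "V m s om = U m 1 s om + V (m + 1) (s - int 1) om" using elim by blast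
  then show "V m s om = a m*\<xi> s om + V (Suc m) (s - 1) om" by (simp add: U_def)
 qed
qed

lemma distr_V: "distr M borel (V m s) = \<mu> m"
 unfolding \<mu>_def V_def[abs_def]
 by (rule distr_shift[of "%f. \<Sum>k. a (m + k)*f k"]) measurable

lemma distr_U: "distr M borel (U 0 m s) = \<tau> m"
 unfolding \<tau>_def U_def[abs_def]
 by (rule distr_shift[of "%f. \<Sum>k<m. a (0 + k)*f k"]) measurable

lemma prob_space_mu: "prob_space (\<mu> m)" unfolding \<mu>_def by (rule prob_space_distr) simp
lemma sets_mu[simp, measurable_cong]: "sets (\<mu> m) = sets borel" by (simp add: \<mu>_def)
lemma space_mu[simp]: "space (\<mu> m) = UNIV" by (simp add: \<mu>_def)
lemma prob_space_tau: "prob_space (\<tau> m)" unfolding \<tau>_def by (rule prob_space_distr) simp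
lemma sets_tau[simp, measurable_cong]: "sets (\<tau> m) = sets borel" by (simp add: \<tau>_def)
lemma space_tau[simp]: "space (\<tau> m) = UNIV" by (simp add: \<tau>_def)

lemma distr_V_xi: "distr M (borel \<Otimes>\<^sub>M borel) (%om. (V m s om, \<xi> (s + 1) om)) = \<mu> m \<Otimes>\<^sub>M \<nu>"
proof -
 have "distr M borel (V m s) \<Otimes>\<^sub>M distr M borel (\<xi> (s + 1)) = distr M (borel \<Otimes>\<^sub>M borel) (%om. (V m s om, \<xi> (s + 1) om))"
  by (rule distr_field_of_pair[of "{..s}" "{s+1}"]) (auto intro: V_field xi_field_of)
 then show ?thesis by (simp add: distr_V distr_xi)
qed

lemma U_moment:
 "integrable M (%om. (U m n s om)^2)" "(LINT om|M. (U m n s om)^2) = s2*(\<Sum>k<n. (a (m + k))^2)"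
 "integrable M (U m n s)" "(LINT om|M. U m n s om) = 0"
proof -
 have inj: "inj_on (%k. s - int k) {..<n}" by (auto simp: inj_on_def)
 let ?J = "(%k. s - int k) ` {..<n}"
 have e: "U m n s = (%om. \<Sum>j\<in>?J. a (m + nat (s - j))*\<xi> j om)"
  unfolding sum.reindex[OF inj] U_def[abs_def] by simp
 have e2: "(\<Sum>k<n. (a (m + k))^2) = (\<Sum>j\<in>?J. (a (m + nat (s - j)))^2)"
  unfolding sum.reindex[OF inj] by simp
 show "integrable M (%om. (U m n s om)^2)" "(LINT om|M. (U m n s om)^2) = s2*(\<Sum>k<n. (a (m + k))^2)"
  unfolding e e2 by (rule sum_xi_second_moment; simp)+
 show "integrable M (U m n s)" unfolding U_def[abs_def] by (intro Bochner_Integration.integrable_sum integrable_mult_right xi_moments(1))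
 have "(LINT om|M. U m n s om) = (\<Sum>k<n. a (m + k)*(LINT om|M. \<xi> (s - int k) om))"
  unfolding U_def[abs_def]
  by (subst Bochner_Integration.integral_sum) (auto intro!: integrable_mult_right xi_moments(1))
 then show "(LINT om|M. U m n s om) = 0" by (simp only: xi_moments(2) mult_zero_right sum.neutral_const)
qed

lemma V_second_moment: "integrable M (%om. (V m s om)^2)" "(LINT om|M. (V m s om)^2) <= s2*A2 m"
proof -
 have lim: "AE om in M. (%n. ennreal ((U m n s om)^2)) \<longlonglongrightarrow> ennreal ((V m s om)^2)"
  using AE_summable
 proof eventually_elim
  case (elim om)
  then have "(%n. U m n s om) \<longlonglongrightarrow> V m s om"
   unfolding U_def V_def by (intro summable_LIMSEQ) blast
  then show ?case by (intro tendsto_ennrealI tendsto_power)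
 qed
 have "(\<integral>\<^sup>+om. ennreal ((V m s om)^2) \<partial>M) = (\<integral>\<^sup>+om. liminf (%n. ennreal ((U m n s om)^2)) \<partial>M)"
 proof (rule nn_integral_cong_AE)
  show "AE om in M. ennreal ((V m s om)^2) = liminf (%n. ennreal ((U m n s om)^2))"
   using lim by eventually_elim (rule lim_imp_Liminf[OF sequentially_bot, symmetric])
 qed
 also have "... <= liminf (%n. \<integral>\<^sup>+om. ennreal ((U m n s om)^2) \<partial>M)"
  by (rule nn_integral_liminf) measurable
 also have "... <= liminf (%n. ennreal (s2*A2 m))"
 proof (intro Liminf_mono always_eventually allI)
  fix n
  have "(\<integral>\<^sup>+om. ennreal ((U m n s om)^2) \<partial>M) = ennreal (s2*(\<Sum>k<n. (a (m + k))^2))"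
   by (subst nn_integral_eq_integral[OF U_moment(1)]) (simp_all add: U_moment(2))
  also have "... <= ennreal (s2*A2 m)"
   unfolding A2_def using s2_pos by (intro ennreal_leI mult_left_mono sum_le_suminf a_sq_shift) auto
  finally show "(\<integral>\<^sup>+om. ennreal ((U m n s om)^2) \<partial>M) <= ennreal (s2*A2 m)" .
 qed
 also have "... = ennreal (s2*A2 m)" by (simp add: Liminf_const)
 finally have le: "(\<integral>\<^sup>+om. ennreal ((V m s om)^2) \<partial>M) <= ennreal (s2*A2 m)" .
 show i: "integrable M (%om. (V m s om)^2)"
  by (rule integrableI_nonneg) (use le in \<open>auto intro: le_less_trans\<close>)
 show "(LINT om|M. (V m s om)^2) <= s2*A2 m"
  using le unfolding nn_integral_eq_integral[OF i AE_I2[OF zero_le_power2]]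
  using s2_pos A2_nonneg[of m] by (subst (asm) ennreal_le_iff) auto
qed

lemma V_integrable: "integrable M (V m s)"
 by (rule square_integrable_imp_integrable[OF V_measurable V_second_moment(1)])

lemma expectation_abs_V: "(LINT om|M. (abs (V m s om))) <= sqrt (s2*A2 m)"
proof -
 have "(LINT om|M. (abs (V m s om)))^2 <= (LINT om|M. (abs (V m s om))^2)"
 proof -
  have "0 <= variance (%om. (abs (V m s om)))" by (rule Bochner_Integration.integral_nonneg) simp
  also have "variance (%om. (abs (V m s om))) = (LINT om|M. (abs (V m s om))^2) - (LINT om|M. (abs (V m s om)))^2"
   by (rule variance_eq) (use V_integrable[of m s] V_second_moment(1)[of m s] in auto)
  finally show ?thesis by simp
 qed
 also have "... <= s2*A2 m" using V_second_moment(2)[of m s] by simp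
 finally show ?thesis by (rule real_le_rsqrt)
qed

text \<open>The innovations between two predictors are centered, so the mean is the same at lag m +
  n for every n, and there it is bounded by the square root of a tail sum.\<close>

lemma V_mean: "(LINT om|M. V m s om) = 0"
proof -
 have le: "\<bar>\<integral>om. V m s om \<partial>M\<bar> <= sqrt (s2*A2 (m + n))" for n
 proof -
  have "(LINT om|M. V m s om) = (LINT om|M. U m n s om + V (m + n) (s - int n) om)"
   by (rule integral_cong_AE) (use AE_V_split in \<open>measurable, eventually_elim, blast\<close>)
  also have "... = (LINT om|M. V (m + n) (s - int n) om)"
   using U_moment(3,4)[of m n s] V_integrable[of "m+n" "s - int n"] by simp
  also have "\<bar>...\<bar> <= sqrt (s2*A2 (m + n))"
   by (rule order_trans[OF integral_abs_bound expectation_abs_V])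
  finally show ?thesis .
 qed
 have "(%n. A2 (m + n)) \<longlonglongrightarrow> 0" using LIMSEQ_ignore_initial_segment[OF A2_lim, of m] by (simp add: add.commute)
 then have l: "(%n. sqrt (s2*A2 (m + n))) \<longlonglongrightarrow> sqrt (s2*0)" by (intro tendsto_intros)
 have "\<bar>\<integral>om. V m s om \<partial>M\<bar> <= sqrt (s2*0)" using LIMSEQ_le_const[OF l] le by blast
 then show ?thesis by simp
qed

lemma cond_exp_V_xi:
 fixes h :: "real \<times> real => real"
 assumes [measurable]: "h \<in> borel_measurable (borel \<Otimes>\<^sub>M borel)" and int: "integrable M (%om. h (V m s om, \<xi> (s + 1) om))"
 shows "AE om in M. real_cond_exp M (past_field M \<xi> s) (%om. h (V m s om, \<xi> (s + 1) om)) om = (LINT y|\<nu>. h (V m s om, y))"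
proof -
 have [measurable]: "V m s \<in> borel_measurable (field_of {..s})" by (rule V_field)
 have eq: "distr M (field_of {..s}) (%om. om) \<Otimes>\<^sub>M distr M borel (\<xi> (s+1)) = distr M (field_of {..s} \<Otimes>\<^sub>M borel) (%om. (om, \<xi> (s+1) om))"
  by (rule distr_field_of_pair[of "{..s}" "{s+1}"]) (auto intro: xi_field_of)
 have m: "(%p. h (V m s (fst p), snd p)) \<in> borel_measurable (field_of {..s} \<Otimes>\<^sub>M borel)" by measurable
 show ?thesis
  using cond_exp_freeze[OF subalgebra_field_of xi_measurable eq m] int by (simp add: past_field_eq distr_xi)
qed

text \<open>Given the past up to s - n, X_s is the predictor at lag n plus an independent block of
  law \<open>\<tau> n\<close>: the predictor is frozen and the block integrated out.\<close>

lemma cond_exp_V_U: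
 fixes f :: "real => real"
 assumes [measurable]: "f \<in> borel_measurable borel" and int: "integrable M (%om. f (V 0 s om))"
 shows "AE om in M. real_cond_exp M (past_field M \<xi> (s - int n)) (%om. f (V 0 s om)) om = (LINT u|\<tau> n. f (V n (s - int n) om + u))"
proof -
 let ?F = "field_of {..s - int n}"
 interpret F: sigma_finite_subalgebra M ?F by (rule finite_measure_sub[OF subalgebra_field_of])
 have [measurable]: "V n (s - int n) \<in> borel_measurable ?F" by (rule V_field)
 have ae: "AE om in M. f (V 0 s om) = f (V n (s - int n) om + U 0 n s om)"
  using AE_V_split
 proof eventually_elim
  case (elim om)
  then have "V 0 s om = U 0 n s om + V (0 + n) (s - int n) om" by blast
  then show ?case by (simp add: add.commute)
 qed
 have int': "integrable M (%om. f (V n (s - int n) om + U 0 n s om))"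
  by (rule integrable_cong_AE_imp[OF int _ ae]) measurable
 have eq: "distr M ?F (%om. om) \<Otimes>\<^sub>M distr M borel (U 0 n s) = distr M (?F \<Otimes>\<^sub>M borel) (%om. (om, U 0 n s om))"
  by (rule distr_field_of_pair[of "{..s - int n}" "{s - int n<..s}"]) (auto intro: U_field)
 have m: "(%p. f (V n (s - int n) (fst p) + snd p)) \<in> borel_measurable (?F \<Otimes>\<^sub>M borel)" by measurable
 have 1: "AE om in M. real_cond_exp M ?F (%om. f (V n (s - int n) om + U 0 n s om)) om = (LINT u|\<tau> n. f (V n (s - int n) om + u))"
  using cond_exp_freeze[OF subalgebra_field_of U_measurable eq m] int' by (simp add: distr_U)
 have 2: "AE om in M. real_cond_exp M ?F (%om. f (V 0 s om)) om = real_cond_exp M ?F (%om. f (V n (s - int n) om + U 0 n s om)) om"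
  by (rule F.real_cond_exp_cong[OF ae]) measurable
 show ?thesis unfolding past_field_eq using 1 2 by eventually_elim simp
qed

text \<open>The preceding formula for the identity function, the block being centered. It replaces
  conditional expectations, fixed only up to null sets, by explicit series.\<close>

lemma lin_pred_eq: "AE om in M. lin_pred M a \<xi> s (s - int n) om = V n (s - int n) om"
proof -
 interpret T: prob_space "\<tau> n" by (rule prob_space_tau)
 have i: "integrable (\<tau> n) (%u. u)" "(LINT u|\<tau> n. u) = 0"
  unfolding \<tau>_def using U_moment(3,4)[of 0 n 0] by (simp_all add: integrable_distr_eq integral_distr)
 have "AE om in M. real_cond_exp M (past_field M \<xi> (s - int n)) (%om. V 0 s om) om = (LINT u|\<tau> n. V n (s - int n) om + u)"
  using cond_exp_V_U[of "%x. x" s n] V_integrable by simp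
 moreover have "(LINT u|\<tau> n. v + u) = v" for v using i T.prob_space by simp
 ultimately show ?thesis unfolding lin_pred_def lin_proc_eq by simp
qed

lemma K_fin_eq:
 assumes [measurable]: "K \<in> borel_measurable borel"
 shows "K_fin M a \<xi> K n w = (LINT u|\<tau> n. K (w + u))"
  "integrable M (%om. K (w + lin_proc a \<xi> (int n) om - lin_pred M a \<xi> (int n) 0 om)) \<longleftrightarrow> integrable (\<tau> n) (%u. K (w + u))"
proof -
 have [measurable]: "lin_pred M a \<xi> (int n) 0 \<in> borel_measurable M" unfolding lin_pred_def
  by (rule borel_measurable_cond_exp2)
 have ae: "AE om in M. K (w + lin_proc a \<xi> (int n) om - lin_pred M a \<xi> (int n) 0 om) = K (w + U 0 n (int n) om)"
  using AE_V_split lin_pred_eq[of "int n" n]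
 proof eventually_elim
  case (elim om)
  have "V 0 (int n) om = U 0 n (int n) om + V (0 + n) (int n - int n) om" using elim(1) by blast
  then show ?case using elim(2) by (simp add: lin_proc_eq)
 qed
 have m: "(%om. K (w + lin_proc a \<xi> (int n) om - lin_pred M a \<xi> (int n) 0 om)) \<in> borel_measurable M"
  unfolding lin_proc_eq by measurable
 have m2: "(%om. K (w + U 0 n (int n) om)) \<in> borel_measurable M" by measurable
 show "K_fin M a \<xi> K n w = (LINT u|\<tau> n. K (w + u))"
  unfolding K_fin_def integral_cong_AE[OF m m2 ae] distr_U[of n "int n", symmetric]
  by (simp add: integral_distr)
 show "integrable M (%om. K (w + lin_proc a \<xi> (int n) om - lin_pred M a \<xi> (int n) 0 om)) \<longleftrightarrow> integrable (\<tau> n) (%u. K (w + u))"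
  unfolding integrable_cong_AE[OF m m2 ae] distr_U[of n "int n", symmetric]
  by (simp add: integrable_distr_eq)
qed

end

section \<open>The normal tail\<close>

definition Phi :: "real => real" where "Phi = cdf std_normal_distribution"

lemma Phi_deriv: "(Phi has_real_derivative std_normal_density z) (at z)"
proof -
 interpret N: real_distribution std_normal_distribution by (rule real_dist_normal_dist)
 define a where "a = z - 1"
 define b where "b = z + 1"
 have cont: "continuous_on {a..b} std_normal_density"
  unfolding std_normal_density_def by (intro continuous_intros) auto
 have eq: "Phi x = Phi a + integral {a..x} std_normal_density" if "x \<in> {a..b}" for x
 proof (cases "x = a")
  case False
  then have ax: "a < x" using that by auto
  have i: "set_integrable lborel {a<..x} std_normal_density"
   unfolding set_integrable_def using integrable_normal_density[of 1 0] by (intro integrable_mult_indicator) auto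
  have "Phi x - Phi a = N.prob {a<..x}" unfolding Phi_def by (rule N.cdf_diff_eq[OF ax])
  also have "... = (LINT u|std_normal_distribution. indicator {a<..x} u)" by simp
  also have "... = (LINT u|lborel. std_normal_density u*indicator {a<..x} u)"
   by (subst integral_density) auto
  also have "... = set_lebesgue_integral lborel {a<..x} std_normal_density"
   by (simp add: set_lebesgue_integral_def mult.commute)
  also have "... = integral {a<..x} std_normal_density" by (rule set_borel_integral_eq_integral(2)[OF i])
  also have "... = integral {a..x} std_normal_density"
  proof (rule integral_subset_negligible)
   have "{a..x} - {a<..x} \<subseteq> {a}" by auto
   then show "negligible ({a..x} - {a<..x})" by (rule negligible_subset[rotated]) simp
  qed auto
  finally show ?thesis by simp
 qed simp
 have "((%x. Phi a + integral {a..x} std_normal_density) has_real_derivative std_normal_density z) (at z within {a..b})"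
  using DERIV_add[OF DERIV_const integral_has_real_derivative[OF cont, of z]] by (auto simp: a_def b_def)
 then have "(Phi has_real_derivative std_normal_density z) (at z within {a..b})"
 proof (rule has_field_derivative_transform_within[where d=1])
  show "Phi a + integral {a..x} std_normal_density = Phi x" if "x \<in> {a..b}" for x using eq[OF that] by simp
 qed (auto simp: a_def b_def)
 then show ?thesis by (simp add: at_within_Icc_at a_def b_def)
qed

lemma Phi_derivative[derivative_intros]:
 "(f has_real_derivative D) (at x) ==> ((%x. Phi (f x)) has_real_derivative std_normal_density (f x)*D) (at x)"
 by (rule DERIV_chain2[OF Phi_deriv])

lemma Phi_mono: "x <= y ==> Phi x <= Phi y"
 unfolding Phi_def
 using finite_borel_measure.cdf_nondecreasing[OF real_distribution.finite_borel_measure_M[OF real_dist_normal_dist]] .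

lemma Phi_bounds: "0 <= Phi x" "Phi x <= 1"
 unfolding Phi_def
 using finite_borel_measure.cdf_nonneg[OF real_distribution.finite_borel_measure_M[OF real_dist_normal_dist]]
  real_distribution.cdf_bounded_prob[OF real_dist_normal_dist] by auto

lemma Phi_lim_top: "(Phi \<longlongrightarrow> 1) at_top"
 unfolding Phi_def
 using real_distribution.cdf_lim_at_top_prob[OF real_dist_normal_dist] .

lemma Phi_lim_bot: "(Phi \<longlongrightarrow> 0) at_bot"
 unfolding Phi_def
 using finite_borel_measure.cdf_lim_at_bot[OF real_distribution.finite_borel_measure_M[OF real_dist_normal_dist]] .

lemma Phi_borel[measurable]: "Phi \<in> borel_measurable borel"
 by (rule borel_measurable_mono) (auto simp: mono_def Phi_mono)

lemma Phi_minus: "Phi (- z) = 1 - Phi z"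
proof -
 have d: "((%z. Phi z + Phi (- z)) has_real_derivative 0) (at z)" for z
  by (auto intro!: derivative_eq_intros simp: std_normal_density_def)
 have c: "Phi z + Phi (- z) = Phi y + Phi (- y)" for y by (rule DERIV_isconst_all[of "%z. Phi z + Phi (- z)"]) (use d in auto)
 have "((%y. Phi y + Phi (- y)) \<longlongrightarrow> 1 + 0) at_top"
  by (intro tendsto_add Phi_lim_top filterlim_compose[OF Phi_lim_bot] filterlim_uminus_at_bot_at_top)
 moreover have "(%y. Phi y + Phi (- y)) = (%y. Phi z + Phi (- z))" by (intro ext) (rule c[symmetric])
 ultimately have "((%y::real. Phi z + Phi (- z)) \<longlongrightarrow> 1) at_top" by simp
 then have "Phi z + Phi (- z) = 1" by (simp add: tendsto_const_iff)
 then show ?thesis by simp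
qed

lemma std_normal_density_le: "std_normal_density t <= exp (- t\<^sup>2/2)"
proof -
 have "1 <= sqrt (2*pi)" using pi_gt3 by simp
 then show ?thesis unfolding std_normal_density_def by (simp add: field_simps)
qed

lemma std_normal_density_ge: "exp (- t\<^sup>2/2)/3 <= std_normal_density t"
proof -
 have "sqrt (2*pi) <= 3" using pi_less_4 by (intro real_le_lsqrt) auto
 then show ?thesis unfolding std_normal_density_def by (simp add: field_simps)
qed

text \<open>A crude exponential bound suffices: it is applied at a point of order (ln n)^2. The
  difference of the two sides decreases to its limit 0, because x^2/2 >= x - 1/2.\<close>

lemma Phi_tail_le: "1 - Phi v <= 3*exp (- v)"
proof -
 let ?D = "%v. 3*exp (- v) - (1 - Phi v)"
 have dec: "?D w <= ?D v" if "v <= w" for v w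
 proof (rule DERIV_nonpos_imp_nonincreasing[OF that])
  fix x :: real
  have "std_normal_density x <= exp (- x\<^sup>2/2)" by (rule std_normal_density_le)
  also have "... <= exp (1 - x)"
   using sum_squares_ge_zero[of "x - 1" 0] zero_le_power2[of "x - 1"] by (auto simp: power2_eq_square algebra_simps)
  also have "... <= 3*exp (- x)" using exp_le by (simp add: exp_diff exp_minus divide_inverse)
  finally have "std_normal_density x - 3*exp (- x) <= 0" by simp
  moreover have "(?D has_real_derivative (std_normal_density x - 3*exp (- x))) (at x)"
   by (auto intro!: derivative_eq_intros)
  ultimately show "\<exists>y. (?D has_real_derivative y) (at x) & y <= 0" by blast
 qed
 have lim: "(?D \<longlongrightarrow> 3*0 - (1 - 1)) at_top"
  by (intro tendsto_diff tendsto_mult tendsto_const Phi_lim_top filterlim_compose[OF exp_at_bot filterlim_uminus_at_bot_at_top])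
 have "eventually (%w. ?D w <= ?D v) at_top"
  by (rule eventually_mono[OF eventually_ge_at_top[of v]]) (rule dec)
 from tendsto_upperbound[OF lim this] have "3*0 - (1 - 1) <= ?D v" by simp
 then show ?thesis by simp
qed

text \<open>The mass of the interval from lam to lam + 1/(1 + lam): on it the density loses at most
  a factor e^{3/2} against exp(-lam^2/2), and 15 bounds 3 e^{3/2}. Taking lam = max x 0 covers
  negative x.\<close>

lemma Phi_tail_ge:
 fixes x :: real
 defines "lam \<equiv> max x 0"
 shows "1 - Phi x >= exp (- lam\<^sup>2/2)/(15*(1 + lam))"
proof -
 define h where "h = 1/(1 + lam)"
 have lam: "lam >= 0" by (simp add: lam_def)
 have h: "0 < h" "h <= 1" "lam*h <= 1" using lam by (auto simp: h_def field_simps)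
 have "\<exists>z>lam. z < lam + h & Phi (lam + h) - Phi lam = (lam + h - lam) * std_normal_density z"
  using h by (intro MVT2) (auto intro!: Phi_deriv)
 then obtain z where z: "z > lam" "z < lam + h" "Phi (lam + h) - Phi lam = h * std_normal_density z" by auto
 have "z^2 <= (lam + h)^2" using z lam by (intro power_mono) auto
 also have "... = lam^2 + 2*(lam*h) + h^2" by (simp add: power2_eq_square algebra_simps)
 also have "... <= lam^2 + 2*1 + 1" using h by (intro add_mono mult_left_mono power_le_one) auto
 finally have "exp (- lam\<^sup>2/2 - 3/2)/3 <= exp (- z\<^sup>2/2)/3" by simp
 also have "... <= std_normal_density z" by (rule std_normal_density_ge)
 also have "exp (- lam\<^sup>2/2 - 3/2) = exp (- lam\<^sup>2/2)*exp (- (3/2))" by (simp only: mult_exp_exp) simp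
 finally have "exp (- lam\<^sup>2/2)*(exp (- (3/2))/3) <= std_normal_density z" by (simp only: times_divide_eq_right)
 moreover have "exp (3/2::real) <= 5"
 proof -
  have "exp (3/2::real) = exp (1/2)*exp 1" by (simp add: mult_exp_exp)
  also have "... <= (17/10)*2.72"
  proof (intro mult_mono)
   have "(exp (1/2::real))^2 = exp 1" by (simp add: power2_eq_square mult_exp_exp)
   also have "... <= (17/10)^2" using e_less_272 by (simp add: power2_eq_square)
   finally show "exp (1/2::real) <= 17/10" by (rule power2_le_imp_le) simp
  qed (use e_less_272 in auto)
  finally show ?thesis by simp
 qed
 then have "1/15 <= exp (- (3/2)::real)/3" by (simp add: exp_minus field_simps)
 then have "exp (- lam\<^sup>2/2)*(1/15) <= exp (- lam\<^sup>2/2)*(exp (- (3/2))/3)" by (rule mult_left_mono) simp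
 ultimately have "exp (- lam\<^sup>2/2)*(1/15) <= std_normal_density z" by (rule order_trans[rotated])
 then have "h*(exp (- lam\<^sup>2/2)*(1/15)) <= Phi (lam + h) - Phi lam"
  unfolding z(3) using h by (intro mult_left_mono) auto
 also have "... <= 1 - Phi x" using Phi_bounds(2)[of "lam + h"] Phi_mono[of x lam] by (simp add: lam_def)
 finally show ?thesis by (simp add: h_def mult_ac)
qed

lemma Phi_tail_pos: "1 - Phi x > 0"
proof -
 have "0 < exp (- (max x 0)\<^sup>2/2)/(15*(1 + max x 0))" by (intro divide_pos_pos) auto
 then show ?thesis using Phi_tail_ge[of x] by linarith
qed

text \<open>Between x and x' the density is at most 3 exp(-lam^2/2), and the lower bound for the
  tail turns this into a relative error; 45 is 3 times 15.\<close>

lemma Phi_tail_shift: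
 fixes x x' :: real
 defines "lam \<equiv> max x 0"
 assumes le1: "\<bar>x' - x\<bar>*(1 + lam) <= 1"
 shows "\<bar>(1 - Phi x') - (1 - Phi x)\<bar> <= 45*(\<bar>x' - x\<bar>*(1 + lam))*(1 - Phi x)"
proof -
 have lam: "lam >= 0" by (simp add: lam_def)
 have dens: "std_normal_density t <= 3*exp (- lam\<^sup>2/2)" if "\<bar>t - x\<bar> <= \<bar>x' - x\<bar>" for t
 proof -
  have "lam*(lam - t) <= lam*\<bar>x' - x\<bar>"
   using that by (cases "x >= 0") (auto simp: lam_def intro!: mult_left_mono)
  also have "... <= \<bar>x' - x\<bar>*(1 + lam)" by (simp add: algebra_simps)
  also have "... <= 1" by fact
  finally have "- t\<^sup>2/2 <= 1 + - lam\<^sup>2/2" using zero_le_power2[of "t - lam"] by (simp add: power2_eq_square algebra_simps)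
  then have "exp (- t\<^sup>2/2) <= exp 1*exp (- lam\<^sup>2/2)" by (simp only: mult_exp_exp exp_le_cancel_iff)
  also have "... <= 3*exp (- lam\<^sup>2/2)" using exp_le by (intro mult_right_mono) auto
  finally show ?thesis using std_normal_density_le[of t] by linarith
 qed
 have m: "\<bar>Phi v - Phi u\<bar> <= 3*exp (- lam\<^sup>2/2)*\<bar>x' - x\<bar>" if "u < v" "u = x & v = x' \<or> u = x' & v = x" for u v
 proof -
  have "\<exists>z>u. z < v & Phi v - Phi u = (v - u) * std_normal_density z"
   using that(1) by (intro MVT2 Phi_deriv)
  then obtain z where z: "z > u" "z < v" "Phi v - Phi u = (v - u) * std_normal_density z" by blast
  have d: "std_normal_density z <= 3*exp (- lam\<^sup>2/2)" using z that by (intro dens) auto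
  have "\<bar>Phi v - Phi u\<bar> = (v - u) * std_normal_density z" unfolding z(3) using that(1) by (simp add: abs_mult)
  also have "... <= (v - u)*(3*exp (- lam\<^sup>2/2))" using d that(1) by (intro mult_left_mono) auto
  finally show ?thesis using that by (auto simp: mult_ac)
 qed
 have "\<bar>Phi x' - Phi x\<bar> <= 3*exp (- lam\<^sup>2/2)*\<bar>x' - x\<bar>"
  using m[of x x'] m[of x' x] by (cases x x' rule: linorder_cases) (auto simp: abs_minus_commute)
 also have "... = 45*(\<bar>x' - x\<bar>*(1 + lam))*(exp (- lam\<^sup>2/2)/(15*(1 + lam)))"
  using lam by (simp add: field_simps)
 also have "... <= 45*(\<bar>x' - x\<bar>*(1 + lam))*(1 - Phi x)"
  using lam Phi_tail_ge[of x] unfolding lam_def by (intro mult_left_mono) auto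
 finally show ?thesis by (simp add: abs_minus_commute)
qed

lemma std_normal_density_deriv: "(std_normal_density has_real_derivative - t * std_normal_density t) (at t)"
proof -
 have "((%t. exp (- t\<^sup>2/2)) has_real_derivative exp (- t\<^sup>2/2)*(- t)) (at t)"
  by (auto intro!: derivative_eq_intros)
 from DERIV_cmult[OF this, of "1/sqrt (2*pi)"] show ?thesis
  by (simp add: std_normal_density_def[abs_def] mult_ac)
qed

lemma std_normal_density_derivative[derivative_intros]:
 "(f has_real_derivative D) (at x) ==>
  ((%x. std_normal_density (f x)) has_real_derivative - f x * std_normal_density (f x)*D) (at x)"
 by (rule DERIV_chain2[OF std_normal_density_deriv])

section \<open>The smoothed normal distribution function as a heat flow\<close>

text \<open>The heat kernel, the density at z of the centered normal law with variance s. The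
  function Phi(z / sqrt s) solves the heat equation: its second derivative in z is twice its
  derivative in s.\<close>

definition hk :: "real => real => real" where "hk z s = std_normal_density (z/sqrt s)/sqrt s"

lemma hk_deriv_z:
 assumes "s > 0"
 shows "((%z. Phi (z/sqrt s)) has_real_derivative hk z s) (at z)"
  "((%z. hk z s) has_real_derivative - z/s*hk z s) (at z)"
  "((%z. - z/s*hk z s) has_real_derivative (z^2/s^2 - 1/s)*hk z s) (at z)"
proof -
 have l: "((%z. z/sqrt s) has_real_derivative 1/sqrt s) (at z)" for z
  using DERIV_cdivide[OF DERIV_ident, of "sqrt s"] by simp
 have sq: "sqrt s * sqrt s = s" using assms by simp
 show "((%z. Phi (z/sqrt s)) has_real_derivative hk z s) (at z)"
  using Phi_derivative[OF l] by (simp add: hk_def)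
 have 2: "((%z. hk z s) has_real_derivative - z/s*hk z s) (at z)" for z
 proof -
  have "((%z. hk z s) has_real_derivative (- (z/sqrt s) * std_normal_density (z/sqrt s)*(1/sqrt s))/sqrt s) (at z)"
   unfolding hk_def by (rule DERIV_cdivide[OF std_normal_density_derivative[OF l]])
  also have "(- (z/sqrt s) * std_normal_density (z/sqrt s)*(1/sqrt s))/sqrt s = - (z/(sqrt s * sqrt s))*hk z s"
   by (simp add: hk_def)
  finally show ?thesis by (simp only: sq minus_divide_left)
 qed
 show "((%z. hk z s) has_real_derivative - z/s*hk z s) (at z)" by (rule 2)
 have "((%z. (- 1/s*z)*hk z s) has_real_derivative (- 1/s*1)*hk z s + (- z/s*hk z s)*(- 1/s*z)) (at z)"
  by (rule DERIV_mult[OF DERIV_cmult[OF DERIV_ident] 2])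
 also have "(- 1/s*1)*hk z s + (- z/s*hk z s)*(- 1/s*z) = (z^2/s^2 - 1/s)*hk z s"
  by (simp add: power2_eq_square algebra_simps)
 finally show "((%z. - z/s*hk z s) has_real_derivative (z^2/s^2 - 1/s)*hk z s) (at z)" by simp
qed

lemma hk_deriv_s:
 assumes "s > 0"
 shows "((%s. Phi (z/sqrt s)) has_real_derivative - z/(2 * s)*hk z s) (at s)"
  "((%s. - z/(2 * s)*hk z s) has_real_derivative (3*z/(4 * s^2) - z ^ 3/(4 * s ^ 3))*hk z s) (at s)"
proof -
 have inv: "((%s. c/sqrt s) has_real_derivative - (c/sqrt s)/(2 * s)) (at s)" for c
 proof -
  have "((%s. c/sqrt s) has_real_derivative (0 * sqrt s - c*(inverse (sqrt s)/2))/(sqrt s * sqrt s)) (at s)"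
   using assms by (intro DERIV_divide DERIV_const DERIV_real_sqrt) auto
  also have "(0 * sqrt s - c*(inverse (sqrt s)/2))/(sqrt s * sqrt s) = - (c/sqrt s)/(2 * s)"
  proof -
   have sq: "sqrt s * sqrt s = s" using assms by simp
   show ?thesis unfolding sq by (simp add: field_simps)
  qed
  finally show ?thesis .
 qed
 have "((%s. Phi (z/sqrt s)) has_real_derivative std_normal_density (z/sqrt s)*(- (z/sqrt s)/(2 * s))) (at s)"
  by (rule Phi_derivative[OF inv])
 then show "((%s. Phi (z/sqrt s)) has_real_derivative - z/(2 * s)*hk z s) (at s)"
  by (simp add: hk_def mult_ac)
 let ?f = "std_normal_density (z/sqrt s)"
 have "((%s. std_normal_density (z/sqrt s)*(1/sqrt s)) has_real_derivative
   (- (z/sqrt s)*?f*(- (z/sqrt s)/(2 * s)))*(1/sqrt s) + (- (1/sqrt s)/(2 * s))*?f) (at s)"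
  by (rule DERIV_mult[OF std_normal_density_derivative[OF inv] inv])
 also have "(- (z/sqrt s)*?f*(- (z/sqrt s)/(2 * s)))*(1/sqrt s) + (- (1/sqrt s)/(2 * s))*?f
   = (z^2/(2 * s^2) - 1/(2 * s))*hk z s"
 proof -
  have "z/sqrt s*(z/sqrt s) = z^2/s" using assms by (simp add: power2_eq_square)
  moreover have "- g*f*(- g/(2 * s)) = (g*g)*f/(2 * s)" for g f :: real by simp
  ultimately have "(- (z/sqrt s)*?f*(- (z/sqrt s)/(2 * s))) = z^2/s*?f/(2 * s)" by (simp only:)
  then show ?thesis by (simp add: hk_def power2_eq_square algebra_simps)
 qed
 finally have h: "((%s. hk z s) has_real_derivative (z^2/(2 * s^2) - 1/(2 * s))*hk z s) (at s)"
  by (simp add: hk_def)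
 have i: "((%s. - z/(2 * s)) has_real_derivative z/(2 * s^2)) (at s)"
  using assms by (auto intro!: derivative_eq_intros simp: power2_eq_square field_simps)
 have "((%s. - z/(2 * s)*hk z s) has_real_derivative z/(2 * s^2)*hk z s + (z^2/(2 * s^2) - 1/(2 * s))*hk z s*(- z/(2 * s))) (at s)"
  by (rule DERIV_mult[OF i h])
 also have "z/(2 * s^2)*hk z s + (z^2/(2 * s^2) - 1/(2 * s))*hk z s*(- z/(2 * s))
   = (3*z/(4 * s^2) - z ^ 3/(4 * s ^ 3))*hk z s"
  using assms by (simp add: power2_eq_square power3_eq_cube field_simps)
 finally show "((%s. - z/(2 * s)*hk z s) has_real_derivative (3*z/(4 * s^2) - z ^ 3/(4 * s ^ 3))*hk z s) (at s)" .
qed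

text \<open>With t = g + c the exponent -g^2/2 is -t^2/2 + gc + c^2/2, the Gaussian seen under a
  tilt by c. The cubic factor is absorbed by 3|t| - t^2/2 <= 9/2, and e^{9/2} <= 243.\<close>

lemma cube_gaussian_bound:
 fixes g c :: real
 assumes "c >= 0"
 shows "(1 + (abs g)) ^ 3*exp (- g\<^sup>2/2) <= 243*(1 + c) ^ 3*exp (g*c + c^2/2)"
proof -
 let ?t = "g + c"
 have e1: "exp (9/2::real) <= 243"
 proof -
  have "exp (9/2::real) <= exp (real 5*1)" by simp
  also have "... = exp 1 ^ 5" by (rule exp_of_nat_mult)
  also have "... <= 3 ^ 5" using exp_le by (intro power_mono) auto
  finally show ?thesis by simp
 qed
 have "1 + \<bar>?t\<bar> <= exp \<bar>?t\<bar>" by (rule exp_ge_add_one_self)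
 then have "(1 + \<bar>?t\<bar>) ^ 3 <= exp \<bar>?t\<bar> ^ 3" by (intro power_mono) auto
 also have "... = exp (real 3*\<bar>?t\<bar>)" by (rule exp_of_nat_mult[symmetric])
 finally have "(1 + \<bar>?t\<bar>) ^ 3*exp (- ?t\<^sup>2/2) <= exp (real 3*\<bar>?t\<bar>)*exp (- ?t\<^sup>2/2)" by (intro mult_right_mono) auto
 also have "... = exp (3*\<bar>?t\<bar> - ?t^2/2)" by (simp only: mult_exp_exp) simp
 also have "... <= exp (9/2)"
  using zero_le_power2[of "\<bar>?t\<bar> - 3"] by (simp add: power2_diff)
 finally have main: "(1 + \<bar>?t\<bar>) ^ 3*exp (- ?t\<^sup>2/2) <= 243" using e1 by linarith
 have "1 + (abs g) <= (1 + \<bar>?t\<bar>)*(1 + c)"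
 proof -
  have "(abs g) <= \<bar>?t\<bar> + c" using assms by linarith
  moreover have "0 <= \<bar>?t\<bar>*c" using assms by simp
  ultimately show ?thesis by (simp add: algebra_simps)
 qed
 then have 1: "(1 + (abs g)) ^ 3 <= (1 + \<bar>?t\<bar>) ^ 3*(1 + c) ^ 3" unfolding power_mult_distrib[symmetric] by (intro power_mono) auto
 have "- g\<^sup>2/2 = - ?t\<^sup>2/2 + (g*c + c^2/2)" by (simp add: power2_eq_square field_simps)
 then have 2: "exp (- g\<^sup>2/2) = exp (- ?t\<^sup>2/2)*exp (g*c + c^2/2)" by (simp only: mult_exp_exp)
 have "(1 + (abs g)) ^ 3*exp (- g\<^sup>2/2) <= ((1 + \<bar>?t\<bar>) ^ 3*(1 + c) ^ 3)*(exp (- ?t\<^sup>2/2)*exp (g*c + c^2/2))"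
  unfolding 2 using 1 by (intro mult_right_mono) auto
 also have "... = ((1 + \<bar>?t\<bar>) ^ 3*exp (- ?t\<^sup>2/2))*((1 + c) ^ 3*exp (g*c + c^2/2))" by (simp only: mult_ac)
 also have "... <= 243*((1 + c) ^ 3*exp (g*c + c^2/2))"
  using main assms by (intro mult_right_mono) auto
 finally show ?thesis by (simp only: mult_ac)
qed

text \<open>One bound for all derivatives in use, with \<open>lam\<close> a free tilt. The
  exponential in z is what turns into a moment generating function when z is a partial sum. The
  number 1944 is 8 times 243, the 8 coming from 1 + lam * sqrt s <= 2(1 + lam).\<close>

definition hkB :: "real => real => real => real => real" where
 "hkB d lam z s = 1944/d ^ 4*(1 + lam) ^ 3*exp (lam*z + lam^2 * s/2)"

text \<open>In the variable g = z / sqrt s each derivative is Q(g) s^{-k/2} times the standard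
  density, with |Q(g)| <= (1 + |g|)^3 and k <= 4, so one Gaussian bound covers all four.\<close>

lemma hk_bounds:
 fixes z s d lam :: real
 assumes d: "0 < d" "d <= 1" and s: "d^2 <= s" "s <= 4" and lam: "lam >= 0"
 shows "(abs (hk z s)) <= hkB d lam z s" "\<bar>- z/s*hk z s\<bar> <= hkB d lam z s"
  "\<bar>(z^2/s^2 - 1/s)*hk z s\<bar> <= hkB d lam z s"
  "\<bar>(3*z/(4 * s^2) - z ^ 3/(4 * s ^ 3))*hk z s\<bar> <= hkB d lam z s"
proof -
 have s0: "s > 0" using d s by (meson less_le_trans zero_less_power)
 define w where "w = sqrt s"
 have w: "w > 0" "s = w^2" "d <= w" "w <= 2"
  using s0 s d by (auto simp: w_def real_le_rsqrt intro: real_le_lsqrt)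
 define g where "g = z/w"
 have z: "z = g*w" using w by (simp add: g_def)
 define E where "E = (1 + (abs g)) ^ 3*exp (- g\<^sup>2/2)"
 have E: "1/d ^ 4*E <= hkB d lam z s"
 proof -
  have "E <= 243*(1 + lam*w) ^ 3*exp (g*(lam*w) + (lam*w)^2/2)"
   unfolding E_def using lam w by (intro cube_gaussian_bound) auto
  also have "g*(lam*w) + (lam*w)^2/2 = lam*z + lam^2 * s/2"
   unfolding z w(2) by (simp add: power_mult_distrib mult_ac)
  also have "243*(1 + lam*w) ^ 3 <= 1944*(1 + lam) ^ 3"
  proof -
   have "lam*w <= lam*2" using w lam by (intro mult_left_mono) auto
   then have "1 + lam*w <= 2*(1 + lam)" by simp
   then have "(1 + lam*w) ^ 3 <= (2*(1 + lam)) ^ 3" using lam w by (intro power_mono) auto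
   also have "(2*(1 + lam)) ^ 3 = 8*(1 + lam) ^ 3" by (simp only: power_mult_distrib) simp
   finally show ?thesis by simp
  qed
  finally have "E <= 1944*(1 + lam) ^ 3*exp (lam*z + lam^2 * s/2)" by simp
  from mult_left_mono[OF this, of "1/d ^ 4"] d show ?thesis by (simp add: hkB_def)
 qed
 have hk: "hk z s = std_normal_density g/w" by (simp add: hk_def g_def w_def)
 have pw: "1/w ^ k <= 1/d ^ 4" if "k <= 4" for k
 proof -
  have "d ^ 4 <= d ^ k" using d that by (intro power_decreasing) auto
  also have "... <= w ^ k" using w d by (intro power_mono) auto
  finally show ?thesis using d by (intro divide_left_mono) (use w in auto)
 qed
 have gen: "\<bar>P*hk z s\<bar> <= hkB d lam z s" if P: "P/w = Q/w ^ k" "(abs Q) <= (1 + (abs g)) ^ 3" "k <= 4" for P Q k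
 proof -
  have "\<bar>P*hk z s\<bar> = 1/w ^ k*((abs Q) * std_normal_density g)"
  proof -
   have "P*hk z s = P/w * std_normal_density g" unfolding hk by simp
   then show ?thesis unfolding P(1) using w by (simp add: abs_mult)
  qed
  also have "... <= 1/d ^ 4*((1 + (abs g)) ^ 3*exp (- g\<^sup>2/2))"
   using pw[OF P(3)] P(2) std_normal_density_le[of g] d by (intro mult_mono) auto
  also have "... <= hkB d lam z s" using E by (simp add: E_def)
  finally show ?thesis .
 qed
 have p3: "(1 + (abs g)) ^ 3 = 1 + 3*(abs g) + 3*(abs g)^2 + (abs g) ^ 3" by (simp add: power2_eq_square power3_eq_cube algebra_simps)
 have nn: "(abs g) ^ 3 >= 0" "(abs g)^2 >= 0" by simp_all
 have "\<bar>1*hk z s\<bar> <= hkB d lam z s" by (rule gen[of 1 1 1]) (use nn in \<open>auto simp: p3\<close>)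
 then show "(abs (hk z s)) <= hkB d lam z s" by simp
 show "\<bar>- z/s*hk z s\<bar> <= hkB d lam z s"
 proof (rule gen[of _ "- g" 2])
  show "- z/s/w = - g/w^2" unfolding z w(2) using w(1) by (simp add: power2_eq_square)
  show "\<bar>- g\<bar> <= (1 + (abs g)) ^ 3" unfolding p3 using nn by simp
 qed simp
 show "\<bar>(z^2/s^2 - 1/s)*hk z s\<bar> <= hkB d lam z s"
 proof (rule gen[of _ "g^2 - 1" 3])
  show "(z^2/s^2 - 1/s)/w = (g^2 - 1)/w ^ 3"
   unfolding z w(2) using w(1) by (simp add: power2_eq_square power3_eq_cube field_simps)
  have "\<bar>g^2 - 1\<bar> <= (abs g)^2 + 1" by (simp add: abs_le_iff)
  then show "\<bar>g^2 - 1\<bar> <= (1 + (abs g)) ^ 3" unfolding p3 using nn abs_ge_zero[of g] by linarith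
 qed simp
 show "\<bar>(3*z/(4 * s^2) - z ^ 3/(4 * s ^ 3))*hk z s\<bar> <= hkB d lam z s"
 proof (rule gen[of _ "3*g/4 - g ^ 3/4" 4])
  show "(3*z/(4 * s^2) - z ^ 3/(4 * s ^ 3))/w = (3*g/4 - g ^ 3/4)/w ^ 4"
   unfolding z w(2) using w(1) by (simp add: eval_nat_numeral field_simps)
  have "\<bar>3*g/4 - g ^ 3/4\<bar> <= \<bar>3*g/4\<bar> + \<bar>g ^ 3/4\<bar>" by (rule abs_triangle_ineq4)
  also have "... = 3/4*(abs g) + (abs g) ^ 3/4" by (simp add: abs_mult power_abs)
  finally show "\<bar>3*g/4 - g ^ 3/4\<bar> <= (1 + (abs g)) ^ 3" unfolding p3 using nn abs_ge_zero[of g] by linarith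
 qed simp
qed

lemma hkB_nonneg: "0 < d ==> 0 <= lam ==> 0 <= hkB d lam z s"
 by (simp add: hkB_def)

text \<open>The third derivative is taken at an intermediate point; moving its bound back to z costs
  exp(lam*|h|), since that point is within |h| of z.\<close>

lemma hk_taylor_z:
 fixes z h s d lam :: real
 assumes d: "0 < d" "d <= 1" and s: "d^2 <= s" "s <= 4" and lam: "lam >= 0"
 shows "\<bar>Phi ((z + h)/sqrt s) - Phi (z/sqrt s) - hk z s*h - (- z/s*hk z s)*h^2/2\<bar>
  <= hkB d lam z s*exp (lam*(abs h))*(abs h) ^ 3"
proof (cases "h = 0")
 case False
 have s0: "s > 0" using d s by (meson less_le_trans zero_less_power)
 define D where "D m z = (if m = 0 then Phi (z/sqrt s) else if m = 1 then hk z s else if m = 2 then - z/s*hk z s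
   else (z^2/s^2 - 1/s)*hk z s)" for m :: nat and z
 have der: "\<forall>m t. m < 3 & z - (abs h) <= t & t <= z + (abs h) \<longrightarrow> DERIV (D m) t :> D (Suc m) t"
 proof (intro allI impI)
  fix m :: nat and t :: real assume "m < 3 & z - (abs h) <= t & t <= z + (abs h)"
  then consider "m = 0" | "m = 1" | "m = 2" by linarith
  then show "DERIV (D m) t :> D (Suc m) t"
   using hk_deriv_z[OF s0] by cases (simp_all add: D_def[abs_def])
 qed
 have "\<exists>t. (if z + h < z then z + h < t & t < z else z < t & t < z + h) &
   D 0 (z + h) = (\<Sum>m<3. D m z/fact m*(z + h - z) ^ m) + D 3 t/fact 3*(z + h - z) ^ 3"
  using False by (intro Taylor[of 3 D "D 0" "z - (abs h)" "z + (abs h)"] der) auto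
 then obtain t where t: "if z + h < z then z + h < t & t < z else z < t & t < z + h"
  "D 0 (z + h) = (\<Sum>m<3. D m z/fact m*h ^ m) + D 3 t/fact 3*h ^ 3" by auto
 have "t - z <= (abs h)" using t(1) by (auto split: if_splits)
 then have "lam*t <= lam*z + lam*(abs h)" using mult_left_mono[OF _ lam, of "t - z" "(abs h)"] by (simp add: algebra_simps)
 then have "exp (lam*t + lam^2 * s/2) <= exp (lam*z + lam^2 * s/2)*exp (lam*(abs h))" by (simp add: mult_exp_exp)
 then have "1944/d ^ 4*(1 + lam) ^ 3*exp (lam*t + lam^2 * s/2)
   <= 1944/d ^ 4*(1 + lam) ^ 3*(exp (lam*z + lam^2 * s/2)*exp (lam*(abs h)))"
  using d lam by (intro mult_left_mono) auto
 then have Bt: "hkB d lam t s <= hkB d lam z s*exp (lam*(abs h))" by (simp only: hkB_def mult_ac)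
 have "(abs (D 3 t)) <= hkB d lam z s*exp (lam*(abs h))"
  using hk_bounds(3)[OF d s lam, of t] Bt by (simp add: D_def)
 then have "(abs (D 3 t))*(abs h) ^ 3 <= hkB d lam z s*exp (lam*(abs h))*(abs h) ^ 3" by (intro mult_right_mono) auto
 moreover have "\<bar>D 3 t/fact 3*h ^ 3\<bar> <= (abs (D 3 t))*(abs h) ^ 3"
  by (simp add: abs_mult power_abs fact_numeral field_simps)
 moreover have "Phi ((z + h)/sqrt s) - Phi (z/sqrt s) - hk z s*h - (- z/s*hk z s)*h^2/2 = D 3 t/fact 3*h ^ 3"
  using t(2) by (simp add: D_def eval_nat_numeral)
 ultimately show ?thesis by linarith
qed simp

lemma hk_taylor_s:
 fixes z t s d lam :: real
 assumes d: "0 < d" "d <= 1" and s: "d^2 <= s" "0 <= t" "s + t <= 4" and lam: "lam >= 0"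
 shows "\<bar>Phi (z/sqrt (s + t)) - Phi (z/sqrt s) - t*(- z/s*hk z s)/2\<bar>
  <= hkB d lam z s*exp (lam^2*t/2)*t^2"
proof (cases "t = 0")
 case False
 have s0: "s > 0" using d s by (meson less_le_trans zero_less_power)
 define D where "D m s = (if m = 0 then Phi (z/sqrt s) else if m = 1 then - z/(2 * s)*hk z s
   else (3*z/(4 * s^2) - z ^ 3/(4 * s ^ 3))*hk z s)" for m :: nat and s
 have der: "\<forall>m r. m < 2 & s <= r & r <= s + t \<longrightarrow> DERIV (D m) r :> D (Suc m) r"
 proof (intro allI impI)
  fix m :: nat and r :: real assume "m < 2 & s <= r & r <= s + t"
  then have "r > 0" "m = 0 \<or> m = 1" using s0 by auto
  then show "DERIV (D m) r :> D (Suc m) r"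
   using hk_deriv_s[of r z] by (auto simp: D_def[abs_def])
 qed
 have "\<exists>r. (if s + t < s then s + t < r & r < s else s < r & r < s + t) &
   D 0 (s + t) = (\<Sum>m<2. D m s/fact m*(s + t - s) ^ m) + D 2 r/fact 2*(s + t - s) ^ 2"
  using False s by (intro Taylor[of 2 D "D 0" s "s + t"] der) auto
 then obtain r where r: "s < r" "r < s + t"
  "D 0 (s + t) = (\<Sum>m<2. D m s/fact m*t ^ m) + D 2 r/fact 2*t ^ 2" using s by auto
 have "lam^2*r/2 <= lam^2*(s + t)/2" using r by (intro divide_right_mono mult_left_mono) auto
 then have "exp (lam*z + lam^2*r/2) <= exp (lam*z + lam^2 * s/2)*exp (lam^2*t/2)"
  by (simp add: mult_exp_exp algebra_simps add_divide_distrib)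
 then have "1944/d ^ 4*(1 + lam) ^ 3*exp (lam*z + lam^2*r/2)
   <= 1944/d ^ 4*(1 + lam) ^ 3*(exp (lam*z + lam^2 * s/2)*exp (lam^2*t/2))"
  using d lam by (intro mult_left_mono) auto
 then have Bt: "hkB d lam z r <= hkB d lam z s*exp (lam^2*t/2)" by (simp only: hkB_def mult_ac)
 have "(abs (D 2 r)) <= hkB d lam z s*exp (lam^2*t/2)"
  using hk_bounds(4)[OF d _ _ lam, of r z] r s Bt by (simp add: D_def)
 then have "(abs (D 2 r))*t^2 <= hkB d lam z s*exp (lam^2*t/2)*t^2" by (intro mult_right_mono) auto
 moreover have "\<bar>D 2 r/fact 2*t^2\<bar> <= (abs (D 2 r))*t^2"
  by (simp add: abs_mult field_simps)
 moreover have "Phi (z/sqrt (s + t)) - Phi (z/sqrt s) - t*(- z/s*hk z s)/2 = D 2 r/fact 2*t^2"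
  using r(3) by (simp add: D_def eval_nat_numeral)
 ultimately show ?thesis by linarith
qed simp

section \<open>Moderate deviations for weighted sums\<close>

lemma exp_le_cubic: "exp v <= 1 + v + v^2/2 + exp (abs v)*(abs v) ^ 3" for v :: real
proof -
 obtain t where t: "(abs t) <= (abs v)" "exp v = (\<Sum>m<3. v ^ m/fact m) + exp t/fact 3 * v ^ 3"
  using Maclaurin_exp_le[of v 3] by auto
 have e: "exp v = 1 + v + v^2/2 + exp t/6 * v ^ 3" unfolding t(2) by (simp add: eval_nat_numeral)
 have "exp t/6 * v ^ 3 <= \<bar>exp t/6 * v ^ 3\<bar>" by simp
 also have "... = exp t/6*(abs v) ^ 3" by (simp add: abs_mult power_abs)
 also have "... <= exp (abs v)*(abs v) ^ 3"
 proof (rule mult_right_mono)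
  have "exp t <= exp (abs v)" using t(1) by simp
  then show "exp t/6 <= exp (abs v)" using exp_gt_zero[of t] by linarith
 qed simp
 finally show ?thesis unfolding e by simp
qed

section \<open>Replacing one bounded summand by a Gaussian one\<close>

locale bounded_summand = prob_space \<rho> for \<rho> :: "real measure" +
 fixes f :: "real => real" and y :: real
 assumes sets_rho: "sets \<rho> = sets borel" and f_meas: "f \<in> borel_measurable borel"
  and f_bound: "!!v. (abs (f v)) <= y"
begin

lemma f_meas'[measurable]: "f \<in> borel_measurable \<rho>" using f_meas sets_rho by (simp cong: measurable_cong_sets)

lemma y_nonneg: "y >= 0" using f_bound[of 0] by linarith

lemma integrable_bounded:
 fixes g :: "real => real" and B :: real
 assumes "g \<in> borel_measurable borel" "!!v. (abs v) <= y ==> (abs (g v)) <= B"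
 shows "integrable \<rho> (%v. g (f v))"
 by (rule integrable_const_bound[where B=B]) (use assms f_bound in \<open>auto intro!: measurable_compose[OF f_meas']\<close>)

lemma integrable_powers: "integrable \<rho> (%v. f v)" "integrable \<rho> (%v. (f v)^2)" "integrable \<rho> (%v. (abs (f v)) ^ 3)"
proof -
 show "integrable \<rho> (%v. f v)" by (rule integrable_bounded[where g="%v. v" and B=y]) auto
 show "integrable \<rho> (%v. (f v)^2)"
  by (rule integrable_bounded[where B="y^2"]) (use abs_le_square_iff y_nonneg in fastforce)+
 show "integrable \<rho> (%v. (abs (f v)) ^ 3)"
  by (rule integrable_bounded[where g="%v. (abs v) ^ 3" and B="y^3"]) (auto intro!: power_mono)
qed

text \<open>What separates a summand from a centered Gaussian of variance t: its mean, the defect of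
  its second moment, the third order remainder in space, and the second order remainder in variance.
  The exponentials are the costs of the tilt.\<close>

definition err :: "real => real => real" where
 "err lam t = \<bar>\<integral>v. f v \<partial>\<rho>\<bar> + \<bar>(LINT v|\<rho>. (f v)^2) - t\<bar> + exp (lam*y)*(LINT v|\<rho>. (abs (f v)) ^ 3) + exp (lam^2*t/2)*t^2"

lemma err_nonneg: "err lam t >= 0"
 unfolding err_def by (intro add_nonneg_nonneg mult_nonneg_nonneg Bochner_Integration.integral_nonneg) auto

text \<open>By the heat equation \<open>D2\<close> is both the second derivative in z and twice the
  derivative in s, so adding a summand with second moment near t almost equals raising the variance
  by t. What does not cancel is collected in \<open>err\<close>.\<close>

lemma heat_step:
 assumes d: "0 < d" "d <= 1" and s: "d^2 <= s" "0 <= t" "s + t <= 4" and lam: "lam >= 0"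
 shows "\<bar>(LINT v|\<rho>. Phi ((z + f v)/sqrt s)) - Phi (z/sqrt (s + t))\<bar> <= hkB d lam z s*err lam t"
proof -
 obtain D1 D2 B where D1: "D1 = hk z s" and D2: "D2 = - z/s*hk z s" and B: "B = hkB d lam z s" by simp
 let ?R = "%v. Phi ((z + f v)/sqrt s) - Phi (z/sqrt s) - D1*f v - D2*(f v)^2/2"
 have s4: "s <= 4" using s by simp
 have B0: "B >= 0" unfolding B by (rule hkB_nonneg[OF d(1) lam])
 have iP: "integrable \<rho> (%v. Phi ((z + f v)/sqrt s))"
  by (rule integrable_bounded[where g="%v. Phi ((z + v)/sqrt s)" and B=1]) (use Phi_bounds in \<open>auto simp: abs_le_iff intro: order_trans[of _ 0]\<close>)
 note ip = integrable_powers
 have iR: "integrable \<rho> ?R" using iP ip by auto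
 have "(LINT v|\<rho>. ?R v) = (LINT v|\<rho>. Phi ((z + f v)/sqrt s)) - Phi (z/sqrt s) - D1*(LINT v|\<rho>. f v) - D2*(LINT v|\<rho>. (f v)^2)/2"
  using iP ip prob_space by simp
 moreover have "\<bar>\<integral>v. ?R v \<partial>\<rho>\<bar> <= B*(exp (lam*y)*(LINT v|\<rho>. (abs (f v)) ^ 3))"
 proof -
  have "\<bar>\<integral>v. ?R v \<partial>\<rho>\<bar> <= (LINT v|\<rho>. \<bar>?R v\<bar>)" by (rule integral_abs_bound)
  also have "... <= (LINT v|\<rho>. B*exp (lam*y)*(abs (f v)) ^ 3)"
  proof (rule integral_mono)
   fix v
   have "\<bar>?R v\<bar> <= B*exp (lam*(abs (f v)))*(abs (f v)) ^ 3" unfolding D1 D2 B by (rule hk_taylor_z[OF d s(1) s4 lam])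
   also have "... <= B*exp (lam*y)*(abs (f v)) ^ 3"
    using f_bound[of v] lam B0 by (intro mult_right_mono mult_left_mono) (auto intro: mult_left_mono)
   finally show "\<bar>?R v\<bar> <= B*exp (lam*y)*(abs (f v)) ^ 3" .
  qed (use iR ip in auto)
  finally show ?thesis using ip by (simp add: mult.assoc)
 qed
 moreover have "\<bar>Phi (z/sqrt (s + t)) - Phi (z/sqrt s) - t*D2/2\<bar> <= B*(exp (lam^2*t/2)*t^2)"
  using hk_taylor_s[OF d s lam, of z] unfolding D2 B by (simp add: mult.assoc)
 moreover have "\<bar>D1*(LINT v|\<rho>. f v)\<bar> <= B*\<bar>\<integral>v. f v \<partial>\<rho>\<bar>"
  using hk_bounds(1)[OF d s(1) s4 lam, of z] unfolding D1[symmetric] B[symmetric] by (simp only: abs_mult) (rule mult_right_mono, simp_all)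
 moreover have "\<bar>D2*((LINT v|\<rho>. (f v)^2) - t)\<bar> <= B*\<bar>(LINT v|\<rho>. (f v)^2) - t\<bar>"
  using hk_bounds(2)[OF d s(1) s4 lam, of z] unfolding D2[symmetric] B[symmetric] by (subst abs_mult) (rule mult_right_mono, simp_all)
 moreover have "D2*((LINT v|\<rho>. (f v)^2) - t) = D2*(LINT v|\<rho>. (f v)^2) - t*D2" by (simp add: algebra_simps)
 moreover have "B*err lam t = B*\<bar>\<integral>v. f v \<partial>\<rho>\<bar> + B*\<bar>(LINT v|\<rho>. (f v)^2) - t\<bar>
   + B*(exp (lam*y)*(LINT v|\<rho>. (abs (f v)) ^ 3)) + B*(exp (lam^2*t/2)*t^2)"
  unfolding err_def by (simp only: distrib_left)
 ultimately show ?thesis unfolding B[symmetric] by linarith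
qed

text \<open>The same \<open>err\<close> controls the moment generating function, because each power
  of lam up to the third is at most (1 + lam)^3. Hence a single small quantity has to be estimated
  later.\<close>

lemma mgf_bound:
 assumes lam: "lam >= 0" and t: "t >= 0"
 shows "integrable \<rho> (%v. exp (lam*f v))" "(LINT v|\<rho>. exp (lam*f v)) <= exp (lam^2*t/2 + (1 + lam) ^ 3*err lam t)"
proof -
 show i: "integrable \<rho> (%v. exp (lam*f v))"
  by (rule integrable_bounded[where g="%v. exp (lam * v)" and B="exp (lam*y)"]) (use lam in \<open>auto intro!: mult_left_mono\<close>)
 note ip = integrable_powers
 let ?m1 = "\<integral>v. f v \<partial>\<rho>" and ?m2 = "\<integral>v. (f v)^2 \<partial>\<rho>" and ?m3 = "\<integral>v. (abs (f v)) ^ 3 \<partial>\<rho>"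
 have m3: "?m3 >= 0" by (rule Bochner_Integration.integral_nonneg) simp
 have "(LINT v|\<rho>. exp (lam*f v)) <= (LINT v|\<rho>. 1 + lam*f v + lam^2/2*(f v)^2 + lam ^ 3*exp (lam*y)*(abs (f v)) ^ 3)"
 proof (rule integral_mono[OF i])
  fix v
  have "exp (lam*f v) <= 1 + lam*f v + (lam*f v)^2/2 + exp \<bar>lam*f v\<bar>*\<bar>lam*f v\<bar> ^ 3" by (rule exp_le_cubic)
  also have "... <= 1 + lam*f v + (lam*f v)^2/2 + exp (lam*y)*\<bar>lam*f v\<bar> ^ 3"
   using f_bound[of v] lam by (intro add_left_mono mult_right_mono) (auto simp: abs_mult intro!: mult_left_mono)
  also have "... = 1 + lam*f v + lam^2/2*(f v)^2 + lam ^ 3*exp (lam*y)*(abs (f v)) ^ 3"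
   using lam by (simp add: abs_mult power_mult_distrib)
  finally show "exp (lam*f v) <= 1 + lam*f v + lam^2/2*(f v)^2 + lam ^ 3*exp (lam*y)*(abs (f v)) ^ 3" .
 qed (use ip in auto)
 also have "... = 1 + lam*?m1 + lam^2/2*?m2 + lam ^ 3*(exp (lam*y)*?m3)"
  using ip prob_space by simp
 also have "... <= 1 + (lam^2*t/2 + (1 + lam) ^ 3*err lam t)"
 proof -
  let ?L = "(1 + lam) ^ 3"
  have L: "lam <= ?L" "lam^2/2 <= ?L" "lam ^ 3 <= ?L" "0 <= ?L"
  proof -
   have e: "?L = 1 + 3*lam + 3*lam^2 + lam ^ 3" by (simp add: power2_eq_square power3_eq_cube algebra_simps)
   have n: "0 <= lam^2" "0 <= lam ^ 3" using lam by auto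
   show "lam <= ?L" "lam^2/2 <= ?L" "lam ^ 3 <= ?L" "0 <= ?L" unfolding e using n lam by linarith+
  qed
  have "lam*?m1 <= lam*\<bar>?m1\<bar>" using lam by (intro mult_left_mono) auto
  also have "... <= ?L*\<bar>?m1\<bar>" using L by (intro mult_right_mono) auto
  finally have 1: "lam*?m1 <= ?L*\<bar>?m1\<bar>" .
  have "lam^2/2*(?m2 - t) <= lam^2/2*\<bar>?m2 - t\<bar>" by (intro mult_left_mono) auto
  also have "... <= ?L*\<bar>?m2 - t\<bar>" using L by (intro mult_right_mono) auto
  finally have 2: "lam^2/2*?m2 <= lam^2*t/2 + ?L*\<bar>?m2 - t\<bar>" by (simp add: algebra_simps)
  have 3: "lam ^ 3*(exp (lam*y)*?m3) <= ?L*(exp (lam*y)*?m3)" using L m3 by (intro mult_right_mono) auto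
  have 4: "0 <= ?L*(exp (lam^2*t/2)*t^2)" using L by simp
  have "?L*err lam t = ?L*\<bar>?m1\<bar> + ?L*\<bar>?m2 - t\<bar> + ?L*(exp (lam*y)*?m3) + ?L*(exp (lam^2*t/2)*t^2)"
   unfolding err_def by (simp only: distrib_left)
  then show ?thesis using 1 2 3 4 by linarith
 qed
 also have "... <= exp (lam^2*t/2 + (1 + lam) ^ 3*err lam t)" by (rule exp_ge_add_one_self)
 finally show "(LINT v|\<rho>. exp (lam*f v)) <= exp (lam^2*t/2 + (1 + lam) ^ 3*err lam t)" .
qed

end

context iid_sequence
begin

lemma expectation_pair_xi:
 fixes g :: "real \<times> real => real"
 assumes j: "j \<notin> I" and W: "W \<in> borel_measurable (field_of I)" and g: "g \<in> borel_measurable (borel \<Otimes>\<^sub>M borel)"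
  and int: "integrable M (%om. g (W om, \<xi> j om))"
 shows "integrable M (%om. \<integral>v. g (W om, v) \<partial>\<nu>)" "(LINT om|M. g (W om, \<xi> j om)) = (\<integral>om. (LINT v|\<nu>. g (W om, v)) \<partial>M)"
proof -
 interpret Q: prob_space \<nu> by (rule prob_space_nu)
 have W': "W \<in> borel_measurable M" using W by (rule field_of_measurable)
 interpret P: prob_space "distr M borel W" using W' by (rule prob_space_distr)
 interpret PQ: pair_sigma_finite "distr M borel W" \<nu> by unfold_locales
 note [measurable] = W' g
 have eq: "distr M borel W \<Otimes>\<^sub>M \<nu> = distr M (borel \<Otimes>\<^sub>M borel) (%om. (W om, \<xi> j om))"
  using distr_field_of_pair[of I "{j}" W borel "\<xi> j" borel] j W by (simp add: xi_field_of distr_xi)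
 have pm: "(%om. (W om, \<xi> j om)) \<in> measurable M (borel \<Otimes>\<^sub>M borel)" by measurable
 have i: "integrable (distr M borel W \<Otimes>\<^sub>M \<nu>) g" unfolding eq using int by (subst integrable_distr_eq[OF pm g])
 have gm: "(%x. \<integral>v. g (x, v) \<partial>\<nu>) \<in> borel_measurable borel" by measurable
 show "integrable M (%om. \<integral>v. g (W om, v) \<partial>\<nu>)"
  using PQ.integrable_fst'[OF i] by (subst (asm) integrable_distr_eq[OF W' gm])
 have "(LINT om|M. g (W om, \<xi> j om)) = (\<integral>x. g x \<partial>(distr M borel W \<Otimes>\<^sub>M \<nu>))"
  unfolding eq by (subst integral_distr[OF pm g]) simp
 also have "... = (\<integral>x. (LINT v|\<nu>. g (x, v)) \<partial>distr M borel W)" using PQ.integral_fst'[OF i] by simp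
 also have "... = (\<integral>om. (LINT v|\<nu>. g (W om, v)) \<partial>M)" by (rule integral_distr[OF W' gm])
 finally show "(LINT om|M. g (W om, \<xi> j om)) = (\<integral>om. (LINT v|\<nu>. g (W om, v)) \<partial>M)" .
qed

text \<open>Summands are exchanged one at a time, and every exchange costs \<open>err\<close> times
  a heat kernel bound that contains exp(lam*S_k). Its mean is controlled by the moment generating
  functions of the earlier summands, so the total error carries exp(-lam*x + lam^2/2 (d^2 +
  \<Sum>t)), the size of the normal tail when lam is near x.\<close>

lemma lindeberg_sum:
 fixes f :: "nat => real => real" and t :: "nat => real" and h :: "nat => int"
 assumes h: "inj h" and fm: "!!k. f k \<in> borel_measurable borel" and fb: "!!k v. (abs (f k v)) <= y"
  and d: "0 < d" "d <= 1" and lam: "lam >= 0" and t: "!!k. t k >= 0" "d^2 + (\<Sum>k<N. t k) <= 4"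
  and \<eta>: "(\<Sum>k<N. bounded_summand.err \<nu> (f k) y lam (t k)) <= \<eta>"
 shows "\<bar>(LINT om|M. Phi (((\<Sum>k<N. f k (\<xi> (h k) om)) - x)/d)) - Phi (- x/sqrt (d^2 + (\<Sum>k<N. t k)))\<bar>
  <= 1944/d ^ 4*(1 + lam) ^ 3*exp (- lam*x + lam^2*(d^2 + (\<Sum>k<N. t k))/2 + (1 + lam) ^ 3*\<eta>)*\<eta>"
proof -
 interpret Q: prob_space \<nu> by (rule prob_space_nu)
 have bs: "bounded_summand \<nu> (f k) y" for k by unfold_locales (use fm fb in auto)
 define e where "e k = bounded_summand.err \<nu> (f k) y lam (t k)" for k
 have e0: "e k >= 0" for k unfolding e_def by (rule bounded_summand.err_nonneg[OF bs])
 define S where "S k om = (\<Sum>i<k. f i (\<xi> (h i) om))" for k om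
 \<comment> \<open>The variance of the Gaussian part at stage \<open>k\<close>: the smoothing
   \<open>d^2\<close> and the summands from index \<open>k\<close> on. At \<open>k = 0\<close>
   everything is Gaussian, at \<open>k = N\<close> only the smoothing is.\<close>
 define s where "s k = d^2 + (\<Sum>i\<in>{k..<N}. t i)" for k
 have Sf: "S k \<in> borel_measurable (field_of (h ` {..<k}))" for k
  unfolding S_def[abs_def] by (intro borel_measurable_sum measurable_compose[OF xi_field_of fm]) auto
 have Sm: "S k \<in> borel_measurable M" for k by (rule field_of_measurable[OF Sf])
 have nin: "h k \<notin> h ` {..<k}" for k using h by (auto dest: injD)
 have SS: "S (Suc k) om = S k om + f k (\<xi> (h k) om)" for k om by (simp add: S_def)
 have sk: "s k = s (Suc k) + t k" if "k < N" for k using that by (simp add: s_def sum.atLeast_Suc_lessThan)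
 have s_le: "s k <= d^2 + (\<Sum>k<N. t k)" "d^2 <= s k" for k
  unfolding s_def using t(1) by (auto intro!: sum_mono2 sum_nonneg)
 have Sb: "(abs (S k om)) <= real k*y" for k om
  unfolding S_def by (rule order_trans[OF sum_abs]) (use sum_bounded_above[of "{..<k}" "%i. \<bar>f i (\<xi> (h i) om)\<bar>" y] fb in simp)
 have iexp: "integrable M (%om. exp (lam * S k om))" for k
 proof (rule integrable_const_bound[where B="exp (lam*(real k*y))"])
  show "AE om in M. norm (exp (lam * S k om)) <= exp (lam*(real k*y))"
   by (rule AE_I2) (use Sb[of k] lam in \<open>auto intro!: mult_left_mono simp: abs_le_iff\<close>)
  show "(%om. exp (lam * S k om)) \<in> borel_measurable M" using Sm[of k] by measurable
 qed
 have mgf: "(LINT om|M. exp (lam * S k om)) <= exp (lam^2*(\<Sum>i<k. t i)/2 + (1 + lam) ^ 3*(\<Sum>i<k. e i))" for k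
 proof (induction k)
  case (Suc k)
  let ?g = "%p. exp (lam*(fst p + f k (snd p)))"
  have fk: "f k \<in> borel_measurable borel" by (rule fm)
  have gm: "?g \<in> borel_measurable (borel \<Otimes>\<^sub>M borel)" using fk by measurable
  have "(LINT om|M. exp (lam * S (Suc k) om)) = (\<integral>om. (LINT v|\<nu>. ?g (S k om, v)) \<partial>M)"
   using expectation_pair_xi(2)[OF nin Sf gm] iexp[of "Suc k"] by (simp add: SS)
  also have "... = (\<integral>om. exp (lam * S k om)*(LINT v|\<nu>. exp (lam*f k v)) \<partial>M)"
   by (simp add: distrib_left exp_add)
  also have "... = (LINT om|M. exp (lam * S k om))*(LINT v|\<nu>. exp (lam*f k v))" by simp
  also have "... <= exp (lam^2*(\<Sum>i<k. t i)/2 + (1 + lam) ^ 3*(\<Sum>i<k. e i))*exp (lam^2*t k/2 + (1 + lam) ^ 3*e k)"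
   using bounded_summand.mgf_bound(2)[OF bs lam t(1), of k k] Suc
   by (intro mult_mono Bochner_Integration.integral_nonneg) (auto simp: e_def)
  also have "... = exp (lam^2*(\<Sum>i<Suc k. t i)/2 + (1 + lam) ^ 3*(\<Sum>i<Suc k. e i))"
   by (simp add: mult_exp_exp algebra_simps add_divide_distrib)
  finally show ?case .
 qed (simp add: S_def prob_space)
 define C where "C = 1944/d ^ 4*(1 + lam) ^ 3*exp (- lam*x + lam^2*(d^2 + (\<Sum>k<N. t k))/2 + (1 + lam) ^ 3*\<eta>)"
 have C0: "C >= 0" using d lam by (simp add: C_def)
 define a where "a k = (LINT om|M. Phi ((S k om - x)/sqrt (s k)))" for k
 have step: "\<bar>a (Suc k) - a k\<bar> <= C*e k" if k: "k < N" for k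
 proof -
  let ?g = "%p. Phi ((fst p - x + f k (snd p))/sqrt (s (Suc k)))"
  have fk: "f k \<in> borel_measurable borel" by (rule fm)
  have gm: "?g \<in> borel_measurable (borel \<Otimes>\<^sub>M borel)" using fk by measurable
  have Pb: "(abs (Phi u)) <= 1" for u using Phi_bounds[of u] by simp
  have i1: "integrable M (%om. ?g (S k om, \<xi> (h k) om))"
  proof (rule integrable_const_bound[where B=1])
   show "(%om. ?g (S k om, \<xi> (h k) om)) \<in> borel_measurable M"
    by (rule measurable_compose[OF _ gm]) (use Sm[of k] in measurable)
  qed (use Pb in auto)
  note ep = expectation_pair_xi[OF nin Sf gm i1]
  have i2: "integrable M (%om. Phi ((S k om - x)/sqrt (s k)))"
  proof (rule integrable_const_bound[where B=1])
   show "(%om. Phi ((S k om - x)/sqrt (s k))) \<in> borel_measurable M" using Sm[of k] by measurable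
  qed (use Pb in auto)
  have iB: "integrable M (%om. hkB d lam (S k om - x) (s (Suc k)))"
  proof -
   have "hkB d lam (S k om - x) (s (Suc k)) = 1944/d ^ 4*(1 + lam) ^ 3*exp (- lam*x + lam^2 * s (Suc k)/2)*exp (lam * S k om)" for om
    unfolding hkB_def mult.assoc mult_exp_exp by (simp add: algebra_simps)
   then show ?thesis using iexp[of k] by simp
  qed
  have aS: "a (Suc k) = (\<integral>om. (LINT v|\<nu>. ?g (S k om, v)) \<partial>M)"
   unfolding ep(2)[symmetric] by (simp add: a_def SS algebra_simps)
  have "\<bar>a (Suc k) - a k\<bar> = \<bar>\<integral>om. (LINT v|\<nu>. ?g (S k om, v)) - Phi ((S k om - x)/sqrt (s k)) \<partial>M\<bar>"
   unfolding aS unfolding a_def by (subst Bochner_Integration.integral_diff[OF ep(1) i2]) simp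
  also have "... <= (\<integral>om. \<bar>(LINT v|\<nu>. ?g (S k om, v)) - Phi ((S k om - x)/sqrt (s k))\<bar> \<partial>M)" by (rule integral_abs_bound)
  also have "... <= (LINT om|M. hkB d lam (S k om - x) (s (Suc k))*e k)"
  proof (rule integral_mono)
   show "integrable M (%om. \<bar>(LINT v|\<nu>. ?g (S k om, v)) - Phi ((S k om - x)/sqrt (s k))\<bar>)"
    by (rule integrable_abs[OF Bochner_Integration.integrable_diff[OF ep(1) i2]])
   show "integrable M (%om. hkB d lam (S k om - x) (s (Suc k))*e k)" using iB by (rule integrable_mult_left)
   fix om
   have st: "s (Suc k) + t k <= 4" using sk[OF k] s_le(1)[of k] t(2) by linarith
   show "\<bar>(LINT v|\<nu>. ?g (S k om, v)) - Phi ((S k om - x)/sqrt (s k))\<bar> <= hkB d lam (S k om - x) (s (Suc k))*e k"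
    using bounded_summand.heat_step[OF bs[of k] d s_le(2)[of "Suc k"] t(1)[of k] st lam, where z="S k om - x"] unfolding sk[OF k] e_def by simp
  qed
  also have "... = 1944/d ^ 4*(1 + lam) ^ 3*exp (- lam*x + lam^2 * s (Suc k)/2)*(LINT om|M. exp (lam * S k om))*e k"
  proof -
   have "hkB d lam (S k om - x) (s (Suc k))*e k = (1944/d ^ 4*(1 + lam) ^ 3*exp (- lam*x + lam^2 * s (Suc k)/2)*e k)*exp (lam * S k om)" for om
   proof -
    have "exp (lam*(S k om - x) + lam^2 * s (Suc k)/2) = exp (- lam*x + lam^2 * s (Suc k)/2)*exp (lam * S k om)"
     unfolding mult_exp_exp by (simp add: algebra_simps)
    then show ?thesis unfolding hkB_def by (simp only: mult_ac)
   qed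
   then have fe: "(%om. hkB d lam (S k om - x) (s (Suc k))*e k) = (%om. (1944/d ^ 4*(1 + lam) ^ 3*exp (- lam*x + lam^2 * s (Suc k)/2)*e k)*exp (lam * S k om))"
    by (rule ext)
   show ?thesis unfolding fe integral_mult_right_zero by (simp only: mult_ac)
  qed
  also have "... <= 1944/d ^ 4*(1 + lam) ^ 3*exp (- lam*x + lam^2 * s (Suc k)/2)*exp (lam^2*(\<Sum>i<k. t i)/2 + (1 + lam) ^ 3*\<eta>)*e k"
  proof (intro mult_right_mono mult_left_mono e0)
   have "(\<Sum>i<k. e i) <= (\<Sum>i<N. e i)" using k e0 by (intro sum_mono2) auto
   then have "(1 + lam) ^ 3*(\<Sum>i<k. e i) <= (1 + lam) ^ 3*\<eta>" using \<eta> lam by (intro mult_left_mono) (auto simp: e_def)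
   then show "(LINT om|M. exp (lam * S k om)) <= exp (lam^2*(\<Sum>i<k. t i)/2 + (1 + lam) ^ 3*\<eta>)"
    using mgf[of k] by (meson add_left_mono exp_le_cancel_iff order_trans)
  qed (use d lam in auto)
  also have "... <= C*e k"
  proof (rule mult_right_mono[OF _ e0])
   have "s (Suc k) + (\<Sum>i<k. t i) <= d^2 + (\<Sum>k<N. t k)"
   proof -
    have "(\<Sum>i\<in>{Suc k..<N}. t i) + (\<Sum>i<k. t i) = (\<Sum>i\<in>{Suc k..<N} \<union> {..<k}. t i)" by (subst sum.union_disjoint) auto
    also have "... <= (\<Sum>k<N. t k)" using k t(1) by (intro sum_mono2) auto
    finally show ?thesis by (simp add: s_def)
   qed
   then have "lam^2*(s (Suc k) + (\<Sum>i<k. t i))/2 <= lam^2*(d^2 + (\<Sum>k<N. t k))/2" by (intro divide_right_mono mult_left_mono) auto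
   then have "(- lam*x + lam^2 * s (Suc k)/2) + (lam^2*(\<Sum>i<k. t i)/2 + (1 + lam) ^ 3*\<eta>) <= - lam*x + lam^2*(d^2 + (\<Sum>k<N. t k))/2 + (1 + lam) ^ 3*\<eta>"
    by (simp add: distrib_left add_divide_distrib)
   then show "1944/d ^ 4*(1 + lam) ^ 3*exp (- lam*x + lam^2 * s (Suc k)/2)*exp (lam^2*(\<Sum>i<k. t i)/2 + (1 + lam) ^ 3*\<eta>) <= C"
    unfolding C_def mult.assoc mult_exp_exp using d lam by (intro mult_left_mono) auto
  qed
  finally show ?thesis .
 qed
 \<comment> \<open>The exchanges telescope from the pure normal law to the smoothed actual
   sum.\<close>
 have "\<bar>a N - a 0\<bar> = \<bar>\<Sum>k<N. a (Suc k) - a k\<bar>" by (simp add: sum_lessThan_telescope)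
 also have "... <= (\<Sum>k<N. C*e k)" by (rule order_trans[OF sum_abs]) (intro sum_mono step, simp)
 also have "... = C*(\<Sum>k<N. e k)" by (simp add: sum_distrib_left)
 also have "... <= C*\<eta>" using \<eta> C0 by (intro mult_left_mono) (auto simp: e_def)
 finally have "\<bar>a N - a 0\<bar> <= C*\<eta>" .
 moreover have "a 0 = Phi (- x/sqrt (d^2 + (\<Sum>k<N. t k)))" by (simp add: a_def S_def s_def prob_space lessThan_atLeast0)
 moreover have "a N = (LINT om|M. Phi (((\<Sum>k<N. f k (\<xi> (h k) om)) - x)/d))" using d by (simp add: a_def S_def s_def)
 ultimately show ?thesis by (simp add: C_def)
qed

end

section \<open>Truncation and the uniform estimate of the tail\<close>

context iid_sequence
begin

definition trunc :: "real => real => real => real" where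
 "trunc y w v = (if \<bar>w * v\<bar> <= y then w * v else 0)"

lemma trunc_measurable[measurable]: "trunc y w \<in> borel_measurable borel"
 unfolding trunc_def[abs_def] by measurable

lemma trunc_bound: "y >= 0 ==> (abs (trunc y w v)) <= y"
 by (simp add: trunc_def)

text \<open>Since y >= 1, truncation moves the first two moments by at most E|wv|^p. The exponent s
  = min p 3 is the best available in the third moment: |wv|^3 <= y^{3-s} |wv|^s below the level y.
  All terms carry w^2 e^{s-2}, which can be summed over the weights.\<close>

lemma trunc_err:
 fixes p y w e lam :: real
 assumes p: "p > 2" "integrable \<nu> (%v. (abs v) powr p)" and y: "y >= 1" and w: "(abs w) <= e" and e: "0 < e" "e <= 1"
  and lam: "lam >= 0" "lam^2*e^2 * s2 <= 2"
 defines "Mp \<equiv> \<integral>v. (abs v) powr p \<partial>\<nu>" and "s \<equiv> min p 3"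
 shows "bounded_summand.err \<nu> (trunc y w) y lam (w^2 * s2) <= w^2*(e powr (s - 2)*(y*exp (lam*y)*(3*Mp + 1 + 3 * s2^2)))"
proof -
 interpret Q: prob_space \<nu> by (rule prob_space_nu)
 interpret B: bounded_summand \<nu> "trunc y w" y by unfold_locales (use y in \<open>auto simp: trunc_bound\<close>)
 have s: "2 < s" "s <= 3" "s <= p" using p by (auto simp: s_def)
 have Mp0: "Mp >= 0" unfolding Mp_def by (rule Bochner_Integration.integral_nonneg) simp
 have iw: "integrable \<nu> (%v. \<bar>w * v\<bar> powr p)" "(LINT v|\<nu>. \<bar>w * v\<bar> powr p) = (abs w) powr p*Mp"
  using p by (auto simp: abs_mult powr_mult Mp_def)
 have big: "\<bar>w * v\<bar> <= \<bar>w * v\<bar> powr p" "(w * v)^2 <= \<bar>w * v\<bar> powr p" if "\<bar>w * v\<bar> > y" for v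
 proof -
  have gen: "u <= u powr p" "u^2 <= u powr p" if "u >= 1" for u :: real
  proof -
   have "u powr 1 <= u powr p" by (rule powr_mono) (use that p in auto)
   moreover have "u powr 2 <= u powr p" by (rule powr_mono) (use that p in auto)
   ultimately show "u <= u powr p" "u^2 <= u powr p" using that by simp_all
  qed
  have 1: "1 <= \<bar>w * v\<bar>" using that y by linarith
  show "\<bar>w * v\<bar> <= \<bar>w * v\<bar> powr p" by (rule gen(1)[OF 1])
  show "(w * v)^2 <= \<bar>w * v\<bar> powr p" using gen(2)[OF 1] by (simp only: power2_abs)
 qed
 note ip = B.integrable_powers
 have i1: "integrable \<nu> (%v. w * v)" "(LINT v|\<nu>. w * v) = 0" using nu_moments(1,2) by simp_all
 have i2: "integrable \<nu> (%v. (w * v)^2)" "(LINT v|\<nu>. (w * v)^2) = w^2 * s2" using nu_moments(3,4) by (simp_all add: power_mult_distrib)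
 have m1: "\<bar>\<integral>v. trunc y w v \<partial>\<nu>\<bar> <= (abs w) powr p*Mp"
 proof -
  have "(LINT v|\<nu>. trunc y w v) = (LINT v|\<nu>. trunc y w v - w * v)" using ip i1 by simp
  also have "\<bar>...\<bar> <= (LINT v|\<nu>. \<bar>trunc y w v - w * v\<bar>)" by (rule integral_abs_bound)
  also have "... <= (LINT v|\<nu>. \<bar>w * v\<bar> powr p)"
   by (rule integral_mono) (use ip i1 iw big(1) in \<open>auto simp: trunc_def\<close>)
  finally show ?thesis using iw by simp
 qed
 have m2: "\<bar>(LINT v|\<nu>. (trunc y w v)^2) - w^2 * s2\<bar> <= (abs w) powr p*Mp"
 proof -
  have "(LINT v|\<nu>. (trunc y w v)^2) - w^2 * s2 = (LINT v|\<nu>. (trunc y w v)^2 - (w * v)^2)"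
   unfolding i2(2)[symmetric] using ip(2) i2(1) by simp
  also have "\<bar>...\<bar> <= (LINT v|\<nu>. \<bar>(trunc y w v)^2 - (w * v)^2\<bar>)" by (rule integral_abs_bound)
  also have "... <= (LINT v|\<nu>. \<bar>w * v\<bar> powr p)"
  proof (rule integral_mono)
   show "integrable \<nu> (%v. \<bar>(trunc y w v)^2 - (w * v)^2\<bar>)" by (rule integrable_abs[OF Bochner_Integration.integrable_diff[OF ip(2) i2(1)]])
   show "\<bar>(trunc y w v)^2 - (w * v)^2\<bar> <= \<bar>w * v\<bar> powr p" for v using big(2)[of v] by (simp add: trunc_def)
  qed (rule iw)
  finally show ?thesis using iw by simp
 qed
 have is3: "integrable \<nu> (%v. y*(abs w) powr s*(1 + (abs v) powr p))" using p by simp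
 have m3: "(LINT v|\<nu>. (abs (trunc y w v)) ^ 3) <= y*(abs w) powr s*(1 + Mp)"
 proof -
  have "(LINT v|\<nu>. (abs (trunc y w v)) ^ 3) <= (LINT v|\<nu>. y*(abs w) powr s*(1 + (abs v) powr p))"
  proof (rule integral_mono[OF ip(3) is3])
   fix v
   show "(abs (trunc y w v)) ^ 3 <= y*(abs w) powr s*(1 + (abs v) powr p)"
   proof (cases "w * v = 0 \<or> \<bar>w * v\<bar> > y")
    case True
    then show ?thesis using y by (auto simp: trunc_def)
   next
    case False
    then have nz: "\<bar>w * v\<bar> > 0" and le: "\<bar>w * v\<bar> <= y" by auto
    have "(abs (trunc y w v)) ^ 3 = \<bar>w * v\<bar> powr (3 - s)*\<bar>w * v\<bar> powr s"
     using nz le by (simp add: trunc_def powr_add[symmetric] powr_numeral del: abs_mult zero_less_abs_iff)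
    also have "... <= y*((abs w) powr s*(1 + (abs v) powr p))"
    proof (rule mult_mono)
     have "\<bar>w * v\<bar> powr (3 - s) <= y powr (3 - s)" using le s by (intro powr_mono2) auto
     also have "... <= y powr 1" using y s by (intro powr_mono) auto
     finally show "\<bar>w * v\<bar> powr (3 - s) <= y" using y by simp
     have "(abs v) powr s <= 1 + (abs v) powr p"
     proof (cases "(abs v) <= 1")
      case True
      then have "(abs v) powr s <= 1 powr s" using s by (intro powr_mono2) auto
      then show ?thesis by (simp add: add_increasing2)
     next
      case False
      then have "(abs v) powr s <= (abs v) powr p" using s by (intro powr_mono) auto
      then show ?thesis by simp
     qed
     then show "\<bar>w * v\<bar> powr s <= (abs w) powr s*(1 + (abs v) powr p)"
      by (simp add: abs_mult powr_mult mult_left_mono)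
    qed (use y in auto)
    finally show ?thesis by (simp only: mult_ac)
   qed
  qed
  also have "... = y*(abs w) powr s*(1 + Mp)" using p Q.prob_space by (simp add: Mp_def)
  finally show ?thesis .
 qed
 have ws: "(abs w) powr s <= w^2*e powr (s - 2)"
 proof (cases "w = 0")
  case False
  have "(abs w) powr s = (abs w) powr 2*(abs w) powr (s - 2)" by (simp only: powr_add[symmetric]) simp
  also have "... <= w^2*e powr (s - 2)" using False w s by (auto simp: powr_numeral intro!: mult_left_mono powr_mono2)
  finally show ?thesis .
 qed simp
 have wp: "(abs w) powr p <= (abs w) powr s" using w e s by (intro powr_mono') auto
 have w4: "(w^2 * s2)^2 <= w^2*e powr (s - 2) * s2^2"
 proof -
  have "w^2 <= e^2" using w e abs_le_square_iff[of w e] by simp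
  also have "e^2 = e powr 2" using e by (simp add: powr_numeral)
  also have "... <= e powr (s - 2)" using e s by (intro powr_mono') auto
  finally have "w^2 * s2^2*w^2 <= w^2 * s2^2*e powr (s - 2)" by (intro mult_left_mono) auto
  then show ?thesis by (simp add: power_mult_distrib power2_eq_square mult_ac)
 qed
 have "lam^2*(w^2 * s2)/2 <= 1"
 proof -
  have "lam^2*(w^2 * s2) <= lam^2*(e^2 * s2)"
   using w e s2_pos abs_le_square_iff[of w e] by (intro mult_left_mono mult_right_mono) auto
  then show ?thesis using lam(2) by (simp add: mult.assoc)
 qed
 then have "exp (lam^2*(w^2 * s2)/2) <= exp 1" by simp
 then have ex: "exp (lam^2*(w^2 * s2)/2) <= 3" using exp_le by linarith
 define W where "W = w^2*e powr (s - 2)"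
 define Y where "Y = y*exp (lam*y)"
 have W0: "W >= 0" by (simp add: W_def)
 have "exp (lam*y) >= 1" using lam y by simp
 from mult_mono[OF y this] have Y1: "Y >= 1" using y by (simp add: Y_def)
 have "B.err lam (w^2 * s2) <= W*Mp + W*Mp + exp (lam*y)*(y*W*(1 + Mp)) + 3*(W * s2^2)"
  unfolding B.err_def
 proof (intro add_mono)
  have "(abs w) powr p*Mp <= W*Mp" unfolding W_def using wp ws Mp0 by (intro mult_right_mono) auto
  then show "\<bar>\<integral>v. trunc y w v \<partial>\<nu>\<bar> <= W*Mp" "\<bar>(LINT v|\<nu>. (trunc y w v)^2) - w^2 * s2\<bar> <= W*Mp"
   using m1 m2 by linarith+
  have "y*(abs w) powr s*(1 + Mp) <= y*W*(1 + Mp)" unfolding W_def using ws y Mp0 by (intro mult_right_mono mult_left_mono) auto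
  then show "exp (lam*y)*(LINT v|\<nu>. (abs (trunc y w v)) ^ 3) <= exp (lam*y)*(y*W*(1 + Mp))"
   using m3 by (intro mult_left_mono) auto
  show "exp (lam^2*(w^2 * s2)/2)*(w^2 * s2)^2 <= 3*(W * s2^2)"
   using ex w4 by (intro mult_mono) (auto simp: W_def)
 qed
 also have "... = W*(2*Mp + 3 * s2^2)*1 + W*(1 + Mp)*Y" by (simp add: Y_def algebra_simps)
 also have "... <= W*(2*Mp + 3 * s2^2)*Y + W*(1 + Mp)*Y"
  using Y1 W0 Mp0 by (intro add_right_mono mult_left_mono) auto
 also have "... = w^2*(e powr (s - 2)*(y*exp (lam*y)*(3*Mp + 1 + 3 * s2^2)))"
  by (simp add: W_def Y_def algebra_simps)
 finally show ?thesis .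
qed

text \<open>All errors are relative to 1 - Phi x. The four terms come from moving threshold and
  variance in the normal tail, from the Lindeberg replacement, from the smoothing, and from
  truncation. The tilt lam = max x 0 matches a positive threshold; there is none for negative
  x.\<close>

lemma md_bound:
 fixes p y e x d \<delta> :: real and N :: nat and w :: "nat => real" and h :: "nat => int"
 assumes p: "p > 2" "integrable \<nu> (%v. (abs v) powr p)" and y: "y >= 1" and h: "inj h"
  and w: "!!k. (abs (w k)) <= e" and e: "0 < e" "e <= 1"
 defines "Mp \<equiv> \<integral>v. (abs v) powr p \<partial>\<nu>" and "s \<equiv> min p 3" and "lam \<equiv> max x 0"
  and "Vn \<equiv> s2*(\<Sum>k<N. (w k)^2)"
 defines "\<eta> \<equiv> 2/s2*(e powr (s - 2)*(y*exp (lam*y)*(3*Mp + 1 + 3 * s2^2)))"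
 defines "\<Delta> \<equiv> d\<^sup>2 + \<bar>Vn - 1\<bar>"
 defines "\<gamma> \<equiv> 2*\<delta> + 2*(abs x)*\<Delta>"
 assumes lam2: "lam^2*e^2 * s2 <= 2" and d: "0 < d" "d <= 1" and Del: "\<Delta> <= 1/2" "lam^2*\<Delta> <= 2"
  and \<delta>: "\<delta> > 0" "lam*\<delta> <= 1" and eta: "(1 + lam) ^ 3*\<eta> <= 1" and gam: "\<gamma>*(1 + lam) <= 1"
 shows "\<bar>prob {om\<in>space M. x <= (\<Sum>k<N. w k*\<xi> (h k) om)} - (1 - Phi x)\<bar>
  <= (45*(\<gamma>*(1 + lam)) + 15*(1 + lam)*(1944/d ^ 4*(1 + lam) ^ 3*27*\<eta>)
    + 45*(1 + lam)*exp (lam^2/2 - \<delta>/d)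
    + 15*(1 + lam)*exp (lam^2/2)*(2/s2*Mp*e powr (p - 2)*y powr (- p)))*(1 - Phi x)"
proof -
 interpret Q: prob_space \<nu> by (rule prob_space_nu)
 define S where "S om = (\<Sum>k<N. w k*\<xi> (h k) om)" for om
 define T where "T om = (\<Sum>k<N. trunc y (w k) (\<xi> (h k) om))" for om
 have Sm[measurable]: "S \<in> borel_measurable M" unfolding S_def[abs_def] by measurable
 have Tm[measurable]: "T \<in> borel_measurable M" unfolding T_def[abs_def] by measurable
 have lam: "lam >= 0" "lam*x = lam^2" by (auto simp: lam_def power2_eq_square max_def)
 have Mp0: "Mp >= 0" unfolding Mp_def by (rule Bochner_Integration.integral_nonneg) simp
 have V: "\<bar>Vn - 1\<bar> <= \<Delta>" "d^2 <= \<Delta>" "\<Delta> >= 0" by (auto simp: \<Delta>_def)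
 have W2: "(\<Sum>k<N. (w k)^2) <= 2/s2" using V Del(1) s2_pos by (auto simp: Vn_def field_simps)
 have tsum: "(\<Sum>k<N. (w k)^2 * s2) = Vn" by (simp add: Vn_def sum_distrib_left mult.commute)
 define q where "q = 2/s2*Mp*e powr (p - 2)*y powr (- p)"
 define g where "g = 1 - Phi x"
 define LB where "LB = exp (- lam\<^sup>2/2)/(15*(1 + lam))"
 have LB: "0 < LB" "LB <= g" using lam Phi_tail_ge[of x] by (auto simp: LB_def g_def lam_def)
 \<comment> \<open>Errors of size exp(-lam^2/2) become relative ones through the lower bound of the
   normal tail, at the price 15(1 + lam).\<close>
 have toLB: "A*exp (- lam\<^sup>2/2) <= 15*(1 + lam)*A*g" if "A >= 0" for A
 proof -
  have "A*exp (- lam\<^sup>2/2) = 15*(1 + lam)*A*LB" using lam by (simp add: LB_def)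
  also have "... <= 15*(1 + lam)*A*g" using LB that lam by (intro mult_left_mono) auto
  finally show ?thesis .
 qed
 have Q: "prob {om\<in>space M. S om \<noteq> T om} <= q"
 proof -
  have "prob {om\<in>space M. S om \<noteq> T om} <= prob (\<Union>k\<in>{..<N}. {om\<in>space M. \<bar>w k*\<xi> (h k) om\<bar> powr p >= y powr p})"
  proof (rule finite_measure_mono)
   show "{om\<in>space M. S om \<noteq> T om} \<subseteq> (\<Union>k\<in>{..<N}. {om\<in>space M. \<bar>w k*\<xi> (h k) om\<bar> powr p >= y powr p})"
   proof
    fix om assume om: "om \<in> {om\<in>space M. S om \<noteq> T om}"
    have "\<exists>k<N. w k*\<xi> (h k) om \<noteq> trunc y (w k) (\<xi> (h k) om)"
    proof (rule ccontr)
     assume "\<not> ?thesis"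
     then have "S om = T om" unfolding S_def T_def by (intro sum.cong) auto
     then show False using om by simp
    qed
    then obtain k where k: "k < N" "\<bar>w k*\<xi> (h k) om\<bar> > y" by (auto simp: trunc_def split: if_splits)
    then have "y powr p <= \<bar>w k*\<xi> (h k) om\<bar> powr p" using y p by (intro powr_mono2) auto
    then show "om \<in> (\<Union>k\<in>{..<N}. {om\<in>space M. \<bar>w k*\<xi> (h k) om\<bar> powr p >= y powr p})" using k om by auto
   qed
  qed measurable
  also have "... <= (\<Sum>k<N. prob {om\<in>space M. \<bar>w k*\<xi> (h k) om\<bar> powr p >= y powr p})"
   by (rule finite_measure_subadditive_finite) (simp, rule image_subsetI, measurable)
  also have "... <= (\<Sum>k<N. (w k)^2*e powr (p - 2)*Mp*y powr (- p))"
  proof (rule sum_mono)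
   fix k
   have bm: "(%v. \<bar>w k * v\<bar> powr p) \<in> borel_measurable borel" by measurable
   have iw: "integrable \<nu> (%v. \<bar>w k * v\<bar> powr p)" "(LINT v|\<nu>. \<bar>w k * v\<bar> powr p) = (abs (w k)) powr p*Mp"
    using p by (auto simp: abs_mult powr_mult Mp_def)
   have "prob {om\<in>space M. \<bar>w k*\<xi> (h k) om\<bar> powr p >= y powr p} <= (LINT om|M. \<bar>w k*\<xi> (h k) om\<bar> powr p)/y powr p"
    using integrable_xi_iff(1)[OF bm, THEN iffD2, OF iw(1), of "h k"] y
    by (intro integral_Markov_inequality_measure[where A="space M"]) auto
   also have "... = (abs (w k)) powr p*Mp*y powr (- p)"
    unfolding integrable_xi_iff(2)[OF bm] iw(2) by (simp add: powr_minus divide_inverse)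
   also have "... <= (w k)^2*e powr (p - 2)*Mp*y powr (- p)"
   proof (intro mult_right_mono Mp0)
    show "(abs (w k)) powr p <= (w k)^2*e powr (p - 2)"
    proof (cases "w k = 0")
     case False
     have "(abs (w k)) powr p = (abs (w k)) powr 2*(abs (w k)) powr (p - 2)" by (simp only: powr_add[symmetric]) simp
     also have "... <= (w k)^2*e powr (p - 2)" using False w p by (auto simp: powr_numeral intro!: mult_left_mono powr_mono2)
     finally show ?thesis .
    qed simp
   qed simp
   finally show "prob {om\<in>space M. \<bar>w k*\<xi> (h k) om\<bar> powr p >= y powr p} <= (w k)^2*e powr (p - 2)*Mp*y powr (- p)" .
  qed
  also have "... = (\<Sum>k<N. (w k)^2)*(e powr (p - 2)*Mp*y powr (- p))" by (simp add: sum_distrib_right mult.assoc)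
  also have "... <= 2/s2*(e powr (p - 2)*Mp*y powr (- p))" using W2 Mp0 by (intro mult_right_mono) auto
  finally show ?thesis by (simp add: q_def mult_ac)
 qed
 have eta_sum: "(\<Sum>k<N. bounded_summand.err \<nu> (trunc y (w k)) y lam ((w k)^2 * s2)) <= \<eta>"
 proof -
  let ?c = "e powr (s - 2)*(y*exp (lam*y)*(3*Mp + 1 + 3 * s2^2))"
  have "(\<Sum>k<N. bounded_summand.err \<nu> (trunc y (w k)) y lam ((w k)^2 * s2)) <= (\<Sum>k<N. (w k)^2*?c)"
   unfolding s_def Mp_def by (intro sum_mono trunc_err p y w e lam lam2)
  also have "... = (\<Sum>k<N. (w k)^2)*?c" by (simp add: sum_distrib_right)
  also have "... <= \<eta>" unfolding \<eta>_def using W2 y Mp0 by (intro mult_right_mono) auto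
  finally show ?thesis .
 qed
 have eta0: "\<eta> >= 0" unfolding \<eta>_def using s2_pos y Mp0 by (intro mult_nonneg_nonneg) auto
 define E where "E = 1944/d ^ 4*(1 + lam) ^ 3*27*\<eta>"
 have E0: "E >= 0" unfolding E_def using d lam eta0 by simp
 have lind: "\<bar>(LINT om|M. Phi ((T om - x')/d)) - Phi (- x'/sqrt (d^2 + Vn))\<bar> <= E*exp (- lam\<^sup>2/2)"
  if x': "\<bar>x' - x\<bar> <= \<delta>" for x'
 proof -
  have "\<bar>(LINT om|M. Phi ((T om - x')/d)) - Phi (- x'/sqrt (d^2 + Vn))\<bar>
   <= 1944/d ^ 4*(1 + lam) ^ 3*exp (- lam*x' + lam^2*(d^2 + Vn)/2 + (1 + lam) ^ 3*\<eta>)*\<eta>"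
   unfolding T_def tsum[symmetric]
  proof (rule lindeberg_sum[OF h _ _ d lam(1) _ _ eta_sum])
   show "d^2 + (\<Sum>k<N. (w k)^2 * s2) <= 4" unfolding tsum using V Del(1) by linarith
  qed (use y s2_pos in \<open>auto simp: trunc_bound\<close>)
  \<comment> \<open>Three corrections of the exponent are at most 1 each: the moved threshold, the
    defect of the variance and the moment generating function. Hence e^3 <= 27.\<close>
  also have "... <= 1944/d ^ 4*(1 + lam) ^ 3*(27*exp (- lam\<^sup>2/2))*\<eta>"
  proof (intro mult_right_mono[OF mult_left_mono eta0])
   have "- lam*x' <= - lam\<^sup>2 + 1"
   proof -
    have "lam*(x - x') <= lam*\<delta>" using x' lam by (intro mult_left_mono) auto
    then show ?thesis using \<delta> lam(2) by (simp add: algebra_simps)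
   qed
   moreover have "lam^2*(d^2 + Vn)/2 <= lam^2/2 + 1"
   proof -
    have "lam^2*(d^2 + (Vn - 1)) <= lam^2*\<Delta>" unfolding \<Delta>_def by (intro mult_left_mono) auto
    then show ?thesis using Del(2) by (simp add: algebra_simps)
   qed
   ultimately have "- lam*x' + lam^2*(d^2 + Vn)/2 + (1 + lam) ^ 3*\<eta> <= 3 + - lam\<^sup>2/2" using eta by simp
   then have "exp (- lam*x' + lam^2*(d^2 + Vn)/2 + (1 + lam) ^ 3*\<eta>) <= exp 3*exp (- lam\<^sup>2/2)"
    unfolding mult_exp_exp by simp
   also have "... <= 27*exp (- lam\<^sup>2/2)"
   proof (rule mult_right_mono)
    have "exp (real 3*1) = exp (1::real) ^ 3" by (rule exp_of_nat_mult)
    also have "... <= 3 ^ 3" using exp_le by (intro power_mono) auto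
    finally show "exp (3::real) <= 27" by simp
   qed simp
   finally show "exp (- lam*x' + lam^2*(d^2 + Vn)/2 + (1 + lam) ^ 3*\<eta>) <= 27*exp (- lam\<^sup>2/2)" .
  qed (use d lam in auto)
  finally show ?thesis by (simp add: E_def mult_ac)
 qed
 have gauss: "\<bar>Phi (- x'/sqrt (d^2 + Vn)) - g\<bar> <= 45*(\<gamma>*(1 + lam))*g" if x': "\<bar>x' - x\<bar> <= \<delta>" for x'
 proof -
  define k where "k = sqrt (d^2 + Vn)"
  have kv2: "\<bar>(d^2 + Vn) - 1\<bar> <= \<Delta>"
   using abs_triangle_ineq[of "d^2" "Vn - 1"] by (simp add: \<Delta>_def)
  have kv: "1/2 <= d^2 + Vn" "\<bar>(d^2 + Vn) - 1\<bar> <= \<Delta>" using kv2 Del(1) by linarith+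
  have k2: "k * k = d^2 + Vn" using kv by (simp add: k_def)
  have "k >= sqrt (1/4)" unfolding k_def by (rule real_sqrt_le_mono) (use kv in linarith)
  then have k: "k >= 1/2" by (simp add: real_sqrt_divide)
  have k1: "\<bar>k - 1\<bar> <= \<Delta>"
  proof -
   have "\<bar>k - 1\<bar>*1 <= \<bar>k - 1\<bar>*(k + 1)" using k by (intro mult_left_mono) auto
   also have "... = \<bar>(k - 1)*(k + 1)\<bar>" using k by (simp add: abs_mult)
   also have "(k - 1)*(k + 1) = k * k - 1" by (simp add: algebra_simps)
   finally show ?thesis using kv(2) k2 by simp
  qed
  have "\<bar>x'/k - x\<bar> = \<bar>(x' - x) + x*(1 - k)\<bar>/k" using k by (simp add: field_simps)
  also have "... <= (\<delta> + (abs x)*\<Delta>)/k"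
  proof (rule divide_right_mono)
   have "\<bar>x*(1 - k)\<bar> <= (abs x)*\<Delta>" using k1 by (simp add: abs_mult abs_minus_commute mult_left_mono)
   then show "\<bar>(x' - x) + x*(1 - k)\<bar> <= \<delta> + (abs x)*\<Delta>" using x' by linarith
  qed (use k in simp)
  also have "... <= (\<delta> + (abs x)*\<Delta>)*2"
  proof -
   have "1/k <= 2" using k by (simp add: field_simps)
   then have "(\<delta> + (abs x)*\<Delta>)*(1/k) <= (\<delta> + (abs x)*\<Delta>)*2" using \<delta> V by (intro mult_left_mono) auto
   then show ?thesis by simp
  qed
  finally have dist: "\<bar>x'/k - x\<bar> <= \<gamma>" by (simp add: \<gamma>_def)
  then have dl: "\<bar>x'/k - x\<bar>*(1 + lam) <= \<gamma>*(1 + lam)" using lam by (intro mult_right_mono) auto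
  have "\<bar>(1 - Phi (x'/k)) - g\<bar> <= 45*(\<bar>x'/k - x\<bar>*(1 + lam))*g"
   unfolding g_def lam_def using dl gam by (intro Phi_tail_shift) (simp add: lam_def)
  also have "... <= 45*(\<gamma>*(1 + lam))*g" by (rule mult_right_mono[OF mult_left_mono[OF dl]]) (use LB in auto)
  finally show ?thesis by (simp add: k_def Phi_minus[symmetric])
 qed
 \<comment> \<open>The indicator of the half line from x lies, up to \<open>tn\<close>, between two
   normal distribution functions of scale d centered at x - \<delta> and x + \<delta>.\<close>
 define tn where "tn = 3*exp (- (\<delta>/d))"
 have iPhi: "integrable M (%om. Phi ((T om - x')/d))" for x'
  by (rule integrable_const_bound[where B=1]) (use Phi_bounds in auto)
 have iT: "integrable M (indicator {om\<in>space M. x <= T om} :: _ => real)" by (rule integrable_real_indicator) (auto simp: less_top[symmetric])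
 have tail: "1 - Phi (u/d) <= tn" if "u >= \<delta>" for u
 proof -
  have "Phi (\<delta>/d) <= Phi (u/d)" using that d by (intro Phi_mono divide_right_mono) auto
  then show ?thesis using Phi_tail_le[of "\<delta>/d"] by (simp add: tn_def)
 qed
 have tn0: "tn >= 0" by (simp add: tn_def)
 have up: "prob {om\<in>space M. x <= T om} <= (LINT om|M. Phi ((T om - (x - \<delta>))/d)) + tn"
 proof -
  have "prob {om\<in>space M. x <= T om} = (LINT om|M. indicator {om\<in>space M. x <= T om} om)" by simp
  also have "... <= (LINT om|M. Phi ((T om - (x - \<delta>))/d) + tn)"
  proof (rule integral_mono[OF iT])
   fix om assume om: "om \<in> space M"
   show "indicator {om\<in>space M. x <= T om} om <= Phi ((T om - (x - \<delta>))/d) + tn"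
    using tail[of "T om - (x - \<delta>)"] Phi_bounds(1)[of "(T om - (x - \<delta>))/d"] tn0 by (auto simp: indicator_def)
  qed (use iPhi in simp)
  also have "... = (LINT om|M. Phi ((T om - (x - \<delta>))/d)) + tn" using iPhi prob_space by simp
  finally show ?thesis .
 qed
 have down: "prob {om\<in>space M. x <= T om} >= (LINT om|M. Phi ((T om - (x + \<delta>))/d)) - tn"
 proof -
  have "(LINT om|M. Phi ((T om - (x + \<delta>))/d)) - tn = (LINT om|M. Phi ((T om - (x + \<delta>))/d) - tn)" using iPhi prob_space by simp
  also have "... <= (LINT om|M. indicator {om\<in>space M. x <= T om} om)"
  proof (rule integral_mono[OF _ iT])
   fix om assume om: "om \<in> space M"
   show "Phi ((T om - (x + \<delta>))/d) - tn <= indicator {om\<in>space M. x <= T om} om"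
   proof (cases "x <= T om")
    case True then show ?thesis using om Phi_bounds(2)[of "(T om - (x + \<delta>))/d"] tn0 by simp
   next
    case False
    then have "1 - Phi ((x + \<delta> - T om)/d) <= tn" by (intro tail) simp
    then have "Phi (- ((x + \<delta> - T om)/d)) <= tn" by (simp only: Phi_minus)
    moreover have "- ((x + \<delta> - T om)/d) = (T om - (x + \<delta>))/d" by (simp add: minus_divide_left)
    ultimately show ?thesis using False by simp
   qed
  qed (use iPhi in simp)
  finally show ?thesis by simp
 qed
 have ST: "\<bar>prob {om\<in>space M. x <= S om} - prob {om\<in>space M. x <= T om}\<bar> <= q"
 proof -
  have "prob {om\<in>space M. x <= S om} <= prob ({om\<in>space M. x <= T om} \<union> {om\<in>space M. S om \<noteq> T om})"
   "prob {om\<in>space M. x <= T om} <= prob ({om\<in>space M. x <= S om} \<union> {om\<in>space M. S om \<noteq> T om})"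
   by (intro finite_measure_mono; force)+
  moreover have "prob ({om\<in>space M. x <= T om} \<union> {om\<in>space M. S om \<noteq> T om}) <= prob {om\<in>space M. x <= T om} + prob {om\<in>space M. S om \<noteq> T om}"
   "prob ({om\<in>space M. x <= S om} \<union> {om\<in>space M. S om \<noteq> T om}) <= prob {om\<in>space M. x <= S om} + prob {om\<in>space M. S om \<noteq> T om}"
   by (intro measure_Un_le; measurable)+
  ultimately show ?thesis using Q by linarith
 qed
 have q0: "q >= 0" using s2_pos Mp0 by (simp add: q_def)
 have pq: "q <= 15*(1 + lam)*(q*exp (lam^2/2))*g"
  using toLB[of "q*exp (lam^2/2)"] q0 by (simp add: mult_exp_exp mult.assoc)
 have pt: "tn <= 15*(1 + lam)*(tn*exp (lam^2/2))*g"
  using toLB[of "tn*exp (lam^2/2)"] tn0 by (simp add: mult_exp_exp mult.assoc)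
 have pE: "E*exp (- lam\<^sup>2/2) <= 15*(1 + lam)*E*g" by (rule toLB[OF E0])
 have "\<bar>prob {om\<in>space M. x <= S om} - g\<bar> <= q + tn + E*exp (- lam\<^sup>2/2) + 45*(\<gamma>*(1 + lam))*g"
  using ST up down lind[of "x - \<delta>"] lind[of "x + \<delta>"] gauss[of "x - \<delta>"] gauss[of "x + \<delta>"] \<delta>(1) by (simp add: abs_le_iff)
 also have "... <= 15*(1 + lam)*(q*exp (lam^2/2))*g + 15*(1 + lam)*(tn*exp (lam^2/2))*g + 15*(1 + lam)*E*g + 45*(\<gamma>*(1 + lam))*g"
  by (intro add_mono pq pt pE order_refl)
 also have "... = (45*(\<gamma>*(1 + lam)) + 15*(1 + lam)*E + 45*(1 + lam)*(exp (lam^2/2)*exp (- (\<delta>/d))) + 15*(1 + lam)*exp (lam^2/2)*q)*g"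
  by (simp add: tn_def algebra_simps)
 also have "exp (lam^2/2)*exp (- (\<delta>/d)) = exp (lam^2/2 - \<delta>/d)" by (simp only: mult_exp_exp) simp
 finally show ?thesis by (simp only: S_def g_def E_def q_def)
qed

text \<open>The range x^2 <= c ln n + 1 leaves room for a later shift of the threshold by 1/ln n,
  and one sequence R serves every x in it. Weights of order n^{-1/2} are the only trace of the
  dependence structure.\<close>

lemma moderate_deviation:
 fixes p c D :: real and N :: "nat => nat" and w :: "nat => nat => real" and h :: "nat => nat => int"
 assumes p: "p > 2" "integrable \<nu> (%v. (abs v) powr p)" and c: "0 <= c" "c <= p - 2" and D: "D > 0"
  and h: "!!n. inj (h n)"
  and w: "\<forall>\<^sub>F n in sequentially. (\<forall>k. (abs (w n k)) <= D/sqrt (real n)) & \<bar>s2*(\<Sum>k<N n. (w n k)^2) - 1\<bar> <= 1/real n"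
 shows "\<exists>R. R \<longlonglongrightarrow> 0 & (\<forall>\<^sub>F n in sequentially. \<forall>x. x^2 <= c*ln (real n) + 1 \<longrightarrow>
  \<bar>prob {om\<in>space M. x <= (\<Sum>k<N n. w n k*\<xi> (h n k) om)} - (1 - Phi x)\<bar> <= R n*(1 - Phi x))"
proof -
 define Mp where "Mp = (LINT v|\<nu>. (abs v) powr p)"
 have Mp0: "Mp >= 0" unfolding Mp_def by (rule Bochner_Integration.integral_nonneg) simp
 define s where "s = min p 3"
 have s: "s > 2" "s <= 3" using p by (auto simp: s_def)
 define b where "b = sqrt (c + 1)"
 have b: "b >= 1" "b*b = c + 1" using c by (auto simp: b_def)
 \<comment> \<open>With thresholds at most b sqrt(ln n) and truncation at \<epsilon> sqrt(ln n), the
   factor exp(lam*y) is at most n^{(s-2)/8}, against a gain of order n^{-(s-2)/2} from the weights;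
   \<open>g\<close> is the power left over.\<close>
 define \<epsilon> where "\<epsilon> = (s - 2)/(8*b)"
 have eps: "\<epsilon> > 0" "b*\<epsilon> = (s - 2)/8" using s b by (auto simp: \<epsilon>_def)
 define g where "g = 3*(s - 2)/8"
 have g: "g > 0" using s by (simp add: g_def)
 define C1 where "C1 = 2/s2*(D powr (s - 2)*(\<epsilon>*(3*Mp + 1 + 3 * s2^2)))"
 have C1: "C1 > 0" using s2_pos D eps Mp0 unfolding C1_def by (intro mult_pos_pos) (auto simp: add_pos_nonneg add_nonneg_pos)
 define C2 where "C2 = 2/s2*Mp*D powr (p - 2)*exp (1/2)"
 have C2: "C2 >= 0" using s2_pos Mp0 by (simp add: C2_def)
 define L where "L n = ln (real n)" for n :: nat
 define La where "La n = b * sqrt (L n)" for n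
 define et where "et n = C1*(L n*real n powr (- g))" for n
 \<comment> \<open>The margin is 1/ln n and the smoothing scale (ln n)^{-3}. Their ratio gives
   exp(-(ln n)^2), far below the tail, while both remain negligible after multiplication by
   thresholds of order sqrt(ln n).\<close>
 define ga where "ga n = 2/L n + 2*La n*((1/L n ^ 3)^2 + 1/real n)" for n
 define R1 where "R1 n = 45*(ga n*(1 + La n))" for n
 define R2 where "R2 n = 15*(1 + La n)*(1944/(1/L n ^ 3) ^ 4*(1 + La n) ^ 3*27*et n)" for n
 define R3 where "R3 n = 45*(1 + La n)*exp ((La n)^2/2 - 1/L n/(1/L n ^ 3))" for n
 define R4 where "R4 n = 15*(1 + La n)*(C2*(\<epsilon> * sqrt (L n)) powr (- p))" for n
 have "R1 \<longlonglongrightarrow> 0" unfolding R1_def ga_def La_def L_def using b by real_asymp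
 moreover have "R2 \<longlonglongrightarrow> 0"
 proof -
  have "(%n. (1 + b * sqrt (ln (real n))) ^ 4*(ln (real n)*real n powr (- g))*ln (real n) ^ 12) \<longlonglongrightarrow> 0"
   using b g by real_asymp
  then have "(%n. (15*1944*27*C1)*((1 + b * sqrt (ln (real n))) ^ 4*(ln (real n)*real n powr (- g))*ln (real n) ^ 12)) \<longlonglongrightarrow> (15*1944*27*C1)*0"
   by (rule tendsto_mult_left)
  also have "(%n. (15*1944*27*C1)*((1 + b * sqrt (ln (real n))) ^ 4*(ln (real n)*real n powr (- g))*ln (real n) ^ 12)) = R2"
  proof
   fix n
   have a1: "(1944::real)/(1/L n ^ 3) ^ 4 = 1944*L n ^ 12" by (simp add: power_one_over power_mult[symmetric])
   have a2: "(1 + La n)*(1 + La n) ^ 3 = (1 + La n) ^ 4" by (simp add: power_Suc[symmetric])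
   have "R2 n = 15*1944*27*C1*(((1 + La n)*(1 + La n) ^ 3)*(L n*real n powr (- g))*L n ^ 12)"
    unfolding R2_def et_def a1 by (simp only: mult_ac)
   then have "R2 n = 15*1944*27*C1*((1 + La n) ^ 4*(L n*real n powr (- g))*L n ^ 12)" by (simp only: a2)
   then show "(15*1944*27*C1)*((1 + b * sqrt (ln (real n))) ^ 4*(ln (real n)*real n powr (- g))*ln (real n) ^ 12) = R2 n"
    by (simp only: La_def L_def)
  qed
  finally show ?thesis by simp
 qed
 moreover have "R3 \<longlonglongrightarrow> 0"
 proof -
  have "(%n. 45*(1 + b * sqrt (ln (real n)))*exp ((b * sqrt (ln (real n)))^2/2 - 1/ln (real n)/(1/ln (real n) ^ 3))) \<longlonglongrightarrow> 0"
   using b by real_asymp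
  then show ?thesis unfolding R3_def La_def L_def .
 qed
 moreover have "R4 \<longlonglongrightarrow> 0"
 proof -
  have "(%n. 15*(1 + b * sqrt (ln (real n)))*(\<epsilon> * sqrt (ln (real n))) powr (- p)) \<longlonglongrightarrow> 0"
   using b p eps by real_asymp
  then have "(%n. C2*(15*(1 + b * sqrt (ln (real n)))*(\<epsilon> * sqrt (ln (real n))) powr (- p))) \<longlonglongrightarrow> C2*0" by (rule tendsto_mult_left)
  then show ?thesis unfolding R4_def La_def L_def by (simp add: mult_ac)
 qed
 ultimately have R: "(%n. R1 n + R2 n + R3 n + R4 n) \<longlonglongrightarrow> 0 + 0 + 0 + 0" by (intro tendsto_add)
 have ev_c: "\<forall>\<^sub>F n in sequentially. L n >= 1 & \<epsilon> * sqrt (L n) >= 1 & D/sqrt (real n) <= 1 &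
   (La n)^2*(D/sqrt (real n))^2 * s2 <= 2 & (1/L n ^ 3)^2 + 1/real n <= 1/2 &
   (La n)^2*((1/L n ^ 3)^2 + 1/real n) <= 2 & La n*(1/L n) <= 1 & (1 + La n) ^ 3*et n <= 1 & ga n*(1 + La n) <= 1"
 proof (intro eventually_conj)
  show "\<forall>\<^sub>F n in sequentially. L n >= 1" unfolding L_def by real_asymp
  show "\<forall>\<^sub>F n in sequentially. \<epsilon> * sqrt (L n) >= 1" unfolding L_def using eps by real_asymp
  show "\<forall>\<^sub>F n in sequentially. D/sqrt (real n) <= 1" using D by real_asymp
  show "\<forall>\<^sub>F n in sequentially. (La n)^2*(D/sqrt (real n))^2 * s2 <= 2"
  proof -
   have "(%n. (La n)^2*(D/sqrt (real n))^2) \<longlonglongrightarrow> 0" unfolding La_def L_def using D b(1) by real_asymp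
   from tendsto_mult_right[OF this, of s2] have "(%n. (La n)^2*(D/sqrt (real n))^2 * s2) \<longlonglongrightarrow> 0" by simp
   from order_tendstoD(2)[OF this, of 2] show ?thesis by (auto elim: eventually_mono)
  qed
  show "\<forall>\<^sub>F n in sequentially. (1/L n ^ 3)^2 + 1/real n <= 1/2" unfolding L_def by real_asymp
  show "\<forall>\<^sub>F n in sequentially. (La n)^2*((1/L n ^ 3)^2 + 1/real n) <= 2" unfolding La_def L_def using b by real_asymp
  show "\<forall>\<^sub>F n in sequentially. La n*(1/L n) <= 1" unfolding La_def L_def using b by real_asymp
  show "\<forall>\<^sub>F n in sequentially. (1 + La n) ^ 3*et n <= 1" unfolding La_def L_def et_def using b g C1 by real_asymp
  show "\<forall>\<^sub>F n in sequentially. ga n*(1 + La n) <= 1" unfolding La_def L_def ga_def using b by real_asymp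
 qed
 show ?thesis
 proof (intro exI[of _ "%n. R1 n + R2 n + R3 n + R4 n"] conjI)
  show "(%n. R1 n + R2 n + R3 n + R4 n) \<longlonglongrightarrow> 0" using R by simp
  show "\<forall>\<^sub>F n in sequentially. \<forall>x. x^2 <= c*ln (real n) + 1 \<longrightarrow>
   \<bar>prob {om\<in>space M. x <= (\<Sum>k<N n. w n k*\<xi> (h n k) om)} - (1 - Phi x)\<bar> <= (R1 n + R2 n + R3 n + R4 n)*(1 - Phi x)"
   using ev_c w eventually_ge_at_top[of 2]
  proof eventually_elim
   case (elim n)
   define e where "e = D/sqrt (real n)"
   define Vn where "Vn = s2*(\<Sum>k<N n. (w n k)^2)"
   define y where "y = \<epsilon> * sqrt (L n)"
   define d where "d = 1/L n ^ 3"
   define \<delta> where "\<delta> = 1/L n"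
   define \<Delta> where "\<Delta> = d^2 + \<bar>Vn - 1\<bar>"
   from elim have L1: "L n >= 1" and y1: "y >= 1" and e1: "e <= 1" and wl: "!!k. (abs (w n k)) <= e" and n2: "n >= 2"
    by (auto simp: y_def e_def)
   have e0: "e > 0" using D n2 by (simp add: e_def)
   have d: "0 < d" "d <= 1" using L1 by (auto simp: d_def)
   have \<delta>0: "\<delta> > 0" using L1 by (simp add: \<delta>_def)
   have Dl: "\<Delta> <= (1/L n ^ 3)^2 + 1/real n" "\<Delta> >= 0" using elim by (auto simp: \<Delta>_def Vn_def d_def)
   have La0: "La n >= 0" using b L1 by (simp add: La_def)
   have ga0: "ga n >= 0" using L1 La0 by (simp add: ga_def)
   show ?case
   proof (intro allI impI)
    fix x :: real assume x: "x^2 <= c*ln (real n) + 1"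
    define lam where "lam = max x 0"
    have La2: "(La n)^2 = (c + 1)*L n" using b L1 by (simp add: La_def power_mult_distrib power2_eq_square[of b])
    have xl: "(abs x) <= La n"
    proof (rule power2_le_imp_le[OF _ La0])
     have "x^2 <= (La n)^2" unfolding La2 using x L1 by (simp add: L_def[symmetric] algebra_simps)
     then show "(abs x)^2 <= (La n)^2" by simp
    qed
    have lam: "0 <= lam" "lam <= La n" "lam^2 <= (La n)^2" "lam^2 <= x^2"
     using xl La0 by (auto simp: lam_def max_def intro!: power_mono)
    define \<eta> where "\<eta> = 2/s2*(e powr (s - 2)*(y*exp (lam*y)*(3*Mp + 1 + 3 * s2^2)))"
    define \<gamma> where "\<gamma> = 2*\<delta> + 2*(abs x)*\<Delta>"
    have nL: "real n powr a = exp (a*L n)" for a using n2 by (simp add: powr_def L_def)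
    have sq: "sqrt (real n) powr a = exp (a/2*L n)" for a
     using nL[of "a/2"] by (simp add: powr_half_sqrt[symmetric] powr_powr)
    have ee: "e powr a = D powr a*exp (- a/2*L n)" for a
    proof -
     have "e powr a = D powr a/sqrt (real n) powr a" unfolding e_def by (rule powr_divide)
     also have "... = D powr a*exp (- (a/2*L n))" by (simp only: sq divide_inverse exp_minus)
     also have "- (a/2*L n) = - a/2*L n" by simp
     finally show ?thesis .
    qed
    have eta: "\<eta> <= et n"
    proof -
     have "lam*y <= La n*y" using lam y1 by (intro mult_right_mono) auto
     also have "... = (b*\<epsilon>)*(sqrt (L n) * sqrt (L n))" by (simp add: La_def y_def)
     also have "... = (s - 2)/8*L n" using L1 eps by simp
     finally have "exp (lam*y) <= exp ((s - 2)/8*L n)" by simp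
     moreover have "y <= \<epsilon>*L n" unfolding y_def using eps L1 sqrt_le_D[of "L n" "L n"]
      by (intro mult_left_mono real_le_lsqrt) (auto simp: power2_eq_square)
     ultimately have yy: "y*exp (lam*y) <= \<epsilon>*L n*exp ((s - 2)/8*L n)"
      using eps L1 by (intro mult_mono) auto
     have "\<eta> <= 2/s2*(D powr (s - 2)*exp (- (s - 2)/2*L n)*(\<epsilon>*L n*exp ((s - 2)/8*L n)*(3*Mp + 1 + 3 * s2^2)))"
      unfolding \<eta>_def ee[of "s - 2"]
      by (rule mult_left_mono[OF mult_left_mono[OF mult_right_mono[OF yy]]]) (use s2_pos Mp0 in auto)
     also have "... = C1*(L n*(exp (- (s - 2)/2*L n)*exp ((s - 2)/8*L n)))"
      by (simp only: C1_def mult_ac)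
     also have "exp (- (s - 2)/2*L n)*exp ((s - 2)/8*L n) = real n powr (- g)"
      unfolding nL mult_exp_exp g_def by (rule arg_cong[of _ _ exp]) (simp add: field_simps)
     finally show ?thesis by (simp add: et_def)
    qed
    have eta0: "\<eta> >= 0" unfolding \<eta>_def using s2_pos y1 Mp0 by (intro mult_nonneg_nonneg) auto
    have gam: "\<gamma> <= ga n" "\<gamma> >= 0" unfolding \<gamma>_def ga_def \<delta>_def using xl Dl La0 L1
     by (auto intro!: add_mono mult_mono)
    have "\<bar>prob {om\<in>space M. x <= (\<Sum>k<N n. w n k*\<xi> (h n k) om)} - (1 - Phi x)\<bar>
     <= (45*(\<gamma>*(1 + lam)) + 15*(1 + lam)*(1944/d ^ 4*(1 + lam) ^ 3*27*\<eta>)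
      + 45*(1 + lam)*exp (lam^2/2 - \<delta>/d)
      + 15*(1 + lam)*exp (lam^2/2)*(2/s2*Mp*e powr (p - 2)*y powr (- p)))*(1 - Phi x)"
     unfolding \<gamma>_def \<eta>_def \<Delta>_def Vn_def Mp_def lam_def s_def
    proof (rule md_bound[OF p y1 h wl e0 e1])
     have "lam^2*e^2 * s2 <= (La n)^2*e^2 * s2" using lam s2_pos by (intro mult_right_mono) auto
     then show "(max x 0)^2*e^2 * s2 <= 2" using elim by (auto simp: lam_def e_def)
     show "d^2 + \<bar>s2*(\<Sum>k<N n. (w n k)^2) - 1\<bar> <= 1/2" using Dl elim by (auto simp: \<Delta>_def Vn_def)
     have "lam^2*\<Delta> <= (La n)^2*((1/L n ^ 3)^2 + 1/real n)" using lam Dl by (intro mult_mono) auto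
     then show "(max x 0)^2*(d^2 + \<bar>s2*(\<Sum>k<N n. (w n k)^2) - 1\<bar>) <= 2" using elim by (auto simp: \<Delta>_def Vn_def lam_def)
     have "lam*\<delta> <= La n*\<delta>" using lam \<delta>0 by (intro mult_right_mono) auto
     also have "La n*\<delta> <= 1" using elim(1) unfolding \<delta>_def by blast
     finally show "max x 0*\<delta> <= 1" unfolding lam_def .
     have "(1 + lam) ^ 3*\<eta> <= (1 + La n) ^ 3*et n" using lam eta eta0 by (intro mult_mono power_mono) auto
     then show "(1 + max x 0) ^ 3*(2/s2*(e powr (min p 3 - 2)*(y*exp (max x 0*y)*(3*(LINT v|\<nu>. (abs v) powr p) + 1 + 3 * s2^2)))) <= 1"
      using elim by (auto simp: \<eta>_def Mp_def lam_def s_def)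
     have "\<gamma>*(1 + lam) <= ga n*(1 + La n)" using lam gam ga0 by (intro mult_mono) auto
     then show "(2*\<delta> + 2*(abs x)*(d^2 + \<bar>s2*(\<Sum>k<N n. (w n k)^2) - 1\<bar>))*(1 + max x 0) <= 1"
      using elim by (auto simp: \<gamma>_def \<Delta>_def Vn_def lam_def)
    qed (use d \<delta>0 in auto)
    also have "... <= (R1 n + R2 n + R3 n + R4 n)*(1 - Phi x)"
    proof (rule mult_right_mono)
     show "0 <= 1 - Phi x" using Phi_bounds by simp
     show "45*(\<gamma>*(1 + lam)) + 15*(1 + lam)*(1944/d ^ 4*(1 + lam) ^ 3*27*\<eta>)
      + 45*(1 + lam)*exp (lam^2/2 - \<delta>/d)
      + 15*(1 + lam)*exp (lam^2/2)*(2/s2*Mp*e powr (p - 2)*y powr (- p)) <= R1 n + R2 n + R3 n + R4 n"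
     proof (intro add_mono)
      show "45*(\<gamma>*(1 + lam)) <= R1 n" unfolding R1_def using lam gam ga0 by (intro mult_left_mono mult_mono) auto
      show "15*(1 + lam)*(1944/d ^ 4*(1 + lam) ^ 3*27*\<eta>) <= R2 n"
       unfolding R2_def d_def[symmetric] using lam eta eta0 d by (intro mult_mono power_mono mult_nonneg_nonneg order_refl) auto
      show "45*(1 + lam)*exp (lam^2/2 - \<delta>/d) <= R3 n"
       unfolding R3_def d_def[symmetric] \<delta>_def[symmetric] using lam by (intro mult_mono) auto
      \<comment> \<open>The first factor is at most e^{1/2} n^{c/2}, the second of order
        n^{-(p-2)/2}. For c = p - 2 the powers of n cancel, and convergence to 0 comes from
        \<open>y powr (- p)\<close> with y of order sqrt(ln n).\<close>
      have "exp (lam^2/2)*e powr (p - 2) <= D powr (p - 2)*exp (1/2)"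
      proof -
       have "lam^2/2 + - (p - 2)/2*L n <= 1/2"
       proof -
        have "c*L n <= (p - 2)*L n" using c L1 by (intro mult_right_mono) auto
        moreover have "- (p - 2)/2*L n = - ((p - 2)*L n)/2" by (simp only: times_divide_eq_left mult_minus_left)
        ultimately show ?thesis using lam(4) x unfolding L_def[symmetric] by linarith
       qed
       then have le: "exp (lam^2/2)*exp (- (p - 2)/2*L n) <= exp (1/2)" unfolding mult_exp_exp by simp
       have "e powr (p - 2) = D powr (p - 2)*exp (- (p - 2)/2*L n)"
        by (rule ee)
       then have "exp (lam^2/2)*e powr (p - 2) = D powr (p - 2)*(exp (lam^2/2)*exp (- (p - 2)/2*L n))" by (simp only: mult_ac)
       also have "... <= D powr (p - 2)*exp (1/2)" by (intro mult_left_mono le) auto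
       finally show ?thesis .
      qed
      then have "2/s2*Mp*(exp (lam^2/2)*e powr (p - 2)) <= 2/s2*Mp*(D powr (p - 2)*exp (1/2))"
       using s2_pos Mp0 by (intro mult_left_mono) auto
      then have "2/s2*Mp*(exp (lam^2/2)*e powr (p - 2)) <= C2" by (simp only: C2_def mult_ac)
      then have "15*(1 + lam)*(2/s2*Mp*(exp (lam^2/2)*e powr (p - 2))*y powr (- p)) <= 15*(1 + La n)*(C2*y powr (- p))"
       using lam C2 s2_pos Mp0 by (intro mult_mono mult_nonneg_nonneg order_refl) auto
      then show "15*(1 + lam)*exp (lam^2/2)*(2/s2*Mp*e powr (p - 2)*y powr (- p)) <= R4 n"
       unfolding R4_def y_def[symmetric] by (simp only: mult_ac)
     qed
    qed
    finally show "\<bar>prob {om\<in>space M. x <= (\<Sum>k<N n. w n k*\<xi> (h n k) om)} - (1 - Phi x)\<bar> <= (R1 n + R2 n + R3 n + R4 n)*(1 - Phi x)" .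
   qed
  qed
 qed
qed

end

section \<open>Densities and differentiation under the integral\<close>

text \<open>Half-open intervals are a generating \<pi>-system. Exhausting the line shows first that
  the total integral vanishes, which gives closure under complements.\<close>

lemma AE_eq_zero_if_Ioc_integrals:
 fixes h :: "real => real"
 assumes h: "integrable lborel h" and z: "!!u v. u <= v ==> (\<integral>x\<in>{u<..v}. h x \<partial>lborel) = 0"
 shows "AE x in lborel. h x = 0"
proof -
 have hs: "set_integrable lborel A h" if "A \<in> sets borel" for A
  using that h unfolding set_integrable_def by (intro integrable_mult_indicator) auto
 have tot: "(LINT x|lborel. h x) = 0"
 proof -
  have "(%n. \<integral>x. indicator {- real n<..real n} x *\<^sub>R h x \<partial>lborel) \<longlonglongrightarrow> (LINT x|lborel. h x)"
  proof (rule integral_dominated_convergence[where w="%x. (abs (h x))"])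
   show "AE x in lborel. (%n. indicator {- real n<..real n} x *\<^sub>R h x) \<longlonglongrightarrow> h x"
   proof (rule AE_I2)
    fix x :: real
    obtain N :: nat where N: "(abs x) < real N" using reals_Archimedean2 by blast
    have "\<forall>\<^sub>F n in sequentially. indicator {- real n<..real n} x *\<^sub>R h x = h x"
     using eventually_ge_at_top[of N]
    proof eventually_elim
     case (elim n)
     then have "(abs x) < real n" using N by simp
     then show ?case by (auto simp: indicator_def)
    qed
    then show "(%n. indicator {- real n<..real n} x *\<^sub>R h x) \<longlonglongrightarrow> h x" by (rule tendsto_eventually)
   qed
  qed (use h in \<open>auto simp: indicator_def\<close>)
  moreover have "(LINT x|lborel. indicator {- real n<..real n} x *\<^sub>R h x) = 0" for n
   using z[of "- real n" "real n"] by (simp add: set_lebesgue_integral_def)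
  ultimately show ?thesis by (simp add: LIMSEQ_const_iff)
 qed
 have all: "(\<integral>x\<in>A. h x \<partial>lborel) = 0" if "A \<in> sets borel" for A
 proof -
  have "Int_stable (range (%(a, b). {a<..b::real}))" by (auto simp: Int_stable_def)
  moreover have "range (%(a, b). {a<..b::real}) \<subseteq> Pow UNIV" by simp
  moreover have "A \<in> sigma_sets UNIV (range (%(a, b). {a<..b::real}))"
   using that by (simp add: borel_sigma_sets_Ioc)
  ultimately show ?thesis
  proof (induction rule: sigma_sets_induct_disjoint)
   case (basic A)
   then obtain a b where "A = {a<..b}" by auto
   then show ?case using z[of a b] by (cases "a <= b") (auto simp: set_lebesgue_integral_def)
  next
   case (compl A)
   then have A: "A \<in> sets borel" by (simp add: borel_sigma_sets_Ioc)
   have "(LINT x|lborel. h x) = (\<integral>x\<in>A \<union> (UNIV - A). h x \<partial>lborel)" by (simp add: set_lebesgue_integral_def)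
   also have "... = (\<integral>x\<in>A. h x \<partial>lborel) + (\<integral>x\<in>UNIV - A. h x \<partial>lborel)"
    using A by (intro set_integral_Un hs) auto
   finally show ?case using tot compl by simp
  next
   case (union A)
   then have A: "A i \<in> sets borel" for i by (auto simp: borel_sigma_sets_Ioc)
   have "(\<integral>x\<in>(\<Union>i. A i). h x \<partial>lborel) = (\<Sum>i. \<integral>x\<in>A i. h x \<partial>lborel)"
    using A union(1) by (intro lebesgue_integral_countable_add hs) (auto simp: disjoint_family_on_def)
   then show ?case using union by simp
  qed (simp add: set_lebesgue_integral_def)
 qed
 show ?thesis
  using density_unique_real[OF h, of "%_. 0"] all by auto
qed

text \<open>The difference quotient of the kernel in Levy's inversion formula converges pointwise to
  a character; the error is the second order remainder of the exponential.\<close>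

lemma iexp_quotient_approx:
 fixes t a h :: real
 assumes "t \<noteq> 0" "h \<noteq> 0"
 shows "cmod ((iexp (-(t * a)) - iexp (-(t*(a + h))))/(\<i>*t)/h - iexp (-(t * a))) <= (abs t)*(abs h)"
proof -
 let ?u = "- (t*h)"
 have e: "iexp (-(t*(a + h))) = iexp (-(t * a))*iexp ?u"
  by (simp add: exp_add[symmetric] algebra_simps)
 have nz: "\<i>*complex_of_real t \<noteq> 0" "complex_of_real h \<noteq> 0" using assms by auto
 have "(iexp (-(t * a)) - iexp (-(t*(a + h))))/(\<i>*t)/h - iexp (-(t * a))
   = - iexp (-(t * a))*((iexp ?u - (1 + \<i>*?u))/(\<i>*t*h))"
  unfolding e using nz by (simp add: field_simps)
 also have "cmod ... = cmod (iexp ?u - (1 + \<i>*?u))/((abs t)*(abs h))"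
  by (simp add: norm_mult norm_divide)
 also have "... <= \<bar>?u\<bar> ^ 2/((abs t)*(abs h))"
 proof (rule divide_right_mono)
  have "cmod (iexp ?u - (\<Sum>k\<le>1. (\<i>*?u) ^ k/fact k)) <= \<bar>?u\<bar> ^ Suc 1/fact (Suc 1)" by (rule iexp_approx1)
  then have "cmod (iexp ?u - (1 + \<i>*?u)) <= \<bar>?u\<bar> ^ 2/2" by (simp add: numeral_2_eq_2)
  also have "... <= \<bar>?u\<bar> ^ 2" by simp
  finally show "cmod (iexp ?u - (1 + \<i>*?u)) <= \<bar>?u\<bar> ^ 2" .
 qed simp
 also have "... = (abs t)*(abs h)" using assms by (simp add: power2_eq_square abs_mult)
 finally show ?thesis .
qed

text \<open>In Levy's formula the integral now converges absolutely. The resulting bound, linear in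
  the length of the interval, excludes atoms, so the formula holds for all end points and may be
  differentiated. Continuity of the density is kept in the conclusion: it makes the set of
  positivity open.\<close>

theorem (in real_distribution) density_of_integrable_char:
 assumes int: "integrable lborel (char M)"
 shows "\<exists>f. continuous_on UNIV f & (\<forall>x. 0 <= f x) & M = density lborel (%x. ennreal (f x))"
proof -
 define \<phi> where "\<phi> = char M"
 have im: "integrable lborel \<phi>" "integrable lborel (%t. cmod (\<phi> t))" using int by (auto simp: \<phi>_def)
 have pm[measurable]: "\<phi> \<in> borel_measurable borel" using im(1) by simp
 define q where "q a b t = (iexp (-(t * a)) - iexp (-(t*b)))/(\<i>*complex_of_real t)" for a b t :: real
 have qm[measurable]: "(%t. q a b t) \<in> borel_measurable borel" for a b
  unfolding q_def by measurable
 have q_neg: "q a b t = - q b a t" for a b t by (simp add: q_def minus_divide_left)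
 have qb: "cmod (q a b t) <= \<bar>b - a\<bar>" for a b t
 proof -
  have le: "cmod (q a b t) <= b - a" if "a <= b" for a b
  proof (cases "t = 0")
   case True then show ?thesis using that by (simp add: q_def)
  next
   case False
   have "q a b t = (iexp (t*(- a)) - iexp (t*(- b)))/(\<i>*complex_of_real t)" by (simp add: q_def)
   then show ?thesis using Levy_Inversion_aux2[of "-b" "-a" t] that False by simp
  qed
  show ?thesis
  proof (cases "a <= b")
   case False then show ?thesis using le[of b a] by (simp add: q_neg[of a b])
  qed (use le in auto)
 qed
 have iq: "integrable lborel (%t. q a b t*\<phi> t)" for a b
 proof (rule Bochner_Integration.integrable_bound)
  show "integrable lborel (%t. \<bar>b - a\<bar>*cmod (\<phi> t))" using im by simp
  show "AE t in lborel. cmod (q a b t*\<phi> t) <= norm (\<bar>b - a\<bar>*cmod (\<phi> t))"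
   using qb by (intro AE_I2) (auto simp: norm_mult intro!: mult_right_mono)
 qed measurable
 define J where "J a b = Re (1/(2*pi)*(LINT t|lborel. q a b t*\<phi> t))" for a b
 have levy: "prob {a<..b} = J a b" if ab: "a <= b" "prob {a} = 0" "prob {b} = 0" for a b
 proof -
  have "(%n. 1/(2*pi)*(CLBINT t=-real n..real n. q a b t*\<phi> t)) \<longlonglongrightarrow> complex_of_real (prob {a<..b})"
   using Levy_Inversion[OF ab] unfolding q_def \<phi>_def by simp
  moreover have "(%n. 1/(2*pi)*(CLBINT t=-real n..real n. q a b t*\<phi> t)) \<longlonglongrightarrow> 1/(2*pi)*(LINT t|lborel. q a b t*\<phi> t)"
  proof (rule tendsto_mult_left)
   have e: "(CLBINT t=-real n..real n. q a b t*\<phi> t) = (LINT t|lborel. indicator {-real n<..<real n} t *\<^sub>R (q a b t*\<phi> t))" for n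
    by (simp add: interval_lebesgue_integral_def set_lebesgue_integral_def einterval_eq)
   show "(%n. CLBINT t=-real n..real n. q a b t*\<phi> t) \<longlonglongrightarrow> (LINT t|lborel. q a b t*\<phi> t)"
    unfolding e
   proof (rule integral_dominated_convergence[where w="%t. cmod (q a b t*\<phi> t)"])
    show "AE x in lborel. (%n. indicator {- real n<..<real n} x *\<^sub>R (q a b x*\<phi> x)) \<longlonglongrightarrow> q a b x*\<phi> x"
    proof (rule AE_I2)
     fix x :: real
     obtain N :: nat where N: "(abs x) < real N" using reals_Archimedean2 by blast
     have "\<forall>\<^sub>F n in sequentially. indicator {- real n<..<real n} x *\<^sub>R (q a b x*\<phi> x) = q a b x*\<phi> x"
      using eventually_ge_at_top[of N]
     proof eventually_elim
      case (elim n)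
      then have "(abs x) < real n" using N by simp
      then show ?case by (auto simp: indicator_def)
     qed
     then show "(%n. indicator {- real n<..<real n} x *\<^sub>R (q a b x*\<phi> x)) \<longlonglongrightarrow> q a b x*\<phi> x" by (rule tendsto_eventually)
    qed
    show "integrable lborel (%t. cmod (q a b t*\<phi> t))" using iq by (rule integrable_norm)
   qed (auto simp: indicator_def)
  qed
  ultimately have "complex_of_real (prob {a<..b}) = 1/(2*pi)*(LINT t|lborel. q a b t*\<phi> t)" by (rule LIMSEQ_unique)
  then show ?thesis unfolding J_def by (metis Re_complex_of_real)
 qed
 define C where "C = 1/(2*pi)*(LINT t|lborel. cmod (\<phi> t))"
 have Jb: "(abs (J a b)) <= \<bar>b - a\<bar>*C" for a b
 proof -
  have "(abs (J a b)) <= cmod (1/(2*pi)*(LINT t|lborel. q a b t*\<phi> t))" unfolding J_def by (rule abs_Re_le_cmod)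
  also have "... = 1/(2*pi)*cmod (LINT t|lborel. q a b t*\<phi> t)" by (simp add: norm_mult norm_divide)
  also have "cmod (LINT t|lborel. q a b t*\<phi> t) <= (LINT t|lborel. cmod (q a b t*\<phi> t))" by (rule integral_norm_bound)
  also have "... <= (LINT t|lborel. \<bar>b - a\<bar>*cmod (\<phi> t))"
   using im(2) qb by (intro integral_mono integrable_norm[OF iq]) (auto simp: norm_mult intro!: mult_right_mono)
  finally show ?thesis using im by (simp add: C_def mult_ac divide_right_mono)
 qed
 have cont_pt: "\<exists>a\<in>{u<..<v}. prob {a} = 0" if "u < v" for u v
 proof (rule ccontr)
  assume neg: "\<not> ?thesis"
  have "{u<..<v} \<subseteq> {x. prob {x} > 0}"
  proof
   fix a assume "a \<in> {u<..<v}"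
   then have "prob {a} \<noteq> 0" using neg by blast
   then show "a \<in> {x. prob {x} > 0}" using measure_nonneg[of M "{a}"] by (simp add: less_le)
  qed
  then have "countable {u<..<v}" using countable_atoms countable_subset by blast
  then show False using that uncountable_open_interval by blast
 qed
 have atom: "prob {x} = 0" for x
 proof -
  have "prob {x} <= 2*e*C" if e: "e > 0" for e
  proof -
   obtain a b where a: "a \<in> {x - e<..<x}" "prob {a} = 0" and b: "b \<in> {x<..<x+e}" "prob {b} = 0"
    using cont_pt[of "x - e" x] cont_pt[of x "x + e"] e by auto
   have "prob {x} <= prob {a<..b}" using a b by (intro finite_measure_mono) auto
   also have "... = J a b" using a b by (intro levy) auto
   also have "... <= \<bar>b - a\<bar>*C" using Jb[of a b] by simp
   also have "... <= 2*e*C" using a b by (intro mult_right_mono) (auto simp: C_def)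
   finally show ?thesis .
  qed
  then have lim: "prob {x} <= 2*inverse (real (Suc n))*C" for n by simp
  have "(%n. 2*inverse (real (Suc n))*C) \<longlonglongrightarrow> 2*0*C"
   by (intro tendsto_intros LIMSEQ_inverse_real_of_nat)
  from LIMSEQ_le_const[OF this] lim have "prob {x} <= 2*0*C" by blast
  then show ?thesis by (simp add: measure_le_0_iff)
 qed
 have cdfJ: "cdf M b - cdf M a = J a b" for a b
 proof (cases a b rule: linorder_cases)
  case less then show ?thesis using levy[of a b] atom cdf_diff_eq[of a b] by simp
 next
  case equal then show ?thesis by (simp add: J_def q_def)
 next
  case greater
  then have "cdf M a - cdf M b = J b a" using levy[of b a] atom cdf_diff_eq[of b a] by simp
  moreover have "J a b = - J b a" unfolding J_def using q_neg[of a b] by simp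
  ultimately show ?thesis by simp
 qed
 define f where "f a = Re (1/(2*pi)*(LINT t|lborel. iexp (-(t * a))*\<phi> t))" for a
 have ie: "integrable lborel (%t. iexp (-(t * a))*\<phi> t)" for a
 proof (rule Bochner_Integration.integrable_bound[OF im(2)])
  show "AE x in lborel. cmod (iexp (- (x * a))*\<phi> x) <= norm (cmod (\<phi> x))" by (simp add: norm_mult)
 qed measurable
 have der: "(cdf M has_real_derivative f a) (at a)" for a
  unfolding DERIV_def tendsto_at_iff_sequentially
 proof (intro allI impI)
  fix h :: "nat => real" assume h: "\<forall>i. h i \<in> UNIV - {0}" "h \<longlonglongrightarrow> 0"
  have "(%n. \<integral>t. q a (a + h n) t/h n*\<phi> t \<partial>lborel) \<longlonglongrightarrow> (LINT t|lborel. iexp (-(t * a))*\<phi> t)"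
  proof (rule integral_dominated_convergence[where w="%t. cmod (\<phi> t)"])
   show "AE t in lborel. (%n. q a (a + h n) t/h n*\<phi> t) \<longlonglongrightarrow> iexp (-(t * a))*\<phi> t"
   proof (rule AE_mp[OF AE_lborel_singleton[of 0] AE_I2], intro impI tendsto_mult tendsto_const)
    fix t :: real assume t: "t \<noteq> 0"
    show "(%n. q a (a + h n) t/h n) \<longlonglongrightarrow> iexp (-(t * a))"
    proof (rule LIM_zero_cancel, rule Lim_null_comparison)
     show "\<forall>\<^sub>F n in sequentially. cmod (q a (a + h n) t/h n - iexp (-(t * a))) <= (abs t)*(abs (h n))"
     proof (rule always_eventually, rule allI)
      fix n
      have "h n \<noteq> 0" using h(1) by simp
      from iexp_quotient_approx[OF t this, of a] show "cmod (q a (a + h n) t/h n - iexp (-(t * a))) <= (abs t)*(abs (h n))"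
       unfolding q_def .
     qed
     have "(%n. (abs t)*(abs (h n))) \<longlonglongrightarrow> (abs t)*\<bar>0\<bar>" by (intro tendsto_intros h(2))
     then show "(%n. (abs t)*(abs (h n))) \<longlonglongrightarrow> 0" by simp
    qed
   qed
   show "AE t in lborel. cmod (q a (a + h n) t/h n*\<phi> t) <= cmod (\<phi> t)" for n
   proof (rule AE_I2)
    fix t
    have "h n \<noteq> 0" using h(1) by simp
    then have "cmod (q a (a + h n) t/h n) <= 1" using qb[of a "a + h n" t] by (simp add: norm_divide divide_le_eq)
    from mult_right_mono[OF this norm_ge_zero[of "\<phi> t"]] show "cmod (q a (a + h n) t/h n*\<phi> t) <= cmod (\<phi> t)" by (simp only: norm_mult mult_1_left)
   qed
  qed (use im in \<open>simp_all\<close>)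
  then have "(%n. Re (1/(2*pi)*(LINT t|lborel. q a (a + h n) t/h n*\<phi> t))) \<longlonglongrightarrow> f a"
   unfolding f_def by (intro tendsto_Re tendsto_mult_left)
  moreover have "Re (1/(2*pi)*(LINT t|lborel. q a (a + h n) t/h n*\<phi> t)) = (cdf M (a + h n) - cdf M a)/h n" for n
  proof -
   have "(LINT t|lborel. q a (a + h n) t/h n*\<phi> t) = (LINT t|lborel. q a (a + h n) t*\<phi> t)/h n"
    by (simp add: mult.commute mult.assoc flip: integral_divide_zero)
   then have "1/(2*pi)*(LINT t|lborel. q a (a + h n) t/h n*\<phi> t) = (1/(2*pi)*(LINT t|lborel. q a (a + h n) t*\<phi> t))/h n" by simp
   then show ?thesis unfolding cdfJ J_def by (simp only: Re_divide_of_real)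
  qed
  ultimately show "((%h. (cdf M (a + h) - cdf M a)/h) \<circ> h) \<longlonglongrightarrow> f a" by (simp add: comp_def)
 qed
 have fc: "continuous_on UNIV f"
 proof (rule continuous_at_imp_continuous_on, intro ballI continuous_at_sequentiallyI)
  fix a :: real and u assume u: "u \<longlonglongrightarrow> a"
  have "(%n. \<integral>t. iexp (-(t*u n))*\<phi> t \<partial>lborel) \<longlonglongrightarrow> (LINT t|lborel. iexp (-(t * a))*\<phi> t)"
  proof (rule integral_dominated_convergence[where w="%t. cmod (\<phi> t)"])
   show "AE t in lborel. (%n. iexp (-(t*u n))*\<phi> t) \<longlonglongrightarrow> iexp (-(t * a))*\<phi> t"
    by (rule AE_I2) (intro tendsto_intros u)
  qed (use im in \<open>simp_all add: norm_mult\<close>)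
  then show "(%n. f (u n)) \<longlonglongrightarrow> f a" unfolding f_def by (intro tendsto_Re tendsto_mult_left)
 qed
 have f0: "f a >= 0" for a
 proof (rule ccontr)
  assume "\<not> ?thesis"
  then obtain d where d: "d > 0" "!!h. h > 0 ==> h < d ==> cdf M a > cdf M (a + h)"
   using DERIV_neg_dec_right[OF der[of a]] by auto
  from d(2)[of "d/2"] d(1) cdf_nondecreasing[of a "a + d/2"] show False by simp
 qed
 have fm[measurable]: "f \<in> borel_measurable borel" using fc by (rule borel_measurable_continuous_onI)
 have "M = density lborel (%x. ennreal (f x))"
 proof (rule measure_eqI_generator_eq[where \<Omega>=UNIV and E="range (%(a, b). {a<..b::real})" and A="%i. {- real i<..real i}"])
  fix X assume "X \<in> range (%(a, b). {a<..b::real})"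
  then obtain a b where X: "X = {a<..b}" by auto
  show "emeasure M X = emeasure (density lborel (%x. ennreal (f x))) X"
  proof (cases "a <= b")
   case True
   have "emeasure (density lborel (%x. ennreal (f x))) X = (\<integral>\<^sup>+x. ennreal (f x)*indicator {a<..b} x \<partial>lborel)"
    unfolding X by (subst emeasure_density) auto
   also have "... = (\<integral>\<^sup>+x. ennreal (f x)*indicator {a..b} x \<partial>lborel)"
    by (rule nn_integral_cong_AE, rule AE_mp[OF AE_lborel_singleton[of a] AE_I2]) (auto simp: indicator_def)
   also have "... = ennreal (cdf M b - cdf M a)"
    using True der f0 by (intro nn_integral_FTC_Icc) auto
   finally show ?thesis unfolding X using emeasure_Ioc[OF True] by simp
  qed (simp add: X)
 qed (auto simp: M_is_borel borel_sigma_sets_Ioc Int_stable_def UN_Ioc_eq_UNIV emeasure_eq_measure)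
 then show ?thesis using fc f0 by blast
qed

text \<open>Only joint integrability of k' is known, no domination near a given point. On an
  interval where the density is bounded below, that integrability passes to Lebesgue measure; Fubini
  and the fundamental theorem then give both sides the same integral over every subinterval, so they
  agree almost everywhere.\<close>

lemma interchange_derivative_integral:
 fixes k kd kp kpd f :: "real => real" and a :: real and \<nu> :: "real measure"
 assumes nu: "prob_space \<nu>" "sets \<nu> = sets borel"
  and f: "continuous_on UNIV f" "!!x. 0 <= f x"
  and k: "!!x. (k has_real_derivative kd x) (at x)" "continuous_on UNIV kd"
  and kp: "!!x. (kp has_real_derivative kpd x) (at x)" "continuous_on UNIV kpd"
  and kp_eq: "!!w. integrable \<nu> (%y. k (w + a*y))" "!!w. kp w = (LINT y|\<nu>. k (w + a*y))"
  and int: "integrable (density lborel (%x. ennreal (f x)) \<Otimes>\<^sub>M \<nu>) (%(w, y). kd (w + a*y))"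
 shows "AE w in density lborel (%x. ennreal (f x)). kpd w = (LINT y|\<nu>. kd (w + a*y))"
proof -
 interpret N: prob_space \<nu> by fact
 note [measurable_cong] = nu(2)
 have fm[measurable]: "f \<in> borel_measurable borel" using f by (intro borel_measurable_continuous_onI)
 have km[measurable]: "k \<in> borel_measurable borel"
  using k(1) by (intro borel_measurable_continuous_onI continuous_at_imp_continuous_on) (auto intro: DERIV_isCont)
 have kdm[measurable]: "kd \<in> borel_measurable borel" using k by (intro borel_measurable_continuous_onI)
 have kpdm[measurable]: "kpd \<in> borel_measurable borel" using kp by (intro borel_measurable_continuous_onI)
 define G where "G w = (LINT y|\<nu>. kd (w + a*y))" for w
 have Gm[measurable]: "G \<in> borel_measurable borel" unfolding G_def[abs_def] by measurable
 let ?\<mu> = "density lborel (%x. ennreal (f x))"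
 have fin: "(\<integral>\<^sup>+w. ennreal (f w)*(\<integral>\<^sup>+y. ennreal \<bar>kd (w + a*y)\<bar> \<partial>\<nu>) \<partial>lborel) < \<infinity>"
 proof -
  have "(\<integral>\<^sup>+w. ennreal (f w)*(\<integral>\<^sup>+y. ennreal \<bar>kd (w + a*y)\<bar> \<partial>\<nu>) \<partial>lborel) = (\<integral>\<^sup>+w. (\<integral>\<^sup>+y. ennreal \<bar>kd (w + a*y)\<bar> \<partial>\<nu>) \<partial>?\<mu>)"
   by (subst nn_integral_density) measurable
  also have "... = (\<integral>\<^sup>+x. ennreal (norm (case x of (w, y) => kd (w + a*y))) \<partial>(?\<mu> \<Otimes>\<^sub>M \<nu>))"
   by (subst N.nn_integral_fst[symmetric]) auto
  also have "... < \<infinity>" using int by (simp add: integrable_iff_bounded)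
  finally show ?thesis .
 qed
 have local: "AE w in lborel. w \<in> {s..t} \<longrightarrow> kpd w = G w" if pos: "\<forall>w\<in>{s..t}. f w > 0" for s t
 proof (cases "s <= t")
  case st: True
  obtain w0 where w0: "w0 \<in> {s..t}" "!!w. w \<in> {s..t} ==> f w0 <= f w"
   using continuous_attains_inf[of "{s..t}" f] st continuous_on_subset[OF f(1)] by auto
  define e where "e = f w0"
  have e: "e > 0" "!!w. w \<in> {s..t} ==> e <= f w" using w0 pos by (auto simp: e_def)
  let ?g = "%(w, y). indicator {s..t} w * kd (w + a*y)"
  interpret P: pair_sigma_finite lborel \<nu> by unfold_locales
  have ig: "integrable (lborel \<Otimes>\<^sub>M \<nu>) ?g"
  proof (rule integrableI_bounded)
   have "(\<integral>\<^sup>+x. ennreal (norm (?g x)) \<partial>(lborel \<Otimes>\<^sub>M \<nu>)) = (\<integral>\<^sup>+w. (\<integral>\<^sup>+y. ennreal (norm (?g (w, y))) \<partial>\<nu>) \<partial>lborel)"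
    by (subst N.nn_integral_fst[symmetric]) auto
   also have "... <= (\<integral>\<^sup>+w. ennreal (1/e)*(ennreal (f w)*(\<integral>\<^sup>+y. ennreal \<bar>kd (w + a*y)\<bar> \<partial>\<nu>)) \<partial>lborel)"
   proof (rule nn_integral_mono)
    fix w :: real
    show "(\<integral>\<^sup>+y. ennreal (norm (?g (w, y))) \<partial>\<nu>) <= ennreal (1/e)*(ennreal (f w)*(\<integral>\<^sup>+y. ennreal \<bar>kd (w + a*y)\<bar> \<partial>\<nu>))"
    proof (cases "w \<in> {s..t}")
     case True
     have "1 <= ennreal (1/e)*ennreal (f w)"
     proof -
      have "1 <= 1/e*f w" using e(1) e(2)[OF True] by (simp add: field_simps)
      then have "ennreal 1 <= ennreal (1/e*f w)" by (rule ennreal_leI)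
      then show ?thesis using e(1) f(2)[of w] by (simp add: ennreal_mult[symmetric])
     qed
     from mult_right_mono[OF this, of "\<integral>\<^sup>+y. ennreal \<bar>kd (w + a*y)\<bar> \<partial>\<nu>"]
     show ?thesis using True by (simp add: mult.assoc)
    qed simp
   qed
   also have "... = ennreal (1/e)*(\<integral>\<^sup>+w. ennreal (f w)*(\<integral>\<^sup>+y. ennreal \<bar>kd (w + a*y)\<bar> \<partial>\<nu>) \<partial>lborel)"
    by (rule nn_integral_cmult) measurable
   also have "... < \<infinity>" using fin by (simp add: ennreal_mult_less_top)
   finally show "(\<integral>\<^sup>+x. ennreal (norm (?g x)) \<partial>(lborel \<Otimes>\<^sub>M \<nu>)) < \<infinity>" .
  qed measurable
  have iG: "integrable lborel (%w. indicator {s..t} w*G w)"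
   using P.integrable_fst[OF ig] by (simp add: G_def)
  have ik: "integrable lborel (%w. indicator {s..t} w * kpd w)"
   using borel_integrable_atLeastAtMost[of s t kpd] kp(2) by (auto simp: continuous_on_eq_continuous_at mult.commute)
  define h where "h w = indicator {s..t} w * kpd w - indicator {s..t} w*G w" for w
  have ih: "integrable lborel h" unfolding h_def using ik iG by simp
  have zero: "(\<integral>w\<in>{u<..v}. h w \<partial>lborel) = 0" if uv: "u <= v" for u v
  proof -
   define u' v' where "u' = max u s" and "v' = min v t"
   show ?thesis
   proof (cases "u' <= v'")
    case False
    have e: "(%w. indicator {u<..v} w *\<^sub>R h w) = (%w. 0)" using False by (intro ext) (auto simp: u'_def v'_def h_def indicator_def)
    show ?thesis unfolding set_lebesgue_integral_def e by simp
   next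
    \<comment> \<open>Both integrals over the clipped interval from \<open>u'\<close> to
      \<open>v'\<close> equal \<open>kp v' - kp u'\<close>: directly for \<open>kpd\<close>, after
      exchanging the integrals for \<open>G\<close>.\<close>
    case True
    have F1: "(LINT w|lborel. kpd w*indicator {u'..v'} w) = kp v' - kp u'"
     using True kp by (intro integral_FTC_Icc_real) (auto simp: continuous_on_eq_continuous_at)
    have sub: "{u'..v'} \<subseteq> {s..t}" using True by (auto simp: u'_def v'_def)
    let ?g' = "%(w, y). indicator {u'..v'} w * kd (w + a*y)"
    have ig': "integrable (lborel \<Otimes>\<^sub>M \<nu>) ?g'"
    proof (rule Bochner_Integration.integrable_bound[OF ig])
     show "AE x in lborel \<Otimes>\<^sub>M \<nu>. norm (?g' x) <= norm (?g x)"
      using sub by (intro AE_I2) (auto simp: indicator_def)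
    qed measurable
    have "(LINT w|lborel. indicator {u'..v'} w*G w) = (\<integral>w. (LINT y|\<nu>. indicator {u'..v'} w * kd (w + a*y)) \<partial>lborel)"
     by (simp add: G_def)
    also have "... = (\<integral>y. (LINT w|lborel. indicator {u'..v'} w * kd (w + a*y)) \<partial>\<nu>)"
     using P.Fubini_integral[of "%w y. indicator {u'..v'} w * kd (w + a*y)"] ig' by simp
    also have "... = (LINT y|\<nu>. k (v' + a*y) - k (u' + a*y))"
    proof (rule Bochner_Integration.integral_cong[OF refl])
     fix y
     have "(LINT w|lborel. kd (w + a*y)*indicator {u'..v'} w) = k (v' + a*y) - k (u' + a*y)"
     proof (rule integral_FTC_Icc_real[OF True])
      show "((%w. k (w + a*y)) has_real_derivative kd (w + a*y)) (at w)" for w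
      proof -
       have "((%w. w + a*y) has_real_derivative 1) (at w)" by (auto intro!: derivative_eq_intros)
       from DERIV_chain2[OF k(1) this] show ?thesis by simp
      qed
      have "continuous_on UNIV (%w. kd (w + a*y))"
       by (rule continuous_on_compose2[OF k(2)]) (auto intro!: continuous_intros)
      then show "isCont (%w. kd (w + a*y)) w" for w by (simp add: continuous_on_eq_continuous_at)
     qed
     then show "(LINT w|lborel. indicator {u'..v'} w * kd (w + a*y)) = k (v' + a*y) - k (u' + a*y)"
      by (simp add: mult.commute)
    qed
    also have "... = kp v' - kp u'" using kp_eq by simp
    finally have F2: "(LINT w|lborel. indicator {u'..v'} w*G w) = kp v' - kp u'" .
    have iG': "integrable lborel (%w. indicator {u'..v'} w*G w)"
     using P.integrable_fst[OF ig'] by (simp add: G_def)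
    have ik': "integrable lborel (%w. kpd w*indicator {u'..v'} w)"
     using borel_integrable_atLeastAtMost[of u' v' kpd] kp(2) by (auto simp: continuous_on_eq_continuous_at)
    have "(\<integral>w\<in>{u<..v}. h w \<partial>lborel) = (LINT w|lborel. kpd w*indicator {u'..v'} w - indicator {u'..v'} w*G w)"
     unfolding set_lebesgue_integral_def
    proof (rule integral_cong_AE)
     show "AE w in lborel. indicator {u<..v} w *\<^sub>R h w = kpd w*indicator {u'..v'} w - indicator {u'..v'} w*G w"
      by (rule AE_mp[OF AE_lborel_singleton[of u] AE_I2]) (auto simp: h_def indicator_def u'_def v'_def)
     show "(%w. indicator {u<..v} w *\<^sub>R h w) \<in> borel_measurable lborel" unfolding h_def by measurable
    qed measurable
    also have "... = 0" using F1 F2 iG' ik' by simp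
    finally show ?thesis .
   qed
  qed
  have "AE w in lborel. h w = 0" by (rule AE_eq_zero_if_Ioc_integrals[OF ih]) (rule zero)
  then show ?thesis
   by eventually_elim (auto simp: h_def)
 qed simp
 \<comment> \<open>Intervals with rational end points are countably many and cover the open set
   where the density is positive.\<close>
 have "AE w in lborel. \<forall>p::rat \<times> rat. (\<forall>x\<in>{of_rat (fst p)..of_rat (snd p)}. f x > 0) \<longrightarrow> w \<in> {of_rat (fst p)..of_rat (snd p)} \<longrightarrow> kpd w = G w"
  unfolding AE_all_countable using local by auto
 then have "AE w in lborel. f w > 0 \<longrightarrow> kpd w = G w"
 proof eventually_elim
  case (elim w)
  show ?case
  proof
   assume w: "f w > 0"
   have "isCont f w" using f(1) by (simp add: continuous_on_eq_continuous_at)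
   then obtain d where "d > 0" "!!x. dist x w < d ==> dist (f x) (f w) < f w"
    using w unfolding continuous_at_eps_delta by metis
   then have "d > 0 & (\<forall>x. \<bar>x - w\<bar> < d \<longrightarrow> f x > 0)" by (auto simp: dist_real_def abs_less_iff)
   then obtain d where d: "d > 0" "!!x. \<bar>x - w\<bar> < d ==> f x > 0" by blast
   obtain p where p: "w - d < of_rat p" "of_rat p < w" using of_rat_dense[of "w - d" w] d by auto
   obtain q where q: "w < of_rat q" "of_rat q < w + d" using of_rat_dense[of w "w + d"] d by auto
   have "\<forall>x\<in>{of_rat (fst (p,q))..of_rat (snd (p,q))}. f x > 0" using p q d(2) by (auto simp: abs_less_iff)
   moreover have "w \<in> {of_rat (fst (p,q))..of_rat (snd (p,q))}" using p q by auto
   ultimately show "kpd w = G w" using elim by blast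
  qed
 qed
 then show ?thesis unfolding G_def[symmetric] by (subst AE_density) (auto simp: ennreal_less_zero_iff)
qed

section \<open>Decay of the characteristic functions of the predictors\<close>

context iid_sequence
begin

text \<open>Only the second moment is used, so the remainder tends to 0 relative to t^2 by dominated
  convergence, without a rate. It takes at most 1/6 of the leading coefficient 1/2, which leaves
  more than 1/4.\<close>

lemma char_nu_bound: "\<exists>t0>0. \<forall>t. (abs t) <= t0 \<longrightarrow> cmod (char \<nu> t) <= exp (- s2*t^2/4)"
proof -
 interpret N: prob_space \<nu> by (rule prob_space_nu)
 interpret N: real_distribution \<nu> by unfold_locales auto
 have var: "N.variance (%x. x) = s2" using nu_moments by simp
 define m where "m t = N.expectation (%x. min (6*x^2) ((abs t)*(abs x) ^ 3))" for t
 have "(m \<longlongrightarrow> N.expectation (%x. 0)) (at 0)"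
  unfolding tendsto_at_iff_sequentially comp_def
 proof (intro allI impI)
  fix X :: "nat => real" assume X: "X \<longlonglongrightarrow> 0"
  show "(%n. m (X n)) \<longlonglongrightarrow> N.expectation (%x. 0)" unfolding m_def
  proof (rule integral_dominated_convergence[where w="%x. 6*x^2"])
   show "AE x in \<nu>. (%n. min (6*x^2) ((abs (X n))*(abs x) ^ 3)) \<longlonglongrightarrow> 0"
   proof (rule AE_I2)
    fix x :: real
    have "(%n. min (6*x^2) ((abs (X n))*(abs x) ^ 3)) \<longlonglongrightarrow> min (6*x^2) (\<bar>0\<bar>*(abs x) ^ 3)" by (intro tendsto_intros X)
    moreover have "min (6*x^2) (\<bar>0\<bar>*(abs x) ^ 3) = 0" by (simp add: min_absorb2)
    ultimately show "(%n. min (6*x^2) ((abs (X n))*(abs x) ^ 3)) \<longlonglongrightarrow> 0" by (simp only:)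
   qed
  qed (use nu_moments(3) in auto)
 qed
 then have "((%t. m t) \<longlongrightarrow> 0) (at 0)" by simp
 from tendstoD[OF this, of s2] s2_pos obtain d where d: "d > 0" "!!t. t \<noteq> 0 ==> (abs t) < d ==> (abs (m t)) < s2"
  by (auto simp: eventually_at dist_real_def)
 define t0 where "t0 = min (d/2) (1/sqrt s2)"
 have t0: "t0 > 0" using d s2_pos by (simp add: t0_def)
 show ?thesis
 proof (intro exI[of _ t0] conjI t0 allI impI)
  fix t assume t: "(abs t) <= t0"
  show "cmod (char \<nu> t) <= exp (- s2*t^2/4)"
  proof (cases "t = 0")
   case True then show ?thesis by (simp add: N.char_zero)
  next
   case False
   then have mt: "m t < s2" using d(2)[of t] t d(1) by (auto simp: t0_def)
   have "t^2 <= (1/sqrt s2)^2" using t abs_le_square_iff[of t "1/sqrt s2"] s2_pos by (simp add: t0_def)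
   then have ts: "t^2 * s2 <= 1" using s2_pos by (simp add: power_divide field_simps)
   have "cmod (char \<nu> t - (1 - t^2 * s2/2)) <= (t^2/6) * m t"
    unfolding m_def by (rule N.char_approx3) (use nu_moments var in auto)
   also have "... <= t^2/6 * s2" using mt by (intro mult_left_mono) auto
   finally have "cmod (char \<nu> t - (1 - t^2 * s2/2)) <= t^2/6 * s2" .
   moreover have "cmod (char \<nu> t) <= cmod (char \<nu> t - complex_of_real (1 - t^2 * s2/2)) + cmod (complex_of_real (1 - t^2 * s2/2))"
    by (rule norm_triangle_sub[of "char \<nu> t" "complex_of_real (1 - t^2 * s2/2)", unfolded add.commute[of _ "cmod (char \<nu> t - _)"]])
   moreover have "cmod (complex_of_real (1 - t^2 * s2/2)) = 1 - t^2 * s2/2" using ts by (simp del: of_real_diff of_real_mult of_real_divide)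
   ultimately have "cmod (char \<nu> t) <= 1 + - s2*t^2/4 - s2*t^2/12" by (simp add: algebra_simps)
   also have "... <= 1 + - s2*t^2/4" using s2_pos by simp
   also have "... <= exp (- s2*t^2/4)" by (rule exp_ge_add_one_self)
   finally show ?thesis .
  qed
 qed
qed

end

context linear_process
begin

text \<open>A block of N innovations splits off as an independent summand; the characteristic
  function of the rest has modulus at most 1.\<close>

lemma char_mu_le: "cmod (char (\<mu> m) t) <= (\<Prod>k<N. cmod (char \<nu> (a (m + k)*t)))"
proof -
 have rdV: "real_distribution (distr M borel (V (m + N) (0 - int N)))" by (rule real_distribution_distr) simp
 have eq: "distr M borel (V m 0) = distr M borel (%om. U m N 0 om + V (m + N) (0 - int N) om)"
 proof (rule distr_cong_AE[OF refl refl])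
  show "AE om in M. V m 0 om = U m N 0 om + V (m + N) (0 - int N) om"
   using AE_V_split by eventually_elim blast
 qed measurable
 have iv: "indep_var borel (U m N 0) borel (V (m + N) (0 - int N))"
  by (rule indep_field_of''[OF _ U_field V_field]) auto
 have "char (\<mu> m) t = char (distr M borel (U m N 0)) t*char (distr M borel (V (m + N) (0 - int N))) t"
  unfolding \<mu>_def eq by (rule char_distr_add[OF iv])
 also have "cmod ... <= cmod (char (distr M borel (U m N 0)) t)*1"
  unfolding norm_mult by (intro mult_left_mono real_distribution.cmod_char_le_1[OF rdV]) simp
 also have "char (distr M borel (U m N 0)) t = (\<Prod>k<N. char \<nu> (a (m + k)*t))"
 proof -
  have ind: "indep_vars (%_. borel) (%k om. a (m + k)*\<xi> (0 - int k) om) {..<N}"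
  proof -
   have "indep_sets (%i. {\<xi> i -` A \<inter> space M | A. A \<in> sets borel}) UNIV" using indep by (auto simp: indep_vars_def2)
   then have "indep_sets (%i. {\<xi> i -` A \<inter> space M | A. A \<in> sets borel}) ((%k. 0 - int k) ` {..<N})"
    by (rule indep_sets_mono_index[rotated]) simp
   from indep_sets_reindex[OF this] have "indep_vars (%_. borel) (%k. \<xi> (0 - int k)) {..<N}"
    by (auto simp: indep_vars_def2 inj_on_def)
   from indep_vars_compose2[OF this, of "%k x. a (m + k)*x" "%_. borel"] show ?thesis by simp
  qed
  have "char (distr M borel (U m N 0)) t = (\<Prod>k<N. char (distr M borel (%om. a (m + k)*\<xi> (0 - int k) om)) t)"
   unfolding U_def[abs_def] by (rule char_distr_sum[OF ind])
  also have "... = (\<Prod>k<N. char \<nu> (a (m + k)*t))"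
  proof (rule prod.cong[OF refl])
   fix k
   show "char (distr M borel (%om. a (m + k)*\<xi> (0 - int k) om)) t = char \<nu> (a (m + k)*t)"
    unfolding char_def distr_xi[of "0 - int k", symmetric] by (simp add: integral_distr mult_ac)
  qed
  finally show ?thesis .
 qed
 finally show ?thesis by (simp add: prod_norm)
qed

text \<open>For large t the first coefficients are too large for the bound near 0, so the indices
  from N to 2N are used, with N the order at which a_N t reaches t0. There are N such factors and
  each squared coefficient is at least of order N^{-2r-1/8}; the exponent grows like a positive
  power of t.\<close>

lemma integrable_char_mu:
 assumes C: "C >= 1" and r: "1/2 < r" "r < 1"
  and ab: "!!i. a i <= C*(1 + real i) powr (1/16 - r)" "!!i. (1 + real i) powr (- r - 1/16) <= C * a i"
 shows "integrable lborel (char (\<mu> m))"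
proof -
 interpret N: prob_space \<nu> by (rule prob_space_nu)
 interpret N: real_distribution \<nu> by unfold_locales auto
 interpret R: prob_space "\<mu> m" by (rule prob_space_mu)
 interpret R: real_distribution "\<mu> m" by unfold_locales auto
 obtain t0 where t0: "t0 > 0" "!!t. (abs t) <= t0 ==> cmod (char \<nu> t) <= exp (- s2*t^2/4)"
  using char_nu_bound by auto
 have a0: "a i >= 0" for i
 proof -
  have "0 <= C * a i" using ab(2)[of i] by (meson order_trans powr_ge_zero)
  then show ?thesis using C by (simp add: zero_le_mult_iff)
 qed
 define u where "u = r - 1/16"
 define z where "z = 2*r + 1/8 - 1"
 have uz: "u > 0" "z > 0" "2*u - z > 0" using r by (auto simp: u_def z_def)
 \<comment> \<open>Solves C Z^{-u} t = t0, so that beyond the index \<open>Z t\<close> the arguments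
   a_i t stay below t0. The final power is 2 - z/u, positive because 2u - z = 3/4.\<close>
 define Z where "Z t = (C*t/t0) powr (1/u)" for t
 have "filterlim (%t. (C*t/t0) powr (1/u)) at_top at_top" using uz t0(1) C by real_asymp
 then have evZ: "\<forall>\<^sub>F t in at_top. Z t >= real m + 1" unfolding Z_def filterlim_at_top by blast
 define c1 where "c1 = s2/(4*C^2)*3 powr (- 2*r - 1/8)*2 powr (- z)*(C/t0) powr (- z/u)"
 have c1: "c1 > 0" using s2_pos C t0 by (simp add: c1_def)
 have main: "cmod (char (\<mu> m) t) <= exp (- c1*(abs t) powr (2 - z/u))" if t: "Z (abs t) >= real m + 1" "t \<noteq> 0" for t
 proof -
  define N where "N = nat \<lceil>Z (abs t)\<rceil>"
  have N: "real N >= Z (abs t)" "real N <= 2*Z (abs t)" "N >= m + 1" using t by (auto simp: N_def) linarith+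
  have Nu: "real N powr (- u)*(C*(abs t)/t0) <= 1"
  proof -
   have Zp: "Z (abs t) > 0" using t by linarith
   have "Z (abs t) powr u = (C*(abs t)/t0) powr 1" unfolding Z_def powr_powr using uz by simp
   then have Zu: "Z (abs t) powr u = C*(abs t)/t0" using C t0 by simp
   have "real N powr (- u) <= Z (abs t) powr (- u)" using N(1) uz Zp by (intro powr_mono2') auto
   also have "... = inverse (C*(abs t)/t0)" using Zu by (simp add: powr_minus)
   finally have "real N powr (- u)*(C*(abs t)/t0) <= inverse (C*(abs t)/t0)*(C*(abs t)/t0)"
    using C t0 by (intro mult_right_mono) auto
   also have "... = 1" using C t0 t(2) by simp
   finally show ?thesis .
  qed
  have small: "\<bar>a (m + k)*t\<bar> <= t0" if "k >= N" for k
  proof -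
   have "a (m + k) <= C*(1 + real (m + k)) powr (- u)" using ab(1)[of "m+k"] by (simp add: u_def)
   also have "... <= C*real N powr (- u)" using that N C uz t by (intro mult_left_mono powr_mono2') auto
   finally have "a (m + k)*(abs t) <= C*real N powr (- u)*(abs t)" by (intro mult_right_mono) auto
   also have "... = (real N powr (- u)*(C*(abs t)/t0))*t0" using t0 by simp
   also have "... <= 1*t0" using Nu t0 by (intro mult_right_mono) auto
   finally show ?thesis using a0[of "m+k"] by (simp add: abs_mult)
  qed
  \<comment> \<open>The factor 3 comes from 1 + m + k <= 3N, since m + 1 <= N and k < 2N.\<close>
  have large: "(a (m + k))^2 >= (3*real N) powr (- 2*r - 1/8)/C^2" if "k < 2*N" for k
  proof -
   have "(3*real N) powr (- r - 1/16) <= (1 + real (m + k)) powr (- r - 1/16)"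
    using that N(3) r by (intro powr_mono2') auto
   also have "... <= C * a (m + k)" by (rule ab(2))
   finally have "((3*real N) powr (- r - 1/16))^2 <= (C * a (m + k))^2" by (intro power_mono) auto
   moreover have "((3*real N) powr (- r - 1/16))^2 = (3*real N) powr (- 2*r - 1/8)"
    by (simp add: power2_eq_square powr_add[symmetric])
   ultimately show ?thesis using C by (simp add: power_mult_distrib divide_le_eq mult.commute)
  qed
  have "cmod (char (\<mu> m) t) <= (\<Prod>k<2*N. cmod (char \<nu> (a (m + k)*t)))" by (rule char_mu_le)
  also have "... <= (\<Prod>k<2*N. if k < N then 1 else exp (- (s2/4*t^2*((3*real N) powr (- 2*r - 1/8)/C^2))))"
  proof (rule prod_mono)
   fix k assume k: "k \<in> {..<2*N}"
   show "0 <= cmod (char \<nu> (a (m + k)*t)) & cmod (char \<nu> (a (m + k)*t)) <= (if k < N then 1 else exp (- (s2/4*t^2*((3*real N) powr (- 2*r - 1/8)/C^2))))"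
   proof (cases "k < N")
    case False
    have "cmod (char \<nu> (a (m + k)*t)) <= exp (- s2*(a (m + k)*t)^2/4)" using small[of k] False by (intro t0(2)) auto
    also have "- s2*(a (m + k)*t)^2/4 = - (s2/4*t^2*(a (m + k))^2)" by (simp add: power_mult_distrib)
    also have "exp ... <= exp (- (s2/4*t^2*((3*real N) powr (- 2*r - 1/8)/C^2)))"
     unfolding exp_le_cancel_iff neg_le_iff_le using large[of k] k s2_pos by (intro mult_left_mono) auto
    finally show ?thesis using False by simp
   qed (simp add: N.cmod_char_le_1)
  qed
  also have "... = exp (- (s2/4*t^2*((3*real N) powr (- 2*r - 1/8)/C^2))) ^ N"
  proof -
   have "(\<Prod>k<2*N. if k < N then 1 else E) = E ^ N" for E :: real
   proof -
    have "(\<Prod>k<2*N. if k < N then 1 else E) = (\<Prod>k\<in>{N..<2*N}. E)"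
     by (rule prod.mono_neutral_cong_right) auto
    then show ?thesis by simp
   qed
   then show ?thesis .
  qed
  also have "... = exp (- (s2/(4*C^2)*t^2*(real N*(3*real N) powr (- 2*r - 1/8))))"
   by (simp add: exp_of_nat_mult[symmetric] mult_ac)
  also have "... <= exp (- c1*(abs t) powr (2 - z/u))"
  proof -
   have Np: "real N > 0" using N by simp
   have e1: "real N*(3*real N) powr (- 2*r - 1/8) = 3 powr (- 2*r - 1/8)*real N powr (- z)"
   proof -
    have "real N*(3*real N) powr (- 2*r - 1/8) = 3 powr (- 2*r - 1/8)*(real N powr 1*real N powr (- 2*r - 1/8))"
     using Np by (simp add: powr_mult)
    also have "real N powr 1*real N powr (- 2*r - 1/8) = real N powr (- z)" unfolding powr_add[symmetric] by (simp add: z_def algebra_simps)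
    finally show ?thesis .
   qed
   have "2 powr (- z)*(C/t0) powr (- z/u)*(abs t) powr (- z/u) = (2*Z (abs t)) powr (- z)"
   proof -
    have "C*(abs t)/t0 = C/t0*(abs t)" by simp
    then have Zt: "Z (abs t) = (C/t0) powr (1/u)*(abs t) powr (1/u)" unfolding Z_def by (simp only: powr_mult)
    have uz1: "1/u*- z = - z/u" by simp
    show ?thesis unfolding Zt powr_mult powr_powr uz1 by (simp only: mult.assoc)
   qed
   also have "... <= real N powr (- z)" using N(2) Np uz by (intro powr_mono2') auto
   finally have e2: "2 powr (- z)*(C/t0) powr (- z/u)*(abs t) powr (- z/u) <= real N powr (- z)" .
   have e3: "(abs t) powr (2 - z/u) = t^2*(abs t) powr (- z/u)"
   proof -
    have "(abs t) powr (2 - z/u) = (abs t) powr 2*(abs t) powr (- z/u)" unfolding powr_add[symmetric] by simp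
    then show ?thesis using t(2) by simp
   qed
   have "c1*(abs t) powr (2 - z/u) = (s2/(4*C^2)*t^2*3 powr (- 2*r - 1/8))*(2 powr (- z)*(C/t0) powr (- z/u)*(abs t) powr (- z/u))"
    unfolding e3 c1_def by (simp only: mult_ac)
   also have "... <= (s2/(4*C^2)*t^2*3 powr (- 2*r - 1/8))*real N powr (- z)"
    using e2 s2_pos by (intro mult_left_mono) auto
   finally show ?thesis unfolding e1 by (simp add: mult_ac)
  qed
  finally show ?thesis .
 qed
 define \<gamma> where "\<gamma> = 2 - z/u"
 have gam: "\<gamma> > 0" using uz by (simp add: \<gamma>_def field_simps)
 have "\<forall>\<^sub>F t in at_top. exp (- c1*t powr \<gamma>) <= inverse (1 + t^2)" using c1 gam by real_asymp
 with evZ have "\<forall>\<^sub>F t in at_top. Z t >= real m + 1 & exp (- c1*t powr \<gamma>) <= inverse (1 + t^2)" by eventually_elim simp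
 then obtain T where T: "!!t. t >= T ==> Z t >= real m + 1 & exp (- c1*t powr \<gamma>) <= inverse (1 + t^2)"
  by (auto simp: eventually_at_top_linorder)
 define T' where "T' = max T 1"
 have bound: "cmod (char (\<mu> m) t) <= (1 + T'^2)*inverse (1 + t^2)" for t
 proof (cases "(abs t) >= T'")
  case True
  have "cmod (char (\<mu> m) t) <= exp (- c1*(abs t) powr (2 - z/u))" using True T[of "(abs t)"] by (intro main) (auto simp: T'_def)
  also have "... <= 1*inverse (1 + (abs t)^2)" using T[of "(abs t)"] True by (simp add: \<gamma>_def T'_def)
  also have "... <= (1 + T'^2)*inverse (1 + (abs t)^2)" by (intro mult_right_mono) auto
  finally show ?thesis by simp
 next
  case False
  then have "(abs t)^2 <= T'^2" by (intro power_mono) auto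
  then have "t^2 <= T'^2" by simp
  then have "1 <= (1 + T'^2)*inverse (1 + t^2)" by (simp add: field_simps add_pos_nonneg)
  then show ?thesis using R.cmod_char_le_1[of t] by linarith
 qed
 have "integrable lborel (%t::real. inverse (1 + t^2))"
  using integrable_inverse_1_plus_square by (simp add: set_integrable_def)
 then have i: "integrable lborel (%t::real. (1 + T'^2)*inverse (1 + t^2))" by simp
 show ?thesis
 proof (rule Bochner_Integration.integrable_bound[OF i])
  show "AE t in lborel. cmod (char (\<mu> m) t) <= norm ((1 + T'^2)*inverse (1 + t^2))"
   using bound by (intro AE_I2) (auto intro: order_trans[OF _ abs_ge_self])
 qed (use R.char_measurable in simp)
qed

end

section \<open>Linearising the conditional expectations\<close>

definition lip_approx :: "real measure => (real => real) => bool" where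
 "lip_approx L f \<longleftrightarrow> integrable L f & (\<forall>e>0. \<exists>k \<Lambda> B. k \<in> borel_measurable borel &
   (\<forall>x y. \<bar>k x - k y\<bar> <= \<Lambda>*\<bar>x - y\<bar>) & (\<forall>x. (abs (k x)) <= B) & (LINT x|L. \<bar>f x - k x\<bar>) < e)"

lemma lip_approxD:
 assumes "lip_approx L f" "e > 0"
 shows "\<exists>k \<Lambda> B. k \<in> borel_measurable borel &
   (\<forall>x y. \<bar>k x - k y\<bar> <= \<Lambda>*\<bar>x - y\<bar>) & (\<forall>x. (abs (k x)) <= B) & (LINT x|L. \<bar>f x - k x\<bar>) < e"
 using assms by (simp add: lip_approx_def)

context
 fixes L :: "real measure"
 assumes fin: "finite_measure L" and sets_L[measurable_cong]: "sets L = sets borel"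
begin

lemma bounded_integrable_L:
 assumes "k \<in> borel_measurable borel" "!!x. (abs (k x)) <= (B::real)"
 shows "integrable L k"
proof (rule finite_measure.integrable_const_bound[OF fin, where B=B])
 show "AE x in L. norm (k x) <= B" using assms(2) by (intro AE_I2) simp
 show "k \<in> borel_measurable L" using assms(1) sets_L by (simp cong: measurable_cong_sets)
qed

lemma lip_approx_limit:
 assumes f: "integrable L f" and g: "!!n. lip_approx L (g n)" and lim: "(%n. \<integral>x. \<bar>f x - g n x\<bar> \<partial>L) \<longlonglongrightarrow> 0"
 shows "lip_approx L f"
 unfolding lip_approx_def
proof (intro conjI allI impI f)
 fix e :: real assume e: "e > 0"
 have gi: "integrable L (g n)" for n using g by (simp add: lip_approx_def)
 have "\<forall>\<^sub>F n in sequentially. (LINT x|L. \<bar>f x - g n x\<bar>) < e/2" using order_tendstoD(2)[OF lim, of "e/2"] e by simp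
 then obtain n where n: "(LINT x|L. \<bar>f x - g n x\<bar>) < e/2" by (auto simp: eventually_sequentially)
 obtain k \<Lambda> B where k0: "k \<in> borel_measurable borel & (\<forall>x y. \<bar>k x - k y\<bar> <= \<Lambda>*\<bar>x - y\<bar>) & (\<forall>x. (abs (k x)) <= B) & (LINT x|L. \<bar>g n x - k x\<bar>) < e/2"
  using lip_approxD[OF g[of n] half_gt_zero[OF e]] by (elim exE) (rule that)
 have k: "k \<in> borel_measurable borel" "\<bar>k x - k y\<bar> <= \<Lambda>*\<bar>x - y\<bar>" "(abs (k x)) <= B" "(LINT x|L. \<bar>g n x - k x\<bar>) < e/2" for x y
  using k0 by simp_all
 have ki: "integrable L k" by (rule bounded_integrable_L[OF k(1,3)])
 have "(LINT x|L. \<bar>f x - k x\<bar>) <= (LINT x|L. \<bar>f x - g n x\<bar> + \<bar>g n x - k x\<bar>)"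
  using f gi[of n] ki by (intro integral_mono) auto
 also have "... = (LINT x|L. \<bar>f x - g n x\<bar>) + (LINT x|L. \<bar>g n x - k x\<bar>)"
  using f gi[of n] ki by (intro Bochner_Integration.integral_add) auto
 also have "... < e" using n k(4) by linarith
 finally show "\<exists>k \<Lambda> B. k \<in> borel_measurable borel &
   (\<forall>x y. \<bar>k x - k y\<bar> <= \<Lambda>*\<bar>x - y\<bar>) & (\<forall>x. (abs (k x)) <= B) & (LINT x|L. \<bar>f x - k x\<bar>) < e"
  using k(1-3) by (intro exI[of _ k] exI[of _ "\<Lambda>"] exI[of _ "B"] conjI allI) simp_all
qed

lemma lip_approx_lin:
 assumes f: "lip_approx L f" and g: "lip_approx L g"
 shows "lip_approx L (%x. c*f x + g x)"
 unfolding lip_approx_def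
proof (intro conjI allI impI)
 have fi: "integrable L f" "integrable L g" using f g by (auto simp: lip_approx_def)
 then show "integrable L (%x. c*f x + g x)" by simp
 fix e :: real assume e: "e > 0"
 define d where "d = e/(2*((abs c) + 1))"
 have d: "d > 0" "(abs c)*d <= e/2" using e by (auto simp: d_def field_simps)
 obtain k \<Lambda> B where k0: "k \<in> borel_measurable borel & (\<forall>x y. \<bar>k x - k y\<bar> <= \<Lambda>*\<bar>x - y\<bar>) & (\<forall>x. (abs (k x)) <= B) & (LINT x|L. \<bar>f x - k x\<bar>) < d"
  using lip_approxD[OF f d(1)] by (elim exE) (rule that)
 have k: "k \<in> borel_measurable borel" "\<bar>k x - k y\<bar> <= \<Lambda>*\<bar>x - y\<bar>" "(abs (k x)) <= B" "(LINT x|L. \<bar>f x - k x\<bar>) < d" for x y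
  using k0 by simp_all
 have e2: "e/2 > 0" using e by simp
 obtain k' \<Lambda>' B' where k'0: "k' \<in> borel_measurable borel & (\<forall>x y. \<bar>k' x - k' y\<bar> <= \<Lambda>'*\<bar>x - y\<bar>) & (\<forall>x. (abs (k' x)) <= B') & (LINT x|L. \<bar>g x - k' x\<bar>) < e/2"
  using lip_approxD[OF g e2] by (elim exE) (rule that)
 have k': "k' \<in> borel_measurable borel" "\<bar>k' x - k' y\<bar> <= \<Lambda>'*\<bar>x - y\<bar>" "(abs (k' x)) <= B'" "(LINT x|L. \<bar>g x - k' x\<bar>) < e/2" for x y
  using k'0 by simp_all
 have ki: "integrable L k" "integrable L k'" by (rule bounded_integrable_L[OF k(1,3)], rule bounded_integrable_L[OF k'(1,3)])
 let ?k = "%x. c * k x + k' x"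
 have "(LINT x|L. \<bar>(c*f x + g x) - ?k x\<bar>) <= (LINT x|L. (abs c)*\<bar>f x - k x\<bar> + \<bar>g x - k' x\<bar>)"
 proof (intro integral_mono)
  fix x
  have "(c*f x + g x) - ?k x = c*(f x - k x) + (g x - k' x)" by (simp add: algebra_simps)
  then show "\<bar>(c*f x + g x) - ?k x\<bar> <= (abs c)*\<bar>f x - k x\<bar> + \<bar>g x - k' x\<bar>"
   by (metis abs_mult abs_triangle_ineq)
 qed (use fi ki in auto)
 also have "... = (abs c)*(LINT x|L. \<bar>f x - k x\<bar>) + (LINT x|L. \<bar>g x - k' x\<bar>)"
  using fi ki by simp
 also have "... < e"
 proof -
  have "(abs c)*(LINT x|L. \<bar>f x - k x\<bar>) <= (abs c)*d" using k(4) by (intro mult_left_mono) auto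
  then show ?thesis using d(2) k'(4) by linarith
 qed
 finally have 1: "(LINT x|L. \<bar>(c*f x + g x) - ?k x\<bar>) < e" .
 have 2: "\<bar>?k x - ?k y\<bar> <= ((abs c)*\<Lambda> + \<Lambda>')*\<bar>x - y\<bar>" for x y
 proof -
  have "?k x - ?k y = c*(k x - k y) + (k' x - k' y)" by (simp add: algebra_simps)
  then have "\<bar>?k x - ?k y\<bar> <= (abs c)*\<bar>k x - k y\<bar> + \<bar>k' x - k' y\<bar>" by (metis abs_mult abs_triangle_ineq)
  also have "... <= (abs c)*(\<Lambda>*\<bar>x - y\<bar>) + \<Lambda>'*\<bar>x - y\<bar>" using k(2) k'(2) by (intro add_mono mult_left_mono) auto
  finally show ?thesis by (simp add: algebra_simps)
 qed
 have 3: "\<bar>?k x\<bar> <= (abs c)*B + B'" for x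
 proof -
  have "\<bar>?k x\<bar> <= (abs c)*(abs (k x)) + (abs (k' x))" by (metis abs_mult abs_triangle_ineq)
  also have "... <= (abs c)*B + B'" using k(3) k'(3) by (intro add_mono mult_left_mono) auto
  finally show ?thesis .
 qed
 have 4: "?k \<in> borel_measurable borel" using k(1) k'(1) by measurable
 show "\<exists>k \<Lambda> B. k \<in> borel_measurable borel &
   (\<forall>x y. \<bar>k x - k y\<bar> <= \<Lambda>*\<bar>x - y\<bar>) & (\<forall>x. (abs (k x)) <= B) & (LINT x|L. \<bar>c*f x + g x - k x\<bar>) < e"
  by (intro exI[of _ ?k] exI[of _ "(abs c)*\<Lambda> + \<Lambda>'"] exI[of _ "(abs c)*B + B'"] conjI allI 1 2 3 4)
qed

lemma lip_approx_self:
 assumes "k \<in> borel_measurable borel" "!!x y. \<bar>k x - k y\<bar> <= \<Lambda>*\<bar>x - y\<bar>" "!!x. (abs (k x)) <= B"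
 shows "lip_approx L k"
 unfolding lip_approx_def
proof (intro conjI allI impI bounded_integrable_L[OF assms(1,3)])
 fix e :: real assume "e > 0"
 then have "(LINT x|L. \<bar>k x - k x\<bar>) < e" by simp
 then show "\<exists>k' \<Lambda> B. k' \<in> borel_measurable borel & (\<forall>x y. \<bar>k' x - k' y\<bar> <= \<Lambda>*\<bar>x - y\<bar>) & (\<forall>x. (abs (k' x)) <= B) & (LINT x|L. \<bar>k x - k' x\<bar>) < e"
  using assms by (intro exI[of _ k] exI[of _ "\<Lambda>"] exI[of _ "B"] conjI allI) simp_all
qed

text \<open>Half lines are limits of ramps, they form a \<pi>-system, and the approximable sets form
  a Dynkin system because approximability is linear and closed under L^1 limits.\<close>

lemma lip_approx_indicator:
 assumes "A \<in> sets borel"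
 shows "lip_approx L (indicator A)"
proof -
 interpret finite_measure L by (rule fin)
 have const: "lip_approx L (%x. c)" for c by (rule lip_approx_self[where \<Lambda>=0 and B="(abs c)"]) auto
 have ind: "integrable L (indicator B :: real => real)" if "B \<in> sets borel" for B
  by (rule bounded_integrable_L[where B=1]) (use that in \<open>auto simp: indicator_def\<close>)
 have "Int_stable (range (%a. {a<..} :: real set))"
 proof (rule Int_stableI)
  fix a b assume "a \<in> range (%a. {a<..} :: real set)" "b \<in> range (%a. {a<..} :: real set)"
  then obtain x y where "a = {x<..}" "b = {y<..}" by auto
  then have "a \<inter> b = {max x y<..}" by auto
  then show "a \<inter> b \<in> range (%a. {a<..} :: real set)" by blast
 qed
 moreover have "range (%a. {a<..} :: real set) \<subseteq> Pow UNIV" by simp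
 moreover have "A \<in> sigma_sets UNIV (range (%a. {a<..} :: real set))" using assms by (simp add: borel_Ioi)
 ultimately show ?thesis
 proof (induction rule: sigma_sets_induct_disjoint)
  case (basic A)
  then obtain a where A: "A = {a<..}" by auto
  let ?g = "%n x. min 1 (max 0 (real n*(x - a)))"
  show ?case
  proof (rule lip_approx_limit[where g="?g"])
   show "integrable L (indicator A :: real => real)" by (rule ind) (simp add: A)
   show "lip_approx L (?g n)" for n
   proof (rule lip_approx_self[where \<Lambda>="real n" and B=1])
    fix x y :: real
    have "\<bar>?g n x - ?g n y\<bar> <= \<bar>real n*(x - a) - real n*(y - a)\<bar>" by (auto simp: min_def max_def)
    also have "... = real n*\<bar>x - y\<bar>" by (simp add: abs_mult flip: right_diff_distrib)
    finally show "\<bar>?g n x - ?g n y\<bar> <= real n*\<bar>x - y\<bar>" .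
   qed auto
   have "(%n. \<integral>x. \<bar>indicator A x - ?g n x\<bar> \<partial>L) \<longlonglongrightarrow> (LINT x|L. 0)"
   proof (rule integral_dominated_convergence[where w="%_. 1"])
    show "AE x in L. (%n. \<bar>indicator A x - ?g n x\<bar>) \<longlonglongrightarrow> 0"
    proof (rule AE_I2, rule tendsto_eventually)
     fix x :: real
     show "\<forall>\<^sub>F n in sequentially. \<bar>indicator A x - ?g n x\<bar> = 0"
     proof (cases "x > a")
      case False
      have "max 0 (real n*(x - a)) = 0" for n using False by (intro max_absorb1 mult_nonneg_nonpos) auto
      then show ?thesis using False by (simp add: A)
     next
      case True
      obtain N :: nat where N: "1 < real N*(x - a)" using True reals_Archimedean3[of "x - a"] by auto
      show ?thesis using eventually_ge_at_top[of N]
      proof eventually_elim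
       case (elim n)
       have "real N*(x - a) <= real n*(x - a)" using elim True by (intro mult_right_mono) auto
       then have "1 < real n*(x - a)" using N by linarith
       then show ?case using True by (simp add: A min_def max_def)
      qed
     qed
    qed
    show "AE x in L. norm \<bar>indicator A x - ?g n x\<bar> <= 1" for n by (rule AE_I2) (auto simp: indicator_def min_def max_def)
    show "(%x. \<bar>indicator A x - ?g n x\<bar>) \<in> borel_measurable L" for n unfolding A by measurable
   qed auto
   then show "(%n. \<integral>x. \<bar>indicator A x - ?g n x\<bar> \<partial>L) \<longlonglongrightarrow> 0" by simp
  qed
 next
  case empty
  show ?case using const[of 0] by (simp add: indicator_def)
 next
  case (compl A)
  have "lip_approx L (%x. (-1)*indicator A x + 1)" by (rule lip_approx_lin[OF compl(2) const])
  moreover have "(%x. (-1)*indicator A x + 1) = (indicator (UNIV - A) :: real => real)" by (auto simp: indicator_def)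
  ultimately show ?case by simp
 next
  case (union A)
  have As: "A i \<in> sets borel" for i using union(2) by (auto simp: borel_Ioi)
  let ?g = "%n x. \<Sum>i<n. indicator (A i) x :: real"
  have gU: "(\<Sum>i<n. indicator (A i) x :: real) = indicator (\<Union>i<n. A i) x" for n x
   using union(1) by (intro indicator_UN_disjoint[symmetric]) (auto simp: disjoint_family_on_def)
  show ?case
  proof (rule lip_approx_limit[where g="?g"])
   show "integrable L (indicator (\<Union>i. A i) :: real => real)" by (rule ind) (use As in auto)
   show "lip_approx L (?g n)" for n
   proof (induction n)
    case 0 show ?case using const[of 0] by simp
   next
    case (Suc n)
    have "lip_approx L (%x. 1*indicator (A n) x + ?g n x)" by (rule lip_approx_lin[OF union(3) Suc])
    then show ?case by (simp add: add.commute)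
   qed
   have "(%n. \<integral>x. \<bar>indicator (\<Union>i. A i) x - ?g n x\<bar> \<partial>L) \<longlonglongrightarrow> (LINT x|L. 0)"
   proof (rule integral_dominated_convergence[where w="%_. 1"])
    show "AE x in L. (%n. \<bar>indicator (\<Union>i. A i) x - ?g n x\<bar>) \<longlonglongrightarrow> 0"
    proof (rule AE_I2, rule tendsto_eventually)
     fix x :: real
     show "\<forall>\<^sub>F n in sequentially. \<bar>indicator (\<Union>i. A i) x - ?g n x\<bar> = 0"
     proof (cases "x \<in> (\<Union>i. A i)")
      case True
      then obtain j where j: "x \<in> A j" by auto
      show ?thesis unfolding gU using eventually_gt_at_top[of j]
       by eventually_elim (use j in \<open>auto simp: indicator_def\<close>)
     next
      case False
      then show ?thesis unfolding gU by (auto simp: indicator_def)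
     qed
    qed
    show "AE x in L. norm \<bar>indicator (\<Union>i. A i) x - ?g n x\<bar> <= 1" for n unfolding gU by (rule AE_I2) (auto simp: indicator_def)
    show "(%x. \<bar>indicator (\<Union>i. A i) x - ?g n x\<bar>) \<in> borel_measurable L" for n using As by measurable
   qed auto
   then show "(%n. \<integral>x. \<bar>indicator (\<Union>i. A i) x - ?g n x\<bar> \<partial>L) \<longlonglongrightarrow> 0" by simp
  qed
 qed
qed

lemma integrable_lip_approx:
 assumes "integrable L f"
 shows "lip_approx L f"
 using assms
proof (induction rule: integrable_induct)
 case (base A c)
 have A: "A \<in> sets borel" using base by (simp add: sets_L)
 have "lip_approx L (%x. c*indicator A x + 0)"
  by (rule lip_approx_lin[OF lip_approx_indicator[OF A]]) (rule lip_approx_self[where \<Lambda>=0 and B=0], auto)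
 then show ?case by (simp add: mult.commute)
next
 case (add f g)
 have "lip_approx L (%x. 1*f x + g x)" by (rule lip_approx_lin[OF add(3,4)])
 then show ?case by simp
next
 case (lim f s)
 show ?case
 proof (rule lip_approx_limit[OF lim(4) lim(5)])
  have "(%n. \<integral>x. \<bar>f x - s n x\<bar> \<partial>L) \<longlonglongrightarrow> (LINT x|L. 0)"
  proof (rule integral_dominated_convergence[where w="%x. 3*(abs (f x))"])
   show "AE x in L. (%n. \<bar>f x - s n x\<bar>) \<longlonglongrightarrow> 0"
   proof (rule AE_I2)
    fix x assume "x \<in> space L"
    from tendsto_rabs[OF tendsto_diff[OF tendsto_const[of "f x"] lim(2)[OF this]]] show "(%n. \<bar>f x - s n x\<bar>) \<longlonglongrightarrow> 0" by simp
   qed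
   show "AE x in L. norm \<bar>f x - s n x\<bar> <= 3*(abs (f x))" for n
   proof (rule AE_I2)
    fix x assume "x \<in> space L"
    from lim(3)[OF this, of n] show "norm \<bar>f x - s n x\<bar> <= 3*(abs (f x))" by simp
   qed
   show "(%x. \<bar>f x - s n x\<bar>) \<in> borel_measurable L" for n
    using lim(1)[of n] lim(4) by (intro borel_measurable_abs borel_measurable_diff) auto
  qed (use lim(4) in auto)
  then show "(%n. \<integral>x. \<bar>f x - s n x\<bar> \<partial>L) \<longlonglongrightarrow> 0" by simp
 qed
qed

end

context linear_process
begin

text \<open>Convergence of E(K(X_{s+m}) | F_s) to the mean in L^1, uniformly in s. It replaces
  convergence of reverse martingales by approximation: for a bounded Lipschitz function the averaged
  function is Lipschitz with the same constant, and the predictor it is evaluated at tends to 0 in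
  L^1.\<close>

lemma cond_mean_tendsto:
 fixes K :: "real => real"
 assumes K: "K \<in> borel_measurable borel" and int: "integrable M (%om. K (V 0 0 om))" and e: "e > 0"
 shows "\<forall>\<^sub>F m in sequentially. \<forall>s. (\<integral>om. \<bar>(LINT u|\<tau> m. K (V m s om + u)) - (LINT om|M. K (V 0 0 om))\<bar> \<partial>M) < e"
proof -
 interpret L: prob_space "\<mu> 0" by (rule prob_space_mu)
 have L: "integrable (\<mu> 0) K" "(LINT x|\<mu> 0. K x) = (LINT om|M. K (V 0 0 om))"
  unfolding \<mu>_def using K int by (auto simp: integrable_distr_eq integral_distr)
 have ap: "lip_approx (\<mu> 0) K" using integrable_lip_approx[OF L.finite_measure_axioms sets_mu L(1)] .
 have e4: "e/4 > 0" using e by simp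
 obtain k \<Lambda> B where k0: "k \<in> borel_measurable borel & (\<forall>x y. \<bar>k x - k y\<bar> <= \<Lambda>*\<bar>x - y\<bar>) & (\<forall>x. (abs (k x)) <= B) & (LINT x|\<mu> 0. \<bar>K x - k x\<bar>) < e/4"
  using lip_approxD[OF ap e4] by (elim exE) (rule that)
 have k: "k \<in> borel_measurable borel" "\<bar>k x - k y\<bar> <= \<Lambda>*\<bar>x - y\<bar>" "(abs (k x)) <= B" "(LINT x|\<mu> 0. \<bar>K x - k x\<bar>) < e/4" for x y
  using k0 by simp_all
 have Lam: "\<Lambda> >= 0" using k(2)[of 1 0] abs_ge_zero[of "k 1 - k 0"] by simp
 note [measurable] = k(1) K
 have A: "(%m. \<Lambda> * sqrt (s2*A2 m)) \<longlonglongrightarrow> \<Lambda> * sqrt (s2*0)" by (intro tendsto_intros A2_lim)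
 have "\<forall>\<^sub>F m in sequentially. \<Lambda> * sqrt (s2*A2 m) < e/4" using order_tendstoD(2)[OF A, of "e/4"] e by simp
 then show ?thesis
 proof eventually_elim
  case (elim m)
  show ?case
  proof
   fix s
   interpret T: prob_space "\<tau> m" by (rule prob_space_tau)
   let ?F = "past_field M \<xi> s"
   interpret F: sigma_finite_subalgebra M ?F unfolding past_field_eq by (rule finite_measure_sub[OF subalgebra_field_of])
   let ?X = "V 0 (s + int m)"
   have lawX: "distr M borel ?X = \<mu> 0" by (rule distr_V)
   have iX: "integrable M (%om. K (?X om))" "integrable M (%om. k (?X om))" "integrable M (%om. K (?X om) - k (?X om))"
   proof -
    show 1: "integrable M (%om. K (?X om))" using L(1) unfolding lawX[symmetric] by (simp add: integrable_distr_eq)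
    show 2: "integrable M (%om. k (?X om))" by (rule integrable_const_bound[where B=B]) (use k(3) in auto)
    show "integrable M (%om. K (?X om) - k (?X om))" using 1 2 by simp
   qed
   have c1: "AE om in M. real_cond_exp M ?F (%om. K (?X om)) om = (LINT u|\<tau> m. K (V m s om + u))"
    using cond_exp_V_U[OF K iX(1), of m] by simp
   have c2: "AE om in M. real_cond_exp M ?F (%om. k (?X om)) om = (LINT u|\<tau> m. k (V m s om + u))"
    using cond_exp_V_U[OF k(1) iX(2), of m] by simp
   have c3: "AE om in M. real_cond_exp M ?F (%om. K (?X om) - k (?X om)) om = real_cond_exp M ?F (%om. K (?X om)) om - real_cond_exp M ?F (%om. k (?X om)) om"
    by (rule F.real_cond_exp_diff[OF iX(1,2)])
   let ?D = "%om. real_cond_exp M ?F (%om. K (?X om) - k (?X om)) om"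
   have iD: "integrable M ?D" by (rule F.real_cond_exp_int(1)[OF iX(3)])
   \<comment> \<open>Conditioning contracts L^1, so the approximation error at X_{s+m} bounds the
     one after conditioning.\<close>
   have Dle: "(LINT om|M. \<bar>?D om\<bar>) <= e/4"
   proof -
    have ia: "integrable M (%om. \<bar>K (?X om) - k (?X om)\<bar>)" using iX(3) by (rule integrable_abs)
    have "AE om in M. \<bar>?D om\<bar> <= real_cond_exp M ?F (%om. \<bar>K (?X om) - k (?X om)\<bar>) om"
    proof -
     have "convex_on UNIV (%x::real. (abs x))" using convex_on_dist[OF convex_UNIV, of "0::real"] by simp
     then show ?thesis using F.real_cond_exp_jensens_inequality(2)[OF iX(3), of UNIV undefined undefined abs] ia by simp
    qed
    then have "(LINT om|M. \<bar>?D om\<bar>) <= (LINT om|M. real_cond_exp M ?F (%om. \<bar>K (?X om) - k (?X om)\<bar>) om)"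
     by (rule integral_mono_AE[OF integrable_abs[OF iD] F.real_cond_exp_int(1)[OF ia]])
    also have "... = (LINT om|M. \<bar>K (?X om) - k (?X om)\<bar>)" by (rule F.real_cond_exp_int(2)[OF ia])
    also have "... = (LINT x|\<mu> 0. \<bar>K x - k x\<bar>)" unfolding lawX[symmetric] by (simp add: integral_distr)
    finally show ?thesis using k(4) by simp
   qed
   define km where "km v = (LINT u|\<tau> m. k (v + u))" for v
   have ki: "integrable (\<tau> m) (%u. k (v + u))" for v by (rule T.integrable_const_bound[where B=B]) (use k(3) in auto)
   have klip: "\<bar>km v - km w\<bar> <= \<Lambda>*\<bar>v - w\<bar>" for v w
   proof -
    have "km v - km w = (LINT u|\<tau> m. k (v + u) - k (w + u))" unfolding km_def using ki by simp
    also have "\<bar>...\<bar> <= (LINT u|\<tau> m. \<bar>k (v + u) - k (w + u)\<bar>)" by (rule integral_abs_bound)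
    also have "... <= (LINT u|\<tau> m. \<Lambda>*\<bar>v - w\<bar>)"
    proof (rule integral_mono)
     show "\<bar>k (v + u) - k (w + u)\<bar> <= \<Lambda>*\<bar>v - w\<bar>" for u using k(2)[of "v + u" "w + u"] by simp
     show "integrable (\<tau> m) (%u. \<bar>k (v + u) - k (w + u)\<bar>)" using ki by auto
    qed simp
    also have "... = \<Lambda>*\<bar>v - w\<bar>" using T.prob_space by simp
    finally show ?thesis .
   qed
   have kmm[measurable]: "km \<in> borel_measurable borel" unfolding km_def[abs_def] by measurable
   have iV: "integrable M (%om. (abs (V m s om)))" using V_integrable by (rule integrable_abs)
   have ikm: "integrable M (%om. km (V m s om))"
   proof (rule integrable_const_bound[where B=B])
    have "(abs (km v)) <= B" for v
    proof -
     have "(abs (km v)) <= (LINT u|\<tau> m. \<bar>k (v + u)\<bar>)" unfolding km_def by (rule integral_abs_bound)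
     also have "... <= (LINT u|\<tau> m. B)" using ki k(3) by (intro integral_mono) auto
     finally show ?thesis using T.prob_space by simp
    qed
    then show "AE om in M. norm (km (V m s om)) <= B" by simp
   qed measurable
   have dev: "(LINT om|M. \<bar>km (V m s om) - km 0\<bar>) < e/4"
   proof -
    have "(LINT om|M. \<bar>km (V m s om) - km 0\<bar>) <= (LINT om|M. \<Lambda>*(abs (V m s om)))"
    proof (rule integral_mono)
     show "\<bar>km (V m s om) - km 0\<bar> <= \<Lambda>*(abs (V m s om))" for om using klip[of "V m s om" 0] by simp
    qed (use iV ikm in auto)
    also have "... = \<Lambda>*(LINT om|M. (abs (V m s om)))" by simp
    also have "... <= \<Lambda> * sqrt (s2*A2 m)" using Lam by (intro mult_left_mono expectation_abs_V)
    finally show ?thesis using elim by simp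
   qed
   have mean: "\<bar>km 0 - (LINT x|\<mu> 0. k x)\<bar> < e/4"
   proof -
    have "(LINT x|\<mu> 0. k x) = (LINT om|M. k (?X om))" unfolding lawX[symmetric] by (simp add: integral_distr)
    also have "... = (LINT om|M. real_cond_exp M ?F (%om. k (?X om)) om)" by (rule F.real_cond_exp_int(2)[OF iX(2), symmetric])
    also have "... = (LINT om|M. km (V m s om))"
     by (rule integral_cong_AE) (use c2 in \<open>auto simp: km_def\<close>)
    finally have "km 0 - (LINT x|\<mu> 0. k x) = (LINT om|M. km 0 - km (V m s om))" using ikm prob_space by simp
    also have "\<bar>...\<bar> <= (LINT om|M. \<bar>km 0 - km (V m s om)\<bar>)" by (rule integral_abs_bound)
    finally show ?thesis using dev by (simp add: abs_minus_commute)
   qed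
   have kK: "\<bar>(LINT x|\<mu> 0. k x) - (LINT x|\<mu> 0. K x)\<bar> < e/4"
   proof -
    have ik: "integrable (\<mu> 0) k" by (rule L.integrable_const_bound[where B=B]) (use k(3) in auto)
    have "(LINT x|\<mu> 0. k x) - (LINT x|\<mu> 0. K x) = (LINT x|\<mu> 0. k x - K x)" using ik L(1) by simp
    also have "\<bar>...\<bar> <= (LINT x|\<mu> 0. \<bar>k x - K x\<bar>)" by (rule integral_abs_bound)
    finally show ?thesis using k(4) by (simp add: abs_minus_commute)
   qed
   let ?c = "km 0 - (LINT x|\<mu> 0. K x)"
   have c: "\<bar>?c\<bar> < e/2" using mean kK by linarith
   have "(\<integral>om. \<bar>(LINT u|\<tau> m. K (V m s om + u)) - (LINT om|M. K (V 0 0 om))\<bar> \<partial>M) = (LINT om|M. \<bar>?D om + (km (V m s om) - km 0) + ?c\<bar>)"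
   proof (rule integral_cong_AE)
    show "AE om in M. \<bar>(LINT u|\<tau> m. K (V m s om + u)) - (LINT om|M. K (V 0 0 om))\<bar> = \<bar>?D om + (km (V m s om) - km 0) + ?c\<bar>"
     using c1 c2 c3 by eventually_elim (simp add: km_def L(2))
   qed measurable
   also have "... <= (LINT om|M. \<bar>?D om\<bar> + \<bar>km (V m s om) - km 0\<bar> + \<bar>?c\<bar>)"
    using iD ikm by (intro integral_mono) auto
   also have "... = (LINT om|M. \<bar>?D om\<bar>) + (LINT om|M. \<bar>km (V m s om) - km 0\<bar>) + \<bar>?c\<bar>"
    using iD ikm prob_space by simp
   also have "... < e" using Dle dev c by linarith
   finally show "(\<integral>om. \<bar>(LINT u|\<tau> m. K (V m s om + u)) - (LINT om|M. K (V 0 0 om))\<bar> \<partial>M) < e" .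
  qed
 qed
qed

end

section \<open>Taylor remainders under local suprema\<close>

lemma C2_derivatives:
 assumes "C2 f"
 shows "(f has_real_derivative deriv f x) (at x)" "(deriv f has_real_derivative (deriv ^^ 2) f x) (at x)"
  "continuous_on UNIV f" "continuous_on UNIV (deriv f)" "continuous_on UNIV ((deriv ^^ 2) f)"
proof -
 have d: "(deriv ^^ i) f differentiable_on UNIV" if "i < 2" for i using assms that by (simp add: C2_def)
 have d0: "f differentiable_on UNIV" using d[of 0] by simp
 have d1: "deriv f differentiable_on UNIV" using d[of 1] by simp
 have D: "(g has_real_derivative deriv g x) (at x)" if "g differentiable_on UNIV" for g :: "real => real"
  using that by (simp add: DERIV_deriv_iff_real_differentiable differentiable_on_def)
 show "(f has_real_derivative deriv f x) (at x)" by (rule D[OF d0])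
 show "(deriv f has_real_derivative (deriv ^^ 2) f x) (at x)" using D[OF d1] by (simp add: numeral_2_eq_2)
 show "continuous_on UNIV f" by (rule differentiable_imp_continuous_on[OF d0])
 show "continuous_on UNIV (deriv f)" by (rule differentiable_imp_continuous_on[OF d1])
 show "continuous_on UNIV ((deriv ^^ 2) f)" using assms by (simp add: C2_def)
qed

lemma local_sup_upper:
 assumes g: "continuous_on UNIV g" and y: "(abs y) <= \<delta>"
 shows "\<bar>g (w + y)\<bar> <= local_sup g \<delta> w"
proof -
 have "compact ((%y. \<bar>g (w + y)\<bar>) ` {-\<delta>..\<delta>})"
 proof (rule compact_continuous_image)
  show "continuous_on {-\<delta>..\<delta>} (%y. \<bar>g (w + y)\<bar>)"
   by (intro continuous_intros continuous_on_compose2[OF g]) auto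
 qed simp
 then have bdd: "bdd_above ((%y. \<bar>g (w + y)\<bar>) ` {-\<delta>..\<delta>})"
  by (intro bounded_imp_bdd_above compact_imp_bounded)
 have "y \<in> {-\<delta>..\<delta>}" using y by (simp add: abs_le_iff)
 from cSUP_upper[OF this bdd] show ?thesis by (simp add: local_sup_def)
qed

lemma local_sup_nonneg:
 assumes "continuous_on UNIV g" "\<delta> >= 0"
 shows "0 <= local_sup g \<delta> w"
 using local_sup_upper[OF assms(1), of 0 \<delta> w] assms(2) by simp

text \<open>The supremum is uncountable, but it exceeds a level exactly on a union of open sets, one
  for each shift; it is lower semicontinuous.\<close>

lemma local_sup_measurable:
 assumes g: "continuous_on UNIV g" and d: "\<delta> >= 0"
 shows "local_sup g \<delta> \<in> borel_measurable borel"
proof (subst borel_measurable_iff_greater, rule allI)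
 fix c
 have "{w \<in> space borel. c < local_sup g \<delta> w} = (\<Union>y\<in>{-\<delta>..\<delta>}. {w. c < \<bar>g (w + y)\<bar>})"
 proof (intro set_eqI iffI)
  fix w assume "w \<in> {w \<in> space borel. c < local_sup g \<delta> w}"
  then have "c < local_sup g \<delta> w" by simp
  then show "w \<in> (\<Union>y\<in>{-\<delta>..\<delta>}. {w. c < \<bar>g (w + y)\<bar>})"
   unfolding local_sup_def using less_cSUP_iff[of "{-\<delta>..\<delta>}" "%y. \<bar>g (w + y)\<bar>" c] d
   by (metis (mono_tags, lifting) UN_I UnI1 atLeastAtMost_iff cSUP_least mem_Collect_eq not_less neg_le_0_iff_le empty_iff)
 next
  fix w assume "w \<in> (\<Union>y\<in>{-\<delta>..\<delta>}. {w. c < \<bar>g (w + y)\<bar>})"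
  then obtain y where y: "(abs y) <= \<delta>" "c < \<bar>g (w + y)\<bar>" using abs_le_iff by fastforce
  then show "w \<in> {w \<in> space borel. c < local_sup g \<delta> w}" using local_sup_upper[OF g y(1), of w] by simp
 qed
 moreover have "open {w. c < \<bar>g (w + y)\<bar>}" for y
  by (intro open_Collect_less continuous_intros continuous_on_compose2[OF g]) auto
 ultimately show "{w \<in> space borel. c < local_sup g \<delta> w} \<in> sets borel"
  by (simp add: open_UN borel_open)
qed

lemma C2_mean_value_bounds:
 fixes k :: "real => real"
 assumes k: "C2 k" and s: "!!y. (abs y) <= (abs t) ==> \<bar>deriv k (v + y)\<bar> <= S1" "!!y. (abs y) <= (abs t) ==> \<bar>(deriv ^^ 2) k (v + y)\<bar> <= S2"
 shows "\<bar>k (v + t) - k v\<bar> <= (abs t) * S1" "\<bar>deriv k (v + t) - deriv k v\<bar> <= (abs t) * S2"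
  "\<bar>k (v + t) - k v - t*deriv k v\<bar> <= t^2 * S2"
proof -
 have mv: "\<exists>y. (abs y) <= (abs t) & g (v + t) - g v = t*g' (v + y)"
  if D: "!!x. (g has_real_derivative g' x) (at x)" for g g' :: "real => real"
 proof (cases t "0::real" rule: linorder_cases)
  case less
  have "\<exists>z. v + t < z & z < v & g v - g (v + t) = (v - (v + t))*g' z"
   by (rule MVT2) (use less D in auto)
  then obtain z where z: "v + t < z" "z < v" "g v - g (v + t) = (v - (v + t))*g' z" by auto
  show ?thesis by (rule exI[of _ "z - v"]) (use z less in \<open>auto simp: algebra_simps\<close>)
 next
  case equal then show ?thesis by (intro exI[of _ 0]) simp
 next
  case greater
  have "\<exists>z. v < z & z < v + t & g (v + t) - g v = (v + t - v)*g' z"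
   by (rule MVT2) (use greater D in auto)
  then obtain z where z: "v < z" "z < v + t" "g (v + t) - g v = (v + t - v)*g' z" by auto
  show ?thesis by (rule exI[of _ "z - v"]) (use z greater in \<open>auto simp: algebra_simps\<close>)
 qed
 obtain y where y: "(abs y) <= (abs t)" "k (v + t) - k v = t*deriv k (v + y)" using mv[OF C2_derivatives(1)[OF k]] by auto
 show "\<bar>k (v + t) - k v\<bar> <= (abs t) * S1" unfolding y(2) abs_mult by (intro mult_left_mono s(1) y(1)) simp
 obtain y' where y': "(abs y') <= (abs t)" "deriv k (v + t) - deriv k v = t*(deriv ^^ 2) k (v + y')" using mv[OF C2_derivatives(2)[OF k]] by auto
 show "\<bar>deriv k (v + t) - deriv k v\<bar> <= (abs t) * S2" unfolding y'(2) abs_mult by (intro mult_left_mono s(2) y'(1)) simp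
 have "((%x. k x - x*deriv k v) has_real_derivative (deriv k x - deriv k v)) (at x)" for x
  by (rule derivative_eq_intros C2_derivatives(1)[OF k] refl | simp)+
 from mv[OF this] obtain z where z: "(abs z) <= (abs t)" "(k (v + t) - (v + t)*deriv k v) - (k v - v * deriv k v) = t*(deriv k (v + z) - deriv k v)" by auto
 have "\<exists>y. (abs y) <= (abs z) & deriv k (v + z) - deriv k v = z*(deriv ^^ 2) k (v + y)"
 proof (cases z "0::real" rule: linorder_cases)
  case less
  have "\<exists>u. v + z < u & u < v & deriv k v - deriv k (v + z) = (v - (v + z))*(deriv ^^ 2) k u"
   by (rule MVT2) (use less C2_derivatives(2)[OF k] in auto)
  then obtain u where u: "v + z < u" "u < v" "deriv k v - deriv k (v + z) = (v - (v + z))*(deriv ^^ 2) k u" by auto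
  show ?thesis by (rule exI[of _ "u - v"]) (use u less in \<open>auto simp: algebra_simps\<close>)
 next
  case equal then show ?thesis by (intro exI[of _ 0]) simp
 next
  case greater
  have "\<exists>u. v < u & u < v + z & deriv k (v + z) - deriv k v = (v + z - v)*(deriv ^^ 2) k u"
   by (rule MVT2) (use greater C2_derivatives(2)[OF k] in auto)
  then obtain u where u: "v < u" "u < v + z" "deriv k (v + z) - deriv k v = (v + z - v)*(deriv ^^ 2) k u" by auto
  show ?thesis by (rule exI[of _ "u - v"]) (use u greater in \<open>auto simp: algebra_simps\<close>)
 qed
 then obtain y2 where y2: "(abs y2) <= (abs z)" "deriv k (v + z) - deriv k v = z*(deriv ^^ 2) k (v + y2)" by auto
 have e: "k (v + t) - k v - t*deriv k v = t*(z*(deriv ^^ 2) k (v + y2))"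
  using z(2) unfolding y2(2) by (simp add: algebra_simps)
 have "\<bar>(deriv ^^ 2) k (v + y2)\<bar> <= S2" by (rule s(2)) (use y2(1) z(1) in linarith)
 then have "(abs z)*\<bar>(deriv ^^ 2) k (v + y2)\<bar> <= (abs t) * S2" using z(1) by (intro mult_mono) auto
 then have "(abs t)*((abs z)*\<bar>(deriv ^^ 2) k (v + y2)\<bar>) <= (abs t)*((abs t) * S2)" by (intro mult_left_mono) auto
 then show "\<bar>k (v + t) - k v - t*deriv k v\<bar> <= t^2 * S2"
  unfolding e abs_mult by (simp add: power2_eq_square flip: mult.assoc)
qed

text \<open>The remainder is of order |t|^h with h = p/q, between its orders for small and for large
  t. For |t| <= \<delta> the second derivative is controlled and t^2 <= \<delta>^{2-h} |t|^h. For
  larger t no derivative is controlled along the way, so each term is estimated alone; then the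
  values at v + t appear, which the last two norms of Condition B control.\<close>

lemma C2_remainder_bounds:
 fixes k :: "real => real" and v :: real
 assumes k: "C2 k" and d: "\<delta> > 0" and h: "1 <= h" "h <= 2"
 defines "S \<equiv> %i. local_sup ((deriv ^^ i) k) \<delta> v"
 shows "\<bar>k (v + t) - k v - t*deriv k v\<bar> <= (\<delta> powr (- h) + \<delta> powr (1 - h) + \<delta> powr (2 - h))*((abs t) powr h*(S 0 + S 1 + S 2 + \<bar>k (v + t)\<bar>))" (is "?L <= ?C*(?T*?R)")
  "\<bar>deriv k (v + t) - deriv k v\<bar> <= (abs t) * S 2 + ((abs t) * S 1 + \<bar>t*deriv k (v + t)\<bar>)/\<delta>"
proof -
 note c = C2_derivatives[OF k]
 have nn: "0 <= S i" if "i <= 2" for i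
  unfolding S_def using that c d by (intro local_sup_nonneg) (auto simp: le_Suc_eq numeral_2_eq_2)
 have n0: "0 <= S 0" "0 <= S 1" "0 <= S 2" using nn by auto
 have up: "(abs y) <= \<delta> ==> \<bar>k (v + y)\<bar> <= S 0" "(abs y) <= \<delta> ==> \<bar>deriv k (v + y)\<bar> <= S 1" "(abs y) <= \<delta> ==> \<bar>(deriv ^^ 2) k (v + y)\<bar> <= S 2" for y
  unfolding S_def using local_sup_upper[OF c(3), of y \<delta> v] local_sup_upper[OF c(4), of y \<delta> v] local_sup_upper[OF c(5), of y \<delta> v] by auto
 have z: "(abs (k v)) <= S 0" "(abs (deriv k v)) <= S 1" using up(1)[of 0] up(2)[of 0] d by auto
 have Tn: "?T >= 0" "?R >= 0" using n0 by auto
 have Cn: "\<delta> powr (- h) >= 0" "\<delta> powr (1 - h) >= 0" "\<delta> powr (2 - h) >= 0" by auto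
 show "?L <= ?C*(?T*?R)"
 proof (cases "(abs t) <= \<delta>")
  case True
  have "?L <= t^2 * S 2"
   by (rule C2_mean_value_bounds(3)[OF k up(2,3)]) (use True in linarith)+
  also have "t^2 <= \<delta> powr (2 - h)*?T"
  proof (cases "t = 0")
   case False
   have "t^2 = (abs t) powr 2" using False by (simp add: powr_numeral)
   also have "... = (abs t) powr (2 - h)*(abs t) powr h" by (simp add: powr_add[symmetric])
   also have "... <= \<delta> powr (2 - h)*(abs t) powr h" using True h by (intro mult_right_mono powr_mono2) auto
   finally show ?thesis .
  qed simp
  then have "t^2 * S 2 <= (\<delta> powr (2 - h)*?T)*?R" using n0 Tn by (intro mult_mono) auto
  also have "... <= ?C*(?T*?R)" unfolding mult.assoc using Cn Tn by (intro mult_right_mono) auto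
  finally show ?thesis .
 next
  case False
  then have t: "(abs t) > \<delta>" by simp
  have 1: "1 <= \<delta> powr (- h)*?T"
  proof -
   have "\<delta> powr (- h)*\<delta> powr h <= \<delta> powr (- h)*(abs t) powr h" using t d h by (intro mult_left_mono powr_mono2) auto
   then show ?thesis using d by (simp flip: powr_add)
  qed
  have 2: "(abs t) <= \<delta> powr (1 - h)*?T"
  proof -
   have "(abs t) powr (1 - h) <= \<delta> powr (1 - h)" using t d h by (intro powr_mono2') auto
   then have "(abs t) powr (1 - h)*?T <= \<delta> powr (1 - h)*?T" by (intro mult_right_mono) auto
   then show ?thesis using t d by (simp flip: powr_add)
  qed
  have "?L <= 1*(\<bar>k (v + t)\<bar> + S 0) + (abs t) * S 1"
  proof -
   have "\<bar>t*deriv k v\<bar> <= (abs t) * S 1" unfolding abs_mult using z by (intro mult_left_mono) auto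
   moreover have "\<bar>A - B - C\<bar> <= 1*((abs A) + B') + C'" if "(abs B) <= B'" "(abs C) <= C'" for A B C B' C' :: real
    using that by (smt (verit))
   ultimately show ?thesis using z(1) by blast
  qed
  also have "... <= (\<delta> powr (- h)*?T)*(\<bar>k (v + t)\<bar> + S 0) + (\<delta> powr (1 - h)*?T) * S 1"
   using 1 2 n0 by (intro add_mono mult_right_mono) auto
  also have "... <= (\<delta> powr (- h)*?T)*?R + (\<delta> powr (1 - h)*?T)*?R"
  proof -
   have "\<bar>k (v + t)\<bar> + S 0 <= ?R" "S 1 <= ?R" using n0 by auto
   then show ?thesis by (intro add_mono[OF mult_left_mono mult_left_mono]) auto
  qed
  also have "... = (\<delta> powr (- h) + \<delta> powr (1 - h))*(?T*?R)" by (simp add: algebra_simps)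
  also have "... <= ?C*(?T*?R)" using Cn Tn by (intro mult_right_mono) auto
  finally show ?thesis .
 qed
 show "\<bar>deriv k (v + t) - deriv k v\<bar> <= (abs t) * S 2 + ((abs t) * S 1 + \<bar>t*deriv k (v + t)\<bar>)/\<delta>"
 proof (cases "(abs t) <= \<delta>")
  case True
  have "\<bar>deriv k (v + t) - deriv k v\<bar> <= (abs t) * S 2"
   by (rule C2_mean_value_bounds(2)[OF k up(2,3)]) (use True in linarith)+
  moreover have "0 <= ((abs t) * S 1 + \<bar>t*deriv k (v + t)\<bar>)/\<delta>" using n0 d by simp
  ultimately show ?thesis by linarith
 next
  case False
  have "\<delta>*\<bar>deriv k (v + t) - deriv k v\<bar> <= (abs t)*(S 1 + \<bar>deriv k (v + t)\<bar>)"
   using False d z by (intro mult_mono) auto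
  also have "... = (abs t) * S 1 + \<bar>t*deriv k (v + t)\<bar>" by (simp add: abs_mult algebra_simps)
  finally have "\<bar>deriv k (v + t) - deriv k v\<bar> <= ((abs t) * S 1 + \<bar>t*deriv k (v + t)\<bar>)/\<delta>"
   using d by (simp add: field_simps)
  moreover have "0 <= (abs t) * S 2" using n0 by simp
  ultimately show ?thesis by linarith
 qed
qed

context linear_process
begin

text \<open>By independence the norms multiply in the same L^q, whereas Hoelder's inequality would
  ask for higher moments.\<close>

lemma nrm_le_indep_mult:
 fixes f g :: "real => real"
 assumes f: "f \<in> borel_measurable borel" "nrm_le M q (%om. f (V m s om)) b"
  and g: "g \<in> borel_measurable borel" "nrm_le M q (%om. g (\<xi> (s + 1) om)) c"
 shows "nrm_le M q (%om. f (V m s om)*g (\<xi> (s + 1) om)) (b*c)"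
proof -
 note [measurable] = f(1) g(1)
 let ?f = "%om. \<bar>f (V m s om)\<bar> powr q" and ?g = "%om. \<bar>g (\<xi> (s + 1) om)\<bar> powr q"
 have mf: "?f \<in> borel_measurable (field_of {..s})"
 proof -
  have [measurable]: "V m s \<in> borel_measurable (field_of {..s})" by (rule V_field)
  show ?thesis by measurable
 qed
 have mg: "?g \<in> borel_measurable (field_of {s+1})"
 proof -
  have [measurable]: "\<xi> (s+1) \<in> borel_measurable (field_of {s+1})" by (rule xi_field_of) simp
  show ?thesis by measurable
 qed
 have ind: "indep_var borel ?f borel ?g" by (rule indep_field_of''[OF _ mf mg]) simp
 have i: "integrable M ?f" "integrable M ?g" using f(2) g(2) by (simp_all add: nrm_le_def)
 have e: "(%om. \<bar>f (V m s om)*g (\<xi> (s + 1) om)\<bar> powr q) = (%om. ?f om*?g om)" by (simp add: abs_mult powr_mult)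
 have bc: "b >= 0" "c >= 0" using f(2) g(2) by (simp_all add: nrm_le_def)
 show ?thesis unfolding nrm_le_def
 proof (intro conjI)
  show "0 <= b*c" using bc by simp
  show "(%om. f (V m s om)*g (\<xi> (s + 1) om)) \<in> borel_measurable M" by measurable
  show "integrable M (%om. \<bar>f (V m s om)*g (\<xi> (s + 1) om)\<bar> powr q)" unfolding e by (rule indep_var_integrable[OF ind i])
  have "(LINT om|M. ?f om*?g om) = (LINT om|M. ?f om)*(LINT om|M. ?g om)" by (rule indep_var_lebesgue_integral[OF ind i])
  also have "... <= b powr q*c powr q" using f(2) g(2) by (intro mult_mono Bochner_Integration.integral_nonneg) (simp_all add: nrm_le_def)
  finally show "(LINT om|M. \<bar>f (V m s om)*g (\<xi> (s + 1) om)\<bar> powr q) <= (b*c) powr q" unfolding e by (simp add: powr_mult)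
 qed
qed

lemma distr_U_xi: "distr M (borel \<Otimes>\<^sub>M borel) (%om. (U 0 m s om, \<xi> (s - int m) om)) = \<tau> m \<Otimes>\<^sub>M \<nu>"
proof -
 have "distr M borel (U 0 m s) \<Otimes>\<^sub>M distr M borel (\<xi> (s - int m)) = distr M (borel \<Otimes>\<^sub>M borel) (%om. (U 0 m s om, \<xi> (s - int m) om))"
  by (rule distr_field_of_pair[of "{s - int m<..s}" "{s - int m}"]) (auto intro: U_field xi_field_of)
 then show ?thesis by (simp add: distr_U distr_xi)
qed

text \<open>The oldest innovation of the block is split off, which gives K_{m+1}(w) = E K_m(w + a_m
  \<xi>).\<close>

lemma tau_Suc:
 fixes K :: "real => real"
 assumes K[measurable]: "K \<in> borel_measurable borel" and int: "integrable (\<tau> (Suc m)) (%u. K (w + u))"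
 shows "integrable \<nu> (%y. \<integral>u. K (w + a m*y + u) \<partial>\<tau> m)"
  "(\<integral>u. K (w + u) \<partial>\<tau> (Suc m)) = (\<integral>y. \<integral>u. K (w + a m*y + u) \<partial>\<tau> m \<partial>\<nu>)"
proof -
 interpret T: prob_space "\<tau> m" by (rule prob_space_tau)
 interpret N: prob_space "\<nu>" by (rule prob_space_nu)
 interpret P: pair_sigma_finite "\<tau> m" "\<nu>" ..
 have U: "U 0 (Suc m) 0 om = U 0 m 0 om + a m*\<xi> (0 - int m) om" for om by (simp add: U_def)
 let ?h = "%u y. K (w + a m*y + u)"
 have int': "integrable M (%om. K (w + U 0 (Suc m) 0 om))" "(\<integral>u. K (w + u) \<partial>\<tau> (Suc m)) = (LINT om|M. K (w + U 0 (Suc m) 0 om))"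
  using int unfolding \<tau>_def by (simp_all add: integrable_distr_eq integral_distr)
 have e: "K (w + U 0 (Suc m) 0 om) = (%(u, y). ?h u y) (U 0 m 0 om, \<xi> (0 - int m) om)" for om by (simp add: U add.assoc add.commute add.left_commute)
 have i: "integrable (\<tau> m \<Otimes>\<^sub>M \<nu>) (%(u, y). ?h u y)" "(LINT om|M. K (w + U 0 (Suc m) 0 om)) = integral\<^sup>L (\<tau> m \<Otimes>\<^sub>M \<nu>) (%(u, y). ?h u y)"
  unfolding distr_U_xi[of m 0, symmetric]
  using int'(1) unfolding e by (simp_all add: integrable_distr_eq integral_distr)
 show "integrable \<nu> (%y. \<integral>u. K (w + a m*y + u) \<partial>\<tau> m)" by (rule P.integrable_snd[OF i(1)])
 show "(\<integral>u. K (w + u) \<partial>\<tau> (Suc m)) = (\<integral>y. \<integral>u. K (w + a m*y + u) \<partial>\<tau> m \<partial>\<nu>)"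
  unfolding int'(2) i(2) by (rule P.integral_snd[OF i(1), symmetric])
qed

end

text \<open>Condition B in terms of lag and time. With n = m + 1, X_{n,0} is
  \<open>V (Suc m) 0\<close> and X_{n,1} is \<open>V (Suc m) 0\<close> plus \<open>a m\<close> times
  \<xi>_1; stationarity then moves time 0 to any \<open>s\<close>. One bound \<open>b\<close> and
  one threshold \<open>n0\<close> replace the O(1) condition.\<close>

locale smooth_process = linear_process M \<xi> a for M :: "'a measure" and \<xi> :: "int => 'a => real" and a :: "nat => real" +
 fixes K :: "real => real" and p q \<delta> b \<kappa> :: real and n0 :: nat
 assumes pq: "2 <= q" "q < p" "p <= 2*q" and pm: "integrable \<nu> (%y. (abs y) powr p)"
  and K_meas: "K \<in> borel_measurable borel" and delta: "\<delta> > 0"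
  and a_pos: "!!i. 0 < a i"
  and dens: "!!m. \<exists>f. continuous_on UNIV f & (\<forall>x. 0 <= f x) & \<mu> m = density lborel (%x. ennreal (f x))"
  and Kn_int: "!!m w. n0 <= m ==> integrable (\<tau> m) (%u. K (w + u))"
  and Kn_C2: "!!m. n0 <= m ==> C2 (%w. \<integral>u. K (w + u) \<partial>\<tau> m)"
  and sup_le: "!!i m s. i <= 2 ==> n0 <= m ==>
   nrm_le M q (%om. local_sup ((deriv ^^ i) (%w. \<integral>u. K (w + u) \<partial>\<tau> m)) \<delta> (V (Suc m) s om)) b"
  and xi_Kn_le: "!!m s. n0 <= m ==>
   nrm_le M q (%om. \<bar>\<xi> (s + 1) om\<bar> powr (p/q)*(LINT u|\<tau> m. K (V (Suc m) s om + a m*\<xi> (s + 1) om + u))) b"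
  and xi_Kd_le: "!!m s. n0 <= m ==>
   nrm_le M q (%om. \<xi> (s + 1) om*deriv (%w. \<integral>u. K (w + u) \<partial>\<tau> m) (V (Suc m) s om + a m*\<xi> (s + 1) om)) b"
  and K_int: "\<forall>\<^sub>F w in nhds 0. integrable M (%om. K (w + V 0 0 om))"
  and K_inf_deriv: "((%w. \<integral>om. K (w + V 0 0 om) \<partial>M) has_real_derivative \<kappa>) (at 0)"
begin

definition Kn :: "nat => real => real" where "Kn m w = (LINT u|\<tau> m. K (w + u))"

definition S :: "nat => nat => real => real" where "S i m = local_sup ((deriv ^^ i) (Kn m)) \<delta>"

text \<open>K_m' at the predictor with lag m. Going one step back in time raises the lag by one, so
  for fixed m + s this is a martingale in s, and letting the lag grow runs it backwards.\<close>

definition Y :: "nat => int => 'a => real" where "Y m s om = deriv (Kn m) (V m s om)"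

definition P :: real where "P = max ((LINT y|\<nu>. (abs y) powr p) powr (1/q)) ((LINT y|\<nu>. (abs y) powr q) powr (1/q))"

lemma b_nonneg: "b >= 0" by (rule nrm_le_nonneg[OF sup_le[of 0 n0 0]]) auto

lemma Kn_eq: "Kn m = (%w. \<integral>u. K (w + u) \<partial>\<tau> m)" by (simp add: Kn_def[abs_def])

lemma Kn_smooth: "n0 <= m ==> C2 (Kn m)" unfolding Kn_eq by (rule Kn_C2)

lemma Kn_measurable:
 assumes "n0 <= m"
 shows "Kn m \<in> borel_measurable borel" "deriv (Kn m) \<in> borel_measurable borel"
 using C2_derivatives(3,4)[OF Kn_smooth[OF assms]] by (auto intro: borel_measurable_continuous_onI)

lemma S_measurable: "i <= 2 ==> n0 <= m ==> S i m \<in> borel_measurable borel"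
 and S_nonneg: "i <= 2 ==> n0 <= m ==> 0 <= S i m v"
 and S_upper: "i <= 2 ==> n0 <= m ==> (abs y) <= \<delta> ==> \<bar>(deriv ^^ i) (Kn m) (v + y)\<bar> <= S i m v"
proof -
 assume i: "i <= 2" "n0 <= m"
 have c: "continuous_on UNIV ((deriv ^^ i) (Kn m))"
  using C2_derivatives(3-5)[OF Kn_smooth[OF i(2)]] i(1) by (auto simp: le_Suc_eq numeral_2_eq_2)
 show "S i m \<in> borel_measurable borel" unfolding S_def by (rule local_sup_measurable[OF c]) (use delta in simp)
 show "0 <= S i m v" unfolding S_def by (rule local_sup_nonneg[OF c]) (use delta in simp)
 show "\<bar>(deriv ^^ i) (Kn m) (v + y)\<bar> <= S i m v" if "(abs y) <= \<delta>" unfolding S_def by (rule local_sup_upper[OF c that])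
qed

lemma S_le: "i <= 2 ==> n0 <= m ==> nrm_le M q (%om. S i m (V (Suc m) s om)) b"
 unfolding S_def Kn_eq by (rule sup_le)

lemma Kn_le:
 assumes "n0 <= m"
 shows "nrm_le M q (%om. Kn m (V (Suc m) s om)) b" "nrm_le M q (%om. deriv (Kn m) (V (Suc m) s om)) b"
proof -
 note [measurable] = Kn_measurable[OF assms]
 have 0: "(abs (Kn m v)) <= (abs (S 0 m v))" for v using S_upper[OF _ assms, of 0 0 v] delta by simp
 have 1: "\<bar>deriv (Kn m) v\<bar> <= (abs (S 1 m v))" for v using S_upper[OF _ assms, of 1 0 v] delta by simp
 show "nrm_le M q (%om. Kn m (V (Suc m) s om)) b"
  by (rule nrm_le_dominated[OF S_le[OF _ assms, of 0]]) (use pq 0 in \<open>auto intro!: AE_I2\<close>)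
 show "nrm_le M q (%om. deriv (Kn m) (V (Suc m) s om)) b"
  by (rule nrm_le_dominated[OF S_le[OF _ assms, of 1]]) (use pq 1 in \<open>auto intro!: AE_I2\<close>)
qed

lemma P_nonneg: "P >= 0" by (simp add: P_def le_max_iff_disj)

lemma xi_powr_le: "nrm_le M q (%om. \<bar>\<xi> s om\<bar> powr (p/q)) P" "nrm_le M q (\<xi> s) P"
proof -
 have N: "nrm_le M q (%om. f (\<xi> s om)) ((LINT y|\<nu>. (abs (f y)) powr q) powr (1/q))"
  if f: "f \<in> borel_measurable borel" and i: "integrable \<nu> (%y. (abs (f y)) powr q)" for f :: "real => real"
 proof -
  note [measurable] = f
  have m: "(%y. (abs (f y)) powr q) \<in> borel_measurable borel" by measurable
  have n: "(LINT y|\<nu>. (abs (f y)) powr q) >= 0" by (rule Bochner_Integration.integral_nonneg) simp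
  show ?thesis unfolding nrm_le_def using integrable_xi_iff[OF m, of s] i n pq by (simp add: powr_powr)
 qed
 have "integrable \<nu> (%y. \<bar>(abs y) powr (p/q)\<bar> powr q)" using pm pq by (simp add: powr_powr)
 from N[OF _ this] have "nrm_le M q (%om. \<bar>\<xi> s om\<bar> powr (p/q)) ((LINT y|\<nu>. \<bar>(abs y) powr (p/q)\<bar> powr q) powr (1/q))" by simp
 then show "nrm_le M q (%om. \<bar>\<xi> s om\<bar> powr (p/q)) P"
  by (rule nrm_le_mono) (use pq in \<open>auto simp: P_def powr_powr\<close>)
 interpret N: prob_space \<nu> by (rule prob_space_nu)
 have "integrable \<nu> (%y. (abs y) powr q)"
 proof (rule Bochner_Integration.integrable_bound)
  show "integrable \<nu> (%y. 1 + (abs y) powr p)" using pm by simp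
  show "AE y in \<nu>. norm ((abs y) powr q) <= norm (1 + (abs y) powr p)"
  proof (rule AE_I2)
   fix y :: real
   have "(abs y) powr q <= 1 + (abs y) powr p"
   proof (cases "(abs y) <= 1")
    case True
    then have "(abs y) powr q <= 1" using pq by (intro powr_le1) auto
    then show ?thesis by (smt (verit) powr_ge_zero)
   next
    case False
    then have "(abs y) powr q <= (abs y) powr p" using pq by (intro powr_mono) auto
    then show ?thesis by simp
   qed
   then show "norm ((abs y) powr q) <= norm (1 + (abs y) powr p)" by simp
  qed
 qed measurable
 from N[OF _ this] have "nrm_le M q (\<xi> s) ((LINT y|\<nu>. (abs y) powr q) powr (1/q))" by simp
 then show "nrm_le M q (\<xi> s) P" by (rule nrm_le_mono) (use pq in \<open>auto simp: P_def\<close>)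
qed

definition c1 :: real where
 "c1 = (\<delta> powr (- (p/q)) + \<delta> powr (1 - p/q) + \<delta> powr (2 - p/q))*(3*(b*P) + b)"

text \<open>The summand 1 makes the constant strictly positive, as the martingale inequality
  requires of its bounds.\<close>

definition c2 :: real where "c2 = b*P + (b*P + b)/\<delta> + 1"

lemma c12: "c1 >= 0" "c2 > 0" unfolding c1_def c2_def using b_nonneg P_nonneg delta by (auto intro!: mult_nonneg_nonneg add_nonneg_nonneg add_nonneg_pos)

text \<open>The local suprema sit at the old predictor and are independent of the new innovation, so
  each contributes \<open>b*P\<close>. The terms at the new predictor are not independent of it and
  are bounded by \<open>b\<close> directly. Hence the three copies of \<open>b*P\<close> and the one
  \<open>b\<close> in \<open>c1\<close>.\<close>

lemma remainder_le:
 assumes m: "n0 <= m"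
 shows "nrm_le M q (%om. Kn m (V (Suc m) s om + a m*\<xi> (s + 1) om) - Kn m (V (Suc m) s om)
   - a m*\<xi> (s + 1) om*deriv (Kn m) (V (Suc m) s om)) (c1 * a m powr (p/q))"
  "nrm_le M q (%om. deriv (Kn m) (V (Suc m) s om + a m*\<xi> (s + 1) om) - deriv (Kn m) (V (Suc m) s om)) (c2 * a m)"
proof -
 note [measurable] = Kn_measurable[OF m] S_measurable[OF _ m]
 define h where "h = p/q"
 have h: "1 <= h" "h <= 2" using pq by (auto simp: h_def field_simps)
 define v where "v om = V (Suc m) s om" for om
 define x where "x om = \<xi> (s + 1) om" for om
 have [measurable]: "v \<in> borel_measurable M" "x \<in> borel_measurable M" by (simp_all add: v_def[abs_def] x_def[abs_def])
 have am: "a m > 0" by (rule a_pos)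
 have SP: "nrm_le M q (%om. S i m (v om)*(abs (x om)) powr h) (b*P)" "nrm_le M q (%om. S i m (v om)*x om) (b*P)" if "i <= 2" for i
 proof -
  show "nrm_le M q (%om. S i m (v om)*(abs (x om)) powr h) (b*P)" unfolding v_def x_def h_def
   by (rule nrm_le_indep_mult[OF S_measurable[OF that m] S_le[OF that m] _ xi_powr_le(1)]) simp
  show "nrm_le M q (%om. S i m (v om)*x om) (b*P)" unfolding v_def x_def
   by (rule nrm_le_indep_mult[OF S_measurable[OF that m] S_le[OF that m] _ xi_powr_le(2)]) simp
 qed
 let ?D = "\<delta> powr (- h) + \<delta> powr (1 - h) + \<delta> powr (2 - h)"
 have B: "nrm_le M q (%om. (abs (x om)) powr h*Kn m (v om + a m*x om)) b"
  unfolding v_def x_def h_def Kn_eq by (rule xi_Kn_le[OF m])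
 have B': "nrm_le M q (%om. \<bar>(abs (x om)) powr h*Kn m (v om + a m*x om)\<bar>) b"
  by (rule nrm_le_dominated[OF B]) (use pq in auto)
 have C: "nrm_le M q (%om. x om*deriv (Kn m) (v om + a m*x om)) b"
  unfolding v_def x_def Kn_eq by (rule xi_Kd_le[OF m])
 have abs: "nrm_le M q (%om. (abs (f om))) c" if "nrm_le M q f c" for f c
  by (rule nrm_le_dominated[OF that]) (use pq nrm_le_meas[OF that] in auto)
 have q1: "q >= 1" "q >= 0" using pq by auto
 let ?R = "%om. S 0 m (v om)*(abs (x om)) powr h + S 1 m (v om)*(abs (x om)) powr h + S 2 m (v om)*(abs (x om)) powr h + \<bar>(abs (x om)) powr h*Kn m (v om + a m*x om)\<bar>"
 have R: "nrm_le M q ?R (b*P + b*P + b*P + b)"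
  by (intro nrm_le_add SP B' q1) auto
 have R': "nrm_le M q (%om. (?D * a m powr h)*?R om) (\<bar>?D * a m powr h\<bar>*(b*P + b*P + b*P + b))"
  by (rule nrm_le_scale[OF R q1(2)])
 have "nrm_le M q (%om. Kn m (v om + a m*x om) - Kn m (v om) - a m*x om*deriv (Kn m) (v om)) (\<bar>?D * a m powr h\<bar>*(b*P + b*P + b*P + b))"
 proof (rule nrm_le_dominated[OF R' _ _ q1(2)])
  show "AE om in M. \<bar>Kn m (v om + a m*x om) - Kn m (v om) - a m*x om*deriv (Kn m) (v om)\<bar> <= \<bar>(?D * a m powr h)*?R om\<bar>"
  proof (rule AE_I2)
   fix om
   have "\<bar>Kn m (v om + a m*x om) - Kn m (v om) - a m*x om*deriv (Kn m) (v om)\<bar>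
    <= ?D*(\<bar>a m*x om\<bar> powr h*(S 0 m (v om) + S 1 m (v om) + S 2 m (v om) + \<bar>Kn m (v om + a m*x om)\<bar>))"
    unfolding S_def by (rule C2_remainder_bounds(1)[OF Kn_smooth[OF m] delta h])
   also have "\<bar>a m*x om\<bar> powr h = a m powr h*(abs (x om)) powr h" using am by (simp add: abs_mult powr_mult)
   also have "?D*(a m powr h*(abs (x om)) powr h*(S 0 m (v om) + S 1 m (v om) + S 2 m (v om) + \<bar>Kn m (v om + a m*x om)\<bar>)) = (?D * a m powr h)*?R om"
    by (simp add: abs_mult ring_distribs mult.assoc mult.commute mult.left_commute)
   finally show "\<bar>Kn m (v om + a m*x om) - Kn m (v om) - a m*x om*deriv (Kn m) (v om)\<bar> <= \<bar>(?D * a m powr h)*?R om\<bar>"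
    by (rule order_trans[OF _ abs_ge_self])
  qed
 qed measurable
 moreover have "\<bar>?D * a m powr h\<bar>*(b*P + b*P + b*P + b) = c1 * a m powr h"
 proof -
  have "?D * a m powr h >= 0" by simp
  then show ?thesis unfolding c1_def h_def[symmetric] by (simp add: algebra_simps)
 qed
 ultimately show "nrm_le M q (%om. Kn m (V (Suc m) s om + a m*\<xi> (s + 1) om) - Kn m (V (Suc m) s om)
   - a m*\<xi> (s + 1) om*deriv (Kn m) (V (Suc m) s om)) (c1 * a m powr (p/q))" by (simp only: v_def x_def h_def)
 let ?Q = "%om. \<bar>S 2 m (v om)*x om\<bar> + (1/\<delta>)*(\<bar>S 1 m (v om)*x om\<bar> + \<bar>x om*deriv (Kn m) (v om + a m*x om)\<bar>)"
 have Q: "nrm_le M q ?Q (b*P + \<bar>1/\<delta>\<bar>*(b*P + b))"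
  by (intro nrm_le_add nrm_le_scale abs SP C q1) auto
 have Q': "nrm_le M q (%om. a m*?Q om) ((abs (a m))*(b*P + \<bar>1/\<delta>\<bar>*(b*P + b)))" by (rule nrm_le_scale[OF Q q1(2)])
 have "nrm_le M q (%om. deriv (Kn m) (v om + a m*x om) - deriv (Kn m) (v om)) ((abs (a m))*(b*P + \<bar>1/\<delta>\<bar>*(b*P + b)))"
 proof (rule nrm_le_dominated[OF Q' _ _ q1(2)])
  show "AE om in M. \<bar>deriv (Kn m) (v om + a m*x om) - deriv (Kn m) (v om)\<bar> <= \<bar>a m*?Q om\<bar>"
  proof (rule AE_I2)
   fix om
   have "\<bar>deriv (Kn m) (v om + a m*x om) - deriv (Kn m) (v om)\<bar>
    <= \<bar>a m*x om\<bar> * S 2 m (v om) + (\<bar>a m*x om\<bar> * S 1 m (v om) + \<bar>a m*x om*deriv (Kn m) (v om + a m*x om)\<bar>)/\<delta>"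
    unfolding S_def by (rule C2_remainder_bounds(2)[OF Kn_smooth[OF m] delta h])
   also have "... = a m*?Q om"
    using am S_nonneg[OF _ m, of 2 "v om"] S_nonneg[OF _ m, of 1 "v om"] delta by (simp add: abs_mult field_simps)
   finally show "\<bar>deriv (Kn m) (v om + a m*x om) - deriv (Kn m) (v om)\<bar> <= \<bar>a m*?Q om\<bar>"
    by (rule order_trans[OF _ abs_ge_self])
  qed
 qed measurable
 then have "nrm_le M q (%om. deriv (Kn m) (v om + a m*x om) - deriv (Kn m) (v om)) (c2 * a m)"
 proof (rule nrm_le_mono[OF _ _ q1(2)])
  have "(abs (a m))*(b*P + \<bar>1/\<delta>\<bar>*(b*P + b)) = a m*(b*P + (b*P + b)/\<delta>)" using am delta by simp
  also have "... <= a m*c2" using am by (intro mult_left_mono) (auto simp: c2_def)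
  finally show "(abs (a m))*(b*P + \<bar>1/\<delta>\<bar>*(b*P + b)) <= c2 * a m" by (simp add: mult.commute)
 qed
 then show "nrm_le M q (%om. deriv (Kn m) (V (Suc m) s om + a m*\<xi> (s + 1) om) - deriv (Kn m) (V (Suc m) s om)) (c2 * a m)"
  unfolding v_def x_def .
qed

text \<open>The innovation is centered, so the linear term drops out and only the change from K_m to
  K_{m+1} remains. Since conditioning is a contraction, this change inherits the bound of the
  remainder.\<close>

lemma cond_exp_step:
 assumes m: "n0 <= m"
 shows "AE om in M. real_cond_exp M (past_field M \<xi> s) (%om. Kn m (V (Suc m) s om + a m*\<xi> (s + 1) om) - Kn m (V (Suc m) s om)
   - a m*\<xi> (s + 1) om*deriv (Kn m) (V (Suc m) s om)) om = Kn (Suc m) (V (Suc m) s om) - Kn m (V (Suc m) s om)"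
proof -
 note [measurable] = Kn_measurable[OF m]
 interpret N: prob_space \<nu> by (rule prob_space_nu)
 let ?h = "%(v, y). Kn m (v + a m*y) - Kn m v - a m*y*deriv (Kn m) v"
 have mh: "?h \<in> borel_measurable (borel \<Otimes>\<^sub>M borel)" by measurable
 have i: "integrable M (%om. ?h (V (Suc m) s om, \<xi> (s + 1) om))"
  using nrm_le_integrable[OF remainder_le(1)[OF m]] pq by simp
 have e: "(LINT y|\<nu>. ?h (v, y)) = Kn (Suc m) v - Kn m v" for v
 proof -
  have int: "integrable \<nu> (%y. Kn m (v + a m*y))" "Kn (Suc m) v = (LINT y|\<nu>. Kn m (v + a m*y))"
   using tau_Suc[OF K_meas Kn_int[of "Suc m" v]] m unfolding Kn_eq by auto
  have "(LINT y|\<nu>. ?h (v, y)) = (LINT y|\<nu>. Kn m (v + a m*y)) - Kn m v - a m*(LINT y|\<nu>. y)*deriv (Kn m) v"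
   using int(1) nu_moments(1) N.prob_space by simp
  then show ?thesis using int(2) nu_moments(2) by simp
 qed
 show ?thesis using cond_exp_V_xi[OF mh i] unfolding e by simp
qed

lemma Kn_diff_le:
 assumes m: "n0 <= m"
 shows "nrm_le M q (%om. Kn (Suc m) (V (Suc m) s om) - Kn m (V (Suc m) s om)) (c1 * a m powr (p/q))"
proof (rule nrm_le_cong_AE)
 show "nrm_le M q (real_cond_exp M (past_field M \<xi> s) (%om. Kn m (V (Suc m) s om + a m*\<xi> (s + 1) om) - Kn m (V (Suc m) s om)
   - a m*\<xi> (s + 1) om*deriv (Kn m) (V (Suc m) s om))) (c1 * a m powr (p/q))"
  unfolding past_field_eq by (rule nrm_le_cond_exp[OF remainder_le(1)[OF m] _ subalgebra_field_of]) (use pq in simp)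
 have "Kn (Suc m) \<in> borel_measurable borel" using m by (intro Kn_measurable) simp
 then show "(%om. Kn (Suc m) (V (Suc m) s om) - Kn m (V (Suc m) s om)) \<in> borel_measurable M"
  using Kn_measurable(1)[OF m] by measurable
 show "AE om in M. Kn (Suc m) (V (Suc m) s om) - Kn m (V (Suc m) s om) = real_cond_exp M (past_field M \<xi> s) (%om. Kn m (V (Suc m) s om + a m*\<xi> (s + 1) om) - Kn m (V (Suc m) s om)
   - a m*\<xi> (s + 1) om*deriv (Kn m) (V (Suc m) s om)) om"
  using cond_exp_step[OF m, of s] by eventually_elim simp
qed (use pq in simp)

lemma Y_past: "n0 <= m ==> Y m s \<in> borel_measurable (past_field M \<xi> s)"
proof -
 assume m: "n0 <= m"
 note [measurable] = Kn_measurable(2)[OF m] V_past[of m s]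
 show ?thesis unfolding Y_def[abs_def] by measurable
qed

lemma Y_measurable: "n0 <= m ==> Y m s \<in> borel_measurable M"
 using field_of_measurable[OF Y_past[unfolded past_field_eq]] .

text \<open>The martingale property is K_{m+1}'(w) = E K_m'(w + a_m \<xi>). It is known for almost
  every w under the law of the predictor, and that is enough once w is replaced by the
  predictor.\<close>

lemma Y_martingale:
 assumes m: "n0 <= m"
 shows "integrable M (Y m (s + 1))" "AE om in M. real_cond_exp M (past_field M \<xi> s) (Y m (s + 1)) om = Y (Suc m) s om"
  "nrm_le M q (%om. deriv (Kn m) (V (Suc m) s om) - Y (Suc m) s om) (c2 * a m)"
  "nrm_le M q (%om. Y m (s + 1) om - Y (Suc m) s om) (2*c2 * a m)"
proof -
 note [measurable] = Kn_measurable[OF m] Y_measurable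
 have m': "n0 <= Suc m" using m by simp
 note [measurable] = Kn_measurable[OF m']
 have q1: "q >= 1" "q >= 0" "q > 1" using pq by auto
 interpret F: sigma_finite_subalgebra M "past_field M \<xi> s" unfolding past_field_eq by (rule finite_measure_sub[OF subalgebra_field_of])
 let ?h = "%(v, y). deriv (Kn m) (v + a m*y)"
 have mh: "?h \<in> borel_measurable (borel \<Otimes>\<^sub>M borel)" by measurable
 let ?X = "%om. deriv (Kn m) (V (Suc m) s om + a m*\<xi> (s + 1) om)"
 let ?v = "%om. deriv (Kn m) (V (Suc m) s om)"
 have ae: "AE om in M. Y m (s + 1) om = ?X om"
  using AE_V_step
 proof eventually_elim
  case (elim om)
  have "V m (s + 1) om = a m*\<xi> (s + 1) om + V (Suc m) (s + 1 - 1) om" using elim by blast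
  then show ?case by (simp add: Y_def add.commute)
 qed
 have iv: "integrable M ?v" by (rule nrm_le_integrable[OF Kn_le(2)[OF m] q1(1)])
 have id: "integrable M (%om. ?X om - ?v om)" by (rule nrm_le_integrable[OF remainder_le(2)[OF m] q1(1)])
 have iX: "integrable M ?X" using Bochner_Integration.integrable_add[OF id iv] by simp
 have iX': "integrable M (%om. ?h (V (Suc m) s om, \<xi> (s + 1) om))" using iX by simp
 show 1: "integrable M (Y m (s + 1))" by (rule integrable_cong_AE_imp[OF iX Y_measurable[OF m]]) (use ae in \<open>eventually_elim, simp\<close>)
 obtain f where f: "continuous_on UNIV f" "!!x. 0 <= f x" "\<mu> (Suc m) = density lborel (%x. ennreal (f x))" using dens[of "Suc m"] by auto
 have int: "integrable (density lborel (%x. ennreal (f x)) \<Otimes>\<^sub>M \<nu>) ?h"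
  unfolding f(3)[symmetric] distr_V_xi[of "Suc m" s, symmetric] using iX' by (simp add: integrable_distr_eq mh)
 have "AE w in density lborel (%x. ennreal (f x)). deriv (Kn (Suc m)) w = (LINT y|\<nu>. deriv (Kn m) (w + a m*y))"
 proof (rule interchange_derivative_integral[OF prob_space_nu sets_nu f(1,2) C2_derivatives(1,4)[OF Kn_smooth[OF m]] C2_derivatives(1,4)[OF Kn_smooth[OF m']] _ _ int])
  show "integrable \<nu> (%y. Kn m (w + a m*y))" "Kn (Suc m) w = (LINT y|\<nu>. Kn m (w + a m*y))" for w
   using tau_Suc[OF K_meas Kn_int[of "Suc m" w]] m unfolding Kn_eq by auto
 qed
 then have "AE w in distr M borel (V (Suc m) s). deriv (Kn (Suc m)) w = (LINT y|\<nu>. deriv (Kn m) (w + a m*y))"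
  unfolding f(3)[symmetric] distr_V .
 then have ch: "AE om in M. Y (Suc m) s om = (LINT y|\<nu>. deriv (Kn m) (V (Suc m) s om + a m*y))"
  unfolding Y_def by (rule AE_distrD[OF V_measurable])
 have cX: "AE om in M. real_cond_exp M (past_field M \<xi> s) ?X om = Y (Suc m) s om"
  using cond_exp_V_xi[OF mh iX'] ch by eventually_elim simp
 have "AE om in M. real_cond_exp M (past_field M \<xi> s) (Y m (s + 1)) om = real_cond_exp M (past_field M \<xi> s) ?X om"
  by (rule F.real_cond_exp_cong[OF ae Y_measurable[OF m]]) measurable
 then show "AE om in M. real_cond_exp M (past_field M \<xi> s) (Y m (s + 1)) om = Y (Suc m) s om"
  using cX by eventually_elim simp
 have vp: "?v \<in> borel_measurable (past_field M \<xi> s)"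
 proof -
  note [measurable] = V_past[of "Suc m" s]
  show ?thesis by measurable
 qed
 have cv: "AE om in M. real_cond_exp M (past_field M \<xi> s) ?v om = ?v om" by (rule F.real_cond_exp_F_meas[OF iv vp])
 \<comment> \<open>Conditioning the remainder of the derivative gives the distance from K_m' to
   K_{m+1}' at the same predictor, hence the same norm bound.\<close>
 have cd: "AE om in M. real_cond_exp M (past_field M \<xi> s) (%om. ?X om - ?v om) om = Y (Suc m) s om - ?v om"
  using F.real_cond_exp_diff[OF iX iv] cv cX by eventually_elim simp
 have n1: "nrm_le M q (real_cond_exp M (past_field M \<xi> s) (%om. ?X om - ?v om)) (c2 * a m)"
  unfolding past_field_eq by (rule nrm_le_cond_exp[OF remainder_le(2)[OF m] q1(3) subalgebra_field_of])
 have n2: "nrm_le M q (%om. Y (Suc m) s om - ?v om) (c2 * a m)"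
  by (rule nrm_le_cong_AE[OF n1]) (use cd q1 Y_measurable[OF m'] in \<open>auto elim: eventually_mono\<close>)
 then have "nrm_le M q (%om. (-1)*(Y (Suc m) s om - ?v om)) (\<bar>-1\<bar>*(c2 * a m))" by (rule nrm_le_scale) (use q1 in simp)
 then show n3: "nrm_le M q (%om. ?v om - Y (Suc m) s om) (c2 * a m)" by simp
 have "nrm_le M q (%om. (?X om - ?v om) + (?v om - Y (Suc m) s om)) (c2 * a m + c2 * a m)"
  by (rule nrm_le_add[OF remainder_le(2)[OF m] n3 q1(1)])
 then have n4: "nrm_le M q (%om. ?X om - Y (Suc m) s om) (2*c2 * a m)" by (simp add: mult.assoc mult.commute mult.left_commute)
 show "nrm_le M q (%om. Y m (s + 1) om - Y (Suc m) s om) (2*c2 * a m)"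
 proof (rule nrm_le_cong_AE[OF n4])
  show "(%om. Y m (s + 1) om - Y (Suc m) s om) \<in> borel_measurable M"
   using Y_measurable[OF m, of "s+1"] Y_measurable[OF m', of s] by measurable
  show "AE om in M. Y m (s + 1) om - Y (Suc m) s om = ?X om - Y (Suc m) s om" using ae by eventually_elim simp
 qed (rule q1)
qed

text \<open>The increments of the reverse martingale are of size a_m, so its oscillation beyond lag
  n is of order the square root of the tail sum of a_m^2, uniformly in the number of steps.\<close>

lemma Y_telescope:
 "\<exists>c>0. \<forall>n\<ge>n0. \<forall>s N. nrm_le M q (%om. Y n s om - Y (n + N) (s - int N) om) (c * sqrt (A2 n))"
proof -
 obtain C where C0: "C > 0 & (\<forall>F D b N. (\<forall>k<N. subalgebra M (F k) & (\<forall>j<k. D j \<in> borel_measurable (F k)) &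
    (AE om in M. real_cond_exp M (F k) (D k) om = 0) & nrm_le M q (D k) (b k) & b k > 0) \<longrightarrow>
  nrm_le M q (%om. \<Sum>k<N. D k om) (C * sqrt (\<Sum>k<(N::nat). (b k)^2)))"
  using martingale_difference_moment[OF pq(1)] by (elim exE) (rule that)
 have C: "C > 0" by (rule conjunct1[OF C0])
 have main: "nrm_le M q (%om. Y n s om - Y (n + N) (s - int N) om) (C*(2*c2) * sqrt (A2 n))" if n: "n0 <= n" for n s N
 proof -
  \<comment> \<open>Large lags belong to early times; counting lags down by \<open>N - Suc k\<close>
    makes time, and hence the fields, increase with \<open>k\<close>.\<close>
  define D where "D k om = Y (n + (N - Suc k)) (s - int (N - Suc k)) om - Y (Suc (n + (N - Suc k))) (s - int (N - Suc k) - 1) om" for k om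
  define F where "F k = past_field M \<xi> (s - int (N - Suc k) - 1)" for k
  define bb where "bb k = 2*c2 * a (n + (N - Suc k))" for k
  have nn: "n0 <= n + j" "n0 <= Suc (n + j)" for j using n by auto
  have "nrm_le M q (%om. \<Sum>k<N. D k om) (C * sqrt (\<Sum>k<N. (bb k)^2))"
  proof (rule conjunct2[OF C0, THEN spec[of _ F], THEN spec[of _ D], THEN spec[of _ bb], THEN spec[of _ N], THEN mp], intro allI impI conjI)
   fix k assume k: "k < N"
   show "subalgebra M (F k)" unfolding F_def past_field_eq by (rule subalgebra_field_of)
   interpret F: sigma_finite_subalgebra M "F k" unfolding F_def past_field_eq by (rule finite_measure_sub[OF subalgebra_field_of])
   show "bb k > 0" unfolding bb_def using c12 a_pos by simp
   show "D j \<in> borel_measurable (F k)" if j: "j < k" for j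
   proof -
    have 1: "Y (n + (N - Suc j)) (s - int (N - Suc j)) \<in> borel_measurable (F k)"
     unfolding F_def past_field_eq by (rule field_of_measurable_mono[OF Y_past[OF nn(1), unfolded past_field_eq]]) (use j k in auto)
    have 2: "Y (Suc (n + (N - Suc j))) (s - int (N - Suc j) - 1) \<in> borel_measurable (F k)"
     unfolding F_def past_field_eq by (rule field_of_measurable_mono[OF Y_past[OF nn(2), unfolded past_field_eq]]) (use j k in auto)
    show ?thesis unfolding D_def[abs_def] by (rule borel_measurable_diff[OF 1 2])
   qed
   define m t where "m = n + (N - Suc k)" and "t = s - int (N - Suc k) - 1"
   have m: "n0 <= m" "n0 <= Suc m" using nn unfolding m_def by auto
   have D: "D k = (%om. Y m (t + 1) om - Y (Suc m) t om)" by (simp add: D_def[abs_def] m_def t_def)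
   have F: "F k = past_field M \<xi> t" by (simp add: F_def t_def)
   show "nrm_le M q (D k) (bb k)" using Y_martingale(4)[OF m(1), of t] unfolding D bb_def m_def .
   have i: "integrable M (Y (Suc m) t)" using Y_martingale(1)[OF m(2), of "t - 1"] by simp
   have "AE om in M. real_cond_exp M (F k) (Y (Suc m) t) om = Y (Suc m) t om"
    by (rule F.real_cond_exp_F_meas[OF i]) (unfold F, rule Y_past[OF m(2)])
   then show "AE om in M. real_cond_exp M (F k) (D k) om = 0"
    using F.real_cond_exp_diff[OF Y_martingale(1)[OF m(1), of t] i] Y_martingale(2)[OF m(1), of t]
    unfolding D F by eventually_elim simp
  qed
  moreover have "(\<Sum>k<N. D k om) = Y n s om - Y (n + N) (s - int N) om" for om
  proof -
   have "(\<Sum>k<N. D k om) = (\<Sum>j<N. Y (n + j) (s - int j) om - Y (n + Suc j) (s - int (Suc j)) om)"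
    unfolding D_def by (subst sum.nat_diff_reindex[of "%j. Y (n + j) (s - int j) om - Y (Suc (n + j)) (s - int j - 1) om"]) (simp add: algebra_simps)
   also have "... = Y n s om - Y (n + N) (s - int N) om"
    by (subst sum_lessThan_telescope') simp
   finally show ?thesis .
  qed
  ultimately have nr: "nrm_le M q (%om. Y n s om - Y (n + N) (s - int N) om) (C * sqrt (\<Sum>k<N. (bb k)^2))" by simp
  have "(\<Sum>k<N. (bb k)^2) = (2*c2)^2*(\<Sum>k<N. (a (n + (N - Suc k)))^2)"
   by (simp add: bb_def power_mult_distrib sum_distrib_left)
  also have "(\<Sum>k<N. (a (n + (N - Suc k)))^2) = (\<Sum>k<N. (a (n + k))^2)"
   by (rule sum.nat_diff_reindex)
  also have "(2*c2)^2*(\<Sum>k<N. (a (n + k))^2) <= (2*c2)^2*A2 n"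
   unfolding A2_def by (intro mult_left_mono sum_le_suminf a_sq_shift) auto
  finally have "sqrt (\<Sum>k<N. (bb k)^2) <= sqrt ((2*c2)^2*A2 n)" by (rule real_sqrt_le_mono)
  also have "... = 2*c2 * sqrt (A2 n)" using c12(2) by (simp add: real_sqrt_mult)
  finally have "C * sqrt (\<Sum>k<N. (bb k)^2) <= C*(2*c2) * sqrt (A2 n)"
   unfolding mult.assoc using C by (intro mult_left_mono) auto
  then show ?thesis by (rule nrm_le_mono[OF nr]) (use pq in simp)
 qed
 show ?thesis by (rule exI[of _ "C*(2*c2)"]) (use C c12(2) main in auto)
qed

end

section \<open>Identification of the limit of the derivatives\<close>

context smooth_process
begin

text \<open>Turns an L^q bound into a bound on a number: were T at least 2b + 1, Markov's inequality
  would give the event probability at most 2^{-q} <= 1/4, less than 1/2.\<close>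

lemma nrm_le_pos_prob:
 assumes X: "nrm_le M q X b" and ev: "!!om. om \<in> space M ==> (abs (W om)) <= t ==> T <= (abs (X om))" and W: "W \<in> borel_measurable M"
  and pr: "prob {om\<in>space M. (abs (W om)) <= t} >= 1/2"
 shows "T < 2*b + 1"
proof (rule ccontr)
 assume "\<not> T < 2*b + 1"
 then have T: "T >= 2*b + 1" by simp
 have Tp: "T > 0" using T b_nonneg by linarith
 have [measurable]: "X \<in> borel_measurable M" by (rule nrm_le_meas[OF X])
 have "1/2 <= prob {om\<in>space M. (abs (W om)) <= t}" by (rule pr)
 also have "... <= prob {om\<in>space M. (abs (X om)) >= T}"
  by (rule finite_measure_mono) (use ev in auto)
 also have "... <= (b/T) powr q" by (rule nrm_le_Markov[OF X _ Tp]) (use pq in simp)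
 also have "... <= (1/2) powr q" using T Tp b_nonneg pq by (intro powr_mono2) (auto simp: field_simps)
 also have "... <= (1/2) powr 2" using pq by (intro powr_mono') auto
 also have "... = 1/4" by (simp add: powr_numeral power2_eq_square)
 finally show False by simp
qed

lemma prob_V_small:
 assumes t: "t > 0" and e: "e > 0"
 shows "\<forall>\<^sub>F m in sequentially. \<forall>s. prob {om\<in>space M. (abs (V m s om)) > t} < e"
proof -
 have A: "(%m. sqrt (s2*A2 m)/t) \<longlonglongrightarrow> sqrt (s2*0)/t" using t by (intro tendsto_intros A2_lim) auto
 have "\<forall>\<^sub>F m in sequentially. sqrt (s2*A2 m)/t < e" using order_tendstoD(2)[OF A, of e] e by simp
 then show ?thesis
 proof eventually_elim
  case (elim m)
  show ?case
  proof
   fix s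
   have "prob {om\<in>space M. (abs (V m s om)) > t} <= prob {om\<in>space M. t <= (abs (V m s om))}"
    by (rule finite_measure_mono) auto
   also have "... <= (LINT om|M. (abs (V m s om)))/t"
    by (rule integral_Markov_inequality_measure[where A="{}"]) (use V_integrable t in auto)
   also have "... <= sqrt (s2*A2 m)/t" using t by (intro divide_right_mono expectation_abs_V) auto
   finally show "prob {om\<in>space M. (abs (V m s om)) > t} < e" using elim by simp
  qed
 qed
qed

lemma prob_V_le:
 assumes t: "t > 0"
 shows "\<forall>\<^sub>F m in sequentially. prob {om\<in>space M. (abs (V m 0 om)) <= t} >= 1/2"
proof -
 have "\<forall>\<^sub>F m in sequentially. \<forall>s. prob {om\<in>space M. (abs (V m s om)) > t} < 1/2" by (rule prob_V_small[OF t]) simp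
 then show ?thesis
 proof eventually_elim
  case (elim m)
  have "{om\<in>space M. (abs (V m 0 om)) <= t} = space M - {om\<in>space M. (abs (V m 0 om)) > t}" by auto
  then have "prob {om\<in>space M. (abs (V m 0 om)) <= t} = 1 - prob {om\<in>space M. (abs (V m 0 om)) > t}"
   by (simp add: prob_compl)
  moreover have "prob {om\<in>space M. (abs (V m 0 om)) > t} < 1/2" using elim by blast
  ultimately show ?case by linarith
 qed
qed

text \<open>When the predictor lies within \<delta>/2 of 0, its local supremum of radius \<delta>
  dominates the values at all |y| <= \<delta>/2. For large lags this happens with probability at
  least 1/2.\<close>

lemma local_bounds:
 "\<forall>\<^sub>F m in sequentially. n0 <= m & (\<forall>i\<le>2. \<forall>y. (abs y) <= \<delta>/2 \<longrightarrow> \<bar>(deriv ^^ i) (Kn m) y\<bar> <= 2*b + 1)"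
proof -
 have d2: "\<delta>/2 > 0" using delta by simp
 have "\<forall>\<^sub>F m in sequentially. prob {om\<in>space M. \<bar>V (Suc m) 0 om\<bar> <= \<delta>/2} >= 1/2"
  using prob_V_le[OF d2] by (subst eventually_sequentially_Suc)
 then show ?thesis using eventually_ge_at_top[of n0]
 proof eventually_elim
  case (elim m)
  show ?case
  proof (intro conjI allI impI)
   show "n0 <= m" by (rule elim(2))
   fix i :: nat and y assume i: "i <= 2" and y: "(abs y) <= \<delta>/2"
   have "\<bar>(deriv ^^ i) (Kn m) y\<bar> < 2*b + 1"
   proof (rule nrm_le_pos_prob[OF S_le[OF i elim(2), of 0] _ _ elim(1)])
    fix om assume "\<bar>V (Suc m) 0 om\<bar> <= \<delta>/2"
    then have "\<bar>y - V (Suc m) 0 om\<bar> <= \<delta>" using y by linarith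
    from S_upper[OF i elim(2) this, of "V (Suc m) 0 om"]
    have "\<bar>(deriv ^^ i) (Kn m) y\<bar> <= S i m (V (Suc m) 0 om)" by simp
    then show "\<bar>(deriv ^^ i) (Kn m) y\<bar> <= \<bar>S i m (V (Suc m) 0 om)\<bar>" by (rule order_trans[OF _ abs_ge_self])
   qed simp
   then show "\<bar>(deriv ^^ i) (Kn m) y\<bar> <= 2*b + 1" by simp
  qed
 qed
qed

lemma Kn_lipschitz_local:
 assumes m: "n0 <= m" and bd: "\<forall>i\<le>2. \<forall>y. (abs y) <= \<delta>/2 \<longrightarrow> \<bar>(deriv ^^ i) (Kn m) y\<bar> <= 2*b + 1"
  and w: "(abs w) + (abs t) <= \<delta>/2"
 shows "\<bar>Kn m (w + t) - Kn m w\<bar> <= (abs t)*(2*b + 1)" "\<bar>deriv (Kn m) (w + t) - deriv (Kn m) w\<bar> <= (abs t)*(2*b + 1)"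
  "\<bar>Kn m (w + t) - Kn m w - t*deriv (Kn m) w\<bar> <= t^2*(2*b + 1)"
proof -
 have wy: "\<bar>w + y\<bar> <= \<delta>/2" if "(abs y) <= (abs t)" for y
  using order_trans[OF abs_triangle_ineq[of w y]] that w by linarith
 have 1: "\<bar>deriv (Kn m) (w + y)\<bar> <= 2*b + 1" if "(abs y) <= (abs t)" for y
  using bd[rule_format, OF _ wy[OF that], of 1] by simp
 have 2: "\<bar>(deriv ^^ 2) (Kn m) (w + y)\<bar> <= 2*b + 1" if "(abs y) <= (abs t)" for y
  by (rule bd[rule_format, OF _ wy[OF that]]) simp
 show "\<bar>Kn m (w + t) - Kn m w\<bar> <= (abs t)*(2*b + 1)" "\<bar>deriv (Kn m) (w + t) - deriv (Kn m) w\<bar> <= (abs t)*(2*b + 1)"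
  "\<bar>Kn m (w + t) - Kn m w - t*deriv (Kn m) w\<bar> <= t^2*(2*b + 1)"
  by (rule C2_mean_value_bounds[OF Kn_smooth[OF m] 1 2]; assumption)+
qed

text \<open>K_m(w + V_m) tends to K_\<infinity>(w) in L^1, V_m tends to 0, and the K_m are
  equi-Lipschitz near 0. A deviation of e at w would persist as e/2 on an event of probability 1/2,
  against a mean below e/4.\<close>

lemma Kn_tendsto:
 assumes w: "(abs w) < \<delta>/2" and i: "integrable M (%om. K (w + V 0 0 om))" and e: "e > 0"
 shows "\<forall>\<^sub>F m in sequentially. \<bar>Kn m w - (LINT om|M. K (w + V 0 0 om))\<bar> < e"
proof -
 define kk where "kk = (LINT om|M. K (w + V 0 0 om))"
 define t where "t = min (\<delta>/2 - (abs w)) (e/(4*(2*b + 1)))"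
 have bp: "2*b + 1 > 0" using b_nonneg by simp
 have t: "t > 0" unfolding t_def using w e bp by auto
 have "t <= \<delta>/2 - (abs w)" unfolding t_def by (rule min.cobounded1)
 then have t1: "(abs w) + t <= \<delta>/2" by linarith
 have "t*(2*b + 1) <= e/(4*(2*b + 1))*(2*b + 1)" using bp by (intro mult_right_mono) (auto simp: t_def)
 moreover have "e/(4*x)*x = e/4" if "x > 0" for x using that by simp
 ultimately have t2: "t*(2*b + 1) <= e/4" using bp by metis
 note [measurable] = K_meas
 have mK: "(%x. K (w + x)) \<in> borel_measurable borel" by measurable
 have e4: "e/4 > 0" using e by simp
 have "\<forall>\<^sub>F m in sequentially. \<forall>s. (\<integral>om. \<bar>(LINT u|\<tau> m. K (w + (V m s om + u))) - (LINT om|M. K (w + V 0 0 om))\<bar> \<partial>M) < e/4"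
  by (rule cond_mean_tendsto[OF mK i e4])
 then show ?thesis using prob_V_le[OF t] local_bounds
 proof eventually_elim
  case (elim m)
  have m: "n0 <= m" by (rule conjunct1[OF elim(3)])
  note [measurable] = Kn_measurable[OF m]
  have E: "(LINT om|M. \<bar>Kn m (w + V m 0 om) - kk\<bar>) < e/4"
   using elim(1)[THEN spec[of _ 0]] unfolding kk_def Kn_def by (simp add: add.assoc)
  have iK: "integrable M (%om. Kn m (w + V m 0 om))"
  proof -
   let ?F = "past_field M \<xi> (int m - int m)"
   interpret F: sigma_finite_subalgebra M ?F unfolding past_field_eq by (rule finite_measure_sub[OF subalgebra_field_of])
   have "distr M borel (V 0 (int m)) = distr M borel (V 0 0)" by (simp add: distr_V)
   then have i': "integrable M (%om. K (w + V 0 (int m) om))"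
    using i integrable_distr_eq[of "V 0 (int m)" M borel "%x. K (w + x)"] integrable_distr_eq[of "V 0 0" M borel "%x. K (w + x)"] mK by simp
   have "AE om in M. real_cond_exp M ?F (%om. K (w + V 0 (int m) om)) om = Kn m (w + V m 0 om)"
    using cond_exp_V_U[OF mK i', of m] by (simp add: Kn_def add.assoc)
   then show ?thesis
    by (rule integrable_cong_AE_imp[OF F.real_cond_exp_int(1)[OF i'], rotated]) measurable
  qed
  show ?case
  proof (rule ccontr)
   assume "\<not> \<bar>Kn m w - (LINT om|M. K (w + V 0 0 om))\<bar> < e"
   then have big: "e <= \<bar>Kn m w - kk\<bar>" by (simp add: kk_def)
   let ?A = "{om\<in>space M. (abs (V m 0 om)) <= t}"
   have "e/2*prob ?A = (LINT om|M. e/2*indicator ?A om)" by simp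
   also have "... <= (LINT om|M. \<bar>Kn m (w + V m 0 om) - kk\<bar>)"
   proof (rule integral_mono)
    show "integrable M (%om. \<bar>Kn m (w + V m 0 om) - kk\<bar>)" using iK by simp
    show "e/2*indicator ?A om <= \<bar>Kn m (w + V m 0 om) - kk\<bar>" for om
    proof (cases "om \<in> ?A")
     case True
     then have v: "(abs (V m 0 om)) <= t" by simp
     have "\<bar>Kn m (w + V m 0 om) - Kn m w\<bar> <= (abs (V m 0 om))*(2*b + 1)"
      by (rule Kn_lipschitz_local(1)[OF m conjunct2[OF elim(3)]]) (use v t1 in linarith)
     also have "... <= t*(2*b + 1)" using v bp by (intro mult_right_mono) auto
     finally have "\<bar>Kn m (w + V m 0 om) - Kn m w\<bar> <= e/4" using t2 by linarith
     then have "e/2 <= \<bar>Kn m (w + V m 0 om) - kk\<bar>" using big e by linarith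
     then show ?thesis using True by simp
    qed simp
   qed (auto intro!: integrable_real_mult_indicator)
   finally have "e/2*prob ?A < e/4" using E by linarith
   moreover have "e/2*(1/2) <= e/2*prob ?A" using elim(2) e by (intro mult_left_mono) auto
   ultimately show False by simp
  qed
 qed
qed

lemma Kd_tendsto:
 assumes e: "e > 0"
 shows "\<forall>\<^sub>F m in sequentially. \<bar>deriv (Kn m) 0 - \<kappa>\<bar> < e"
proof -
 define kk where "kk w = (LINT om|M. K (w + V 0 0 om))" for w
 define b' where "b' = 2*b + 1"
 have b': "b' > 0" using b_nonneg by (simp add: b'_def)
 have lim: "((%h. (kk h - kk 0)/h) \<longlongrightarrow> \<kappa>) (at 0)"
  using K_inf_deriv by (simp add: kk_def[abs_def] has_field_derivative_iff)
 have e3: "e/3 > 0" using e by simp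
 have 1: "\<forall>\<^sub>F h in at 0. \<bar>(kk h - kk 0)/h - \<kappa>\<bar> < e/3"
  using tendstoD[OF lim e3] by (simp add: dist_real_def)
 have 2: "\<forall>\<^sub>F h in at (0::real). integrable M (%om. K (h + V 0 0 om))"
  using K_int by (simp add: eventually_at_filter eventually_mono)
 have K0: "integrable M (%om. K (0 + V 0 0 om))" using eventually_nhds_x_imp_x[OF K_int] .
 define \<rho> where "\<rho> = min (\<delta>/2) (e/(3*b'))"
 have r: "\<rho> > 0" unfolding \<rho>_def using delta e b' by auto
 have 3: "\<forall>\<^sub>F h in at (0::real). h \<noteq> 0 & (abs h) < \<rho>"
  unfolding eventually_at using r by (intro exI[of _ \<rho>]) (auto simp: dist_real_def)
 \<comment> \<open>A single step h is fixed, small for the difference quotient of K_\<infinity> and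
   for the second order error |h| b'; only then does the lag grow, with errors proportional to
   |h|.\<close>
 have "\<exists>h. (\<bar>(kk h - kk 0)/h - \<kappa>\<bar> < e/3 & integrable M (%om. K (h + V 0 0 om))) & (h \<noteq> 0 & (abs h) < \<rho>)"
  by (rule eventually_happens'[OF at_neq_bot eventually_conj[OF eventually_conj[OF 1 2] 3]])
 then obtain h where h: "\<bar>(kk h - kk 0)/h - \<kappa>\<bar> < e/3" "integrable M (%om. K (h + V 0 0 om))" "h \<noteq> 0" "(abs h) < \<rho>" by auto
 have h2: "(abs h) < \<delta>/2" "\<bar>0::real\<bar> < \<delta>/2" using h(4) delta by (auto simp: \<rho>_def)
 have hb: "(abs h)*b' <= e/3"
 proof -
  have "(abs h)*b' <= e/(3*b')*b'" using h(4) b' by (intro mult_right_mono) (auto simp: \<rho>_def)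
  then show ?thesis using b' by simp
 qed
 have e6: "e*(abs h)/6 > 0" using e h(3) by simp
 show ?thesis using Kn_tendsto[OF h2(1) h(2) e6] Kn_tendsto[OF h2(2) K0 e6] local_bounds
 proof eventually_elim
  case (elim m)
  have A: "\<bar>Kn m h - kk h\<bar> < e*(abs h)/6" "\<bar>Kn m 0 - kk 0\<bar> < e*(abs h)/6" using elim(1,2) by (simp_all add: kk_def)
  have T: "\<bar>Kn m (0 + h) - Kn m 0 - h*deriv (Kn m) 0\<bar> <= h^2*(2*b + 1)"
   by (rule Kn_lipschitz_local(3)[OF conjunct1[OF elim(3)] conjunct2[OF elim(3)]]) (use h2 in simp)
  have hh: "h*(A - B/h) = h*A - B" for A B using h(3) by (simp add: right_diff_distrib)
  have "\<bar>h*(deriv (Kn m) 0 - (kk h - kk 0)/h)\<bar> = \<bar>h*deriv (Kn m) 0 - (kk h - kk 0)\<bar>" by (simp only: hh)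
  also have "... <= h^2*b' + 2*(e*(abs h)/6)"
  proof -
   have "\<bar>D - (k1 - k0)\<bar> <= X + 2*z" if "\<bar>A1 - k1\<bar> < z" "\<bar>A0 - k0\<bar> < z" "\<bar>A1 - A0 - D\<bar> <= X" for D k1 k0 X z A1 A0 :: real
    using that by (smt (verit))
   from this[OF A T[unfolded add_0_left]] show ?thesis by (simp only: b'_def)
  qed
  also have "... = (abs h)*((abs h)*b' + e/3)" by (simp add: algebra_simps power2_eq_square)
  also have "... <= (abs h)*(2*e/3)" using hb by (intro mult_left_mono) auto
  finally have "\<bar>deriv (Kn m) 0 - (kk h - kk 0)/h\<bar> <= 2*e/3" using h(3) by (simp add: abs_mult)
  then show ?case using h(1) by linarith
 qed
qed

lemma Y_limit:
 assumes e: "e > 0"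
 shows "(%N. prob {om\<in>space M. \<bar>Y (n + N) (s - int N) om - \<kappa>\<bar> > e}) \<longlonglongrightarrow> 0"
proof (rule tendstoI)
 fix \<eta> :: real assume \<eta>: "\<eta> > 0"
 define b' where "b' = 2*b + 1"
 have b': "b' > 0" using b_nonneg by (simp add: b'_def)
 define t where "t = min (\<delta>/2) (e/(3*b'))"
 have t: "t > 0" unfolding t_def using delta e b' by auto
 have e3: "e/3 > 0" using e by simp
 have tb: "t*b' <= e/3"
 proof -
  have "t*b' <= e/(3*b')*b'" using b' by (intro mult_right_mono) (auto simp: t_def)
  then show ?thesis using b' by simp
 qed
 have "\<forall>\<^sub>F m in sequentially. \<forall>s. prob {om\<in>space M. \<bar>Y m s om - \<kappa>\<bar> > e} < \<eta>"
  using prob_V_small[OF t \<eta>] local_bounds Kd_tendsto[OF e3]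
 proof eventually_elim
  case (elim m)
  show ?case
  proof
   fix s
   have "prob {om\<in>space M. \<bar>Y m s om - \<kappa>\<bar> > e} <= prob {om\<in>space M. (abs (V m s om)) > t}"
   proof (rule finite_measure_mono)
    show "{om\<in>space M. \<bar>Y m s om - \<kappa>\<bar> > e} \<subseteq> {om\<in>space M. (abs (V m s om)) > t}"
    proof (rule Collect_mono, rule impI, elim conjE, rule conjI)
     fix om assume bad: "\<bar>Y m s om - \<kappa>\<bar> > e"
     show "(abs (V m s om)) > t"
     proof (rule ccontr)
      assume "\<not> (abs (V m s om)) > t"
      then have v: "(abs (V m s om)) <= t" by simp
      have "\<bar>deriv (Kn m) (0 + V m s om) - deriv (Kn m) 0\<bar> <= (abs (V m s om))*(2*b + 1)"
       by (rule Kn_lipschitz_local(2)[OF conjunct1[OF elim(2)] conjunct2[OF elim(2)]]) (use v in \<open>simp add: t_def\<close>)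
      also have "... <= t*b'" using v b' unfolding b'_def by (intro mult_right_mono) auto
      finally have "\<bar>Y m s om - deriv (Kn m) 0\<bar> <= e/3" using tb by (simp add: Y_def)
      then show False using bad elim(3) e by linarith
     qed
    qed
   qed measurable
   also have "... < \<eta>" using elim(1) by blast
   finally show "prob {om\<in>space M. \<bar>Y m s om - \<kappa>\<bar> > e} < \<eta>" .
  qed
 qed
 then obtain m0 where m0: "!!m s. m >= m0 ==> prob {om\<in>space M. \<bar>Y m s om - \<kappa>\<bar> > e} < \<eta>"
  unfolding eventually_sequentially by auto
 show "\<forall>\<^sub>F N in sequentially. dist (prob {om\<in>space M. \<bar>Y (n + N) (s - int N) om - \<kappa>\<bar> > e}) 0 < \<eta>"
  using eventually_ge_at_top[of m0]
 proof eventually_elim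
  case (elim N)
  show ?case using m0[of "n + N" "s - int N"] elim by (simp add: dist_real_def)
 qed
qed

lemma Y_dist_le:
 "\<exists>c>0. \<forall>n\<ge>n0. \<forall>s. nrm_le M q (%om. Y n s om - \<kappa>) (c * sqrt (A2 n))"
proof -
 obtain c where c: "c > 0" "!!n s N. n >= n0 ==> nrm_le M q (%om. Y n s om - Y (n + N) (s - int N) om) (c * sqrt (A2 n))"
  using Y_telescope by auto
 have "nrm_le M q (%om. Y n s om - \<kappa>) (c * sqrt (A2 n))" if n: "n >= n0" for n s
 proof (rule nrm_le_limit_in_prob[where B="%N. Y (n + N) (s - int N)"])
  show "Y n s \<in> borel_measurable M" by (rule Y_measurable[OF n])
  show "Y (n + N) (s - int N) \<in> borel_measurable M" for N by (rule Y_measurable) (use n in simp)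
  show "nrm_le M q (%om. Y n s om - Y (n + N) (s - int N) om) (c * sqrt (A2 n))" for N by (rule c(2)[OF n])
  show "q >= 1" using pq by simp
 qed (rule Y_limit)
 then show ?thesis using c(1) by blast
qed

text \<open>Three sources: the Taylor remainder, the change from K_m to K_{m+1}, and the replacement
  of K_m' by \<kappa> in the linear term. In the third, independence of the innovation multiplies
  a_m by the norm of K_m' - \<kappa>, which is of order a_m plus the tail norm.\<close>

theorem linearisation_error:
 "\<exists>c>0. \<forall>m\<ge>n0. \<forall>s. nrm_le M q (%om. Kn m (V (Suc m) s om + a m*\<xi> (s + 1) om) - Kn (Suc m) (V (Suc m) s om) - \<kappa>*(a m*\<xi> (s + 1) om))
   (c*(a m powr (p/q) + a m*(a m + sqrt (A2 (Suc m)))))"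
proof -
 obtain c3 where c3: "c3 > 0" "!!n s. n >= n0 ==> nrm_le M q (%om. Y n s om - \<kappa>) (c3 * sqrt (A2 n))"
  using Y_dist_le by auto
 define c where "c = 2*c1 + (c2 + c3)*P + 1"
 have q1: "q >= 1" "q >= 0" using pq by auto
 have cp: "c > 0" unfolding c_def using c12 c3(1) P_nonneg by (intro add_nonneg_pos add_nonneg_nonneg mult_nonneg_nonneg) auto
 have "nrm_le M q (%om. Kn m (V (Suc m) s om + a m*\<xi> (s + 1) om) - Kn (Suc m) (V (Suc m) s om) - \<kappa>*(a m*\<xi> (s + 1) om))
   (c*(a m powr (p/q) + a m*(a m + sqrt (A2 (Suc m)))))" if m: "n0 <= m" for m s
 proof -
  have m': "n0 <= Suc m" using m by simp
  have am: "a m > 0" by (rule a_pos)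
  have A: "A2 (Suc m) >= 0" by (rule A2_nonneg)
  note [measurable] = Kn_measurable[OF m]
  have "nrm_le M q (%om. (deriv (Kn m) (V (Suc m) s om) - Y (Suc m) s om) + (Y (Suc m) s om - \<kappa>)) (c2 * a m + c3 * sqrt (A2 (Suc m)))"
   by (rule nrm_le_add[OF Y_martingale(3)[OF m] c3(2)[OF m'] q1(1)])
  then have 1: "nrm_le M q (%om. (%v. deriv (Kn m) v - \<kappa>) (V (Suc m) s om)) (c2 * a m + c3 * sqrt (A2 (Suc m)))" by simp
  have "nrm_le M q (%om. (%v. deriv (Kn m) v - \<kappa>) (V (Suc m) s om)*(%y. y) (\<xi> (s + 1) om)) ((c2 * a m + c3 * sqrt (A2 (Suc m)))*P)"
   by (rule nrm_le_indep_mult[OF _ 1]) (use xi_powr_le(2) in auto)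
  then have 2: "nrm_le M q (%om. a m*((deriv (Kn m) (V (Suc m) s om) - \<kappa>)*\<xi> (s + 1) om)) ((abs (a m))*((c2 * a m + c3 * sqrt (A2 (Suc m)))*P))"
   by (intro nrm_le_scale q1) simp
  have 3: "nrm_le M q (%om. (Kn m (V (Suc m) s om + a m*\<xi> (s + 1) om) - Kn m (V (Suc m) s om)
   - a m*\<xi> (s + 1) om*deriv (Kn m) (V (Suc m) s om)) - (Kn (Suc m) (V (Suc m) s om) - Kn m (V (Suc m) s om))
   + a m*((deriv (Kn m) (V (Suc m) s om) - \<kappa>)*\<xi> (s + 1) om))
   ((c1 * a m powr (p/q) + c1 * a m powr (p/q)) + (abs (a m))*((c2 * a m + c3 * sqrt (A2 (Suc m)))*P))"
   by (rule nrm_le_add[OF nrm_le_diff[OF remainder_le(1)[OF m] Kn_diff_le[OF m] q1(1)] 2 q1(1)])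
  have e: "(Kn m (V (Suc m) s om + a m*\<xi> (s + 1) om) - Kn m (V (Suc m) s om)
   - a m*\<xi> (s + 1) om*deriv (Kn m) (V (Suc m) s om)) - (Kn (Suc m) (V (Suc m) s om) - Kn m (V (Suc m) s om))
   + a m*((deriv (Kn m) (V (Suc m) s om) - \<kappa>)*\<xi> (s + 1) om) = Kn m (V (Suc m) s om + a m*\<xi> (s + 1) om) - Kn (Suc m) (V (Suc m) s om) - \<kappa>*(a m*\<xi> (s + 1) om)" for om
   by (simp add: algebra_simps)
  have f: "(c1*T + c1*T) + (abs (a m))*((c2 * a m + c3 * R)*P) <= c*(T + a m*(a m + R))" if "T >= 0" "R >= 0" for T R
  proof -
   have 1: "2*c1*T <= c*T" by (rule mult_right_mono) (use that c12 c3(1) P_nonneg in \<open>simp_all add: c_def\<close>)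
   have "c2*P <= (c2 + c3)*P" "c3*P <= (c2 + c3)*P" using c12 c3(1) P_nonneg by (auto intro!: mult_right_mono)
   then have "c2*P <= c" "c3*P <= c" using c12 unfolding c_def by linarith+
   then have "(c2*P) * a m + (c3*P) * R <= c * a m + c * R" using am that by (intro add_mono mult_right_mono) auto
   then have "a m*((c2*P) * a m + (c3*P) * R) <= a m*(c * a m + c * R)" using am by (intro mult_left_mono) auto
   then show ?thesis using 1 am by (simp add: algebra_simps)
  qed
  show ?thesis by (rule nrm_le_mono[OF 3[unfolded e] f q1(2)]) (use A in simp_all)
 qed
 then show ?thesis using cp by blast
qed

end

section \<open>Reduction to the partial sums\<close>

text \<open>Here g(j) bounds the norm of the projection of the whole sum at time j. For the 2n
  latest times g is at most of order n^{1-\<beta>}. At an earlier time every term has lag beyond n +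
  v, and the squares are summable since 2\<beta> > 1.\<close>

lemma sum_powr_kernel_le:
 fixes \<beta> C :: real and n N :: nat
 assumes b: "1/2 < \<beta>" "\<beta> < 1" and C: "C >= 0" and n: "n >= 1"
 defines "g \<equiv> %j::int. \<Sum>i=1..n. (if j <= int i then C*(1 + real (nat (int i - j))) powr (- \<beta>) else 0)"
 shows "(\<Sum>u<N + n. (g (int n - int u))^2) <= (2*(C/(1 - \<beta>))^2 + C^2*(2*\<beta>/(2*\<beta> - 1)))*real n powr (3 - 2*\<beta>)"
proof -
 have g0: "0 <= g j" for j unfolding g_def using C by (intro sum_nonneg) auto
 have ga: "g j <= C/(1 - \<beta>)*real n powr (1 - \<beta>)" for j
 proof -
  \<comment> \<open>Terms with i < j vanish and i starts at 1, so lags may be counted from the later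
    of the two times.\<close>
  define t where "t = nat (max 1 j)"
  have "g j <= (\<Sum>i=1..n. if t <= i then C*(1 + real (i - t)) powr (- \<beta>) else 0)"
   unfolding g_def
  proof (rule sum_mono)
   fix i assume i: "i \<in> {1..n}"
   show "(if j <= int i then C*(1 + real (nat (int i - j))) powr (- \<beta>) else 0) <= (if t <= i then C*(1 + real (i - t)) powr (- \<beta>) else 0)"
   proof (cases "j <= int i")
    case True
    then have t: "t <= i" using i by (auto simp: t_def)
    have "int t = max 1 j" by (simp add: t_def)
   then have "int (i - t) <= int i - j" using t by (simp add: of_nat_diff)
    then have "i - t <= nat (int i - j)" by simp
    then have "(1 + real (nat (int i - j))) powr (- \<beta>) <= (1 + real (i - t)) powr (- \<beta>)"
     using b by (intro powr_mono2') auto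
    then show ?thesis using True t C by (simp add: mult_left_mono)
   next
    case False
    then show ?thesis using C by simp
   qed
  qed
  also have "... = (\<Sum>i\<in>{1..n} \<inter> {i. t <= i}. C*(1 + real (i - t)) powr (- \<beta>))"
   by (simp only: sum.inter_restrict[OF finite_atLeastAtMost] mem_Collect_eq)
  also have "... = (\<Sum>m\<in>(%i. i - t) ` ({1..n} \<inter> {i. t <= i}). C*(1 + real m) powr (- \<beta>))"
   by (subst sum.reindex) (auto simp: inj_on_def)
  also have "... <= (\<Sum>m<n. C*(1 + real m) powr (- \<beta>))"
  proof (rule sum_mono2)
   have "t >= 1" by (simp add: t_def)
   then show "(%i. i - t) ` ({1..n} \<inter> {i. t <= i}) \<subseteq> {..<n}" by auto
  qed (use C in auto)
  also have "... = C*(\<Sum>m<n. (real m + 1) powr (- \<beta>))" by (simp add: sum_distrib_left add.commute)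
  also have "... <= C*(real n powr (1 - \<beta>)/(1 - \<beta>))" using b C by (intro mult_left_mono sum_powr_le) auto
  finally show ?thesis by simp
 qed
 have gb: "(g (int n - int (2*n + v)))^2 <= (real n)^2*C^2*(real (n + v)) powr (- (2*\<beta>))" for v
 proof -
  have "g (int n - int (2*n + v)) <= (\<Sum>i=1..n. C*(real (n + v)) powr (- \<beta>))"
   unfolding g_def
  proof (rule sum_mono)
   fix i assume "i \<in> {1..n}"
   have "(1 + real (nat (int i - (int n - int (2*n + v))))) powr (- \<beta>) <= (real (n + v)) powr (- \<beta>)"
    using b n by (intro powr_mono2') auto
   then show "(if int n - int (2*n + v) <= int i then C*(1 + real (nat (int i - (int n - int (2*n + v))))) powr (- \<beta>) else 0) <= C*(real (n + v)) powr (- \<beta>)"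
    using C by (auto intro: mult_left_mono)
  qed
  also have "... = real n*(C*(real (n + v)) powr (- \<beta>))" by simp
  finally have "(g (int n - int (2*n + v)))^2 <= (real n*(C*(real (n + v)) powr (- \<beta>)))^2"
   using g0 by (intro power_mono) auto
  also have "... = (real n)^2*C^2*((real (n + v)) powr (- \<beta>))^2" by (simp add: power_mult_distrib)
  also have "((real (n + v)) powr (- \<beta>))^2 = (real (n + v)) powr (- (2*\<beta>))"
   unfolding power2_eq_square by (simp flip: powr_add)
  finally show ?thesis .
 qed
 have split: "(\<Sum>u<2*n + N. f u) = (\<Sum>u<2*n. f u) + (\<Sum>v<N. f (2*n + v))" for f :: "nat => real"
  by (induction N) (auto simp: add.assoc)
 have "(\<Sum>u<N + n. (g (int n - int u))^2) <= (\<Sum>u<2*n + N. (g (int n - int u))^2)"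
  by (rule sum_mono2) auto
 also have "... = (\<Sum>u<2*n. (g (int n - int u))^2) + (\<Sum>v<N. (g (int n - int (2*n + v)))^2)"
  by (rule split)
 also have "... <= (\<Sum>u<2*n. (C/(1 - \<beta>)*real n powr (1 - \<beta>))^2) + (\<Sum>v<N. (real n)^2*C^2*(real (n + v)) powr (- (2*\<beta>)))"
  by (intro add_mono sum_mono power_mono ga gb g0)
 also have "... = (C/(1 - \<beta>))^2*(2*(real n*(real n powr (1 - \<beta>))^2)) + (real n)^2*C^2*(\<Sum>v<N. (real (n + v)) powr (- (2*\<beta>)))"
  by (simp only: sum_distrib_left sum_constant power_mult_distrib card_lessThan of_nat_mult of_nat_numeral mult.assoc mult.commute mult.left_commute)
 also have "... <= (C/(1 - \<beta>))^2*(2*(real n*(real n powr (1 - \<beta>))^2)) + (real n)^2*C^2*(2*\<beta>/(2*\<beta> - 1)*real n powr (1 - 2*\<beta>))"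
  using b n by (intro add_left_mono mult_left_mono sum_powr_tail_le) auto
 also have "real n*(real n powr (1 - \<beta>))^2 = real n powr (3 - 2*\<beta>)"
 proof -
  have "real n powr (1 + (1 - \<beta>) + (1 - \<beta>)) = real n powr 1*real n powr (1 - \<beta>)*real n powr (1 - \<beta>)"
   by (simp only: powr_add)
  moreover have "1 + (1 - \<beta>) + (1 - \<beta>) = 3 - 2*\<beta>" by simp
  moreover have "real n powr 1 = real n" using n by simp
  ultimately show ?thesis by (simp only: power2_eq_square mult.assoc)
 qed
 also have "(real n)^2*C^2*(2*\<beta>/(2*\<beta> - 1)*real n powr (1 - 2*\<beta>)) = C^2*(2*\<beta>/(2*\<beta> - 1))*real n powr (3 - 2*\<beta>)"
 proof -
  have "real n powr (2 + (1 - 2*\<beta>)) = real n powr 2*real n powr (1 - 2*\<beta>)" by (simp only: powr_add)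
  moreover have "2 + (1 - 2*\<beta>) = 3 - 2*\<beta>" by simp
  moreover have "real n powr 2 = (real n)^2" using n by (simp add: powr_numeral)
  ultimately have e: "(real n)^2*real n powr (1 - 2*\<beta>) = real n powr (3 - 2*\<beta>)" by simp
  show ?thesis unfolding e[symmetric] by (simp only: mult.assoc mult.commute mult.left_commute)
 qed
 finally show ?thesis by (simp add: algebra_simps)
qed

section \<open>Projections of the nonlinear part along the filtration\<close>

context smooth_process
begin

definition L :: "int => 'a => real" where "L i om = K (V 0 i om) - \<kappa>*V 0 i om"

text \<open>The minimum makes \<open>E i j\<close> equal to L_i almost surely once j >= i, so that
  sums over i telescope over one common range of times j.\<close>

definition E :: "int => int => 'a => real" where "E i j = real_cond_exp M (past_field M \<xi> (min i j)) (L i)"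

lemma K_proc_integrable: "integrable M (%om. K (V 0 i om))"
 and K_proc_mean: "(LINT om|M. K (V 0 i om)) = (LINT om|M. K (V 0 0 om))"
proof -
 note [measurable] = K_meas
 have e: "distr M borel (V 0 i) = distr M borel (V 0 0)" by (simp add: distr_V)
 have "integrable M (%om. K (0 + V 0 0 om))" using eventually_nhds_x_imp_x[OF K_int] .
 then show "integrable M (%om. K (V 0 i om))"
  using integrable_distr_eq[of "V 0 i" M borel K] integrable_distr_eq[of "V 0 0" M borel K] e K_meas by simp
 show "(LINT om|M. K (V 0 i om)) = (LINT om|M. K (V 0 0 om))"
  using integral_distr[of "V 0 i" M borel K] integral_distr[of "V 0 0" M borel K] e K_meas by simp
qed

lemma L_integrable: "integrable M (L i)"
 unfolding L_def[abs_def] by (intro Bochner_Integration.integrable_diff K_proc_integrable integrable_mult_right V_integrable)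

lemma E_eq: "AE om in M. E (j + int m) j om = Kn m (V m j om) - \<kappa>*V m j om"
 and E_split: "AE om in M. E (j + int m) j om = real_cond_exp M (past_field M \<xi> j) (%om. K (V 0 (j + int m) om)) om - \<kappa>*V m j om"
proof -
 interpret F: sigma_finite_subalgebra M "past_field M \<xi> j" unfolding past_field_eq by (rule finite_measure_sub[OF subalgebra_field_of])
 have m: "min (j + int m) j = j" by simp
 have iV: "integrable M (%om. \<kappa>*V 0 (j + int m) om)" by (intro integrable_mult_right V_integrable)
 have 1: "AE om in M. E (j + int m) j om = real_cond_exp M (past_field M \<xi> j) (%om. K (V 0 (j + int m) om)) om - real_cond_exp M (past_field M \<xi> j) (%om. \<kappa>*V 0 (j + int m) om) om"
  unfolding E_def m L_def[abs_def] by (rule F.real_cond_exp_diff[OF K_proc_integrable iV])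
 have 2: "AE om in M. real_cond_exp M (past_field M \<xi> j) (%om. \<kappa>*V 0 (j + int m) om) om = \<kappa>*real_cond_exp M (past_field M \<xi> j) (V 0 (j + int m)) om"
  by (rule F.real_cond_exp_cmult[OF V_integrable])
 have 3: "AE om in M. real_cond_exp M (past_field M \<xi> j) (V 0 (j + int m)) om = V m j om"
  using lin_pred_eq[of "j + int m" m] unfolding lin_pred_def lin_proc_eq by simp
 show 4: "AE om in M. E (j + int m) j om = real_cond_exp M (past_field M \<xi> j) (%om. K (V 0 (j + int m) om)) om - \<kappa>*V m j om"
  using 1 2 3 by eventually_elim simp
 have "AE om in M. real_cond_exp M (past_field M \<xi> j) (%om. K (V 0 (j + int m) om)) om = Kn m (V m j om)"
  using cond_exp_V_U[OF K_meas K_proc_integrable, of "j + int m" m] unfolding Kn_def by simp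
 then show "AE om in M. E (j + int m) j om = Kn m (V m j om) - \<kappa>*V m j om"
  using 4 by eventually_elim simp
qed

lemma E_integrable: "integrable M (E i j)"
 and E_past: "E i j \<in> borel_measurable (past_field M \<xi> (min i j))"
proof -
 interpret F: sigma_finite_subalgebra M "past_field M \<xi> (min i j)" unfolding past_field_eq by (rule finite_measure_sub[OF subalgebra_field_of])
 show "integrable M (E i j)" unfolding E_def by (rule F.real_cond_exp_int(1)[OF L_integrable])
 show "E i j \<in> borel_measurable (past_field M \<xi> (min i j))" unfolding E_def by (rule borel_measurable_cond_exp)
qed

lemma E_measurable: "E i j \<in> borel_measurable M" by (rule borel_measurable_integrable[OF E_integrable])

lemma E_past': "j <= k ==> E i j \<in> borel_measurable (past_field M \<xi> k)"
 unfolding past_field_eq by (rule field_of_measurable_mono[OF E_past[unfolded past_field_eq]]) auto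

lemma E_martingale: "AE om in M. real_cond_exp M (past_field M \<xi> (j - 1)) (%om. E i j om - E i (j - 1) om) om = 0"
proof -
 interpret F: sigma_finite_subalgebra M "past_field M \<xi> (j - 1)" unfolding past_field_eq by (rule finite_measure_sub[OF subalgebra_field_of])
 have F': "AE om in M. real_cond_exp M (past_field M \<xi> (j - 1)) (E i (j - 1)) om = E i (j - 1) om"
  by (rule F.real_cond_exp_F_meas[OF E_integrable E_past']) simp
 have "AE om in M. real_cond_exp M (past_field M \<xi> (j - 1)) (E i j) om = E i (j - 1) om"
 proof (cases "j <= i")
  case True
  then have e: "min i j = j" "min i (j - 1) = j - 1" by auto
  show ?thesis unfolding E_def e
   by (rule F.real_cond_exp_nested_subalg[OF _ _ L_integrable]) (unfold past_field_eq, rule subalgebra_field_of, rule subalgebra_field_of_mono, auto)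
 next
  case False
  then have "min i j = min i (j - 1)" by auto
  then have "E i j = E i (j - 1)" by (simp add: E_def)
  then show ?thesis using F' by simp
 qed
 then show ?thesis using F' F.real_cond_exp_diff[OF E_integrable[of i j] E_integrable[of i "j - 1"]] by eventually_elim simp
qed

text \<open>At lag m >= n0 the projection is exactly the linearisation error. The finitely many
  smaller lags, where Condition B gives nothing, are bounded by the moment of K and absorbed in the
  constant.\<close>

lemma E_diff_le:
 assumes B0: "!!i. nrm_le M q (%om. K (V 0 i om)) B0" and b: "1/2 < \<beta>" "\<beta> < 1"
  and ab: "!!m. a m powr (p/q) + a m*(a m + sqrt (A2 (Suc m))) <= C*(1 + real m) powr (- \<beta>)"
 shows "\<exists>c>0. \<forall>i j. nrm_le M q (%om. E i j om - E i (j - 1) om) (if j <= i then c*(1 + real (nat (i - j))) powr (- \<beta>) else 0)"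
proof -
 obtain c where c: "c > 0" "!!m s. m >= n0 ==> nrm_le M q (%om. Kn m (V (Suc m) s om + a m*\<xi> (s + 1) om) - Kn (Suc m) (V (Suc m) s om) - \<kappa>*(a m*\<xi> (s + 1) om))
   (c*(a m powr (p/q) + a m*(a m + sqrt (A2 (Suc m)))))" using linearisation_error by auto
 have q1: "q >= 1" "q >= 0" "q > 1" using pq by auto
 define d where "d m = 2*B0 + \<bar>\<kappa>\<bar>*(a m*P)" for m
 \<comment> \<open>Weighting each exceptional bound by (1 + m)^\<beta> makes the same decaying
   majorant hold at these lags too.\<close>
 define c' where "c' = c*C + (\<Sum>m<n0. (abs (d m))*(1 + real m) powr \<beta>) + 1"
 have C0: "C >= 0"
 proof -
  have "0 <= a 0 powr (p/q) + a 0*(a 0 + sqrt (A2 (Suc 0)))" using a_pos[of 0] A2_nonneg[of "Suc 0"] by (intro add_nonneg_nonneg mult_nonneg_nonneg) auto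
  then show ?thesis using ab[of 0] by simp
 qed
 have cC: "c*C >= 0" using c(1) C0 by simp
 have c'1: "c' > 0" "c*C <= c'" unfolding c'_def using cC by (auto intro!: add_nonneg_pos add_nonneg_nonneg sum_nonneg)
 have dm: "d m <= c'*(1 + real m) powr (- \<beta>)" if "m < n0" for m
 proof -
  have "(abs (d m))*(1 + real m) powr \<beta> <= (\<Sum>m<n0. (abs (d m))*(1 + real m) powr \<beta>)"
   by (rule member_le_sum) (use that in auto)
  then have le: "(abs (d m))*(1 + real m) powr \<beta> <= c'" unfolding c'_def using cC by linarith
  have "(abs (d m))*(1 + real m) powr \<beta>*(1 + real m) powr (- \<beta>) <= c'*(1 + real m) powr (- \<beta>)"
   using le by (rule mult_right_mono) simp
  moreover have "(abs (d m))*(1 + real m) powr \<beta>*(1 + real m) powr (- \<beta>) = (abs (d m))" by (simp add: mult.assoc flip: powr_add)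
  ultimately show ?thesis by linarith
 qed
 have "nrm_le M q (%om. E i j om - E i (j - 1) om) (if j <= i then c'*(1 + real (nat (i - j))) powr (- \<beta>) else 0)" for i j
 proof (cases "j <= i")
  case False
  then have "min i j = min i (j - 1)" by auto
  then have "E i j = E i (j - 1)" by (simp add: E_def)
  then show ?thesis using False nrm_le_0 by simp
 next
  case True
  define m where "m = nat (i - j)"
  have i: "i = j + int m" "i = (j - 1) + int (Suc m)" using True by (simp_all add: m_def)
  have mD: "(%om. E i j om - E i (j - 1) om) \<in> borel_measurable M" by (intro borel_measurable_diff E_measurable)
  have st: "AE om in M. V m j om = a m*\<xi> j om + V (Suc m) (j - 1) om" using AE_V_step by eventually_elim blast
  have "nrm_le M q (%om. E i j om - E i (j - 1) om) (c'*(1 + real m) powr (- \<beta>))"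
  proof (cases "n0 <= m")
   case True
   have n: "nrm_le M q (%om. Kn m (V (Suc m) (j - 1) om + a m*\<xi> j om) - Kn (Suc m) (V (Suc m) (j - 1) om) - \<kappa>*(a m*\<xi> j om)) (c*(a m powr (p/q) + a m*(a m + sqrt (A2 (Suc m)))))"
    using c(2)[OF True, of "j - 1"] by simp
   have e: "AE om in M. E i j om - E i (j - 1) om = Kn m (V (Suc m) (j - 1) om + a m*\<xi> j om) - Kn (Suc m) (V (Suc m) (j - 1) om) - \<kappa>*(a m*\<xi> j om)"
    using E_eq[of j m, folded i(1)] E_eq[of "j - 1" "Suc m", folded i(2)] st
    by eventually_elim (simp add: algebra_simps)
   have "c*(a m powr (p/q) + a m*(a m + sqrt (A2 (Suc m)))) <= c*(C*(1 + real m) powr (- \<beta>))"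
    using c(1) by (intro mult_left_mono ab) simp
   also have "... <= c'*(1 + real m) powr (- \<beta>)" unfolding mult.assoc[symmetric] using c'1 by (intro mult_right_mono) auto
   finally show ?thesis by (rule nrm_le_mono[OF nrm_le_cong_AE[OF n mD e q1(2)] _ q1(2)])
  next
   case False
   let ?G = "%j. real_cond_exp M (past_field M \<xi> j) (%om. K (V 0 i om))"
   have G: "nrm_le M q (?G k) B0" for k unfolding past_field_eq by (rule nrm_le_cond_exp[OF B0 q1(3) subalgebra_field_of])
   have n: "nrm_le M q (%om. (?G j om - ?G (j - 1) om) - \<kappa>*(a m*\<xi> j om)) ((B0 + B0) + \<bar>\<kappa>\<bar>*((abs (a m))*P))"
    by (intro nrm_le_diff nrm_le_scale G q1 xi_powr_le(2))
   have e: "AE om in M. E i j om - E i (j - 1) om = (?G j om - ?G (j - 1) om) - \<kappa>*(a m*\<xi> j om)"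
    using E_split[of j m, folded i(1)] E_split[of "j - 1" "Suc m", folded i(2)] st
    by eventually_elim (simp add: algebra_simps)
   have am: "a m > 0" by (rule a_pos)
   have "(B0 + B0) + \<bar>\<kappa>\<bar>*((abs (a m))*P) = d m" using am by (simp add: d_def)
   also have "... <= c'*(1 + real m) powr (- \<beta>)" by (rule dm) (use False in simp)
   finally show ?thesis by (rule nrm_le_mono[OF nrm_le_cong_AE[OF n mD e q1(2)] _ q1(2)])
  qed
  then show ?thesis using True by (simp add: m_def)
 qed
 then show ?thesis using c'1(1) by blast
qed

text \<open>Seen from the remote past, both K(X_i), whose mean is 0, and the linear part have
  conditional expectations tending to 0 in L^1.\<close>

lemma E_limit:
 assumes mean: "(LINT om|M. K (V 0 0 om)) = 0"
 shows "(%N. \<integral>om. \<bar>E (int i) (- int N) om\<bar> \<partial>M) \<longlonglongrightarrow> 0"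
proof (rule tendstoI)
 fix e :: real assume e: "e > 0"
 have K0: "integrable M (%om. K (V 0 0 om))" by (rule K_proc_integrable)
 have A: "(%m. \<bar>\<kappa>\<bar> * sqrt (s2*A2 m)) \<longlonglongrightarrow> \<bar>\<kappa>\<bar> * sqrt (s2*0)" by (intro tendsto_intros A2_lim)
 have "\<forall>\<^sub>F m in sequentially. \<bar>\<kappa>\<bar> * sqrt (s2*A2 m) < e/2" using order_tendstoD(2)[OF A, of "e/2"] e by simp
 then have "\<forall>\<^sub>F m in sequentially. \<forall>s. (LINT om|M. \<bar>E (s + int m) s om\<bar>) < e"
  using cond_mean_tendsto[OF K_meas K0 half_gt_zero[OF e]]
 proof eventually_elim
  case (elim m)
  show ?case
  proof
   fix s
   have i1: "integrable M (%om. E (s + int m) s om + \<kappa>*V m s om)" by (intro Bochner_Integration.integrable_add integrable_mult_right V_integrable E_integrable)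
   have i2: "integrable M (%om. \<bar>\<kappa>\<bar>*(abs (V m s om)))" by (intro integrable_mult_right integrable_abs V_integrable)
   have "(LINT om|M. \<bar>E (s + int m) s om\<bar>) <= (LINT om|M. \<bar>E (s + int m) s om + \<kappa>*V m s om\<bar> + \<bar>\<kappa>\<bar>*(abs (V m s om)))"
   proof (rule integral_mono)
    show "\<bar>E (s + int m) s om\<bar> <= \<bar>E (s + int m) s om + \<kappa>*V m s om\<bar> + \<bar>\<kappa>\<bar>*(abs (V m s om))" for om
     unfolding abs_mult[symmetric] by linarith
    show "integrable M (%om. \<bar>E (s + int m) s om\<bar>)" by (rule integrable_abs[OF E_integrable])
    show "integrable M (%om. \<bar>E (s + int m) s om + \<kappa>*V m s om\<bar> + \<bar>\<kappa>\<bar>*(abs (V m s om)))"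
     by (rule Bochner_Integration.integrable_add[OF integrable_abs[OF i1] i2])
   qed
   also have "... = (LINT om|M. \<bar>E (s + int m) s om + \<kappa>*V m s om\<bar>) + \<bar>\<kappa>\<bar>*(LINT om|M. (abs (V m s om)))"
    by (subst Bochner_Integration.integral_add[OF integrable_abs[OF i1] i2]) simp
   also have "(LINT om|M. \<bar>E (s + int m) s om + \<kappa>*V m s om\<bar>) = (\<integral>om. \<bar>(LINT u|\<tau> m. K (V m s om + u)) - (LINT om|M. K (V 0 0 om))\<bar> \<partial>M)"
   proof (rule integral_cong_AE)
    note [measurable] = K_meas E_measurable[of "s + int m" s]
    show "(%om. \<bar>E (s + int m) s om + \<kappa>*V m s om\<bar>) \<in> borel_measurable M" by measurable
    interpret T: prob_space "\<tau> m" by (rule prob_space_tau)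
    show "(%om. \<bar>(LINT u|\<tau> m. K (V m s om + u)) - (LINT om|M. K (V 0 0 om))\<bar>) \<in> borel_measurable M" unfolding mean by measurable
    show "AE om in M. \<bar>E (s + int m) s om + \<kappa>*V m s om\<bar> = \<bar>(LINT u|\<tau> m. K (V m s om + u)) - (LINT om|M. K (V 0 0 om))\<bar>"
     using E_eq[of s m] by eventually_elim (simp add: Kn_def mean)
   qed
   also have "... < e/2" using elim(2) by blast
   also have "\<bar>\<kappa>\<bar>*(LINT om|M. (abs (V m s om))) <= e/2"
    using mult_left_mono[OF expectation_abs_V[of m s] abs_ge_zero[of \<kappa>]] elim(1) by linarith
   finally show "(LINT om|M. \<bar>E (s + int m) s om\<bar>) < e" by simp
  qed
 qed
 then obtain m0 where m0: "!!m s. m >= m0 ==> (LINT om|M. \<bar>E (s + int m) s om\<bar>) < e"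
  unfolding eventually_sequentially by auto
 show "\<forall>\<^sub>F N in sequentially. dist (LINT om|M. \<bar>E (int i) (- int N) om\<bar>) 0 < e"
  using eventually_ge_at_top[of m0]
 proof eventually_elim
  case (elim N)
  have "(LINT om|M. \<bar>E (int i) (- int N) om\<bar>) < e" using m0[of "i + N" "- int N"] elim by simp
  moreover have "(LINT om|M. \<bar>E (int i) (- int N) om\<bar>) >= 0" by (rule Bochner_Integration.integral_nonneg) simp
  ultimately show ?case by (simp add: dist_real_def)
 qed
qed

text \<open>At each time the projections of all L_i are added by Minkowski's inequality; across
  times the martingale inequality adds squares only. The order n^{3/2-\<beta>} is the square root of
  the kernel sum.\<close>

theorem reduction_principle:
 assumes B0: "!!i. nrm_le M q (%om. K (V 0 i om)) B0" and mean: "(LINT om|M. K (V 0 0 om)) = 0" and b: "1/2 < \<beta>" "\<beta> < 1"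
  and ab: "!!m. a m powr (p/q) + a m*(a m + sqrt (A2 (Suc m))) <= C*(1 + real m) powr (- \<beta>)"
 shows "\<exists>C'>0. \<forall>n\<ge>1. nrm_le M q (%om. \<Sum>i=1..n. L (int i) om) (C'*real n powr (3/2 - \<beta>))"
proof -
 obtain c where c: "c > 0" "!!i j. nrm_le M q (%om. E i j om - E i (j - 1) om) (if j <= i then c*(1 + real (nat (i - j))) powr (- \<beta>) else 0)"
  using E_diff_le[OF B0 b ab] by auto
 obtain Cm where C0: "Cm > 0 & (\<forall>F D b N. (\<forall>k<N. subalgebra M (F k) & (\<forall>j<k. D j \<in> borel_measurable (F k)) &
    (AE om in M. real_cond_exp M (F k) (D k) om = 0) & nrm_le M q (D k) (b k) & b k > 0) \<longrightarrow>
  nrm_le M q (%om. \<Sum>k<N. D k om) (Cm * sqrt (\<Sum>k<(N::nat). (b k)^2)))"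
  using martingale_difference_moment[OF pq(1)] by (elim exE) (rule that)
 have Cm: "Cm > 0" by (rule conjunct1[OF C0])
 define B where "B = 2*(c/(1 - \<beta>))^2 + c^2*(2*\<beta>/(2*\<beta> - 1))"
 have Bp: "B > 0" unfolding B_def using b c(1) by (intro add_pos_pos mult_pos_pos divide_pos_pos zero_less_power) auto
 have q1: "q >= 1" "q >= 0" using pq by auto
 have "nrm_le M q (%om. \<Sum>i=1..n. L (int i) om) (Cm * sqrt B*real n powr (3/2 - \<beta>))" if n: "n >= 1" for n
 proof -
  define g where "g j = (\<Sum>i=1..n. (if j <= int i then c*(1 + real (nat (int i - j))) powr (- \<beta>) else 0))" for j :: int
  have step: "nrm_le M q (%om. (\<Sum>i=1..n. E (int i) (int n) om) - (\<Sum>i=1..n. E (int i) (- int N) om)) (Cm * sqrt B*real n powr (3/2 - \<beta>))" for N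
  proof -
   define t where "t k = int k - int N + 1" for k
   define D where "D k om = (\<Sum>i=1..n. E (int i) (t k) om - E (int i) (t k - 1) om)" for k om
   have "nrm_le M q (%om. \<Sum>k<N + n. D k om) (Cm * sqrt (\<Sum>k<N + n. (g (t k))^2))"
   proof (rule conjunct2[OF C0, THEN spec[of _ "%k. past_field M \<xi> (t k - 1)"], THEN spec[of _ D], THEN spec[of _ "%k. g (t k)"], THEN spec[of _ "N + n"], THEN mp], intro allI impI conjI)
    fix k assume k: "k < N + n"
    show "subalgebra M (past_field M \<xi> (t k - 1))" unfolding past_field_eq by (rule subalgebra_field_of)
    interpret F: sigma_finite_subalgebra M "past_field M \<xi> (t k - 1)" unfolding past_field_eq by (rule finite_measure_sub[OF subalgebra_field_of])
    show "D j \<in> borel_measurable (past_field M \<xi> (t k - 1))" if "j < k" for j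
     unfolding D_def[abs_def] by (intro borel_measurable_sum borel_measurable_diff E_past') (use that in \<open>auto simp: t_def\<close>)
    show "nrm_le M q (D k) (g (t k))" unfolding D_def[abs_def] g_def by (rule nrm_le_sum[OF c(2) q1(1)])
    have "0 < (if t k <= int n then c*(1 + real (nat (int n - t k))) powr (- \<beta>) else 0)" using k c(1) by (auto simp: t_def intro!: mult_pos_pos)
    also have "... <= g (t k)" unfolding g_def
     by (rule member_le_sum[of n "{1..n}" "%i. if t k <= int i then c*(1 + real (nat (int i - t k))) powr (- \<beta>) else 0"]) (use n c(1) in auto)
    finally show "0 < g (t k)" .
    have "AE om in M. \<forall>i\<in>{1..n}. real_cond_exp M (past_field M \<xi> (t k - 1)) (%om. E (int i) (t k) om - E (int i) (t k - 1) om) om = 0"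
     by (subst AE_finite_all) (auto intro: E_martingale)
    moreover have "AE om in M. real_cond_exp M (past_field M \<xi> (t k - 1)) (%om. \<Sum>i=1..n. E (int i) (t k) om - E (int i) (t k - 1) om) om = (\<Sum>i=1..n. real_cond_exp M (past_field M \<xi> (t k - 1)) (%om. E (int i) (t k) om - E (int i) (t k - 1) om) om)"
     by (rule F.real_cond_exp_sum) (intro Bochner_Integration.integrable_diff E_integrable)
    ultimately show "AE om in M. real_cond_exp M (past_field M \<xi> (t k - 1)) (D k) om = 0"
     unfolding D_def[abs_def] by eventually_elim simp
   qed
   moreover have "(\<Sum>k<N + n. D k om) = (\<Sum>i=1..n. E (int i) (int n) om) - (\<Sum>i=1..n. E (int i) (- int N) om)" for om
   proof -
    have "(\<Sum>k<N + n. D k om) = (\<Sum>i=1..n. \<Sum>k<N + n. E (int i) (int (Suc k) - int N) om - E (int i) (int k - int N) om)"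
     unfolding D_def t_def by (subst sum.swap) (simp add: algebra_simps)
    also have "... = (\<Sum>i=1..n. E (int i) (int (N + n) - int N) om - E (int i) (int 0 - int N) om)"
     by (rule sum.cong[OF refl], rule sum_lessThan_telescope)
    also have "... = (\<Sum>i=1..n. E (int i) (int n) om) - (\<Sum>i=1..n. E (int i) (- int N) om)" by (simp add: sum_subtractf)
    finally show ?thesis .
   qed
   ultimately have nr: "nrm_le M q (%om. (\<Sum>i=1..n. E (int i) (int n) om) - (\<Sum>i=1..n. E (int i) (- int N) om)) (Cm * sqrt (\<Sum>k<N + n. (g (t k))^2))" by simp
   have "(\<Sum>k<N + n. (g (t k))^2) = (\<Sum>k<N + n. (%u. (g (int n - int u))^2) (N + n - Suc k))"
    by (intro sum.cong refl) (auto simp: t_def of_nat_diff algebra_simps)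
   also have "... = (\<Sum>u<N + n. (g (int n - int u))^2)" by (rule sum.nat_diff_reindex)
   also have "... <= B*real n powr (3 - 2*\<beta>)"
    unfolding g_def B_def by (rule sum_powr_kernel_le[OF b _ n]) (use c(1) in simp)
   finally have "sqrt (\<Sum>k<N + n. (g (t k))^2) <= sqrt (B*real n powr (3 - 2*\<beta>))" by (rule real_sqrt_le_mono)
   also have "... = sqrt B*real n powr (3/2 - \<beta>)"
   proof -
    have "real n powr (3 - 2*\<beta>) = (real n powr (3/2 - \<beta>))^2" unfolding power2_eq_square by (simp flip: powr_add)
    then show ?thesis by (simp add: real_sqrt_mult)
   qed
   finally have "Cm * sqrt (\<Sum>k<N + n. (g (t k))^2) <= Cm * sqrt B*real n powr (3/2 - \<beta>)"
    unfolding mult.assoc using Cm by (intro mult_left_mono) auto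
   then show ?thesis by (rule nrm_le_mono[OF nr _ q1(2)])
  qed
  \<comment> \<open>The bound does not depend on N, so the contribution of the remote past is
    removed in the limit in probability.\<close>
  have "nrm_le M q (%om. (\<Sum>i=1..n. E (int i) (int n) om) - 0) (Cm * sqrt B*real n powr (3/2 - \<beta>))"
  proof (rule nrm_le_limit_in_prob[OF _ _ step])
   fix e :: real assume e: "e > 0"
   have iB: "integrable M (%om. \<Sum>i=1..n. E (int i) (- int N) om)" for N by (intro Bochner_Integration.integrable_sum E_integrable)
   have lim: "(%N. (\<Sum>i=1..n. \<integral>om. \<bar>E (int i) (- int N) om\<bar> \<partial>M)/e) \<longlonglongrightarrow> (\<Sum>i=1..n. 0)/e"
    using e by (intro tendsto_divide tendsto_sum E_limit[OF mean] tendsto_const) simp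
   show "(%N. prob {om\<in>space M. \<bar>(\<Sum>i=1..n. E (int i) (- int N) om) - 0\<bar> > e}) \<longlonglongrightarrow> 0"
   proof (rule tendsto_sandwich[OF _ _ tendsto_const])
    show "(%N. (\<Sum>i=1..n. \<integral>om. \<bar>E (int i) (- int N) om\<bar> \<partial>M)/e) \<longlonglongrightarrow> 0" using lim by simp
    show "\<forall>\<^sub>F N in sequentially. prob {om\<in>space M. \<bar>(\<Sum>i=1..n. E (int i) (- int N) om) - 0\<bar> > e} <= (\<Sum>i=1..n. \<integral>om. \<bar>E (int i) (- int N) om\<bar> \<partial>M)/e"
    proof (rule always_eventually, rule allI)
     fix N
     let ?B = "%om. \<Sum>i=1..n. E (int i) (- int N) om"
     note [measurable] = E_measurable
     have "prob {om\<in>space M. \<bar>?B om - 0\<bar> > e} <= prob {om\<in>space M. e <= \<bar>?B om\<bar>}"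
      by (rule finite_measure_mono) auto
     also have "... <= (LINT om|M. \<bar>?B om\<bar>)/e"
      by (rule integral_Markov_inequality_measure[where A="{}"]) (use integrable_abs[OF iB[of N]] e in auto)
     also have "(LINT om|M. \<bar>?B om\<bar>) <= (LINT om|M. (\<Sum>i=1..n. \<bar>E (int i) (- int N) om\<bar>))"
      by (rule integral_mono[OF integrable_abs[OF iB]]) (intro Bochner_Integration.integrable_sum integrable_abs E_integrable, rule sum_abs)
     also have "... = (\<Sum>i=1..n. \<integral>om. \<bar>E (int i) (- int N) om\<bar> \<partial>M)"
      by (rule Bochner_Integration.integral_sum) (rule integrable_abs[OF E_integrable])
     finally show "prob {om\<in>space M. \<bar>?B om - 0\<bar> > e} <= (\<Sum>i=1..n. \<integral>om. \<bar>E (int i) (- int N) om\<bar> \<partial>M)/e"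
      using e by (simp add: divide_right_mono)
    qed
   qed simp
  qed (intro borel_measurable_sum E_measurable q1)+
  then have nr: "nrm_le M q (%om. \<Sum>i=1..n. E (int i) (int n) om) (Cm * sqrt B*real n powr (3/2 - \<beta>))" by simp
  show ?thesis
  proof (rule nrm_le_cong_AE[OF nr _ _ q1(2)])
   show "(%om. \<Sum>i=1..n. L (int i) om) \<in> borel_measurable M"
    by (intro borel_measurable_sum borel_measurable_integrable L_integrable)
   have "AE om in M. \<forall>i\<in>{1..n}. E (int i) (int n) om = L (int i) om"
   proof (subst AE_finite_all, simp, rule ballI)
    fix i assume i: "i \<in> {1..n}"
    then have e: "min (int i) (int n) = int i" by simp
    interpret F: sigma_finite_subalgebra M "past_field M \<xi> (int i)" unfolding past_field_eq by (rule finite_measure_sub[OF subalgebra_field_of])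
    note [measurable] = V_past[of 0 "int i"] K_meas
    show "AE om in M. E (int i) (int n) om = L (int i) om" unfolding E_def e
     by (rule F.real_cond_exp_F_meas[OF L_integrable]) (unfold L_def[abs_def], measurable)
   qed
   then show "AE om in M. (\<Sum>i=1..n. L (int i) om) = (\<Sum>i=1..n. E (int i) (int n) om)" by eventually_elim simp
  qed
 qed
 then show ?thesis using Cm Bp by (intro exI[of _ "Cm * sqrt B"]) auto
qed

end

section \<open>The weights of the partial sums\<close>

context linear_process
begin

text \<open>The coefficient of \<xi>_{n-u} in S_n. Counting times backwards from n makes it
  independent of where the past is cut off.\<close>

definition wt :: "nat => nat => real" where
 "wt n u = (\<Sum>i=1..n. if n <= i + u then a (i + u - n) else 0)"

text \<open>The part of S_n carried by innovations up to time -N: the sum of the predictors of X_1,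
  ..., X_n from that time.\<close>

definition rem :: "nat => nat => 'a => real" where
 "rem n N om = (\<Sum>i=1..n. V (i + N) (- int N) om)"

definition part :: "nat => nat => 'a => real" where
 "part n N om = (\<Sum>u<N + n. wt n u*\<xi> (int n - int u) om)"

lemma AE_partial_sum: "AE om in M. \<forall>n N. (\<Sum>i=1..n. V 0 (int i) om) = part n N om + rem n N om"
 using AE_V_split
proof eventually_elim
 case (elim om)
 show ?case
 proof (intro allI)
  fix n N
  have v: "V 0 (int i) om = U 0 (i + N) (int i) om + V (i + N) (- int N) om" for i
  proof -
   have "V 0 (int i) om = U 0 (i + N) (int i) om + V (0 + (i + N)) (int i - int (i + N)) om" using elim by blast
   then show ?thesis by simp
  qed
  have u: "U 0 (i + N) (int i) om = (\<Sum>u<N + n. (if n <= i + u then a (i + u - n) else 0)*\<xi> (int n - int u) om)" if i: "i \<in> {1..n}" for i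
  proof -
   have "(\<Sum>u<N + n. (if n <= i + u then a (i + u - n) else 0)*\<xi> (int n - int u) om)
     = (\<Sum>u\<in>{n - i..<N + n}. a (i + u - n)*\<xi> (int n - int u) om)"
    by (rule sum.mono_neutral_cong_right) (use i in auto)
   also have "... = (\<Sum>k\<in>{0..<i + N}. a (i + (k + (n - i)) - n)*\<xi> (int n - int (k + (n - i))) om)"
    using sum.shift_bounds_nat_ivl[of "%u. a (i + u - n)*\<xi> (int n - int u) om" 0 "n - i" "i + N"] i by (simp add: add.commute)
   also have "... = (\<Sum>k<i + N. a k*\<xi> (int i - int k) om)"
    by (rule sum.cong) (use i in \<open>auto simp: of_nat_diff algebra_simps\<close>)
   finally show ?thesis by (simp add: U_def)
  qed
  have "(\<Sum>i=1..n. V 0 (int i) om) = (\<Sum>i=1..n. U 0 (i + N) (int i) om) + rem n N om"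
   by (simp add: v rem_def sum.distrib)
  also have "(\<Sum>i=1..n. U 0 (i + N) (int i) om) = (\<Sum>i=1..n. \<Sum>u<N + n. (if n <= i + u then a (i + u - n) else 0)*\<xi> (int n - int u) om)"
   by (rule sum.cong[OF refl u])
  also have "... = part n N om" unfolding part_def wt_def by (subst sum.swap) (simp add: sum_distrib_right)
  finally show "(\<Sum>i=1..n. V 0 (int i) om) = part n N om + rem n N om" .
 qed
qed

lemma rem_field: "rem n N \<in> borel_measurable (field_of {..- int N})"
 unfolding rem_def[abs_def] by (intro borel_measurable_sum V_field)

lemma rem_measurable[measurable]: "rem n N \<in> borel_measurable M"
 by (rule field_of_measurable[OF rem_field])

lemma part_measurable[measurable]: "part n N \<in> borel_measurable M"
 unfolding part_def[abs_def] by measurable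

lemma rem_second_moment:
 "integrable M (%om. (rem n N om)^2)" "(LINT om|M. (rem n N om)^2) <= real n*(\<Sum>i=1..n. s2*A2 (i + N))"
proof -
 have le: "(rem n N om)^2 <= (\<Sum>i=1..n. (V (i + N) (- int N) om)^2)*real n" for om
  using sum_squared_le_sum_of_squares[of "%i. V (i + N) (- int N) om" "{1..n}"] by (simp add: rem_def)
 have i: "integrable M (%om. (\<Sum>i=1..n. (V (i + N) (- int N) om)^2)*real n)"
  by (intro integrable_mult_left Bochner_Integration.integrable_sum V_second_moment(1))
 have nn: "0 <= (\<Sum>i=1..n. (V (i + N) (- int N) om)^2)*real n" for om by (intro mult_nonneg_nonneg sum_nonneg) auto
 show r: "integrable M (%om. (rem n N om)^2)"
  by (rule Bochner_Integration.integrable_bound[OF i]) (measurable, rule AE_I2, use le nn in simp)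
 have "(LINT om|M. (rem n N om)^2) <= (LINT om|M. (\<Sum>i=1..n. (V (i + N) (- int N) om)^2)*real n)"
  by (rule integral_mono[OF r i le])
 also have "... = (\<Sum>i=1..n. \<integral>om. (V (i + N) (- int N) om)^2 \<partial>M)*real n"
  by (simp add: Bochner_Integration.integral_sum V_second_moment(1))
 also have "... <= (\<Sum>i=1..n. s2*A2 (i + N))*real n"
  by (intro mult_right_mono sum_mono V_second_moment(2)) simp
 finally show "(LINT om|M. (rem n N om)^2) <= real n*(\<Sum>i=1..n. s2*A2 (i + N))" by (simp add: mult.commute)
qed

lemma part_second_moment:
 "integrable M (%om. (part n N om)^2)" "(LINT om|M. (part n N om)^2) = s2*(\<Sum>u<N + n. (wt n u)^2)"
proof -
 have inj: "inj_on (%u. int n - int u) {..<N + n}" by (auto simp: inj_on_def)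
 let ?J = "(%u. int n - int u) ` {..<N + n}"
 have e: "part n N = (%om. \<Sum>j\<in>?J. wt n (nat (int n - j))*\<xi> j om)"
  unfolding sum.reindex[OF inj] part_def[abs_def] by simp
 have e2: "(\<Sum>u<N + n. (wt n u)^2) = (\<Sum>j\<in>?J. (wt n (nat (int n - j)))^2)"
  unfolding sum.reindex[OF inj] by simp
 show "integrable M (%om. (part n N om)^2)" "(LINT om|M. (part n N om)^2) = s2*(\<Sum>u<N + n. (wt n u)^2)"
  unfolding e e2 by (rule sum_xi_second_moment; simp)+
qed

lemma part_rem_orthogonal:
 "integrable M (%om. part n N om*rem n N om)" "(LINT om|M. part n N om*rem n N om) = 0"
proof -
 have ir: "integrable M (rem n N)" unfolding rem_def[abs_def] by (intro Bochner_Integration.integrable_sum V_integrable)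
 have o: "integrable M (%om. rem n N om*\<xi> (int n - int u) om)" "(LINT om|M. rem n N om*\<xi> (int n - int u) om) = 0" if "u < N + n" for u
  by (rule expectation_mult_xi[OF _ rem_field ir]; use that in simp)+
 have e: "part n N om*rem n N om = (\<Sum>u<N + n. wt n u*(rem n N om*\<xi> (int n - int u) om))" for om
  by (simp add: part_def sum_distrib_right sum_distrib_left mult.assoc mult.commute mult.left_commute)
 show "integrable M (%om. part n N om*rem n N om)" unfolding e
  by (intro Bochner_Integration.integrable_sum integrable_mult_right) (use o(1) in auto)
 have "(LINT om|M. part n N om*rem n N om) = (\<Sum>u<N + n. \<integral>om. wt n u*(rem n N om*\<xi> (int n - int u) om) \<partial>M)" unfolding e
  by (rule Bochner_Integration.integral_sum) (intro integrable_mult_right, use o(1) in auto)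
 also have "... = 0" by (rule sum.neutral) (use o(2) in simp)
 finally show "(LINT om|M. part n N om*rem n N om) = 0" .
qed

text \<open>The two parts are orthogonal, so the identity holds for every cut N. With N = 0 it
  bounds the variance below, with N large it shows that the retained weights are almost
  normalised.\<close>

lemma sigma_S_eq:
 "(sigma_S M a \<xi> n)^2 = s2*(\<Sum>u<N + n. (wt n u)^2) + (LINT om|M. (rem n N om)^2)" "sigma_S M a \<xi> n >= 0"
proof -
 have S: "S_sum a \<xi> n = (%om. \<Sum>i=1..n. V 0 (int i) om)" by (simp add: S_sum_def[abs_def] lin_proc_eq)
 have m: "(LINT om|M. S_sum a \<xi> n om) = 0" unfolding S by (simp add: Bochner_Integration.integral_sum V_integrable V_mean)
 have v: "variance (S_sum a \<xi> n) = (LINT om|M. (S_sum a \<xi> n om)^2)" unfolding m by simp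
 have [measurable]: "S_sum a \<xi> n \<in> borel_measurable M" unfolding S by measurable
 have "(LINT om|M. (S_sum a \<xi> n om)^2) = (LINT om|M. (part n N om)^2 + 2*(part n N om*rem n N om) + (rem n N om)^2)"
 proof (rule integral_cong_AE)
  show "AE om in M. (S_sum a \<xi> n om)^2 = (part n N om)^2 + 2*(part n N om*rem n N om) + (rem n N om)^2"
   using AE_partial_sum
  proof eventually_elim
   case (elim om)
   have "S_sum a \<xi> n om = part n N om + rem n N om" unfolding S using elim by blast
   then show ?case by (simp add: power2_sum)
  qed
 qed measurable
 also have "... = s2*(\<Sum>u<N + n. (wt n u)^2) + (LINT om|M. (rem n N om)^2)"
  using part_second_moment[of n N] rem_second_moment(1)[of n N] part_rem_orthogonal[of n N]
  by (simp add: Bochner_Integration.integral_add)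
 finally have e: "variance (S_sum a \<xi> n) = s2*(\<Sum>u<N + n. (wt n u)^2) + (LINT om|M. (rem n N om)^2)" using v by simp
 have "0 <= variance (S_sum a \<xi> n)" unfolding v by (rule Bochner_Integration.integral_nonneg) simp
 then show "(sigma_S M a \<xi> n)^2 = s2*(\<Sum>u<N + n. (wt n u)^2) + (LINT om|M. (rem n N om)^2)" "sigma_S M a \<xi> n >= 0"
  unfolding sigma_S_def using e by simp_all
qed

lemma wt_bounds:
 assumes a0: "!!i. 0 <= a i" and n: "n >= 1" and C: "C > 0" and Rn: "Rn > 0"
  and up: "!!J. (\<Sum>i\<in>{J..<J + n}. a i) <= C * Rn" and lo: "!!k. n <= 2 * k ==> k <= n ==> Rn <= C*(\<Sum>i<k. a i)"
 shows "0 <= wt n u" "wt n u <= C * Rn" "real n * Rn^2 <= 2*C^2*(\<Sum>u<N + n. (wt n u)^2)"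
proof -
 show "0 <= wt n u" unfolding wt_def by (rule sum_nonneg) (use a0 in simp)
 have e: "wt n u = (\<Sum>m\<in>(%i. i + u - n) ` ({1..n} \<inter> {i. n <= i + u}). a m)" for u
 proof -
  have "wt n u = (\<Sum>i\<in>{1..n} \<inter> {i. n <= i + u}. a (i + u - n))"
   unfolding wt_def by (simp only: sum.inter_restrict[OF finite_atLeastAtMost] mem_Collect_eq)
  also have "... = (\<Sum>m\<in>(%i. i + u - n) ` ({1..n} \<inter> {i. n <= i + u}). a m)"
   by (subst sum.reindex) (auto simp: inj_on_def)
  finally show ?thesis .
 qed
 have "wt n u <= (\<Sum>i\<in>{u + 1 - n..<u + 1 - n + n}. a i)" unfolding e
  by (rule sum_mono2) (use a0 in auto)
 then show "wt n u <= C * Rn" using up[of "u + 1 - n"] by linarith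
 have low: "Rn <= C*wt n u" if u: "u < n" "n <= 2*(u + 1)" for u
 proof -
  have "{..<u + 1} \<subseteq> (%i. i + u - n) ` ({1..n} \<inter> {i. n <= i + u})"
  proof
   fix m assume "m \<in> {..<u + 1}"
   then show "m \<in> (%i. i + u - n) ` ({1..n} \<inter> {i. n <= i + u})"
    using u by (intro image_eqI[of _ _ "m + n - u"]) auto
  qed
  then have "(\<Sum>i<u + 1. a i) <= wt n u" unfolding e by (intro sum_mono2) (use a0 in auto)
  then have "C*(\<Sum>i<u + 1. a i) <= C*wt n u" using C by (intro mult_left_mono) auto
  then show ?thesis using lo[of "u + 1"] u by simp
 qed
 \<comment> \<open>Only the indices u from n div 2 to n - 1 are used; there are at least n/2 of
   them, and each weight contains the first u + 1 >= n/2 coefficients.\<close>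
 have "real n/2 * Rn^2 <= real (card {n div 2..<n}) * Rn^2" by (intro mult_right_mono) auto
 also have "... = (\<Sum>u\<in>{n div 2..<n}. Rn^2)" by simp
 also have "... <= (\<Sum>u\<in>{n div 2..<n}. (C*wt n u)^2)"
  by (intro sum_mono power_mono low) (use Rn in auto)
 also have "... <= (\<Sum>u<N + n. (C*wt n u)^2)" by (rule sum_mono2) auto
 also have "... = C^2*(\<Sum>u<N + n. (wt n u)^2)" by (simp add: power_mult_distrib sum_distrib_left)
 finally show "real n * Rn^2 <= 2*C^2*(\<Sum>u<N + n. (wt n u)^2)" by simp
qed

lemma rem_small:
 assumes e: "e > 0"
 shows "\<exists>N. (LINT om|M. (rem n N om)^2) <= e"
proof -
 have "(%N. real n*(\<Sum>i=1..n. s2*A2 (N + i))) \<longlonglongrightarrow> real n*(\<Sum>i=1..n. s2*0)"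
  by (intro tendsto_intros LIMSEQ_ignore_initial_segment A2_lim)
 then have "\<forall>\<^sub>F N in sequentially. real n*(\<Sum>i=1..n. s2*A2 (N + i)) < e"
  using e by (intro order_tendstoD(2)) auto
 then obtain N where "real n*(\<Sum>i=1..n. s2*A2 (N + i)) < e" by (auto simp: eventually_sequentially)
 then show ?thesis using rem_second_moment(2)[of n N] by (intro exI[of _ N]) (simp add: add.commute)
qed

end

section \<open>Proof of the theorem\<close>

text \<open>Outside an event of probability e_n, H and W differ by less than 1/ln n. Such a shift
  changes the normal tail by a factor tending to 1, since thresholds are of order sqrt(ln n). The
  probability e_n is negligible if it is small against the least tail in the range, of order
  n^{-c/2} up to logarithms.\<close>

lemma (in prob_space) normal_tail_transfer:
 fixes H W :: "nat => 'a => real" and x e R :: "nat => real" and c :: real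
 assumes meas[measurable]: "!!n. H n \<in> borel_measurable M" "!!n. W n \<in> borel_measurable M" and c: "c > 0"
  and R: "R \<longlonglongrightarrow> 0"
  and md: "\<forall>\<^sub>F n in sequentially. \<forall>y. y^2 <= c*ln (real n) + 1 \<longrightarrow> \<bar>prob {om\<in>space M. y <= W n om} - (1 - Phi y)\<bar> <= R n*(1 - Phi y)"
  and err: "\<forall>\<^sub>F n in sequentially. prob {om\<in>space M. 1/ln (real n) <= \<bar>H n om - W n om\<bar>} <= e n"
  and e: "(%n. e n*(15*(1 + sqrt (c*ln (real n)))*real n powr (c/2))) \<longlonglongrightarrow> 0"
  and x: "!!n. 1 <= n ==> (x n)\<^sup>2 <= c*ln (real n)"
 shows "\<exists>\<epsilon>. \<epsilon> \<longlonglongrightarrow> 0 & (\<forall>n\<ge>1. prob {om\<in>space M. x n <= H n om} = (1 - Phi (x n))*(1 + \<epsilon> n))"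
proof -
 define Q where "Q n = 1 - Phi (x n)" for n
 define Pr where "Pr n = prob {om\<in>space M. x n <= H n om}" for n
 define \<gamma> where "\<gamma> n = (1 + sqrt (c*ln (real n)))/ln (real n)" for n :: nat
 define \<zeta> where "\<zeta> n = 45*\<gamma> n + 46*(abs (R n)) + \<bar>e n*(15*(1 + sqrt (c*ln (real n)))*real n powr (c/2))\<bar>" for n
 have Q: "Q n > 0" for n unfolding Q_def by (rule Phi_tail_pos)
 have g: "\<gamma> \<longlonglongrightarrow> 0" unfolding \<gamma>_def[abs_def] using c by real_asymp
 have z: "\<zeta> \<longlonglongrightarrow> 45*0 + 46*\<bar>0\<bar> + \<bar>0\<bar>" unfolding \<zeta>_def[abs_def] by (intro tendsto_intros g R e)
 have ev1: "\<forall>\<^sub>F n in sequentially. \<gamma> n < 1" using order_tendstoD(2)[OF g, of 1] by simp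
 have lim2: "(%n. 2 * sqrt (c*ln (real n))/ln (real n) + (1/ln (real n))^2) \<longlonglongrightarrow> 0" using c by real_asymp
 have ev2: "\<forall>\<^sub>F n in sequentially. 2 * sqrt (c*ln (real n))/ln (real n) + (1/ln (real n))^2 < 1"
  using order_tendstoD(2)[OF lim2, of 1] by simp
 have main: "\<forall>\<^sub>F n in sequentially. \<bar>Pr n/Q n - 1\<bar> <= \<zeta> n"
  using md err ev1 ev2 eventually_ge_at_top[of 3]
 proof eventually_elim
  case (elim n)
  have n: "n >= 3" by (rule elim(5))
  have lnn: "ln (real n) > 0" using n by simp
  define d where "d = 1/ln (real n)"
  have d: "d > 0" using lnn by (simp add: d_def)
  define s where "s = sqrt (c*ln (real n))"
  have xs: "(x n)^2 <= c*ln (real n)" using x[of n] n by simp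
  have ax: "(abs (x n)) <= s" unfolding s_def using real_sqrt_le_mono[OF xs] by simp
  have s0: "s >= 0" using ax by linarith
  have g1: "\<gamma> n = (1 + s)*d" by (simp add: \<gamma>_def s_def d_def)
  have shift: "(y)^2 <= c*ln (real n) + 1" "\<bar>y - x n\<bar>*(1 + max (x n) 0) <= \<gamma> n" if y: "\<bar>y - x n\<bar> = d" for y
  proof -
   have "(abs y) <= s + d" using y ax by linarith
   then have "y^2 <= (s + d)^2" using s0 d by (intro iffD1[OF abs_le_square_iff]) simp
   also have "... = s^2 + (2 * s*d + d^2)" by (simp add: power2_sum)
   also have "s^2 = c*ln (real n)" unfolding s_def using c lnn by simp
   also have "2 * s*d + d^2 <= 1" using elim(4) by (simp add: s_def d_def)
   finally show "(y)^2 <= c*ln (real n) + 1" by simp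
   have "1 + max (x n) 0 <= 1 + s" using ax s0 by auto
   then show "\<bar>y - x n\<bar>*(1 + max (x n) 0) <= \<gamma> n" unfolding y g1 using d by (simp add: mult.commute mult_left_mono)
  qed
  have tail: "\<bar>(1 - Phi y) - Q n\<bar> <= 45*\<gamma> n*Q n" "\<bar>prob {om\<in>space M. y <= W n om} - (1 - Phi y)\<bar> <= 46*(abs (R n))*Q n" if y: "\<bar>y - x n\<bar> = d" for y
  proof -
   have le1: "\<bar>y - x n\<bar>*(1 + max (x n) 0) <= 1" using shift(2)[OF y] elim(3) by linarith
   have "\<bar>(1 - Phi y) - Q n\<bar> <= 45*(\<bar>y - x n\<bar>*(1 + max (x n) 0))*Q n"
    unfolding Q_def by (rule Phi_tail_shift[OF le1])
   also have "... <= 45*\<gamma> n*Q n" using shift(2)[OF y] Q[of n] by (intro mult_right_mono) auto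
   finally show t1: "\<bar>(1 - Phi y) - Q n\<bar> <= 45*\<gamma> n*Q n" .
   have "45*\<gamma> n*Q n <= 45*Q n" using elim(3) Q[of n] by simp
   then have "1 - Phi y <= 46*Q n" using t1 by linarith
   moreover have "1 - Phi y > 0" by (rule Phi_tail_pos)
   ultimately have "R n*(1 - Phi y) <= (abs (R n))*(46*Q n)" by (intro mult_mono) auto
   moreover have "\<bar>prob {om\<in>space M. y <= W n om} - (1 - Phi y)\<bar> <= R n*(1 - Phi y)"
    using elim(1) shift(1)[OF y] by blast
   ultimately show "\<bar>prob {om\<in>space M. y <= W n om} - (1 - Phi y)\<bar> <= 46*(abs (R n))*Q n" by linarith
  qed
  have up: "Pr n <= prob {om\<in>space M. x n - d <= W n om} + e n"
  proof -
   have "Pr n <= prob ({om\<in>space M. x n - d <= W n om} \<union> {om\<in>space M. d <= \<bar>H n om - W n om\<bar>})"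
    unfolding Pr_def by (rule finite_measure_mono) auto
   also have "... <= prob {om\<in>space M. x n - d <= W n om} + prob {om\<in>space M. d <= \<bar>H n om - W n om\<bar>}"
    by (rule measure_Un_le) auto
   finally show ?thesis using elim(2) by (simp add: d_def)
  qed
  have lo: "prob {om\<in>space M. x n + d <= W n om} <= Pr n + e n"
  proof -
   have "prob {om\<in>space M. x n + d <= W n om} <= prob ({om\<in>space M. x n <= H n om} \<union> {om\<in>space M. d <= \<bar>H n om - W n om\<bar>})"
    by (rule finite_measure_mono) auto
   also have "... <= Pr n + prob {om\<in>space M. d <= \<bar>H n om - W n om\<bar>}"
    unfolding Pr_def by (rule measure_Un_le) auto
   finally show ?thesis using elim(2) by (simp add: d_def)
  qed
  have y1: "\<bar>(x n - d) - x n\<bar> = d" "\<bar>(x n + d) - x n\<bar> = d" using d by auto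
  \<comment> \<open>The lower bound of the normal tail at the edge of the range has the reciprocal
    15(1 + sqrt(c ln n)) n^{c/2}, the factor in the hypothesis on \<open>e\<close>.\<close>
  have e0: "e n <= \<bar>e n*(15*(1 + s)*real n powr (c/2))\<bar>*Q n"
  proof -
   have lam: "(max (x n) 0)^2 <= c*ln (real n)" "max (x n) 0 <= s" using xs ax s0 c lnn by (auto simp: max_def)
   have ge: "exp (- (max (x n) 0)\<^sup>2/2)/(15*(1 + max (x n) 0)) <= Q n" unfolding Q_def by (rule Phi_tail_ge)
   have "real n powr (- (c/2)) = exp (- (c*ln (real n))/2)" using n by (simp add: powr_def)
   also have "... <= exp (- (max (x n) 0)\<^sup>2/2)" using lam(1) by simp
   finally have "real n powr (- (c/2))/(15*(1 + s)) <= exp (- (max (x n) 0)\<^sup>2/2)/(15*(1 + max (x n) 0))"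
    using lam(2) s0 by (intro frac_le) auto
   then have q: "real n powr (- (c/2))/(15*(1 + s)) <= Q n" using ge by linarith
   define T where "T = 15*(1 + s)*real n powr (c/2)"
   have T: "T > 0" unfolding T_def using s0 n by simp
   have "real n powr (- (c/2))/(15*(1 + s)) = 1/T" unfolding T_def by (simp add: powr_minus field_simps)
   then have "1/T <= Q n" using q by (simp only:)
   then have "1 <= T*Q n" using T by (simp add: pos_divide_le_eq mult.commute)
   then have "(abs (e n))*1 <= (abs (e n))*(T*Q n)" by (intro mult_left_mono) auto
   also have "... = \<bar>e n*T\<bar>*Q n" using T by (simp add: abs_mult)
   finally show ?thesis unfolding T_def[symmetric] by linarith
  qed
  have "\<bar>Pr n - Q n\<bar> <= 45*\<gamma> n*Q n + 46*(abs (R n))*Q n + \<bar>e n*(15*(1 + s)*real n powr (c/2))\<bar>*Q n"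
  proof -
   have gen: "\<bar>pp - qq\<bar> <= A + B + C" if "pp <= w1 + ee" "w2 <= pp + ee" "\<bar>f1 - qq\<bar> <= A" "\<bar>f2 - qq\<bar> <= A" "\<bar>w1 - f1\<bar> <= B" "\<bar>w2 - f2\<bar> <= B" "ee <= C"
    for pp qq w1 w2 f1 f2 A B C ee :: real
    using that by (smt (verit))
   show ?thesis by (rule gen[OF up lo tail(1)[OF y1(1)] tail(1)[OF y1(2)] tail(2)[OF y1(1)] tail(2)[OF y1(2)] e0])
  qed
  also have "... = \<zeta> n*Q n" by (simp add: \<zeta>_def s_def algebra_simps)
  finally have le: "\<bar>Pr n - Q n\<bar> <= \<zeta> n*Q n" .
  have "Pr n/Q n - 1 = (Pr n - Q n)/Q n" using Q[of n] by (simp add: diff_divide_distrib)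
  then show ?case using le Q[of n] by (simp add: pos_divide_le_eq)
 qed
 have lim: "(%n. Pr n/Q n - 1) \<longlonglongrightarrow> 0"
  by (rule Lim_null_comparison[where g=\<zeta>]) (use main z in \<open>simp_all\<close>)
 have "prob {om\<in>space M. x n <= H n om} = (1 - Phi (x n))*(1 + (Pr n/Q n - 1))" for n
  using Q[of n] by (simp add: Pr_def Q_def)
 then show ?thesis using lim by blast
qed

lemma nrm_le_of_Lnorm:
 assumes "in_Lq M q Y" "Lnorm M q Y <= b" "q > 0"
 shows "nrm_le M q Y b"
proof -
 let ?I = "\<integral>om. (abs (Y om)) powr q \<partial>M"
 have I: "?I >= 0" by (rule Bochner_Integration.integral_nonneg) simp
 have b: "b >= 0" using assms(2) order_trans[OF powr_ge_zero] unfolding Lnorm_def by blast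
 have "?I = (?I powr (1/q)) powr q" using I assms(3) by (simp add: powr_powr)
 also have "... <= b powr q" using assms(2,3) unfolding Lnorm_def by (intro powr_mono2) auto
 finally show ?thesis using assms(1) b by (simp add: nrm_le_def in_Lq_def)
qed

lemma square_summable_of_rate:
 fixes a :: "nat => real"
 assumes a: "!!i. 0 < a i" "!!i. a i <= C*(1 + real i) powr (\<eta> - r)" and C: "C >= 1" and s: "2*(r - \<eta>) > 1"
 shows "summable (%k. (a (m + k))^2)"
  "(\<Sum>k. (a (Suc m + k))^2) <= C^2*(2*(r - \<eta>)/(2*(r - \<eta>) - 1))*(1 + real m) powr (1 - 2*(r - \<eta>))"
proof -
 let ?s = "2*(r - \<eta>)"
 have sq: "(a (m + k))^2 <= C^2*real (Suc m + k) powr (- ?s)" for m k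
 proof -
  have "(a (m + k))^2 <= (C*(1 + real (m + k)) powr (\<eta> - r))^2"
   using a(1)[of "m + k"] a(2)[of "m + k"] by (intro power_mono) auto
  also have "... = C^2*((1 + real (m + k)) powr (\<eta> - r)*(1 + real (m + k)) powr (\<eta> - r))"
   by (simp add: power2_eq_square)
  also have "(1 + real (m + k)) powr (\<eta> - r)*(1 + real (m + k)) powr (\<eta> - r) = real (Suc m + k) powr (- ?s)"
   by (simp add: algebra_simps flip: powr_add)
  finally show ?thesis .
 qed
 have part: "(\<Sum>k<n. (a (m + k))^2) <= C^2*(?s/(?s - 1)*real (Suc m) powr (1 - ?s))" for n m
 proof -
  have "(\<Sum>k<n. (a (m + k))^2) <= C^2*(\<Sum>k<n. real (Suc m + k) powr (- ?s))"
   unfolding sum_distrib_left by (rule sum_mono) (rule sq)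
  also have "... <= C^2*(?s/(?s - 1)*real (Suc m) powr (1 - ?s))"
   using s by (intro mult_left_mono sum_powr_tail_le) auto
  finally show ?thesis .
 qed
 show sm: "summable (%k. (a (m + k))^2)" for m by (rule summableI_nonneg_bounded[OF _ part]) simp
 have "(\<Sum>k. (a (Suc m + k))^2) <= C^2*(?s/(?s - 1)*real (Suc (Suc m)) powr (1 - ?s))"
  by (rule suminf_le_const[OF sm part])
 also have "... <= C^2*(?s/(?s - 1)*(1 + real m) powr (1 - ?s))"
  using s by (intro mult_left_mono powr_mono2') auto
 finally show "(\<Sum>k. (a (Suc m + k))^2) <= C^2*(?s/(?s - 1))*(1 + real m) powr (1 - ?s)" by (simp add: mult.assoc)
qed

context linear_process
begin

text \<open>The square root of the tail sum is of order m^{1/2-r+\<eta>}, so the product has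
  exponent 2r - 1/2 and the power term r h, each up to 2\<eta>. As h <= 2, one allowance of 2\<eta>
  covers both.\<close>

lemma coefficient_rate:
 assumes a: "!!i. 0 < a i" "!!i. a i <= C*(1 + real i) powr (\<eta> - r)" and C: "C >= 1" and s: "2*(r - \<eta>) > 1" and eta: "\<eta> > 0"
  and h: "1 <= h" "h <= 2" and b: "\<beta> <= r*h - 2*\<eta>" "\<beta> <= 2*r - 1/2 - 2*\<eta>"
 shows "\<exists>C'. \<forall>m. a m powr h + a m*(a m + sqrt (A2 (Suc m))) <= C'*(1 + real m) powr (- \<beta>)"
proof -
 define D where "D = C * sqrt (2*(r - \<eta>)/(2*(r - \<eta>) - 1))"
 have D0: "D >= 0" using C s by (simp add: D_def)
 show ?thesis
 proof (intro exI[of _ "C powr h + C*(C + D)"] allI)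
  fix m
  define t where "t = 1 + real m"
  have t: "t >= 1" by (simp add: t_def)
  have am: "0 <= a m" "a m <= C*t powr (\<eta> - r)" using a(1)[of m] a(2)[of m] by (auto simp: t_def)
  have "sqrt (A2 (Suc m)) <= sqrt (C^2*(2*(r - \<eta>)/(2*(r - \<eta>) - 1))*t powr (1 - 2*(r - \<eta>)))"
   unfolding A2_def t_def by (rule real_sqrt_le_mono[OF square_summable_of_rate(2)[OF a C s]])
  also have "t powr (1 - 2*(r - \<eta>)) = (t powr (1/2 - r + \<eta>))^2"
   unfolding power2_eq_square by (simp add: algebra_simps flip: powr_add)
  also have "sqrt (C^2*(2*(r - \<eta>)/(2*(r - \<eta>) - 1))*(t powr (1/2 - r + \<eta>))^2) = D*t powr (1/2 - r + \<eta>)"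
   unfolding D_def using C by (simp only: real_sqrt_mult real_sqrt_abs) simp
  finally have A: "sqrt (A2 (Suc m)) <= D*t powr (1/2 - r + \<eta>)" .
  have "a m <= C*t powr (1/2 - r + \<eta>)"
  proof -
   have "C*t powr (\<eta> - r) <= C*t powr (1/2 - r + \<eta>)" using C t by (intro mult_left_mono powr_mono) auto
   then show ?thesis using am(2) by linarith
  qed
  then have s1: "a m + sqrt (A2 (Suc m)) <= (C + D)*t powr (1/2 - r + \<eta>)" using A by (simp add: distrib_right)
  have "a m*(a m + sqrt (A2 (Suc m))) <= (C*t powr (\<eta> - r))*((C + D)*t powr (1/2 - r + \<eta>))"
   using am s1 A2_nonneg[of "Suc m"] C by (intro mult_mono) auto
  also have "... = C*(C + D)*(t powr (\<eta> - r)*t powr (1/2 - r + \<eta>))" by (simp add: mult.assoc mult.commute mult.left_commute)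
  also have "t powr (\<eta> - r)*t powr (1/2 - r + \<eta>) = t powr ((\<eta> - r) + (1/2 - r + \<eta>))" by (simp only: powr_add)
  also have "C*(C + D)*... <= C*(C + D)*t powr (- \<beta>)"
   using C D0 t b(2) by (intro mult_left_mono powr_mono) auto
  finally have 1: "a m*(a m + sqrt (A2 (Suc m))) <= C*(C + D)*t powr (- \<beta>)" .
  have "a m powr h <= (C*t powr (\<eta> - r)) powr h" using am h by (intro powr_mono2) auto
  also have "... = C powr h*t powr ((\<eta> - r)*h)" by (simp add: powr_mult powr_powr)
  also have "... <= C powr h*t powr (- \<beta>)"
  proof (intro mult_left_mono powr_mono)
   have "\<eta>*h <= \<eta>*2" using eta h by (intro mult_left_mono) auto
   then show "(\<eta> - r)*h <= - \<beta>" using b(1) by (simp add: algebra_simps)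
  qed (use t in auto)
  finally show "a m powr h + a m*(a m + sqrt (A2 (Suc m))) <= (C powr h + C*(C + D))*(1 + real m) powr (- \<beta>)"
   using 1 by (simp add: t_def distrib_right)
 qed
qed

lemma nrm_le_stationary:
 fixes f :: "real \<times> real => real"
 assumes f[measurable]: "f \<in> borel_measurable (borel \<Otimes>\<^sub>M borel)" and n: "nrm_le M q (%om. f (V m t om, \<xi> (t + 1) om)) b"
 shows "nrm_le M q (%om. f (V m s om, \<xi> (s + 1) om)) b"
proof -
 let ?g = "%z. (abs (f z)) powr q"
 have d: "distr M (borel \<Otimes>\<^sub>M borel) (%om. (V m s om, \<xi> (s + 1) om)) = distr M (borel \<Otimes>\<^sub>M borel) (%om. (V m t om, \<xi> (t + 1) om))"
  by (simp only: distr_V_xi)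
 have g: "?g \<in> borel_measurable (borel \<Otimes>\<^sub>M borel)" by measurable
 have p: "(%om. (V m s om, \<xi> (s + 1) om)) \<in> measurable M (borel \<Otimes>\<^sub>M borel)" for s by measurable
 have "integrable M (%om. ?g (V m s om, \<xi> (s + 1) om)) = integrable M (%om. ?g (V m t om, \<xi> (t + 1) om))"
  unfolding integrable_distr_eq[OF p g, symmetric] by (simp only: d)
 moreover have "(LINT om|M. ?g (V m s om, \<xi> (s + 1) om)) = (LINT om|M. ?g (V m t om, \<xi> (t + 1) om))"
  unfolding integral_distr[OF p g, symmetric] by (simp only: d)
 ultimately show ?thesis using n unfolding nrm_le_def by simp
qed

end

context smooth_process
begin

text \<open>The hypothesis \<open>gap\<close> is the comparison of exponents: the L^q error relative
  to \<sigma>_n is n^{-(\<theta>-r)} up to \<eta>, Markov's inequality raises it to the power q, and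
  the normal tail is of order n^{-c/2}.\<close>

theorem moderate_deviation_nonlinear:
 fixes l :: "real => real" and r v c B0 :: real and x :: "nat => real"
 assumes v: "q = p * v" "1/2 <= v" "v < 1"
  and r: "1/2 < r" "r < 1"
  and l: "!!t. 0 < t ==> 0 < l t" "slowly_varying l"
  and a: "!!i. a i = l (real i + 1)*(1 + real i) powr (- r)" "a 0 = 1"
  and B0: "!!i. nrm_le M q (%om. K (V 0 i om)) B0" and mean: "(LINT om|M. K (V 0 0 om)) = 0" and kappa: "\<kappa> \<noteq> 0"
  and c: "0 < c" "c <= p - 2" and gap: "c/2 < q*(min (r/v) (min (2*r - 1/2) 1) - r)"
  and x: "!!n. 1 <= n ==> (x n)\<^sup>2 <= c*ln (real n)"
 shows "\<exists>\<epsilon>. \<epsilon> \<longlonglongrightarrow> 0 & (\<forall>n\<ge>1. prob {om\<in>space M. \<bar>\<kappa>\<bar> * sigma_S M a \<xi> n*x n <= (\<Sum>i=1..n. K (V 0 (int i) om))} = (1 - Phi (x n))*(1 + \<epsilon> n))"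
proof -
 \<comment> \<open>The rates r/v and 2r - 1/2 come from the two terms of the linearisation error;
   the cap 1 comes from the kernel estimate, which asks for \<beta> < 1.\<close>
 define \<theta> where "\<theta> = min (r/v) (min (2*r - 1/2) 1)"
 define G where "G = q*(\<theta> - r) - c/2"
 have G: "G > 0" using gap by (simp add: G_def \<theta>_def)
 have q0: "q > 0" using pq by simp
 have v0: "v > 0" using v by simp
 have rv: "r < r/v" using v r v0 by (simp add: field_simps)
 have th: "\<theta> > 1/2" unfolding \<theta>_def min_less_iff_conj by (intro conjI; use rv r in linarith)
 have th1: "\<theta> <= r/v" "\<theta> <= 2*r - 1/2" "\<theta> <= 1" by (auto simp: \<theta>_def)
 \<comment> \<open>The three bounds ensure 2(r - \<eta>) > 1, then \<beta> > 1/2, and finally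
   3q\<eta> <= G/2, so that half of the gap survives in \<open>d\<close>.\<close>
 define \<eta> where "\<eta> = min (min ((r - 1/2)/2) ((\<theta> - 1/2)/4)) (G/(6*q))"
 have eta: "\<eta> > 0" unfolding \<eta>_def using r th G q0 by auto
 have eta1: "\<eta> <= (r - 1/2)/2" "\<eta> <= (\<theta> - 1/2)/4"
  unfolding \<eta>_def by (rule order_trans[OF min.cobounded1 min.cobounded1], rule order_trans[OF min.cobounded1 min.cobounded2])
 have eta2: "3*q*\<eta> <= G/2"
 proof -
  have "3*q*\<eta> <= 3*q*(G/(6*q))" using q0 by (intro mult_left_mono) (auto simp: \<eta>_def)
  then show ?thesis using q0 by simp
 qed
 define \<beta> where "\<beta> = \<theta> - 2*\<eta>"
 have b1: "1/2 < \<beta>"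
 proof -
  have "4*\<eta> <= \<theta> - 1/2" using eta1(2) by simp
  then show ?thesis using th unfolding \<beta>_def by simp
 qed
 have b2: "\<beta> < 1" using eta th1(3) unfolding \<beta>_def by linarith
 note b = b1 b2
 define d where "d = q*(\<beta> - r - \<eta>) - c/2"
 have d: "d > 0"
 proof -
  have "d = G - 3*q*\<eta>" by (simp add: d_def G_def \<beta>_def algebra_simps)
  then show ?thesis using eta2 G by linarith
 qed
 have s: "2*(r - \<eta>) > 1"
 proof -
  have "2*\<eta> <= r - 1/2" using eta1(1) by simp
  then show ?thesis using r by simp
 qed
 obtain C1 where C1: "C1 >= 1" "!!i. a i <= C1*(1 + real i) powr (\<eta> - r)" "!!i. (1 + real i) powr (- r - \<eta>) <= C1 * a i"
  using regularly_varying_coeffs[OF l a r eta] by auto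
 obtain C2 where C2: "C2 >= 1" "!!n J. n >= 1 ==> (\<Sum>i\<in>{J..<J + n}. a i) <= C2*(real n powr (1 - r)*l (real n))"
   "!!n k. n >= 1 ==> n <= 2 * k ==> k <= n ==> real n powr (1 - r)*l (real n) <= C2*(\<Sum>i<k. a i)"
  using regularly_varying_sums[OF l a(1) r] by auto
 have pq_v: "p/q = 1/v" using v pq by simp
 have h: "1 <= p/q" "p/q <= 2" unfolding pq_v using v by (auto simp: field_simps)
 obtain C3 where C3: "!!m. a m powr (p/q) + a m*(a m + sqrt (A2 (Suc m))) <= C3*(1 + real m) powr (- \<beta>)"
  using coefficient_rate[OF a_pos C1(2,1) s eta h, of \<beta>] th1(1,2) eta unfolding pq_v \<beta>_def by auto
 obtain C4 where C4: "C4 > 0" "!!n. n >= 1 ==> nrm_le M q (%om. \<Sum>i=1..n. L (int i) om) (C4*real n powr (3/2 - \<beta>))"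
  using reduction_principle[OF B0 mean b C3] by auto
 define R where "R n = real n powr (1 - r)*l (real n)" for n
 define \<sigma> where "\<sigma> n = sigma_S M a \<xi> n" for n
 have R0: "R n > 0" if "n >= 1" for n unfolding R_def using that l(1)[of "real n"] by simp
 define m0 where "m0 = sqrt (s2/2)/C2"
 have m0: "m0 > 0" unfolding m0_def using s2_pos C2(1) by simp
 have a0: "0 <= a i" for i using a_pos[of i] by simp
 have wb: "0 <= wt n u" "wt n u <= C2 * R n" "real n*(R n)^2 <= 2*C2^2*(\<Sum>u<N + n. (wt n u)^2)" if n: "n >= 1" for n u N
  using wt_bounds[OF a0 n _ R0[OF n], of C2] C2 n by (auto simp: R_def)
 have sig: "m0*(sqrt (real n) * R n) <= \<sigma> n" if n: "n >= 1" for n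
 proof -
  have e: "(\<sigma> n)^2 = s2*(\<Sum>u<0 + n. (wt n u)^2) + (LINT om|M. (rem n 0 om)^2)" unfolding \<sigma>_def by (rule sigma_S_eq(1))
  have "(LINT om|M. (rem n 0 om)^2) >= 0" by (rule Bochner_Integration.integral_nonneg) simp
  then have 1: "s2*(\<Sum>u<0 + n. (wt n u)^2) <= (\<sigma> n)^2" using e by linarith
  have "(m0*(sqrt (real n) * R n))^2 = s2/(2*C2^2)*(real n*(R n)^2)"
   unfolding m0_def using s2_pos by (simp add: power_mult_distrib power_divide)
  also have "... <= s2/(2*C2^2)*(2*C2^2*(\<Sum>u<0 + n. (wt n u)^2))"
   using s2_pos wb(3)[OF n, of 0] by (intro mult_left_mono) auto
  also have "... = s2*(\<Sum>u<0 + n. (wt n u)^2)" using C2(1) by simp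
  finally have "(m0*(sqrt (real n) * R n))^2 <= (\<sigma> n)^2" using 1 by linarith
  then show ?thesis using sigma_S_eq(2)[of n] unfolding \<sigma>_def by (rule power2_le_imp_le)
 qed
 have sig0: "\<sigma> n > 0" if n: "n >= 1" for n
 proof -
  have "0 < m0*(sqrt (real n) * R n)" using m0 R0[OF n] n by simp
  then show ?thesis using sig[OF n] by linarith
 qed
 \<comment> \<open>A pure power below \<sigma>_n, at the loss of \<eta>, is enough for the error
   probability; for the weights the exact order in \<open>sig\<close> is kept.\<close>
 have sigl: "m0/C1*real n powr (3/2 - r - \<eta>) <= \<sigma> n" if n: "n >= 1" for n
 proof -
  have an: "1 + real (n - 1) = real n" using n by simp
  have "real n powr (- r - \<eta>) <= C1*(l (real n)*real n powr (- r))"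
   using C1(3)[of "n - 1"] a(1)[of "n - 1"] an by (simp add: add.commute)
  then have "(real n powr (1/2)*real n powr 1)*real n powr (- r - \<eta>) <= (real n powr (1/2)*real n powr 1)*(C1*(l (real n)*real n powr (- r)))"
   by (intro mult_left_mono) auto
  moreover have "(real n powr (1/2)*real n powr 1)*real n powr (- r - \<eta>) = real n powr (3/2 - r - \<eta>)"
   unfolding powr_add[symmetric] by (rule arg_cong[where f="(powr) (real n)"]) simp
  ultimately have "real n powr (3/2 - r - \<eta>) <= (real n powr (1/2)*real n powr 1)*(C1*(l (real n)*real n powr (- r)))"
   by (simp only:)
  also have "... = C1*(real n powr (1/2)*((real n powr 1*real n powr (- r))*l (real n)))"
   by (simp only: mult.assoc mult.commute mult.left_commute)
  also have "real n powr 1*real n powr (- r) = real n powr (1 - r)"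
   unfolding powr_add[symmetric] by simp
  finally have "real n powr (3/2 - r - \<eta>) <= C1*(real n powr (1/2) * R n)" by (simp only: R_def)
  then have "m0/C1*real n powr (3/2 - r - \<eta>) <= m0/C1*(C1*(real n powr (1/2) * R n))"
   using m0 C1(1) by (intro mult_left_mono) auto
  also have "... = m0*(sqrt (real n) * R n)" using C1(1) by (simp add: powr_half_sqrt)
  finally show ?thesis using sig[OF n] by linarith
 qed
 have "\<exists>N. (LINT om|M. (rem n N om)^2) <= (if n >= 1 then (\<sigma> n)\<^sup>2*real n powr (- p) else 1)" for n
 proof (rule rem_small)
  show "0 < (if n >= 1 then (\<sigma> n)\<^sup>2*real n powr (- p) else 1)"
  proof (cases "n >= 1")
   case True
   then have "0 < (\<sigma> n)^2*real n powr (- p)" using sig0[OF True] by (intro mult_pos_pos) auto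
   then show ?thesis using True by simp
  qed simp
 qed
 then obtain N where N0: "!!n. (LINT om|M. (rem n (N n) om)^2) <= (if n >= 1 then (\<sigma> n)\<^sup>2*real n powr (- p) else 1)" by metis
 have N: "(LINT om|M. (rem n (N n) om)^2) <= (\<sigma> n)^2*real n powr (- p)" if "n >= 1" for n using N0[of n] that by simp
 \<comment> \<open>The threshold is scaled by |\<kappa>|, so the sign of \<kappa> goes into the
   weights. They are 0 beyond the block because their bound is required for all indices.\<close>
 define w where "w n u = (if u < N n + n then sgn \<kappa>*wt n u/\<sigma> n else 0)" for n u
 define H where "H n om = (\<Sum>i=1..n. K (V 0 (int i) om))/(\<bar>\<kappa>\<bar>*\<sigma> n)" for n om
 define W where "W n om = (\<Sum>u<N n + n. w n u*\<xi> (int n - int u) om)" for n om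
 define D where "D = C2/m0"
 have D: "D > 0" using C2(1) m0 by (simp add: D_def)
 note [measurable] = K_meas
 have mH[measurable]: "H n \<in> borel_measurable M" for n unfolding H_def[abs_def] by measurable
 have mW[measurable]: "W n \<in> borel_measurable M" for n unfolding W_def[abs_def] by measurable
 have k2: "sgn \<kappa> * sgn \<kappa> = 1" "\<bar>sgn \<kappa>\<bar> = 1" "sgn \<kappa>/1 = \<kappa>/\<bar>\<kappa>\<bar>" using kappa by (auto simp: sgn_if)
 have wcond: "\<forall>\<^sub>F n in sequentially. (\<forall>u. (abs (w n u)) <= D/sqrt (real n)) & \<bar>s2*(\<Sum>u<N n + n. (w n u)^2) - 1\<bar> <= 1/real n"
  using eventually_ge_at_top[of 1]
 proof eventually_elim
  case (elim n)
  note n = elim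
  show ?case
  proof (intro conjI allI)
   fix u
   have "wt n u/\<sigma> n <= D/sqrt (real n)"
   proof -
    have "wt n u*(m0 * sqrt (real n)) <= C2 * R n*(m0 * sqrt (real n))" using wb(2)[OF n] m0 by (intro mult_right_mono) auto
    also have "... = C2*(m0*(sqrt (real n) * R n))" by simp
    also have "... <= C2*\<sigma> n" using sig[OF n] C2(1) by (intro mult_left_mono) auto
    finally show ?thesis unfolding D_def using sig0[OF n] m0 n by (simp add: field_simps)
   qed
   moreover have "\<bar>sgn \<kappa>*wt n u/\<sigma> n\<bar> = wt n u/\<sigma> n"
    using k2(2) wb(1)[OF n, of u] sig0[OF n] by (simp add: abs_mult)
   ultimately show "(abs (w n u)) <= D/sqrt (real n)" unfolding w_def using D by simp
  next
   have "(\<Sum>u<N n + n. (w n u)^2) = (\<Sum>u<N n + n. (wt n u)^2)/(\<sigma> n)^2"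
    unfolding sum_divide_distrib
    by (rule sum.cong) (use k2(1) in \<open>auto simp: w_def power_divide power_mult_distrib power2_eq_square\<close>)
   then have "s2*(\<Sum>u<N n + n. (w n u)^2) = ((\<sigma> n)^2 - (LINT om|M. (rem n (N n) om)^2))/(\<sigma> n)^2"
    using sigma_S_eq(1)[of n "N n"] by (simp add: \<sigma>_def)
   then have e: "s2*(\<Sum>u<N n + n. (w n u)^2) - 1 = - ((LINT om|M. (rem n (N n) om)^2)/(\<sigma> n)^2)"
    using sig0[OF n] by (simp add: diff_divide_distrib)
   have "(LINT om|M. (rem n (N n) om)^2) >= 0" by (rule Bochner_Integration.integral_nonneg) simp
   then have "\<bar>s2*(\<Sum>u<N n + n. (w n u)^2) - 1\<bar> = (LINT om|M. (rem n (N n) om)^2)/(\<sigma> n)^2" unfolding e by simp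
   also have "... <= real n powr (- p)" using N[OF n] sig0[OF n] by (simp add: pos_divide_le_eq mult.commute)
   also have "... <= real n powr (- 1)" using n pq by (intro powr_mono) auto
   also have "... = 1/real n" using n by (simp add: powr_minus_divide)
   finally show "\<bar>s2*(\<Sum>u<N n + n. (w n u)^2) - 1\<bar> <= 1/real n" .
  qed
 qed
 have p2: "p > 2" using pq by simp
 have c0: "0 <= c" using c(1) by simp
 have hinj: "inj (%u. int n - int u)" for n by (simp add: inj_def)
 obtain Rm where Rm0: "Rm \<longlonglongrightarrow> 0 & (\<forall>\<^sub>F n in sequentially. \<forall>x. x^2 <= c*ln (real n) + 1 \<longrightarrow>
  \<bar>prob {om\<in>space M. x <= (\<Sum>k<N n + n. w n k*\<xi> (int n - int k) om)} - (1 - Phi x)\<bar> <= Rm n*(1 - Phi x))"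
  using moderate_deviation[where h="%n u. int n - int u", OF p2 pm c0 c(2) D hinj wcond] by (elim exE) (rule that)
 note Rm = conjunct1[OF Rm0] conjunct2[OF Rm0, folded W_def]
 define C5 where "C5 = 2*C4/(\<bar>\<kappa>\<bar>*(m0/C1))"
 have C5: "C5 > 0" unfolding C5_def using C4(1) kappa m0 C1(1) by simp
 define e where "e n = (C5*ln (real n)) powr q*real n powr (- (d + c/2)) + 4*(ln (real n))^2*real n powr (- p)" for n
 have err: "\<forall>\<^sub>F n in sequentially. prob {om\<in>space M. 1/ln (real n) <= \<bar>H n om - W n om\<bar>} <= e n"
  using eventually_ge_at_top[of 3]
 proof eventually_elim
  case (elim n)
  have n: "n >= 1" using elim by simp
  have lnn: "ln (real n) > 0" using elim by simp
  define \<delta>' where "\<delta>' = 1/ln (real n)"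
  have d': "\<delta>' > 0" using lnn by (simp add: \<delta>'_def)
  define t1 where "t1 = \<bar>\<kappa>\<bar>*\<sigma> n*\<delta>'/2"
  define t2 where "t2 = \<sigma> n*\<delta>'/2"
  have t12: "t1 > 0" "t2 > 0" unfolding t1_def t2_def using kappa sig0[OF n] d' by simp_all
  let ?Ls = "%om. \<Sum>i=1..n. L (int i) om"
  note [measurable] = borel_measurable_integrable[OF L_integrable]
  \<comment> \<open>The error has two parts, the nonlinear one and the discarded past. Each gets
    half of 1/ln n; the first is handled by Markov's inequality in L^q, the second by
    Chebyshev's.\<close>
  have dec: "AE om in M. H n om - W n om = ?Ls om/(\<bar>\<kappa>\<bar>*\<sigma> n) + sgn \<kappa>*(rem n (N n) om/\<sigma> n)"
   using AE_partial_sum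
  proof eventually_elim
   case (elim om)
   have 1: "(\<Sum>i=1..n. V 0 (int i) om) = part n (N n) om + rem n (N n) om" using elim by blast
   have 2: "W n om = sgn \<kappa>*(part n (N n) om/\<sigma> n)"
    unfolding W_def part_def w_def sum_divide_distrib sum_distrib_left by (rule sum.cong) auto
   have 3: "(\<Sum>i=1..n. K (V 0 (int i) om)) = ?Ls om + \<kappa>*(part n (N n) om + rem n (N n) om)"
    unfolding 1[symmetric] by (simp add: L_def sum_subtractf sum_distrib_left)
   have 4: "\<kappa> = \<bar>\<kappa>\<bar> * sgn \<kappa>" by (simp add: abs_mult_sgn)
   have kx: "\<kappa>*X/(\<bar>\<kappa>\<bar>*\<sigma> n) = sgn \<kappa>*(X/\<sigma> n)" for X
    using kappa by (subst 4) simp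
   have "H n om = ?Ls om/(\<bar>\<kappa>\<bar>*\<sigma> n) + sgn \<kappa>*((part n (N n) om + rem n (N n) om)/\<sigma> n)"
    by (simp only: H_def 3 add_divide_distrib kx)
   then show ?case by (simp only: 2 add_divide_distrib distrib_left add_diff_cancel_left' add.assoc[symmetric])
  qed
  let ?E1 = "{om\<in>space M. t1 <= \<bar>?Ls om\<bar>}" and ?E2 = "{om\<in>space M. t2 <= \<bar>rem n (N n) om\<bar>}"
  have "prob {om\<in>space M. 1/ln (real n) <= \<bar>H n om - W n om\<bar>} <= prob (?E1 \<union> ?E2)"
  proof (rule finite_measure_mono_AE)
   show "AE om in M. om \<in> {om\<in>space M. 1/ln (real n) <= \<bar>H n om - W n om\<bar>} \<longrightarrow> om \<in> ?E1 \<union> ?E2"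
    using dec
   proof eventually_elim
    case (elim om)
    show ?case
    proof (rule impI, rule ccontr)
     assume as: "om \<in> {om\<in>space M. 1/ln (real n) <= \<bar>H n om - W n om\<bar>}" and no: "om \<notin> ?E1 \<union> ?E2"
     have lt: "\<bar>?Ls om\<bar> < t1" "\<bar>rem n (N n) om\<bar> < t2" using as no by auto
     have "\<bar>?Ls om/(\<bar>\<kappa>\<bar>*\<sigma> n)\<bar> = \<bar>?Ls om\<bar>/(\<bar>\<kappa>\<bar>*\<sigma> n)" using sig0[OF n] by (simp add: abs_mult)
     also have "... < t1/(\<bar>\<kappa>\<bar>*\<sigma> n)" using lt(1) kappa sig0[OF n] by (intro divide_strict_right_mono) auto
     also have "... = \<delta>'/2" unfolding t1_def using kappa sig0[OF n] by simp
     finally have 1: "\<bar>?Ls om/(\<bar>\<kappa>\<bar>*\<sigma> n)\<bar> < \<delta>'/2" .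
     have "\<bar>sgn \<kappa>*(rem n (N n) om/\<sigma> n)\<bar> = \<bar>rem n (N n) om\<bar>/\<sigma> n" using k2(2) sig0[OF n] by (simp add: abs_mult)
     also have "... < t2/\<sigma> n" using lt(2) sig0[OF n] by (intro divide_strict_right_mono) auto
     also have "... = \<delta>'/2" unfolding t2_def using sig0[OF n] by simp
     finally have 2: "\<bar>sgn \<kappa>*(rem n (N n) om/\<sigma> n)\<bar> < \<delta>'/2" .
     have "\<bar>X + Y\<bar> < z" if "(abs X) < z/2" "(abs Y) < z/2" for X Y z :: real using that by linarith
     from this[OF 1 2] have "\<bar>H n om - W n om\<bar> < \<delta>'" unfolding elim .
     moreover have "\<delta>' <= \<bar>H n om - W n om\<bar>" using as by (simp add: \<delta>'_def)
     ultimately show False by linarith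
    qed
   qed
  qed measurable
  also have "... <= prob ?E1 + prob ?E2" by (rule measure_Un_le) auto
  also have "prob ?E1 <= (C4*real n powr (3/2 - \<beta>)/t1) powr q" by (rule nrm_le_Markov[OF C4(2)[OF n] q0 t12(1)])
  also have "... <= (C5*ln (real n)) powr q*real n powr (- (d + c/2))"
  proof -
   have lower: "\<bar>\<kappa>\<bar>*(m0/C1*real n powr (3/2 - r - \<eta>))*\<delta>'/2 <= t1"
    unfolding t1_def using sigl[OF n] d' by (intro divide_right_mono mult_right_mono[OF mult_left_mono]) auto
   have pos: "\<bar>\<kappa>\<bar>*(m0/C1*real n powr (3/2 - r - \<eta>))*\<delta>'/2 > 0" using kappa m0 C1(1) n d' by simp
   have "C4*real n powr (3/2 - \<beta>)/t1 <= C4*real n powr (3/2 - \<beta>)/(\<bar>\<kappa>\<bar>*(m0/C1*real n powr (3/2 - r - \<eta>))*\<delta>'/2)"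
    using lower pos C4(1) t12(1) by (intro divide_left_mono mult_pos_pos) auto
   also have "... = C5*ln (real n)*(real n powr (3/2 - \<beta>)/real n powr (3/2 - r - \<eta>))"
    unfolding C5_def \<delta>'_def using lnn by (simp add: field_simps)
   also have "real n powr (3/2 - \<beta>)/real n powr (3/2 - r - \<eta>) = real n powr (- (\<beta> - r - \<eta>))"
    unfolding powr_diff[symmetric] by (simp add: algebra_simps)
   finally have "(C4*real n powr (3/2 - \<beta>)/t1) powr q <= (C5*ln (real n)*real n powr (- (\<beta> - r - \<eta>))) powr q"
    using q0 C4(1) t12(1) by (intro powr_mono2) auto
   also have "... = (C5*ln (real n)) powr q*real n powr (- (\<beta> - r - \<eta>)*q)" by (simp add: powr_mult powr_powr)
   also have "- (\<beta> - r - \<eta>)*q = - (d + c/2)" by (simp add: d_def algebra_simps)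
   finally show ?thesis .
  qed
  also have "prob ?E2 <= 4*(ln (real n))^2*real n powr (- p)"
  proof -
   have "prob ?E2 = prob {om\<in>space M. t2^2 <= (rem n (N n) om)^2}"
    using t12(2) by (intro arg_cong[where f=prob] Collect_cong conj_cong refl) (simp add: abs_le_square_iff[symmetric])
   also have "... <= (LINT om|M. (rem n (N n) om)^2)/t2^2"
    by (rule integral_Markov_inequality_measure[where A="{}"]) (use rem_second_moment(1) t12 in auto)
   also have "... <= (\<sigma> n)^2*real n powr (- p)/t2^2" by (intro divide_right_mono N n) simp
   also have "... = 4*(ln (real n))^2*real n powr (- p)"
    unfolding t2_def \<delta>'_def using sig0[OF n] lnn by (simp add: power_mult_distrib power_divide field_simps)
   finally show ?thesis .
  qed
  finally show "prob {om\<in>space M. 1/ln (real n) <= \<bar>H n om - W n om\<bar>} <= e n" unfolding e_def by simp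
 qed
 have elim: "(%n. e n*(15*(1 + sqrt (c*ln (real n)))*real n powr (c/2))) \<longlonglongrightarrow> 0"
 proof -
  have l1: "(%n. (C5*ln (real n)) powr q*real n powr (- d)*(15*(1 + sqrt (c*ln (real n))))) \<longlonglongrightarrow> 0"
   using C5 q0 d c(1) by real_asymp
  define d2 where "d2 = p - c/2"
  have d2: "d2 > 0" using c p2 unfolding d2_def by linarith
  have l2: "(%n. 4*(ln (real n))^2*real n powr (- d2)*(15*(1 + sqrt (c*ln (real n))))) \<longlonglongrightarrow> 0"
   using d2 c(1) by real_asymp
  have eq: "e n*(15*(1 + sqrt (c*ln (real n)))*real n powr (c/2)) = (C5*ln (real n)) powr q*real n powr (- d)*(15*(1 + sqrt (c*ln (real n)))) + 4*(ln (real n))^2*real n powr (- d2)*(15*(1 + sqrt (c*ln (real n))))" for n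
  proof -
   have 1: "real n powr (- (d + c/2))*real n powr (c/2) = real n powr (- d)" unfolding powr_add[symmetric] by simp
   have 2: "real n powr (- p)*real n powr (c/2) = real n powr (- d2)" unfolding powr_add[symmetric] d2_def by simp
   have "(A*X + B*Y)*(Z*T) = A*(X*T)*Z + B*(Y*T)*Z" for A B X Y Z T :: real by (simp add: algebra_simps)
   then show ?thesis unfolding e_def 1[symmetric] 2[symmetric] by blast
  qed
  show ?thesis unfolding eq using tendsto_add[OF l1 l2] by simp
 qed
 obtain \<epsilon> where eps: "\<epsilon> \<longlonglongrightarrow> 0" "!!n. n >= 1 ==> prob {om\<in>space M. x n <= H n om} = (1 - Phi (x n))*(1 + \<epsilon> n)"
  using normal_tail_transfer[OF mH mW c(1) Rm err elim x] by blast
 have "prob {om\<in>space M. \<bar>\<kappa>\<bar> * sigma_S M a \<xi> n*x n <= (\<Sum>i=1..n. K (V 0 (int i) om))} = (1 - Phi (x n))*(1 + \<epsilon> n)" if n: "n >= 1" for n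
 proof -
  have "\<bar>\<kappa>\<bar>*\<sigma> n > 0" using kappa sig0[OF n] by simp
  then have "(\<bar>\<kappa>\<bar>*\<sigma> n*x n <= X) = (x n <= X/(\<bar>\<kappa>\<bar>*\<sigma> n))" for X by (simp add: pos_le_divide_eq mult.commute)
  then show ?thesis using eps(2)[OF n] by (simp only: H_def \<sigma>_def)
 qed
 then show ?thesis using eps(1) by blast
qed

end

theorem theorem2p4:
  fixes M :: "'a measure" and \<xi> :: "int \<Rightarrow> 'a \<Rightarrow> real"
    and a :: "nat \<Rightarrow> real" and l K :: "real \<Rightarrow> real"
    and p r c \<kappa> :: real and x :: "nat \<Rightarrow> real"
  assumes "prob_space M"
    and indep: "prob_space.indep_vars M (\<lambda>_. borel) \<xi> UNIV"
    and ident: "\<And>i. distr M borel (\<xi> i) = distr M borel (\<xi> 0)"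
    and centered: "integrable M (\<xi> 0)" "(\<integral>\<omega>. \<xi> 0 \<omega> \<partial>M) = 0"
    and second_moment: "integrable M (\<lambda>\<omega>. (\<xi> 0 \<omega>)\<^sup>2)" "0 < (\<integral>\<omega>. (\<xi> 0 \<omega>)\<^sup>2 \<partial>M)"
    and p: "2 < p" "integrable M (\<lambda>\<omega>. \<bar>\<xi> 0 \<omega>\<bar> powr p)"
    and r: "1/2 < r" "r < 1"
    and l: "\<And>t. 0 < t \<Longrightarrow> 0 < l t" "slowly_varying l"
    and a: "\<And>i. a i = l (real i + 1) * (1 + real i) powr (- r)" "a 0 = 1"
    and K: "K \<in> borel_measurable borel"
    and K_mean: "integrable M (\<lambda>\<omega>. K (lin_proc a \<xi> 0 \<omega>))"
                "(\<integral>\<omega>. K (lin_proc a \<xi> 0 \<omega>) \<partial>M) = 0"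
    and K_moment: "in_Lq M (p * omega r) (\<lambda>\<omega>. K (lin_proc a \<xi> 0 \<omega>))"
    and K_inf_exists: "\<forall>\<^sub>F w in nhds 0. integrable M (\<lambda>\<omega>. K (w + lin_proc a \<xi> 0 \<omega>))"
    and kappa: "(K_inf M a \<xi> K has_real_derivative \<kappa>) (at 0)" "\<kappa> \<noteq> 0"
    and cond_B: "condition_B M a \<xi> K p (p * omega r)"
    and c: "0 < c" "c \<le> p - 2" "c < 2 * p * rho r"
    and x: "\<And>n. 1 \<le> n \<Longrightarrow> (x n)\<^sup>2 \<le> c * ln (real n)"
  shows "\<exists>\<epsilon>. \<epsilon> \<longlonglongrightarrow> 0 \<and>
           (\<forall>n\<ge>1. measure M {\<omega> \<in> space M. \<bar>\<kappa>\<bar> * sigma_S M a \<xi> n * x n \<le> H_sum a \<xi> K n \<omega>}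
                  = (1 - cdf std_normal_distribution (x n)) * (1 + \<epsilon> n))"
proof -
 interpret iid_sequence M \<xi>
  by (rule iid_sequence.intro[OF \<open>prob_space M\<close>], rule iid_sequence_axioms.intro[OF indep ident centered second_moment])
 define q where "q = p * omega r"
 have pq: "2 <= q" "q < p" "p <= 2*q" using cond_B unfolding condition_B_def q_def by blast+
 have q0: "q > 0" using pq by simp
 \<comment> \<open>The relations q < p <= 2q in Condition B place the minimiser in its
   range.\<close>
 have om: "1/2 <= omega r" "omega r < 1" using pq p(1) unfolding q_def by (auto simp: field_simps)
 have a_pos: "0 < a i" for i unfolding a(1) using l(1)[of "real i + 1"] by simp
 define \<eta> where "\<eta> = (r - 1/2)/2"
 have eta: "\<eta> > 0" and s: "2*(r - \<eta>) > 1" using r by (simp_all add: \<eta>_def field_simps)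
 obtain Ca where Ca: "Ca >= 1" "!!i. a i <= Ca*(1 + real i) powr (\<eta> - r)"
  using regularly_varying_coeffs[OF l a r eta] by auto
 have sq: "summable (%k. (a k)^2)" using square_summable_of_rate(1)[OF a_pos Ca(2,1) s, of 0] by simp
 interpret linear_process M \<xi> a by unfold_locales (rule sq)
 have Kf: "K_fin M a \<xi> K n = (%w. \<integral>u. K (w + u) \<partial>\<tau> n)" for n by (rule ext) (rule K_fin_eq(1)[OF K])
 obtain n1 where n1: "!!n w. n1 <= n ==> integrable M (%om. K (w + lin_proc a \<xi> (int n) om - lin_pred M a \<xi> (int n) 0 om))"
   "!!n. n1 <= n ==> C2 (K_fin M a \<xi> K n)"
  using cond_B unfolding condition_B_def eventually_sequentially by blast
 obtain \<delta> where delta: "\<delta> > 0" and ev: "let A = (%i n om. local_sup ((deriv ^^ i) (K_fin M a \<xi> K (n - 1))) \<delta>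
              (lin_pred M a \<xi> (int n) 0 om));
      B = (%n om. \<bar>\<xi> 1 om\<bar> powr (p/q)*K_fin M a \<xi> K (n - 1) (lin_pred M a \<xi> (int n) 1 om));
      C = (%n om. \<xi> 1 om*deriv (K_fin M a \<xi> K (n - 1)) (lin_pred M a \<xi> (int n) 1 om))
    in (\<forall>\<^sub>F n in sequentially.
       (\<forall>i\<le>2. in_Lq M q (A i n)) & in_Lq M q (B n) & in_Lq M q (C n)) &
      (%n. (\<Sum>i\<le>2. Lnorm M q (A i n)) + Lnorm M q (B n) + Lnorm M q (C n)) \<in> O(%_. 1)"
  using cond_B unfolding condition_B_def q_def[symmetric] by blast
 define A where "A = (%(i::nat) n om. local_sup ((deriv ^^ i) (K_fin M a \<xi> K (n - 1))) \<delta> (lin_pred M a \<xi> (int n) 0 om))"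
 define B where "B = (%n om. \<bar>\<xi> 1 om\<bar> powr (p/q)*K_fin M a \<xi> K (n - 1) (lin_pred M a \<xi> (int n) 1 om))"
 define C where "C = (%n om. \<xi> 1 om*deriv (K_fin M a \<xi> K (n - 1)) (lin_pred M a \<xi> (int n) 1 om))"
 have ev': "\<forall>\<^sub>F n in sequentially. (\<forall>i\<le>2. in_Lq M q (A i n)) & in_Lq M q (B n) & in_Lq M q (C n)"
  "(%n. (\<Sum>i\<le>2. Lnorm M q (A i n)) + Lnorm M q (B n) + Lnorm M q (C n)) \<in> O(%_. 1)"
  using ev unfolding Let_def A_def B_def C_def by blast+
 have nnL: "0 <= Lnorm M q Z" for Z by (simp add: Lnorm_def)
 obtain b where "\<forall>\<^sub>F n in sequentially. norm ((\<Sum>i\<le>2. Lnorm M q (A i n)) + Lnorm M q (B n) + Lnorm M q (C n)) <= b*norm (1::real)"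
  using landau_o.bigE[OF ev'(2)] by blast
 then have "\<forall>\<^sub>F n in sequentially. ((\<forall>i\<le>2. in_Lq M q (A i n)) & in_Lq M q (B n) & in_Lq M q (C n)) & (\<Sum>i\<le>2. Lnorm M q (A i n)) + Lnorm M q (B n) + Lnorm M q (C n) <= b"
  using ev'(1) by eventually_elim (simp add: abs_le_iff)
 then obtain n2 where n2: "!!n. n2 <= n ==> ((\<forall>i\<le>2. in_Lq M q (A i n)) & in_Lq M q (B n) & in_Lq M q (C n)) & (\<Sum>i\<le>2. Lnorm M q (A i n)) + Lnorm M q (B n) + Lnorm M q (C n) <= b"
  unfolding eventually_sequentially by blast
 have nrm: "i <= 2 ==> nrm_le M q (A i n) b" "nrm_le M q (B n) b" "nrm_le M q (C n) b" if n: "n2 <= n" for n i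
 proof -
  define SA where "SA = (\<Sum>i\<le>2. Lnorm M q (A i n))"
  have SA: "0 <= SA" unfolding SA_def by (intro sum_nonneg nnL)
  have le: "SA + Lnorm M q (B n) + Lnorm M q (C n) <= b" unfolding SA_def using n2[OF n] by blast
  show "nrm_le M q (B n) b" "nrm_le M q (C n) b"
   using n2[OF n] le SA nnL[of "B n"] nnL[of "C n"] by (auto intro!: nrm_le_of_Lnorm q0)
  assume i: "i <= 2"
  have "Lnorm M q (A i n) <= SA" unfolding SA_def by (rule member_le_sum) (use i nnL in auto)
  then have "Lnorm M q (A i n) <= b" using le nnL[of "B n"] nnL[of "C n"] by linarith
  then show "nrm_le M q (A i n) b" using n2[OF n] i by (intro nrm_le_of_Lnorm q0) auto
 qed
 define n0 where "n0 = max n1 n2"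
 have C2K: "C2 (%w. \<integral>u. K (w + u) \<partial>\<tau> m)" if "n0 <= m" for m using n1(2)[of m] that unfolding Kf n0_def by simp
 have lp0: "AE om in M. lin_pred M a \<xi> (int (Suc m)) 0 om = V (Suc m) 0 om" for m
  using lin_pred_eq[of "int (Suc m)" "Suc m"] by simp
 \<comment> \<open>X_{m+1,1} is the predictor with lag m at time 1. Splitting off \<xi>_1 expresses
   it through the predictor at time 0, to which that innovation is independent.\<close>
 have lp1: "AE om in M. lin_pred M a \<xi> (int (Suc m)) 1 om = V (Suc m) 0 om + a m*\<xi> 1 om" for m
 proof -
  have "int (Suc m) - int m = 1" by simp
  then have "AE om in M. lin_pred M a \<xi> (int (Suc m)) 1 om = V m 1 om" using lin_pred_eq[of "int (Suc m)" m] by simp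
  moreover have "AE om in M. V m 1 om = a m*\<xi> 1 om + V (Suc m) (1 - 1) om" using AE_V_step by eventually_elim blast
  ultimately show ?thesis by eventually_elim (simp add: add.commute)
 qed
 note [measurable] = K
 have sup_le: "nrm_le M q (%om. local_sup ((deriv ^^ i) (%w. \<integral>u. K (w + u) \<partial>\<tau> m)) \<delta> (V (Suc m) s om)) b" if i: "i <= 2" and m: "n0 <= m" for i m s
 proof -
  have "continuous_on UNIV ((deriv ^^ i) (%w. \<integral>u. K (w + u) \<partial>\<tau> m))"
   using C2_derivatives(3-5)[OF C2K[OF m]] i by (auto simp: le_Suc_eq numeral_2_eq_2)
  then have f[measurable]: "local_sup ((deriv ^^ i) (%w. \<integral>u. K (w + u) \<partial>\<tau> m)) \<delta> \<in> borel_measurable borel"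
   using delta by (intro local_sup_measurable) simp_all
  let ?f = "%z. local_sup ((deriv ^^ i) (%w. \<integral>u. K (w + u) \<partial>\<tau> m)) \<delta> (fst z)"
  have "nrm_le M q (%om. ?f (V (Suc m) 0 om, \<xi> (0 + 1) om)) b"
  proof (rule nrm_le_cong_AE)
   show "nrm_le M q (A i (Suc m)) b" by (rule nrm(1)) (use m i in \<open>auto simp: n0_def\<close>)
   show "AE om in M. ?f (V (Suc m) 0 om, \<xi> (0 + 1) om) = A i (Suc m) om"
    using lp0[of m] by eventually_elim (simp add: A_def Kf)
  qed (use q0 in \<open>simp_all\<close>)
  then have "nrm_le M q (%om. ?f (V (Suc m) s om, \<xi> (s + 1) om)) b" by (rule nrm_le_stationary[rotated]) measurable
  then show ?thesis by simp
 qed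
 have xi_le: "nrm_le M q (%om. \<bar>\<xi> (s + 1) om\<bar> powr (p/q)*(LINT u|\<tau> m. K (V (Suc m) s om + a m*\<xi> (s + 1) om + u))) b"
  "nrm_le M q (%om. \<xi> (s + 1) om*deriv (%w. \<integral>u. K (w + u) \<partial>\<tau> m) (V (Suc m) s om + a m*\<xi> (s + 1) om)) b" if m: "n0 <= m" for m s
 proof -
  have [measurable]: "(%w. \<integral>u. K (w + u) \<partial>\<tau> m) \<in> borel_measurable borel" "deriv (%w. \<integral>u. K (w + u) \<partial>\<tau> m) \<in> borel_measurable borel"
   using C2_derivatives(3,4)[OF C2K[OF m]] by (auto intro: borel_measurable_continuous_onI)
  let ?f = "%z. (abs (snd z)) powr (p/q)*(%w. \<integral>u. K (w + u) \<partial>\<tau> m) (fst z + a m * snd z)"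
  let ?g = "%z. snd z*deriv (%w. \<integral>u. K (w + u) \<partial>\<tau> m) (fst z + a m * snd z)"
  have mf: "?f \<in> borel_measurable (borel \<Otimes>\<^sub>M borel)"
   by (intro borel_measurable_times measurable_compose[OF _ \<open>(%w. \<integral>u. K (w + u) \<partial>\<tau> m) \<in> borel_measurable borel\<close>]) measurable
  have mg: "?g \<in> borel_measurable (borel \<Otimes>\<^sub>M borel)" by measurable
  have pm: "(%om. (V (Suc m) 0 om, \<xi> (0 + 1) om)) \<in> measurable M (borel \<Otimes>\<^sub>M borel)" by measurable
  have m2: "n2 <= Suc m" using m by (simp add: n0_def)
  have "nrm_le M q (%om. ?f (V (Suc m) 0 om, \<xi> (0 + 1) om)) b"
  proof (rule nrm_le_cong_AE[OF nrm(2)[OF m2] measurable_compose[OF pm mf]])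
   show "AE om in M. ?f (V (Suc m) 0 om, \<xi> (0 + 1) om) = B (Suc m) om"
    using lp1[of m] by eventually_elim (simp add: B_def Kf)
  qed (use q0 in simp)
  from nrm_le_stationary[OF mf this, of s]
  show "nrm_le M q (%om. \<bar>\<xi> (s + 1) om\<bar> powr (p/q)*(LINT u|\<tau> m. K (V (Suc m) s om + a m*\<xi> (s + 1) om + u))) b" by simp
  have "nrm_le M q (%om. ?g (V (Suc m) 0 om, \<xi> (0 + 1) om)) b"
  proof (rule nrm_le_cong_AE[OF nrm(3)[OF m2] measurable_compose[OF pm mg]])
   show "AE om in M. ?g (V (Suc m) 0 om, \<xi> (0 + 1) om) = C (Suc m) om"
    using lp1[of m] by eventually_elim (simp add: C_def Kf)
  qed (use q0 in simp)
  from nrm_le_stationary[OF mg this, of s]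
  show "nrm_le M q (%om. \<xi> (s + 1) om*deriv (%w. \<integral>u. K (w + u) \<partial>\<tau> m) (V (Suc m) s om + a m*\<xi> (s + 1) om)) b" by simp
 qed
 \<comment> \<open>The exponent 1/16 is the one for which the decay of the characteristic functions
   was computed.\<close>
 have dens: "\<exists>f. continuous_on UNIV f & (\<forall>x. 0 <= f x) & \<mu> m = density lborel (%x. ennreal (f x))" for m
 proof -
  obtain D where D: "D >= 1" "!!i. a i <= D*(1 + real i) powr (1/16 - r)" "!!i. (1 + real i) powr (- r - 1/16) <= D * a i"
   using regularly_varying_coeffs[OF l a r, of "1/16"] by auto
  interpret mu: prob_space "\<mu> m" by (rule prob_space_mu)
  interpret mu: real_distribution "\<mu> m" by unfold_locales simp
  show ?thesis by (rule mu.density_of_integrable_char[OF integrable_char_mu[OF D(1) r D(2,3)]])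
 qed
 have Kint: "integrable (\<tau> m) (%u. K (w + u))" if "n0 <= m" for m w
  using n1(1)[of m w] that unfolding K_fin_eq(2)[OF K] n0_def by simp
 have pm: "integrable \<nu> (%y. (abs y) powr p)"
  using integrable_xi_iff(1)[of "%y. (abs y) powr p" 0] p(2) by simp
 have Kinf: "((%w. \<integral>om. K (w + V 0 0 om) \<partial>M) has_real_derivative \<kappa>) (at 0)"
  using kappa(1) unfolding K_inf_def[abs_def] lin_proc_eq .
 interpret smooth_process M \<xi> a K p q \<delta> b \<kappa> n0
  by (unfold_locales; (rule pq pm K delta a_pos dens Kint C2K sup_le xi_le Kinf K_inf_exists[unfolded lin_proc_eq]; assumption?))
 have B0: "nrm_le M q (%om. K (V 0 i om)) (Lnorm M q (%om. K (V 0 0 om)))" for i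
 proof -
  have "nrm_le M q (%om. (%z. K (fst z)) (V 0 0 om, \<xi> (0 + 1) om)) (Lnorm M q (%om. K (V 0 0 om)))"
   using K_moment unfolding lin_proc_eq q_def[symmetric] by (simp add: nrm_le_of_Lnorm q0)
  then have "nrm_le M q (%om. (%z. K (fst z)) (V 0 i om, \<xi> (i + 1) om)) (Lnorm M q (%om. K (V 0 0 om)))"
   by (rule nrm_le_stationary[rotated]) measurable
  then show ?thesis by simp
 qed
 \<comment> \<open>In \<open>chi\<close> the maximum of r - r/v, 1/2 - r and r - 1 is minus the
   distance from r to the smallest of r/v, 2r - 1/2 and 1; multiplied by v and p this turns
   p\<rho>(r) into q(\<theta> - r).\<close>
 have gap: "c/2 < q*(min (r/omega r) (min (2*r - 1/2) 1) - r)"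
 proof -
  define Z where "Z = min (r/omega r) (min (2*r - 1/2) 1)"
  have "max (r - y) (max (1/2 - r) (r - 1)) = - (min y (min (2*r - 1/2) 1) - r)" for y
   by (simp add: max_def min_def; linarith)
  from this[of "r/omega r"] have m: "max (r - r/omega r) (max (1/2 - r) (r - 1)) = - (Z - r)"
   unfolding Z_def .
  have "p*rho r = q*(min (r/omega r) (min (2*r - 1/2) 1) - r)"
   unfolding rho_def chi_def q_def Z_def[symmetric] m by (simp add: algebra_simps)
  then show ?thesis using c(3) by linarith
 qed
 have Hs: "H_sum a \<xi> K n om = (\<Sum>i=1..n. K (V 0 (int i) om))" for n om by (simp add: H_sum_def lin_proc_eq)
 show ?thesis unfolding Hs Phi_def[symmetric]
  by (rule moderate_deviation_nonlinear[OF q_def om r l a B0 K_mean(2)[unfolded lin_proc_eq] kappa(2) c(1,2) gap x])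
qed

end
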